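(* Let $V:\mathbb{R}\to\mathbb{R}$ be measurable, locally bounded and bounded from below. Let $\phi_1,\phi_2\in L_2(\mathbb{R})$ be real-valued with compact supports, and let $q:\mathbb{R}\to\mathbb{R}$ be measurable and bounded with compact support. Suppose that (i) $\int_{\mathbb{R}}\phi_1\,dx=\int_{\mathbb{R}}\phi_2\,dx=0$, the antiderivatives $\phi_1^{(-1)}$ and $\phi_2^{(-1)}$ are orthogonal in $L_2(\mathbb{R})$, and $\|\phi_1^{(-1)}\|\cdot\|\phi_2^{(-1)}\|=1$; (ii) $a_0a_2=a_1^2$ and $a_2\neq\kappa a_1$, where $\kappa,a_0,a_1,a_2$ are the numbers defined in the context, and suppose that $\kappa\neq0$. Then, as $\varepsilon\to0^+$, the operators $$S_\varepsilon=S_0+\varepsilon^{-3}B_\varepsilon+\varepsilon^{-1}q\left(\tfrac{x}{\varepsilon}\right)$$ converge in the norm resolvent sense in $L_2(\mathbb{R})$ to the operator $S_{\alpha\beta}$ with $$\alpha=\frac{a_2-\kappa a_1}{a_2},\qquad \beta=\frac{\kappa^2}{a_2-\kappa a_1}.$$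
   Context: The norm and inner product of $L_2(\mathbb{R})$ are $\|\cdot\|$ and $\langle\cdot,\cdot\rangle$. For a function $f$ of compact support, $f^{(-1)}(x)=\int_{-\infty}^x f(s)\,ds$ and $f^{(-2)}(x)=\int_{-\infty}^x(x-s)f(s)\,ds$. If $f$ has zero mean, then $f^{(-1)}$ has compact support. Put $\omega=\|\phi_2^{(-1)}\|\,\phi_1^{(-2)}-\|\phi_1^{(-1)}\|\,\phi_2^{(-2)}$; when $\phi_1,\phi_2$ have zero means, $\omega$ is constant near $-\infty$ and near $+\infty$. Define $$\kappa=\lim_{x\to+\infty}\omega(x),\quad a_0=\int_{\mathbb{R}}q\,dx,\quad a_1=\int_{\mathbb{R}}q\,\omega\,dx,\quad a_2=\int_{\mathbb{R}}q\,\omega^2\,dx.$$ $S_0=-\frac{d^2}{dx^2}+V$ is the self-adjoint Schrödinger operator in $L_2(\mathbb{R})$, with domain $\operatorname{dom}S_0=\{f\in L_2(\mathbb{R}): f,f' \text{ locally absolutely continuous},\ -f''+Vf\in L_2(\mathbb{R})\}$. For $\varepsilon>0$, $$(B_\varepsilon v)(x)=\phi_1\left(\tfrac{x}{\varepsilon}\right)\int_{\mathbb{R}}\phi_2\left(\tfrac{s}{\varepsilon}\right)v(s)\,ds+\phi_2\left(\tfrac{x}{\varepsilon}\right)\int_{\mathbb{R}}\phi_1\left(\tfrac{s}{\varepsilon}\right)v(s)\,ds,$$ and $q(x/\varepsilon)$ acts as a multiplication operator; $S_\varepsilon$ is self-adjoint with $\operatorname{dom}S_\varepsilon=\operatorname{dom}S_0$.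 $\mathcal{V}$ is the space of $f\in L_2(\mathbb{R})$ such that $f=f_-$ on $(-\infty,0)$ and $f=f_+$ on $(0,\infty)$ for some $f_-,f_+\in\operatorname{dom}S_0$. For real $\alpha\ne0$ and $\beta$, $S_{\alpha\beta}f=-f''+Vf$ on $\mathbb{R}\setminus\{0\}$ with $$\operatorname{dom}S_{\alpha\beta}=\{f\in\mathcal{V}: f(+0)=\alpha f(-0)+\beta f'(-0),\ f'(+0)=\alpha^{-1}f'(-0)\}.$$ Norm resolvent convergence $S_\varepsilon\to S_{\alpha\beta}$ means $\|(S_\varepsilon-\zeta)^{-1}-(S_{\alpha\beta}-\zeta)^{-1}\|\to0$ in operator norm for $\zeta\in\mathbb{C}\setminus\mathbb{R}$. *)

theory Defs
  imports "HOL-Analysis.Analysis"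
begin

section \<open>The space of square integrable functions on the line\<close>

text \<open>
  Elements of the Hilbert space are represented by Lebesgue measurable functions, and
  equality of elements is equality almost everywhere.
\<close>

definition L2_space :: "(real \<Rightarrow> 'a::{banach, second_countable_topology}) set" where
  "L2_space = {f. f \<in> borel_measurable lebesgue \<and> integrable lebesgue (\<lambda>x. (norm (f x))\<^sup>2)}"

definition L2_norm :: "(real \<Rightarrow> 'a::{banach, second_countable_topology}) \<Rightarrow> real" where
  "L2_norm f = sqrt (LINT x|lebesgue. (norm (f x))\<^sup>2)"

definition L2_inner :: "(real \<Rightarrow> real) \<Rightarrow> (real \<Rightarrow> real) \<Rightarrow> real" where
  "L2_inner f g = (LINT x|lebesgue. f x * g x)"

text \<open>Compactness of the support of an element of the space, i.e.\ of the essential support.\<close>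

definition compact_ess_support :: "(real \<Rightarrow> real) \<Rightarrow> bool" where
  "compact_ess_support f \<longleftrightarrow> (\<exists>K. compact K \<and> (AE x in lebesgue. x \<notin> K \<longrightarrow> f x = 0))"

section \<open>Absolute continuity\<close>

definition abs_continuous_on_Icc :: "(real \<Rightarrow> complex) \<Rightarrow> real \<Rightarrow> real \<Rightarrow> bool" where
  "abs_continuous_on_Icc f a b \<longleftrightarrow>
    (\<forall>e>0. \<exists>d>0. \<forall>\<D>. \<D> division_of (\<Union>\<D>) \<and> \<Union>\<D> \<subseteq> {a..b} \<and> (\<Sum>I\<in>\<D>. Sup I - Inf I) < d
      \<longrightarrow> (\<Sum>I\<in>\<D>. norm (f (Sup I) - f (Inf I))) < e)"

definition locally_abs_continuous :: "(real \<Rightarrow> complex) \<Rightarrow> bool" where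
  "locally_abs_continuous f \<longleftrightarrow> (\<forall>a b. abs_continuous_on_Icc f a b)"

section \<open>Unbounded operators, resolvents and norm resolvent convergence\<close>

record L2_operator =
  domain :: "(real \<Rightarrow> complex) set"
  action :: "(real \<Rightarrow> complex) \<Rightarrow> real \<Rightarrow> complex"

definition shifted :: "L2_operator \<Rightarrow> complex \<Rightarrow> (real \<Rightarrow> complex) \<Rightarrow> real \<Rightarrow> complex" where
  "shifted T \<zeta> f = (\<lambda>x. action T f x - \<zeta> * f x)"

text \<open>
  \<open>\<zeta>\<close> is in the resolvent set if \<open>T - \<zeta>\<close> is a bijection from the domain onto the
  whole space (everything modulo null sets) whose inverse is bounded.
\<close>

definition resolvent_set :: "L2_operator \<Rightarrow> complex set" where
  "resolvent_set T = {\<zeta>.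
     (\<forall>g\<in>L2_space. \<exists>f\<in>domain T. AE x in lebesgue. shifted T \<zeta> f x = g x) \<and>
     (\<forall>f\<in>domain T. \<forall>h\<in>domain T. (AE x in lebesgue. shifted T \<zeta> f x = shifted T \<zeta> h x)
        \<longrightarrow> (AE x in lebesgue. f x = h x)) \<and>
     (\<exists>C. \<forall>f\<in>domain T. L2_norm f \<le> C * L2_norm (shifted T \<zeta> f))}"

text \<open>
  For \<open>\<zeta>\<close> in the resolvent set and \<open>g\<close> square integrable, the value of the
  resolvent is determined up to a null set.
\<close>

definition resolvent :: "L2_operator \<Rightarrow> complex \<Rightarrow> (real \<Rightarrow> complex) \<Rightarrow> real \<Rightarrow> complex" where
  "resolvent T \<zeta> g = (SOME f. f \<in> domain T \<and> (AE x in lebesgue. shifted T \<zeta> f x = g x))"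

text \<open>The operator norm takes values in the extended reals, so that it is
  \<open>\<infinity>\<close> for an unbounded map.\<close>

definition L2_opnorm :: "((real \<Rightarrow> complex) \<Rightarrow> real \<Rightarrow> complex) \<Rightarrow> ennreal" where
  "L2_opnorm A = (SUP g\<in>{g \<in> L2_space. L2_norm g \<le> 1}. ennreal (L2_norm (A g)))"

definition norm_resolvent_convergence :: "(real \<Rightarrow> L2_operator) \<Rightarrow> L2_operator \<Rightarrow> bool" where
  "norm_resolvent_convergence S T \<longleftrightarrow>
    (\<forall>\<zeta>. \<zeta> \<notin> \<real> \<longrightarrow>
      (\<forall>\<epsilon>>0. \<zeta> \<in> resolvent_set (S \<epsilon>)) \<and> \<zeta> \<in> resolvent_set T \<and>
      ((\<lambda>\<epsilon>. L2_opnorm (\<lambda>g x. resolvent (S \<epsilon>) \<zeta> g x - resolvent T \<zeta> g x))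
         \<longlongrightarrow> 0) (at_right 0))"

section \<open>The Schroedinger operators\<close>

abbreviation deriv1 :: "(real \<Rightarrow> complex) \<Rightarrow> real \<Rightarrow> complex" where
  "deriv1 f \<equiv> (\<lambda>x. vector_derivative f (at x))"

text \<open>
  For \<open>f\<close> and \<open>f'\<close> locally absolutely continuous, \<open>f''\<close> exists almost everywhere; the
  values of \<open>vector_derivative\<close> on the exceptional null set are irrelevant.
\<close>

definition schroedinger_expr :: "(real \<Rightarrow> real) \<Rightarrow> (real \<Rightarrow> complex) \<Rightarrow> real \<Rightarrow> complex" where
  "schroedinger_expr V f = (\<lambda>x. - deriv1 (deriv1 f) x + complex_of_real (V x) * f x)"

text \<open>
  Elements of the domain are given by their continuous representatives; as \<open>f'\<close> is required
  to be (absolutely) continuous, \<open>f\<close> is differentiable everywhere.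
\<close>

definition S0_domain :: "(real \<Rightarrow> real) \<Rightarrow> (real \<Rightarrow> complex) set" where
  "S0_domain V = {f \<in> L2_space.
     (\<forall>x. f differentiable (at x)) \<and>
     locally_abs_continuous f \<and> locally_abs_continuous (deriv1 f) \<and>
     schroedinger_expr V f \<in> L2_space}"

definition S0 :: "(real \<Rightarrow> real) \<Rightarrow> L2_operator" where
  "S0 V = \<lparr>domain = S0_domain V, action = schroedinger_expr V\<rparr>"

definition B_op ::
  "(real \<Rightarrow> real) \<Rightarrow> (real \<Rightarrow> real) \<Rightarrow> real \<Rightarrow> (real \<Rightarrow> complex) \<Rightarrow> real \<Rightarrow> complex" where
  "B_op \<phi>1 \<phi>2 \<epsilon> v = (\<lambda>x.
      complex_of_real (\<phi>1 (x / \<epsilon>)) * (LINT s|lebesgue. complex_of_real (\<phi>2 (s / \<epsilon>)) * v s)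
    + complex_of_real (\<phi>2 (x / \<epsilon>)) * (LINT s|lebesgue. complex_of_real (\<phi>1 (s / \<epsilon>)) * v s))"

definition S_eps ::
  "(real \<Rightarrow> real) \<Rightarrow> (real \<Rightarrow> real) \<Rightarrow> (real \<Rightarrow> real) \<Rightarrow> (real \<Rightarrow> real) \<Rightarrow> real \<Rightarrow> L2_operator" where
  "S_eps V \<phi>1 \<phi>2 q \<epsilon> = \<lparr>
     domain = domain (S0 V),
     action = (\<lambda>f x. action (S0 V) f x
       + complex_of_real (1 / \<epsilon> ^ 3) * B_op \<phi>1 \<phi>2 \<epsilon> f x
       + complex_of_real (1 / \<epsilon> * q (x / \<epsilon>)) * f x)\<rparr>"

definition V_space :: "(real \<Rightarrow> real) \<Rightarrow> (real \<Rightarrow> complex) set" where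
  "V_space V = {f \<in> L2_space. \<exists>f1\<in>domain (S0 V). \<exists>f2\<in>domain (S0 V).
     (\<forall>x<0. f x = f1 x) \<and> (\<forall>x>0. f x = f2 x)}"

text \<open>The value \<open>f 0\<close> is arbitrary; it affects the expression only at the point 0.\<close>

definition S_point :: "(real \<Rightarrow> real) \<Rightarrow> real \<Rightarrow> real \<Rightarrow> L2_operator" where
  "S_point V \<alpha> \<beta> = \<lparr>
     domain = {f \<in> V_space V.
       Lim (at_right 0) f = complex_of_real \<alpha> * Lim (at_left 0) f
         + complex_of_real \<beta> * Lim (at_left 0) (deriv1 f) \<and>
       Lim (at_right 0) (deriv1 f) = complex_of_real (inverse \<alpha>) * Lim (at_left 0) (deriv1 f)},
     action = schroedinger_expr V\<rparr>"

section \<open>Antiderivatives and the numbers governing the interaction\<close>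

definition antideriv1 :: "(real \<Rightarrow> real) \<Rightarrow> real \<Rightarrow> real" where
  "antideriv1 f x = (LINT s:{..x}|lebesgue. f s)"

definition antideriv2 :: "(real \<Rightarrow> real) \<Rightarrow> real \<Rightarrow> real" where
  "antideriv2 f x = (LINT s:{..x}|lebesgue. (x - s) * f s)"

definition omega :: "(real \<Rightarrow> real) \<Rightarrow> (real \<Rightarrow> real) \<Rightarrow> real \<Rightarrow> real" where
  "omega \<phi>1 \<phi>2 x = L2_norm (antideriv1 \<phi>2) * antideriv2 \<phi>1 x
                   - L2_norm (antideriv1 \<phi>1) * antideriv2 \<phi>2 x"

end

theory Submission imports Defs begin

text \<open>Let \<open>f\<close> solve the limit problem \<open>(S\<^sub>\<alpha>\<^sub>\<beta> - \<zeta>) f = g\<close>. Since the antiderivatives of the potentials are orthogonal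
  and normalised, \<open>\<omega>\<close> is a half-bound state of the scaled operator near the origin. On \<open>|x| < M \<epsilon>\<close> one replaces
  \<open>f\<close> by \<open>v(x / \<epsilon>)\<close> with \<open>v = f(-0) + s \<omega> + O(\<epsilon>)\<close> and \<open>s = (f(+0) - f(-0)) / \<kappa>\<close>. The first-order corrector exists
  with one-sided slopes given by the moments \<open>a0\<close>, \<open>a1\<close>, \<open>a2\<close>; because \<open>a0 a2 = a1\<^sup>2\<close>, the interface
  conditions are exactly what makes these slopes equal to \<open>f'(-0)\<close> and \<open>f'(+0)\<close>. The glued function solves the
  resolvent equation of \<open>S\<^sub>\<epsilon>\<close> up to \<open>O(sqrt \<epsilon>)\<close>, uniformly for \<open>g\<close> in the unit ball, and by symmetry the resolvent of
  \<open>S\<^sub>\<epsilon>\<close> has norm at most \<open>1 / |Im \<zeta>|\<close>.\<close>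

subsection \<open>Primitives of locally integrable functions\<close>

text \<open>The datum \<open>g\<close> is merely square integrable, so on a core of length
  O(\<epsilon>) its norm need not be small uniformly over the unit ball. Therefore
  \<open>g (\<epsilon> * x)\<close> is put into the inner equation, where it disturbs only the
  slopes, by O(sqrt \<epsilon>); together with the Hoelder continuity of exponent 1/2 of the
  derivative of the outer solution this fixes the rate. In the inner equation \<open>q\<close> acts
  on the leading profile \<open>v0\<close> and not on \<open>v\<close>. The difference of the two is
  O(\<epsilon>) and enters the residual divided by \<epsilon>; it is bounded there, which suffices
  since a bounded function on the core has squared norm O(\<epsilon>). The comparison starts from
  solutions of the limit problem, so only these have to be analysed near the origin, and the
  coefficient of order -3 in \<epsilon> never has to be estimated. Membership in the operator
  domains is stated by epsilon-delta conditions and pointwise derivatives, whereas all estimates are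
  integral estimates. \<open>is_primitive\<close> is the bridge; the density is an explicit argument
  because it is determined only up to null sets.\<close>

definition is_primitive :: "(real \<Rightarrow> 'a::euclidean_space) \<Rightarrow> (real \<Rightarrow> 'a) \<Rightarrow> bool" where
  "is_primitive F k \<longleftrightarrow> (\<forall>a b. k absolutely_integrable_on {a..b}) \<and>
     (\<forall>a b. a \<le> b \<longrightarrow> F b - F a = integral {a..b} k)"

lemma is_primitiveD:
  assumes "is_primitive F k"
  shows "k absolutely_integrable_on {a..b}" "k integrable_on {a..b}"
    "a \<le> b \<Longrightarrow> F b - F a = integral {a..b} k" "a \<le> b \<Longrightarrow> F b = F a + integral {a..b} k"
  using assms set_lebesgue_integral_eq_integral(1) unfolding is_primitive_def by (auto simp: algebra_simps)

text \<open>The averages in the Lebesgue differentiation theorem are taken over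
  \<open>{x..x+h}\<close>, so only increments to the right are controlled; the two-sided statement
  follows by applying this also to \<open>F (-x)\<close>.\<close>

lemma primitive_right_derivative:
  fixes F :: "real \<Rightarrow> 'a::euclidean_space"
  assumes "is_primitive F k"
  obtains N where "negligible N"
    "\<And>x e. x \<notin> N \<Longrightarrow> 0 < e \<Longrightarrow> \<exists>d>0. \<forall>h. 0 < h \<and> h < d \<longrightarrow> norm (F (x + h) - F x - h *\<^sub>R k x) \<le> e * h"
proof -
  have "k integrable_on cbox a b" for a b
    using is_primitiveD[OF assms] by auto
  then obtain N where N: "negligible N"
    "\<And>x e. \<lbrakk>x \<notin> N; 0 < e\<rbrakk> \<Longrightarrow> \<exists>d>0. \<forall>h. 0 < h \<and> h < d \<longrightarrow>
        norm (integral (cbox x (x + h *\<^sub>R One)) k /\<^sub>R h ^ DIM(real) - k x) < e"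
    using integrable_ccontinuous_explicit by blast
  show thesis
  proof (rule that[OF N(1)])
    fix x e :: real assume "x \<notin> N" "0 < e"
    then obtain d where d: "d > 0" "\<And>h. 0 < h \<Longrightarrow> h < d \<Longrightarrow> norm (integral {x..x+h} k /\<^sub>R h - k x) < e"
      using N(2)[of x e] by auto
    have "norm (F (x + h) - F x - h *\<^sub>R k x) \<le> e * h" if h: "0 < h" "h < d" for h
    proof -
      have "F (x + h) - F x = integral {x..x+h} k"
        using is_primitiveD(3)[OF assms, of x "x+h"] h by simp
      then have "F (x + h) - F x - h *\<^sub>R k x = h *\<^sub>R (integral {x..x+h} k /\<^sub>R h - k x)"
        using h by (simp add: algebra_simps)
      then have "norm (F (x + h) - F x - h *\<^sub>R k x) = h * norm (integral {x..x+h} k /\<^sub>R h - k x)"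
        using h by simp
      also have "\<dots> \<le> h * e" using d(2)[OF h] h by (intro mult_left_mono) auto
      finally show ?thesis by (simp add: mult.commute)
    qed
    then show "\<exists>d>0. \<forall>h. 0 < h \<and> h < d \<longrightarrow> norm (F (x + h) - F x - h *\<^sub>R k x) \<le> e * h"
      using d(1) by blast
  qed
qed

lemma is_primitive_reflect:
  assumes "is_primitive F k"
  shows "is_primitive (\<lambda>x. F (-x)) (\<lambda>x. - k (-x))"
  unfolding is_primitive_def
proof safe
  fix a b :: real
  have *: "(\<lambda>x. k (-x)) absolutely_integrable_on {a..b}"
    using absolutely_integrable_reflect_real[where f=k and a="-b" and b="-a"] is_primitiveD(1)[OF assms] by simp
  then show "(\<lambda>x. - k (-x)) absolutely_integrable_on {a..b}"
    by (simp add: set_integrable_def)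
  show "F (-b) - F (-a) = integral {a..b} (\<lambda>x. - k (-x))" if "a \<le> b"
  proof -
    have "F (-a) - F (-b) = integral {-b..-a} k" using is_primitiveD(3)[OF assms, of "-b" "-a"] that by simp
    also have "\<dots> = integral {a..b} (\<lambda>x. k (-x))" using Henstock_Kurzweil_Integration.integral_reflect_real[where f=k and a="-b" and b="-a"] by simp
    finally show ?thesis by (metis add_diff_cancel_right' diff_add_cancel minus_diff_eq Henstock_Kurzweil_Integration.integral_neg)
  qed
qed

lemma AE_lebesgue_negligible: "(AE x in lebesgue. P x) \<longleftrightarrow> (\<exists>N. negligible N \<and> (\<forall>x. x \<notin> N \<longrightarrow> P x))"
proof
  assume "AE x in lebesgue. P x"
  then show "\<exists>N. negligible N \<and> (\<forall>x. x \<notin> N \<longrightarrow> P x)"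
    unfolding eventually_ae_filter by (auto simp: negligible_iff_null_sets)
next
  assume "\<exists>N. negligible N \<and> (\<forall>x. x \<notin> N \<longrightarrow> P x)"
  then show "AE x in lebesgue. P x"
    unfolding eventually_ae_filter by (auto simp: negligible_iff_null_sets)
qed

lemma is_primitive_AE_derivative:
  fixes F :: "real \<Rightarrow> 'a::euclidean_space"
  assumes "is_primitive F k"
  shows "AE x in lebesgue. (F has_vector_derivative k x) (at x)"
proof -
  obtain N where N: "negligible N"
    "\<And>x e. x \<notin> N \<Longrightarrow> 0 < e \<Longrightarrow> \<exists>d>0. \<forall>h. 0 < h \<and> h < d \<longrightarrow> norm (F (x + h) - F x - h *\<^sub>R k x) \<le> e * h"
    using primitive_right_derivative[OF assms] by blast
  obtain N' where N': "negligible N'"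
    "\<And>x e. x \<notin> N' \<Longrightarrow> 0 < e \<Longrightarrow> \<exists>d>0. \<forall>h. 0 < h \<and> h < d \<longrightarrow>
        norm (F (- (x + h)) - F (-x) - h *\<^sub>R (- k (-x))) \<le> e * h"
    using primitive_right_derivative[OF is_primitive_reflect[OF assms]] by blast
  have neg: "negligible (N \<union> uminus ` N')"
    using N(1) N'(1)
    by (intro negligible_Un negligible_differentiable_image_negligible) (auto intro!: derivative_intros simp: differentiable_on_def)
  have "(F has_vector_derivative k x) (at x)" if x: "x \<notin> N \<union> uminus ` N'" for x
    unfolding has_vector_derivative_def has_derivative_at_alt
  proof safe
    show "bounded_linear (\<lambda>xa. xa *\<^sub>R k x)" by (rule bounded_linear_scaleR_left)
    fix e :: real assume e: "e > 0"
    obtain d1 where d1: "d1 > 0" "\<And>h. 0 < h \<Longrightarrow> h < d1 \<Longrightarrow> norm (F (x + h) - F x - h *\<^sub>R k x) \<le> e * h"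
      using N(2)[OF _ e, of x] x by auto
    have "-x \<notin> N'" using x by force
    then obtain d2 where d2: "d2 > 0" "\<And>h. 0 < h \<Longrightarrow> h < d2 \<Longrightarrow> norm (F (x - h) - F x + h *\<^sub>R k x) \<le> e * h"
      using N'(2)[OF _ e, of "-x"] by auto
    have "norm (F y - F x - (y - x) *\<^sub>R k x) \<le> e * norm (y - x)" if y: "norm (y - x) < min d1 d2" for y
    proof -
      consider "y > x" | "y = x" | "y < x" by linarith
      then show ?thesis
      proof cases
        case 1 then show ?thesis using d1(2)[of "y - x"] y by simp
      next
        case 2 then show ?thesis by simp
      next
        case 3 then show ?thesis using d2(2)[of "x - y"] y by (simp add: algebra_simps)
      qed
    qed
    then show "\<exists>d>0. \<forall>y. norm (y - x) < d \<longrightarrow> norm (F y - F x - (y - x) *\<^sub>R k x) \<le> e * norm (y - x)"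
      using d1(1) d2(1) by (intro exI[of _ "min d1 d2"]) auto
  qed
  with neg show ?thesis unfolding AE_lebesgue_negligible by blast
qed

lemma integral_division_le:
  fixes g :: "real \<Rightarrow> real"
  assumes D: "D division_of (\<Union>D)" "\<Union>D \<subseteq> {a..b}" and g: "g absolutely_integrable_on {a..b}" "\<And>x. g x \<ge> 0"
  shows "(\<Sum>I\<in>D. integral I g) \<le> integral {a..b} g"
proof -
  have fin: "finite D" using D(1) by auto
  have "g integrable_on {a..b}" using g set_lebesgue_integral_eq_integral(1) by blast
  have int: "g integrable_on \<Union>D"
  proof (rule integrable_on_subdivision[OF D(1)])
    show "g integrable_on {a..b}" by fact
    show "\<Union>D \<subseteq> {a..b}" by fact
  qed
  have "(\<Sum>I\<in>D. integral I g) = integral (\<Union>D) g"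
    using integral_combine_division_bottomup[OF D(1), of g] D
    by (metis (no_types, lifting) \<open>g integrable_on {a..b}\<close> division_ofD(4) Sup_upper box_real(2) integrable_on_subcbox order_trans)
  also have "\<dots> \<le> integral {a..b} g"
    by (rule integral_subset_le[OF D(2) int \<open>g integrable_on {a..b}\<close>]) (use g in auto)
  finally show ?thesis .
qed

lemma Icc_Sup_Inf: "K \<noteq> {} \<Longrightarrow> K = cbox a b \<Longrightarrow> K = {Inf K..Sup K} \<and> Inf K \<le> Sup K" for K :: "real set"
  by auto

text \<open>Truncation at height \<open>M\<close>: the excess of \<open>norm (k x)\<close> over
  \<open>M\<close> has arbitrarily small integral by dominated convergence. This separates a bounded
  density, whose integrals are controlled by length, from a remainder that is small on all subsets
  at once.\<close>

lemma absolutely_integrable_tail: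
  fixes k :: "real \<Rightarrow> 'a::euclidean_space"
  assumes k: "k absolutely_integrable_on {a..b}" and e: "e > 0"
  obtains M :: nat where "integral {a..b} (\<lambda>x. norm (k x) - min (norm (k x)) (real M)) < e"
proof -
  have nk: "(\<lambda>x. norm (k x)) absolutely_integrable_on {a..b}" using absolutely_integrable_norm[OF k] by (simp add: o_def)
  have nki: "(\<lambda>x. norm (k x)) integrable_on {a..b}" using nk set_lebesgue_integral_eq_integral(1) by blast
  define h where "h M x = norm (k x) - min (norm (k x)) (real M)" for M x
  have c: "(\<lambda>x::real. real M) absolutely_integrable_on {a..b}" for M
    by (intro absolutely_integrable_continuous_real continuous_intros)
  have hab: "h M absolutely_integrable_on {a..b}" for M
    unfolding h_def by (intro set_integral_diff(1) nk absolutely_integrable_min_1 c)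
  have hi: "h M integrable_on {a..b}" for M using hab set_lebesgue_integral_eq_integral(1) by blast
  have "(\<lambda>M. integral {a..b} (h M)) \<longlonglongrightarrow> integral {a..b} (\<lambda>x. 0)"
  proof (rule dominated_convergence(2)[OF hi nki])
    fix M x show "norm (h M x) \<le> norm (k x)" unfolding h_def by auto
  next
    fix x
    obtain M0 :: nat where "norm (k x) \<le> real M0" using real_arch_simple by blast
    then have "eventually (\<lambda>M. h M x = 0) sequentially"
      unfolding eventually_sequentially h_def by (intro exI[of _ M0]) auto
    then show "(\<lambda>M. h M x) \<longlonglongrightarrow> 0" by (rule tendsto_eventually)
  qed
  then have "eventually (\<lambda>M. integral {a..b} (h M) < e) sequentially"
    using e by (auto simp: order_tendsto_iff)
  then obtain M where "integral {a..b} (h M) < e" by (auto simp: eventually_sequentially)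
  then show thesis using that unfolding h_def by blast
qed

text \<open>Over a family of intervals the truncated part of \<open>k\<close> contributes at most
  \<open>M\<close> times the total length, and the remainder less than \<open>e / 2\<close> however
  the family is chosen.\<close>

lemma is_primitive_locally_abs_continuous:
  assumes F: "is_primitive F k"
  shows "locally_abs_continuous F"
  unfolding locally_abs_continuous_def abs_continuous_on_Icc_def
proof safe
  fix a b e :: real assume e: "e > 0"
  note kab = is_primitiveD(1)[OF F]
  obtain M :: nat where M: "integral {a..b} (\<lambda>x. norm (k x) - min (norm (k x)) (real M)) < e / 2"
    using absolutely_integrable_tail[OF kab, of "e/2" a b] e by auto
  define t where "t x = norm (k x) - min (norm (k x)) (real M)" for x
  have nk: "(\<lambda>x. norm (k x)) absolutely_integrable_on {c..d}" for c d
    using absolutely_integrable_norm[OF kab] by (simp add: o_def)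
  have c: "(\<lambda>x. real M) absolutely_integrable_on {c..d}" for c d :: real
    by (intro absolutely_integrable_continuous_real continuous_intros)
  have tab: "t absolutely_integrable_on {c..d}" for c d
    unfolding t_def by (intro set_integral_diff(1) nk absolutely_integrable_min_1 c)
  have ti: "t integrable_on {c..d}" for c d using tab set_lebesgue_integral_eq_integral(1) by blast
  have t0: "t x \<ge> 0" for x unfolding t_def by auto
  \<comment> \<open>This makes \<open>M * d\<close> at most \<open>e / 2\<close>; the summand 1
    covers \<open>M = 0\<close>.\<close>
  define d where "d = e / (2 * (real M + 1))"
  have d: "d > 0" unfolding d_def using e by (auto intro!: divide_pos_pos)
  show "\<exists>d>0. \<forall>\<D>. \<D> division_of \<Union>\<D> \<and> \<Union>\<D> \<subseteq> {a..b} \<and> (\<Sum>I\<in>\<D>. Sup I - Inf I) < d \<longrightarrow>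
      (\<Sum>I\<in>\<D>. norm (F (Sup I) - F (Inf I))) < e"
  proof (intro exI[of _ d] conjI d allI impI)
    fix D assume D: "D division_of \<Union>D \<and> \<Union>D \<subseteq> {a..b} \<and> (\<Sum>I\<in>D. Sup I - Inf I) < d"
    have "norm (F (Sup I) - F (Inf I)) \<le> integral I t + real M * (Sup I - Inf I)" if I: "I \<in> D" for I
    proof -
      have I': "I = {Inf I..Sup I}" "Inf I \<le> Sup I"
        using Icc_Sup_Inf[of I] division_ofD(3,4)[OF conjunct1[OF D] I] by blast+
      have "norm (F (Sup I) - F (Inf I)) = norm (integral {Inf I..Sup I} k)"
        using is_primitiveD(3)[OF F I'(2)] by simp
      also have "\<dots> \<le> integral {Inf I..Sup I} (\<lambda>x. t x + real M)"
        by (rule Henstock_Kurzweil_Integration.integral_norm_bound_integral[OF is_primitiveD(2)[OF F]])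
           (auto intro!: integrable_add ti[unfolded t_def] simp: t_def)
      also have "\<dots> = integral {Inf I..Sup I} t + real M * (Sup I - Inf I)"
        using I'(2) by (subst Henstock_Kurzweil_Integration.integral_add) (auto intro!: ti)
      finally show ?thesis using I'(1) by simp
    qed
    then have "(\<Sum>I\<in>D. norm (F (Sup I) - F (Inf I))) \<le> (\<Sum>I\<in>D. integral I t + real M * (Sup I - Inf I))"
      by (rule sum_mono)
    also have "\<dots> = (\<Sum>I\<in>D. integral I t) + real M * (\<Sum>I\<in>D. Sup I - Inf I)"
      by (simp add: sum.distrib sum_distrib_left)
    also have "\<dots> \<le> integral {a..b} t + real M * d"
      using integral_division_le[of D a b t] D tab t0 by (intro add_mono mult_left_mono) auto
    also have "\<dots> < e / 2 + e / 2"
    proof (rule add_less_le_mono)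
      show "integral {a..b} t < e / 2" using M unfolding t_def .
      show "real M * d \<le> e / 2" unfolding d_def using e by (simp add: field_simps)
    qed
    finally show "(\<Sum>I\<in>D. norm (F (Sup I) - F (Inf I))) < e" by simp
  qed
qed

subsection \<open>Absolutely continuous functions are primitives\<close>

text \<open>Intervals of a division may share endpoints, but their interiors are disjoint and have
  the same lengths, so additivity of the measure is applied to the interiors.\<close>

lemma division_of_length_le:
  fixes p :: "real set set"
  assumes p: "p division_of (\<Union>p)" and W: "\<Union>p \<subseteq> W" "W \<in> sets lborel"
  shows "ennreal (\<Sum>I\<in>p. Sup I - Inf I) \<le> emeasure lborel W"
proof -
  have fin: "finite p" using p by auto
  have I: "I = {Inf I..Sup I} \<and> Inf I \<le> Sup I" if "I \<in> p" for I
    using Icc_Sup_Inf[of I] division_ofD(3,4)[OF p that] by blast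
  have int: "interior I = {Inf I<..<Sup I}" if "I \<in> p" for I
    using I[OF that] interior_atLeastAtMost_real by metis
  have disj: "disjoint_family_on (\<lambda>I. {Inf I<..<Sup I}) p"
    unfolding disjoint_family_on_def using division_ofD(5)[OF p] int by metis
  have "ennreal (\<Sum>I\<in>p. Sup I - Inf I) = (\<Sum>I\<in>p. ennreal (Sup I - Inf I))"
    by (subst sum_ennreal) (use I in auto)
  also have "\<dots> = (\<Sum>I\<in>p. emeasure lborel {Inf I<..<Sup I})"
    by (intro sum.cong refl) (use I in auto)
  also have "\<dots> = emeasure lborel (\<Union>I\<in>p. {Inf I<..<Sup I})"
    by (rule sum_emeasure) (use disj fin in auto)
  also have "\<dots> \<le> emeasure lborel W"
  proof (rule emeasure_mono[OF _ W(2)])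
    show "(\<Union>I\<in>p. {Inf I<..<Sup I}) \<subseteq> W"
      using W(1) int interior_subset by blast
  qed
  finally show ?thesis .
qed

text \<open>Absolute continuity makes the Stieltjes measure of \<open>G\<close> absolutely continuous with respect to
  Lebesgue measure; the density is its Radon--Nikodym derivative. All functions are clipped, that is
  constant outside \<open>{a..b}\<close>, so that they live on the whole line.\<close>

lemma mono_abs_continuous_primitive:
  fixes G :: "real \<Rightarrow> real"
  assumes ab: "a < b" and mono: "\<And>x y. x \<le> y \<Longrightarrow> G x \<le> G y"
    and clip: "\<And>x. G x = G (max a (min b x))"
    and ac: "\<And>e. e > 0 \<Longrightarrow> \<exists>d>0. \<forall>D. D division_of \<Union>D \<and> \<Union>D \<subseteq> {a..b} \<and> (\<Sum>I\<in>D. Sup I - Inf I) < d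
       \<longrightarrow> (\<Sum>I\<in>D. G (Sup I) - G (Inf I)) < e"
  shows "\<exists>k. is_primitive G k"
proof -
  \<comment> \<open>A division may consist of a single interval, so absolute continuity contains
    continuity; points outside \<open>{a..b}\<close> are moved to the endpoints by clipping.\<close>
  have cont: "continuous_on UNIV G"
    unfolding continuous_on_iff
  proof safe
    fix x e :: real assume e: "e > 0"
    obtain d where d: "d > 0" "\<And>D. D division_of \<Union>D \<Longrightarrow> \<Union>D \<subseteq> {a..b} \<Longrightarrow> (\<Sum>I\<in>D. Sup I - Inf I) < d
       \<Longrightarrow> (\<Sum>I\<in>D. G (Sup I) - G (Inf I)) < e" using ac[OF e] by blast
    have *: "G y - G x < e" if "x \<le> y" "y - x < d" for x y
    proof -
      define u v where "u = max a (min b x)" and "v = max a (min b y)"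
      have uv: "u \<le> v" "{u..v} \<subseteq> {a..b}" "v - u < d" using that ab d(1) unfolding u_def v_def by auto
      have "(\<Sum>I\<in>{{u..v}}. G (Sup I) - G (Inf I)) < e"
      proof (rule d(2))
        show "{{u..v}} division_of \<Union>{{u..v}}"
          using division_of_self[of u v] uv by simp
      qed (use uv in auto)
      then show ?thesis using uv clip unfolding u_def v_def by simp
    qed
    show "\<exists>d>0. \<forall>x'\<in>UNIV. dist x' x < d \<longrightarrow> dist (G x') (G x) < e"
    proof (intro exI[of _ d] conjI ballI impI d(1))
      fix x' assume "dist x' x < d"
      then show "dist (G x') (G x) < e"
        using *[of x x'] *[of x' x] mono[of x x'] mono[of x' x] unfolding dist_real_def by (cases "x \<le> x'") auto
    qed
  qed
  define \<mu> where "\<mu> = interval_measure G"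
  have Icc: "emeasure \<mu> {x..y} = ennreal (G y - G x)" if "x \<le> y" for x y
    unfolding \<mu>_def by (rule emeasure_interval_measure_Icc[OF that mono cont])
  have sets\<mu>[simp]: "sets \<mu> = sets borel" "space \<mu> = UNIV" unfolding \<mu>_def by auto
  \<comment> \<open>Clipping makes \<open>G\<close> constant to the left of \<open>a\<close>, so the
    Stieltjes measure has no mass there, and likewise to the right of \<open>b\<close>. The covering
    argument is then confined to null sets inside the open interval.\<close>
  have low: "{..a} \<in> null_sets \<mu>"
  proof -
    have "(\<Union>n::nat. {a - real n..a}) \<in> null_sets \<mu>"
    proof (rule null_sets_UN)
      fix n :: nat
      have "max a (min b (a - real n)) = a" using ab by auto
      then have "G (a - real n) = G a" using clip[of "a - real n"] by (simp only:)
      then show "{a - real n..a} \<in> null_sets \<mu>" using Icc[of "a - real n" a] by (auto simp: null_sets_def)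
    qed
    also have "(\<Union>n::nat. {a - real n..a}) = {..a}"
    proof safe
      fix x assume "x \<le> a"
      obtain n :: nat where "a - x \<le> real n" using real_arch_simple by blast
      then show "x \<in> (\<Union>n::nat. {a - real n..a})" using \<open>x \<le> a\<close> by (auto intro!: exI[of _ n])
    qed auto
    finally show ?thesis .
  qed
  have high: "{b..} \<in> null_sets \<mu>"
  proof -
    have "(\<Union>n::nat. {b..b + real n}) \<in> null_sets \<mu>"
    proof (rule null_sets_UN)
      fix n :: nat
      have "max a (min b (b + real n)) = b" using ab by auto
      then have "G (b + real n) = G b" using clip[of "b + real n"] by (simp only:)
      then show "{b..b + real n} \<in> null_sets \<mu>" using Icc[of b "b + real n"] by (auto simp: null_sets_def)
    qed
    also have "(\<Union>n::nat. {b..b + real n}) = {b..}"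
    proof safe
      fix x assume "b \<le> x"
      obtain n :: nat where "x - b \<le> real n" using real_arch_simple by blast
      then show "x \<in> (\<Union>n::nat. {b..b + real n})" using \<open>b \<le> x\<close> by (auto intro!: exI[of _ n])
    qed auto
    finally show ?thesis .
  qed
  have acont: "absolutely_continuous lborel \<mu>"
    unfolding absolutely_continuous_def
  proof
    fix N :: "real set" assume N: "N \<in> null_sets lborel"
    define N' where "N' = N \<inter> {a<..<b}"
    have N': "N' \<in> null_sets lborel" unfolding N'_def using N by (auto intro: null_set_Int2)
    have "emeasure \<mu> N' \<le> 0 + ennreal e" if e: "e > 0" for e
    proof -
      obtain d where d: "d > 0" "\<And>D. D division_of \<Union>D \<Longrightarrow> \<Union>D \<subseteq> {a..b} \<Longrightarrow> (\<Sum>I\<in>D. Sup I - Inf I) < d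
        \<Longrightarrow> (\<Sum>I\<in>D. G (Sup I) - G (Inf I)) < e" using ac[OF e] by blast
      have "N' \<in> sets lebesgue" using N' by (auto intro: sets_completionI_sets)
      \<comment> \<open>Outer regularity: the null set is enclosed in an open set that exceeds it by
        measure less than \<open>d\<close>. The part of this set in the open interval is exhausted
        by finite unions of boxes, each of which has \<open>\<mu>\<close>-measure at most
        \<open>e\<close>.\<close>
      then obtain T where T: "open T" "N' \<subseteq> T" "T - N' \<in> lmeasurable" "emeasure lebesgue (T - N') < ennreal d"
        using sets_lebesgue_outer_open[OF _ d(1)] by blast
      define W where "W = T \<inter> {a<..<b}"
      have Wo: "open W" unfolding W_def using T by auto
      have WN: "N' \<subseteq> W" "W \<subseteq> {a..b}" unfolding W_def N'_def using T by (auto simp: N'_def)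
      have "emeasure lborel W \<le> emeasure lborel (T - N') + emeasure lborel N'"
        using T N' WN by (intro order_trans[OF _ emeasure_subadditive] emeasure_mono) (auto simp: W_def N'_def)
      also have "\<dots> = emeasure lebesgue (T - N')"
      proof -
        have "T - N' \<in> sets lborel" using T(1) N' by auto
        then show ?thesis using N' by (simp add: null_sets_def)
      qed
      also have "\<dots> < ennreal d" by (rule T(4))
      finally have Wd: "emeasure lborel W < ennreal d" .
      obtain \<D> where \<D>: "countable \<D>" "\<D> \<subseteq> Pow W" "\<And>X. X \<in> \<D> \<Longrightarrow> \<exists>a b. X = cbox a b" "\<Union>\<D> = W"
        using open_countable_Union_open_cbox[OF Wo] by blast
      show ?thesis
      proof (cases "\<D> = {}")
        case True then show ?thesis using \<D>(4) WN by simp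
      next
        case False
        define K where "K n = (\<Union>i<n. from_nat_into \<D> i)" for n :: nat
        have fni: "from_nat_into \<D> i \<in> \<D>" for i using False by (rule from_nat_into)
        have bor: "from_nat_into \<D> i \<in> sets borel" for i using \<D>(3)[OF fni[of i]] by auto
        have Ks: "range K \<subseteq> sets \<mu>" unfolding K_def using bor by auto
        have inc: "incseq K" unfolding K_def incseq_def by force
        have KW: "(\<Union>n. K n) = W"
        proof -
          have "(\<Union>n. K n) = (\<Union>i. from_nat_into \<D> i)" unfolding K_def by auto
          also have "\<dots> = \<Union>\<D>" using \<D>(1) False by (simp add: range_from_nat_into)
          finally show ?thesis using \<D>(4) by simp
        qed
        have Kn: "emeasure \<mu> (K n) \<le> ennreal e" for n
        proof -
          \<comment> \<open>The boxes may overlap. A division of their finite union consists of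
            non-overlapping intervals, as the hypothesis on \<open>G\<close> demands, and its total
            length is at most the measure of \<open>W\<close>.\<close>
          obtain p where p0: "p division_of \<Union>(from_nat_into \<D> ` {..<n})"
            using elementary_unions_intervals[of "from_nat_into \<D> ` {..<n}"] \<D>(3)[OF fni] by blast
          then have pK: "\<Union>p = K n" unfolding K_def using division_ofD(6)[OF p0] by simp
          have p: "p division_of \<Union>p" using p0 by (metis division_ofD(6))
          have pW: "\<Union>p \<subseteq> W" using pK KW by auto
          have "ennreal (\<Sum>I\<in>p. Sup I - Inf I) < ennreal d"
            using division_of_length_le[OF p pW] Wo Wd by auto
          then have "(\<Sum>I\<in>p. Sup I - Inf I) < d" by (meson ennreal_leI not_le)
          then have lt: "(\<Sum>I\<in>p. G (Sup I) - G (Inf I)) < e" using d(2)[OF p] pW WN by auto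
          have I: "I = {Inf I..Sup I} \<and> Inf I \<le> Sup I" if "I \<in> p" for I
            using Icc_Sup_Inf[of I] division_ofD(3,4)[OF p that] by blast
          have "emeasure \<mu> (K n) = emeasure \<mu> (\<Union>I\<in>p. I)" using pK by simp
          also have "\<dots> \<le> (\<Sum>I\<in>p. emeasure \<mu> I)"
          proof (rule emeasure_subadditive_finite)
            show "finite p" using p by auto
            show "(\<lambda>I. I) ` p \<subseteq> sets \<mu>"
            proof
              fix J assume "J \<in> (\<lambda>I. I) ` p"
              then obtain u v where "J = {u..v}" using division_ofD(4)[OF p, of J] by auto
              then show "J \<in> sets \<mu>" by simp
            qed
          qed
          also have "\<dots> = (\<Sum>I\<in>p. ennreal (G (Sup I) - G (Inf I)))"
            by (intro sum.cong refl) (metis I Icc)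
          also have "\<dots> = ennreal (\<Sum>I\<in>p. G (Sup I) - G (Inf I))"
            by (subst sum_ennreal) (use I mono in auto)
          also have "\<dots> \<le> ennreal e" using lt by (intro ennreal_leI) auto
          finally show ?thesis .
        qed
        have "emeasure \<mu> N' \<le> emeasure \<mu> W" using WN Wo N' by (intro emeasure_mono) auto
        also have "\<dots> = (SUP n. emeasure \<mu> (K n))" using SUP_emeasure_incseq[OF Ks inc] KW by simp
        also have "\<dots> \<le> ennreal e" using Kn by (intro SUP_least)
        finally show ?thesis by simp
      qed
    qed
    then have "emeasure \<mu> N' \<le> 0" by (rule ennreal_le_epsilon)
    then have N'0: "N' \<in> null_sets \<mu>" using N' by (auto simp: null_sets_def)
    have "N \<subseteq> N' \<union> ({..a} \<union> {b..})" unfolding N'_def by auto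
    moreover have "N' \<union> ({..a} \<union> {b..}) \<in> null_sets \<mu>" using N'0 low high by (intro null_sets.Un)
    ultimately show "N \<in> null_sets \<mu>"
      using N null_sets_subset[of "N' \<union> ({..a} \<union> {b..})" \<mu> N] by auto
  qed
  obtain f where f: "f \<in> borel_measurable lborel" "density lborel f = \<mu>"
    using sigma_finite_measure.Radon_Nikodym[OF lborel.sigma_finite_measure_axioms acont] by auto
  define k where "k x = enn2real (f x)" for x
  have nn: "(\<integral>\<^sup>+x. f x * indicator {x0..y0} x \<partial>lborel) = ennreal (G y0 - G x0)" if "x0 \<le> y0" for x0 y0
    using Icc[OF that] f emeasure_density[OF f(1), of "{x0..y0}"] by simp
  \<comment> \<open>The density has finite integral over every bounded interval and is therefore
    finite almost everywhere; only then does \<open>enn2real\<close> preserve its integrals.\<close>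
  have "AE x in lborel. \<forall>n::nat. f x * indicator {- real n..real n} x \<noteq> \<infinity>"
    unfolding AE_all_countable
  proof
    fix n :: nat
    show "AE x in lborel. f x * indicator {- real n..real n} x \<noteq> \<infinity>"
      using f(1) nn[of "- real n" "real n"] by (intro nn_integral_PInf_AE) auto
  qed
  then have fin: "AE x in lborel. f x \<noteq> \<infinity>"
  proof (rule AE_mp, intro AE_I2 impI)
    fix x assume *: "\<forall>n::nat. f x * indicator {- real n..real n} x \<noteq> \<infinity>"
    obtain n :: nat where "\<bar>x\<bar> \<le> real n" using real_arch_simple by blast
    then have "x \<in> {- real n..real n}" by auto
    then have "indicator {- real n..real n} x = (1::ennreal)" by (rule indicator_simps(1))
    then show "f x \<noteq> \<infinity>" using *[rule_format, of n] by simp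
  qed
  have kb: "k \<in> borel_measurable lborel" unfolding k_def using f(1) by measurable
  have nnk: "(\<integral>\<^sup>+x. ennreal (indicator {x0..y0} x *\<^sub>R k x) \<partial>lborel) = ennreal (G y0 - G x0)" if "x0 \<le> y0" for x0 y0
  proof -
    have "(\<integral>\<^sup>+x. ennreal (indicator {x0..y0} x *\<^sub>R k x) \<partial>lborel) = (\<integral>\<^sup>+x. f x * indicator {x0..y0} x \<partial>lborel)"
    proof (rule nn_integral_cong_AE)
      show "AE x in lborel. ennreal (indicator {x0..y0} x *\<^sub>R k x) = f x * indicator {x0..y0} x"
        using fin by eventually_elim (auto simp: k_def indicator_def less_top)
    qed
    then show ?thesis using nn[OF that] by simp
  qed
  have k0: "k x \<ge> 0" for x unfolding k_def by simp
  have intk: "integrable lborel (\<lambda>x. indicator {x0..y0} x *\<^sub>R k x)" if "x0 \<le> y0" for x0 y0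
    by (rule integrableI_nn_integral_finite[OF _ _ nnk[OF that]]) (use kb k0 in auto)
  have vk: "integral\<^sup>L lborel (\<lambda>x. indicator {x0..y0} x *\<^sub>R k x) = G y0 - G x0" if "x0 \<le> y0" for x0 y0
    by (subst integral_eq_nn_integral) (use kb k0 mono[OF that] nnk[OF that] in auto)
  have abs: "k absolutely_integrable_on {x0..y0}" for x0 y0
  proof (cases "x0 \<le> y0")
    case True then show ?thesis
      unfolding set_integrable_def using intk[OF True] kb by (subst integrable_completion) auto
  qed auto
  have "is_primitive G k"
    unfolding is_primitive_def
  proof safe
    show "k absolutely_integrable_on {x..y}" for x y by (rule abs)
    fix x y :: real assume xy: "x \<le> y"
    have "integral {x..y} k = (LINT s:{x..y}|lebesgue. k s)" using set_lebesgue_integral_eq_integral(2)[OF abs] by simp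
    also have "\<dots> = G y - G x"
      unfolding set_lebesgue_integral_def using vk[OF xy] kb by (subst integral_completion) auto
    finally show "G y - G x = integral {x..y} k" by simp
  qed
  then show ?thesis by blast
qed

text \<open>The variations of \<open>F\<close> along the partition \<open>p\<close>, up to \<open>x\<close> and between \<open>x\<close> and \<open>y\<close>.
  The supremum \<open>T\<close> of \<open>vsum\<close> is the variation function; \<open>F\<close> is then split into the differences of
  the monotone functions \<open>T\<close> and \<open>T - Re F\<close>, and likewise for the imaginary part.\<close>

definition vsum :: "(real \<Rightarrow> complex) \<Rightarrow> (nat \<Rightarrow> real) \<Rightarrow> nat \<Rightarrow> real \<Rightarrow> real" where
  "vsum F p n x = (\<Sum>i<n. norm (F (min x (p (Suc i))) - F (min x (p i))))"

definition csum :: "(real \<Rightarrow> complex) \<Rightarrow> (nat \<Rightarrow> real) \<Rightarrow> nat \<Rightarrow> real \<Rightarrow> real \<Rightarrow> real" where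
  "csum F p n x y = (\<Sum>i<n. norm (F (max x (min y (p (Suc i)))) - F (max x (min y (p i)))))"

text \<open>The path is cut at \<open>x\<close>: each increment of the path stopped at
  \<open>y\<close> is the sum of an increment stopped at \<open>x\<close> and one taken within
  \<open>{x..y}\<close>, because
  \<open>F (min y t) = F (min x t) + F (max x (min y t)) - F x\<close>.\<close>

lemma vsum_le_csum:
  assumes "x \<le> y"
  shows "vsum F p n y \<le> vsum F p n x + csum F p n x y"
proof -
  have *: "F (min y t) = F (min x t) + F (max x (min y t)) - F x" for t
    using assms by (cases "t \<le> x") (auto simp: min_def max_def)
  have "norm (F (min y (p (Suc i))) - F (min y (p i))) \<le> norm (F (min x (p (Suc i))) - F (min x (p i))) +
     norm (F (max x (min y (p (Suc i)))) - F (max x (min y (p i))))" for i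
    unfolding *[of "p (Suc i)"] *[of "p i"]
    by (rule order_trans[OF _ norm_triangle_ineq]) (simp add: algebra_simps)
  then show ?thesis unfolding vsum_def csum_def sum.distrib[symmetric] by (intro sum_mono)
qed

text \<open>Clipping lets partition points coincide. Without the degenerate intervals the remaining
  ones are pairwise distinct, so a sum over the set of intervals equals the sum over the indices,
  where the omitted terms are zero anyway.\<close>

lemma mesh_division:
  fixes q :: "nat \<Rightarrow> real" and F :: "real \<Rightarrow> complex"
  assumes q: "mono q" and xy: "x \<le> q 0" "q n \<le> y"
  defines "E \<equiv> (\<lambda>i. {q i..q (Suc i)}) ` {i. i < n \<and> q i < q (Suc i)}"
  shows "finite E" "\<And>I. I \<in> E \<Longrightarrow> I \<subseteq> {x..y} \<and> interior I \<noteq> {} \<and> (\<exists>u v. I = cbox u v)"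
    "\<And>I J. I \<in> E \<Longrightarrow> J \<in> E \<Longrightarrow> I \<noteq> J \<Longrightarrow> interior I \<inter> interior J = {}"
    "(\<Sum>I\<in>E. norm (F (Sup I) - F (Inf I))) = (\<Sum>i<n. norm (F (q (Suc i)) - F (q i)))"
    "(\<Sum>I\<in>E. Sup I - Inf I) = q n - q 0"
proof -
  show "finite E" unfolding E_def by auto
  have qle: "q i \<le> q j" if "i \<le> j" for i j using q that by (auto dest: monoD)
  show "I \<subseteq> {x..y} \<and> interior I \<noteq> {} \<and> (\<exists>u v. I = cbox u v)" if IE: "I \<in> E" for I
  proof -
    obtain i where i: "I = {q i..q (Suc i)}" "i < n" "q i < q (Suc i)" using IE unfolding E_def by auto
    have "x \<le> q i" "q (Suc i) \<le> y" using qle[of 0 i] qle[of "Suc i" n] i xy by auto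
    then show ?thesis using i by (auto intro!: exI[of _ "q i"] exI[of _ "q (Suc i)"])
  qed
  show "interior I \<inter> interior J = {}" if IJ: "I \<in> E" "J \<in> E" "I \<noteq> J" for I J
  proof -
    obtain i j where i: "I = {q i..q (Suc i)}" and j: "J = {q j..q (Suc j)}" using IJ unfolding E_def by auto
    have "i \<noteq> j" using i j IJ by auto
    then have "Suc i \<le> j \<or> Suc j \<le> i" by auto
    then have "q (Suc i) \<le> q j \<or> q (Suc j) \<le> q i" using qle by blast
    then show ?thesis unfolding i j by auto
  qed
  have inj: "inj_on (\<lambda>i. {q i..q (Suc i)}) {i. i < n \<and> q i < q (Suc i)}"
  proof (rule inj_onI)
    fix i j assume a: "i \<in> {i. i < n \<and> q i < q (Suc i)}" "j \<in> {i. i < n \<and> q i < q (Suc i)}"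
      and e: "{q i..q (Suc i)} = {q j..q (Suc j)}"
    then have "q i = q j" "q (Suc i) = q (Suc j)" by (auto simp: Icc_eq_Icc)
    then show "i = j" using a qle[of "Suc i" j] qle[of "Suc j" i] by (cases i j rule: linorder_cases) auto
  qed
  have S: "(\<Sum>I\<in>E. h (Inf I) (Sup I)) = (\<Sum>i<n. h (q i) (q (Suc i)))" if h0: "\<And>u. h u u = 0" for h :: "real \<Rightarrow> real \<Rightarrow> real"
  proof -
    have "(\<Sum>I\<in>E. h (Inf I) (Sup I)) = (\<Sum>i | i < n \<and> q i < q (Suc i). h (q i) (q (Suc i)))"
      unfolding E_def by (subst sum.reindex[OF inj]) (auto intro!: sum.cong)
    also have "\<dots> = (\<Sum>i<n. h (q i) (q (Suc i)))"
    proof (rule sum.mono_neutral_left)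
      show "\<forall>i\<in>{..<n} - {i. i < n \<and> q i < q (Suc i)}. h (q i) (q (Suc i)) = 0"
      proof
        fix i assume "i \<in> {..<n} - {i. i < n \<and> q i < q (Suc i)}"
        then have "q i = q (Suc i)" using qle[of i "Suc i"] by auto
        then show "h (q i) (q (Suc i)) = 0" using h0 by simp
      qed
    qed auto
    finally show ?thesis .
  qed
  show "(\<Sum>I\<in>E. norm (F (Sup I) - F (Inf I))) = (\<Sum>i<n. norm (F (q (Suc i)) - F (q i)))"
    by (rule S[of "\<lambda>u v. norm (F v - F u)"]) simp
  have "(\<Sum>I\<in>E. Sup I - Inf I) = (\<Sum>i<n. q (Suc i) - q i)" by (rule S[of "\<lambda>u v. v - u"]) simp
  then show "(\<Sum>I\<in>E. Sup I - Inf I) = q n - q 0" by (simp add: sum_lessThan_telescope)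
qed

text \<open>Refining every interval of \<open>D\<close> by its own partition gives again a division,
  of no larger total length. A bound on increments over divisions thus becomes a bound on
  variations, with the same \<open>d\<close> and \<open>e\<close>.\<close>

lemma csum_family:
  fixes F :: "real \<Rightarrow> complex"
  assumes d: "\<And>D. D division_of \<Union>D \<Longrightarrow> \<Union>D \<subseteq> {a..b} \<Longrightarrow> (\<Sum>I\<in>D. Sup I - Inf I) < d
       \<Longrightarrow> (\<Sum>I\<in>D. norm (F (Sup I) - F (Inf I))) < e"
    and D: "D division_of \<Union>D" "\<Union>D \<subseteq> {a..b}" "(\<Sum>I\<in>D. Sup I - Inf I) < d"
    and p: "\<And>I. I \<in> D \<Longrightarrow> mono (p I)"
  shows "(\<Sum>I\<in>D. csum F (p I) (n I) (Inf I) (Sup I)) < e"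
proof -
  have fin: "finite D" using D(1) by auto
  have I: "I = {Inf I..Sup I} \<and> Inf I \<le> Sup I" if "I \<in> D" for I
    using Icc_Sup_Inf[of I] division_ofD(3,4)[OF D(1) that] by blast
  define q where "q I i = max (Inf I) (min (Sup I) (p I i))" for I i
  have mq: "mono (q I)" if "I \<in> D" for I
    using p[OF that] unfolding mono_def q_def by (intro allI impI max.mono min.mono) auto
  have q1: "Inf I \<le> q I 0" "q I (n I) \<le> Sup I" if "I \<in> D" for I using I[OF that] unfolding q_def by auto
  define E where "E I = (\<lambda>i. {q I i..q I (Suc i)}) ` {i. i < n I \<and> q I i < q I (Suc i)}" for I
  note M = mesh_division[OF mq q1, folded E_def]
  have cE: "csum F (p I) (n I) (Inf I) (Sup I) = (\<Sum>J\<in>E I. norm (F (Sup J) - F (Inf J)))" if "I \<in> D" for I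
    using M(4)[OF that that that, of F] unfolding csum_def q_def by simp
  have finE: "finite (E I)" if "I \<in> D" for I using M(1)[OF that that that] .
  have EI: "J \<subseteq> I \<and> interior J \<noteq> {} \<and> (\<exists>u v. J = cbox u v)" if "I \<in> D" "J \<in> E I" for I J
    using M(2)[OF that(1) that(1) that(1) that(2)] I[OF that(1)] by auto
  have disj: "interior J \<inter> interior J' = {}" if "I \<in> D" "I' \<in> D" "I \<noteq> I'" "J \<in> E I" "J' \<in> E I'" for I I' J J'
  proof -
    have "interior J \<subseteq> interior I" "interior J' \<subseteq> interior I'" using EI that by (auto intro!: interior_mono)
    then show ?thesis using division_ofD(5)[OF D(1) that(1,2,3)] by auto
  qed
  have disjE: "\<forall>I\<in>D. \<forall>I'\<in>D. I \<noteq> I' \<longrightarrow> E I \<inter> E I' = {}"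
    using disj EI by (metis disjoint_iff inf.idem)
  let ?U = "\<Union>I\<in>D. E I"
  have sumU: "(\<Sum>J\<in>?U. g J) = (\<Sum>I\<in>D. \<Sum>J\<in>E I. g J)" for g :: "real set \<Rightarrow> real"
    by (rule sum.UNION_disjoint) (use fin finE disjE in auto)
  have div: "?U division_of \<Union>?U"
  proof (rule division_ofI)
    show "finite ?U" using fin finE by auto
    fix K assume "K \<in> ?U"
    then show "K \<subseteq> \<Union>?U" by auto
    show "K \<noteq> {}" using EI \<open>K \<in> ?U\<close> by force
    show "\<exists>a b. K = cbox a b" using EI \<open>K \<in> ?U\<close> by blast
    fix K' assume "K' \<in> ?U" "K \<noteq> K'"
    then show "interior K \<inter> interior K' = {}"
      using \<open>K \<in> ?U\<close> disj M(3) by (metis UN_iff)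
  qed auto
  have "(\<Sum>J\<in>?U. norm (F (Sup J) - F (Inf J))) < e"
  proof (rule d[OF div])
    show "\<Union>?U \<subseteq> {a..b}" using EI D(2) by blast
    have "(\<Sum>J\<in>?U. Sup J - Inf J) = (\<Sum>I\<in>D. q I (n I) - q I 0)" unfolding sumU
      by (intro sum.cong refl M(5))
    also have "\<dots> \<le> (\<Sum>I\<in>D. Sup I - Inf I)" using q1 by (intro sum_mono) (meson diff_mono)
    finally show "(\<Sum>J\<in>?U. Sup J - Inf J) < d" using D(3) by simp
  qed
  then show ?thesis unfolding sumU using cE by simp
qed


lemma abs_continuous_on_IccE:
  assumes "abs_continuous_on_Icc F a b" "e > 0"
  obtains d where "d > 0" "\<And>D. D division_of \<Union>D \<Longrightarrow> \<Union>D \<subseteq> {a..b} \<Longrightarrow> (\<Sum>I\<in>D. Sup I - Inf I) < d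
     \<Longrightarrow> (\<Sum>I\<in>D. norm (F (Sup I) - F (Inf I))) < e"
proof -
  obtain d where "d > 0" "\<forall>D. D division_of \<Union>D \<and> \<Union>D \<subseteq> {a..b} \<and> (\<Sum>I\<in>D. Sup I - Inf I) < d
     \<longrightarrow> (\<Sum>I\<in>D. norm (F (Sup I) - F (Inf I))) < e"
    using assms unfolding abs_continuous_on_Icc_def by meson
  then show thesis using that by blast
qed

lemma csum_small:
  fixes F :: "real \<Rightarrow> complex"
  assumes d: "\<And>D. D division_of \<Union>D \<Longrightarrow> \<Union>D \<subseteq> {a..b} \<Longrightarrow> (\<Sum>I\<in>D. Sup I - Inf I) < d
       \<Longrightarrow> (\<Sum>I\<in>D. norm (F (Sup I) - F (Inf I))) < e"
    and xy: "a \<le> x" "x \<le> y" "y \<le> b" "y - x < d" and p: "mono p"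
  shows "csum F p n x y < e"
proof -
  have "(\<Sum>I\<in>{{x..y}}. csum F p n (Inf I) (Sup I)) < e"
    by (rule csum_family[OF d]) (use xy p division_of_self[of x y] in auto)
  then show ?thesis using xy by simp
qed

text \<open>The interval is traversed in steps of length \<open>d / 2\<close>, each of which adds at
  most 1 to the variation; the number of steps does not depend on the partition.\<close>

lemma vsum_bounded:
  fixes F :: "real \<Rightarrow> complex"
  assumes ab: "a < b" and clip: "\<And>x. F x = F (max a (min b x))" and ac: "abs_continuous_on_Icc F a b"
  obtains B where "\<And>p n x. mono p \<Longrightarrow> vsum F p n x \<le> B"
proof -
  obtain d where d: "d > 0" "\<And>D. D division_of \<Union>D \<Longrightarrow> \<Union>D \<subseteq> {a..b} \<Longrightarrow> (\<Sum>I\<in>D. Sup I - Inf I) < d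
       \<Longrightarrow> (\<Sum>I\<in>D. norm (F (Sup I) - F (Inf I))) < 1"
    using abs_continuous_on_IccE[OF ac zero_less_one] by blast
  obtain m :: nat where m: "2 * (b - a) / d \<le> real m" using real_arch_simple by blast
  have step: "vsum F p n (min x (a + real j * (d/2))) \<le> real j" if "mono p" "a \<le> x" "x \<le> b" for p n x j
  proof (induction j)
    case 0
    have "F (min (min x a) t) = F a" for t
    proof -
      have "max a (min b (min (min x a) t)) = a" using ab by auto
      then show ?thesis using clip[of "min (min x a) t"] by (simp only:)
    qed
    then show ?case using \<open>a \<le> x\<close> by (simp add: vsum_def)
  next
    case (Suc j)
    let ?u = "min x (a + real j * (d/2))" and ?v = "min x (a + real (Suc j) * (d/2))"
    define r where "r = a + real j * (d/2)"
    have r: "a + real (Suc j) * (d/2) = r + d/2" "a \<le> r" unfolding r_def using d(1) by (auto simp: field_simps)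
    have uv: "?u \<le> ?v" "a \<le> ?u" "?v \<le> b" "?v - ?u < d"
      unfolding r(1) r_def[symmetric] using that d(1) r(2) by auto
    have "vsum F p n ?v \<le> vsum F p n ?u + csum F p n ?u ?v" by (rule vsum_le_csum[OF uv(1)])
    also have "\<dots> \<le> real j + 1" using Suc csum_small[OF d(2) uv(2,1,3,4) that(1), of n] by simp
    finally show ?case by simp
  qed
  have "vsum F p n x \<le> real m" if p: "mono p" for p n x
  proof -
    define c where "c = max a (min b x)"
    have c: "a \<le> c" "c \<le> b" using ab unfolding c_def by auto
    have "F (min x t) = F (min c t)" for t
    proof -
      have "max a (min b (min x t)) = max a (min b (min c t))" unfolding c_def using ab by (auto simp: min_def max_def)
      then show ?thesis using clip by metis
    qed
    then have "vsum F p n x = vsum F p n c" unfolding vsum_def by simp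
    also have "c = min c (a + real m * (d/2))"
    proof -
      have "b - a \<le> real m * (d / 2)" using m d(1) by (simp add: field_simps)
      then show ?thesis using c by auto
    qed
    also have "vsum F p n (min c (a + real m * (d/2))) \<le> real m" by (rule step[OF p c])
    finally show ?thesis .
  qed
  then show thesis using that by blast
qed

text \<open>Absolute continuity passes from \<open>F\<close> to its variation: on each interval of
  \<open>D\<close> the increment of \<open>T\<close> is attained up to \<open>h\<close> by one
  partition, and \<open>csum_family\<close> controls these finitely many partitions
  together.\<close>

lemma variation_function:
  fixes F :: "real \<Rightarrow> complex"
  assumes ab: "a < b" and clip: "\<And>x. F x = F (max a (min b x))" and ac: "abs_continuous_on_Icc F a b"
  obtains T where "\<And>x y. x \<le> y \<Longrightarrow> norm (F y - F x) \<le> T y - T x"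
    "\<And>x. T x = T (max a (min b x))"
    "\<And>e. e > 0 \<Longrightarrow> \<exists>d>0. \<forall>D. D division_of \<Union>D \<and> \<Union>D \<subseteq> {a..b} \<and> (\<Sum>I\<in>D. Sup I - Inf I) < d
       \<longrightarrow> (\<Sum>I\<in>D. T (Sup I) - T (Inf I)) < e"
proof -
  obtain B where B: "\<And>p n x. mono p \<Longrightarrow> vsum F p n x \<le> B"
    using vsum_bounded[of a b F, OF ab _ ac] clip by metis
  define X where "X = {pn :: (nat \<Rightarrow> real) \<times> nat. mono (fst pn)}"
  define T where "T x = (SUP pn\<in>X. vsum F (fst pn) (snd pn) x)" for x
  have X0: "X \<noteq> {}" unfolding X_def by (auto intro!: exI[of _ "\<lambda>_. 0"] simp: mono_def)
  have bdd: "bdd_above ((\<lambda>pn. vsum F (fst pn) (snd pn) x) ` X)" for x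
    using B unfolding X_def by (intro bdd_aboveI2) auto
  have Tge: "vsum F p n x \<le> T x" if "mono p" for p n x
    unfolding T_def using that bdd by (intro cSUP_upper2[where x="(p, n)"]) (auto simp: X_def)
  have T1: "norm (F y - F x) \<le> T y - T x" if xy: "x \<le> y" for x y
  proof -
    have "T x \<le> T y - norm (F y - F x)"
      unfolding T_def[of x]
    proof (rule cSUP_least[OF X0])
      fix pn assume "pn \<in> X"
      then obtain p n where pn: "pn = (p, n)" "mono p" unfolding X_def by (cases pn) auto
      \<comment> \<open>The partition is stopped at \<open>x\<close>, then the points
        \<open>x\<close> and \<open>y\<close> are appended; the last step contributes
        \<open>norm (F y - F x)\<close> in full.\<close>
      define p' where "p' i = (if i \<le> n then min x (p i) else if i = Suc n then x else y)" for i
      have mp': "mono p'"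
        using xy monoD[OF pn(2)] unfolding mono_def p'_def by (auto simp: min.coboundedI1 intro: min.mono min.coboundedI2)
      have "vsum F p' (Suc (Suc n)) y = (\<Sum>i<n. norm (F (min y (p' (Suc i))) - F (min y (p' i)))) +
          norm (F x - F (min y (p' n))) + norm (F y - F x)"
        unfolding vsum_def using xy by (simp add: p'_def min.absorb1 min.absorb2)
      also have "(\<Sum>i<n. norm (F (min y (p' (Suc i))) - F (min y (p' i)))) = vsum F p n x"
        unfolding vsum_def using xy by (intro sum.cong refl) (auto simp: p'_def min.absorb2 min.coboundedI1)
      finally have "vsum F p n x + norm (F y - F x) \<le> vsum F p' (Suc (Suc n)) y" by simp
      also have "\<dots> \<le> T y" by (rule Tge[OF mp'])
      finally show "vsum F (fst pn) (snd pn) x \<le> T y - norm (F y - F x)" using pn by simp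
    qed
    then show ?thesis by simp
  qed
  have T2: "T x = T (max a (min b x))" for x
  proof -
    have "F (min x t) = F (min (max a (min b x)) t)" for t
    proof -
      have "max a (min b (min x t)) = max a (min b (min (max a (min b x)) t))" using ab by (auto simp: min_def max_def)
      then show ?thesis using clip by metis
    qed
    then have "vsum F p n x = vsum F p n (max a (min b x))" for p n unfolding vsum_def by presburger
    then show ?thesis unfolding T_def by presburger
  qed
  have T3: "\<exists>d>0. \<forall>D. D division_of \<Union>D \<and> \<Union>D \<subseteq> {a..b} \<and> (\<Sum>I\<in>D. Sup I - Inf I) < d
       \<longrightarrow> (\<Sum>I\<in>D. T (Sup I) - T (Inf I)) < e" if e: "e > 0" for e
  proof -
    have e2: "e / 2 > 0" using e by simp
    obtain d where d: "d > 0" "\<And>D. D division_of \<Union>D \<Longrightarrow> \<Union>D \<subseteq> {a..b} \<Longrightarrow> (\<Sum>I\<in>D. Sup I - Inf I) < d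
       \<Longrightarrow> (\<Sum>I\<in>D. norm (F (Sup I) - F (Inf I))) < e / 2"
      using abs_continuous_on_IccE[OF ac e2] by blast
    show ?thesis
    proof (intro exI[of _ d] conjI d(1) allI impI)
      fix D assume "D division_of \<Union>D \<and> \<Union>D \<subseteq> {a..b} \<and> (\<Sum>I\<in>D. Sup I - Inf I) < d"
      then have D: "D division_of \<Union>D" "\<Union>D \<subseteq> {a..b}" "(\<Sum>I\<in>D. Sup I - Inf I) < d" by auto
      have fin: "finite D" using D(1) by auto
      \<comment> \<open>One error \<open>h\<close> for each interval of \<open>D\<close>; together
        they amount to at most \<open>e / 2\<close>.\<close>
      define h where "h = e / (2 * (real (card D) + 1))"
      have h: "h > 0" unfolding h_def using e by (intro divide_pos_pos) auto
      have "\<exists>p n. mono p \<and> T (Sup I) - h < vsum F p n (Sup I)" for I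
      proof -
        have "\<exists>pn\<in>X. T (Sup I) - h < vsum F (fst pn) (snd pn) (Sup I)"
          using less_cSUP_iff[OF X0 bdd[of "Sup I"], of "T (Sup I) - h"] h unfolding T_def by simp
        then show ?thesis unfolding X_def by force
      qed
      then obtain p n where p: "\<And>I. mono (p I)" "\<And>I. T (Sup I) - h < vsum F (p I) (n I) (Sup I)" by metis
      have "T (Sup I) - T (Inf I) \<le> csum F (p I) (n I) (Inf I) (Sup I) + h" if "I \<in> D" for I
      proof -
        have "Inf I \<le> Sup I" using Icc_Sup_Inf[of I] division_ofD(3,4)[OF D(1) that] by blast
        then have "vsum F (p I) (n I) (Sup I) \<le> vsum F (p I) (n I) (Inf I) + csum F (p I) (n I) (Inf I) (Sup I)"
          by (rule vsum_le_csum)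
        then show ?thesis using p(2)[of I] Tge[OF p(1), of I "n I" "Inf I"] by linarith
      qed
      then have "(\<Sum>I\<in>D. T (Sup I) - T (Inf I)) \<le> (\<Sum>I\<in>D. csum F (p I) (n I) (Inf I) (Sup I) + h)"
        by (rule sum_mono)
      also have "\<dots> = (\<Sum>I\<in>D. csum F (p I) (n I) (Inf I) (Sup I)) + real (card D) * h" by (simp add: sum.distrib)
      also have "\<dots> < e / 2 + e / 2"
      proof (rule add_less_le_mono)
        show "(\<Sum>I\<in>D. csum F (p I) (n I) (Inf I) (Sup I)) < e / 2"
          by (rule csum_family[OF d(2) D p(1)])
        show "real (card D) * h \<le> e / 2" unfolding h_def using e by (simp add: field_simps)
      qed
      finally show "(\<Sum>I\<in>D. T (Sup I) - T (Inf I)) < e" by simp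
    qed
  qed
  show thesis using that T1 T2 T3 by blast
qed

lemma is_primitive_add:
  assumes "is_primitive F k" "is_primitive G l"
  shows "is_primitive (\<lambda>x. F x + G x) (\<lambda>x. k x + l x)"
  unfolding is_primitive_def
proof safe
  show "(\<lambda>x. k x + l x) absolutely_integrable_on {a..b}" for a b
    using assms by (intro set_integral_add(1) is_primitiveD(1))
  fix a b :: real assume "a \<le> b"
  then show "F b + G b - (F a + G a) = integral {a..b} (\<lambda>x. k x + l x)"
    using assms is_primitiveD(3)[OF assms(1)] is_primitiveD(3)[OF assms(2)]
    by (simp add: Henstock_Kurzweil_Integration.integral_add is_primitiveD(2) algebra_simps)
qed

lemma is_primitive_bounded_linear:
  assumes F: "is_primitive F k" and h: "bounded_linear h"
  shows "is_primitive (\<lambda>x. h (F x)) (\<lambda>x. h (k x))"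
  unfolding is_primitive_def
proof safe
  show "(\<lambda>x. h (k x)) absolutely_integrable_on {a..b}" for a b
    using absolutely_integrable_linear[OF is_primitiveD(1)[OF F] h] by (simp add: o_def)
  fix a b :: real assume "a \<le> b"
  have "integral {a..b} (\<lambda>x. h (k x)) = h (integral {a..b} k)"
    using integral_linear[OF is_primitiveD(2)[OF F] h] by (simp add: o_def)
  then show "h (F b) - h (F a) = integral {a..b} (\<lambda>x. h (k x))"
    using is_primitiveD(3)[OF F \<open>a \<le> b\<close>, symmetric] bounded_linear.linear[OF h] by (simp add: linear_diff)
qed

lemma is_primitive_diff:
  assumes "is_primitive F k" "is_primitive G l"
  shows "is_primitive (\<lambda>x. F x - G x) (\<lambda>x. k x - l x)"
  using is_primitive_add[OF assms(1) is_primitive_bounded_linear[OF assms(2) bounded_linear_minus[OF bounded_linear_ident]]]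
  by simp

text \<open>For a real function \<open>h\<close> whose increments are bounded by those of the
  argument in norm, \<open>T x - h (F x)\<close> is monotone and its increments are at most twice
  those of \<open>T\<close>; so it is a primitive by the monotone case. The choices
  \<open>0\<close>, \<open>Re\<close> and \<open>Im\<close> recover \<open>F\<close>.\<close>

lemma clipped_abs_continuous_primitive:
  fixes F :: "real \<Rightarrow> complex"
  assumes ab: "a < b" and clip: "\<And>x. F x = F (max a (min b x))" and ac: "abs_continuous_on_Icc F a b"
  obtains k where "is_primitive F k"
proof -
  obtain T where T: "\<And>x y. x \<le> y \<Longrightarrow> norm (F y - F x) \<le> T y - T x"
    "\<And>x. T x = T (max a (min b x))"
    "\<And>e. e > 0 \<Longrightarrow> \<exists>d>0. \<forall>D. D division_of \<Union>D \<and> \<Union>D \<subseteq> {a..b} \<and> (\<Sum>I\<in>D. Sup I - Inf I) < d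
       \<longrightarrow> (\<Sum>I\<in>D. T (Sup I) - T (Inf I)) < e"
    using variation_function[of a b F, OF ab clip ac] by blast
  have main: "\<exists>k. is_primitive (\<lambda>x. T x - h (F x)) k"
    if h: "\<And>z w. h z - h w \<le> norm (z - w)" for h :: "complex \<Rightarrow> real"
  proof (rule mono_abs_continuous_primitive[OF ab])
    show "T x - h (F x) \<le> T y - h (F y)" if "x \<le> y" for x y using T(1)[OF that] h[of "F y" "F x"] by linarith
    show "T x - h (F x) = T (max a (min b x)) - h (F (max a (min b x)))" for x
      using T(2)[of x] clip[of x] by presburger
    fix e :: real assume "e > 0"
    then have e2: "e / 2 > 0" by simp
    obtain d where d: "d > 0" "\<And>D. D division_of \<Union>D \<Longrightarrow> \<Union>D \<subseteq> {a..b} \<Longrightarrow> (\<Sum>I\<in>D. Sup I - Inf I) < d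
       \<Longrightarrow> (\<Sum>I\<in>D. T (Sup I) - T (Inf I)) < e / 2" using T(3)[OF e2] by meson
    show "\<exists>d>0. \<forall>D. D division_of \<Union>D \<and> \<Union>D \<subseteq> {a..b} \<and> (\<Sum>I\<in>D. Sup I - Inf I) < d
       \<longrightarrow> (\<Sum>I\<in>D. (T (Sup I) - h (F (Sup I))) - (T (Inf I) - h (F (Inf I)))) < e"
    proof (intro exI[of _ d] conjI d(1) allI impI)
      fix D assume "D division_of \<Union>D \<and> \<Union>D \<subseteq> {a..b} \<and> (\<Sum>I\<in>D. Sup I - Inf I) < d"
      then have D: "D division_of \<Union>D" "\<Union>D \<subseteq> {a..b}" "(\<Sum>I\<in>D. Sup I - Inf I) < d" by auto
      have "(T (Sup I) - h (F (Sup I))) - (T (Inf I) - h (F (Inf I))) \<le> 2 * (T (Sup I) - T (Inf I))" if "I \<in> D" for I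
      proof -
        have "Inf I \<le> Sup I" using Icc_Sup_Inf[of I] division_ofD(3,4)[OF D(1) that] by blast
        then have "norm (F (Inf I) - F (Sup I)) \<le> T (Sup I) - T (Inf I)"
          using T(1) by (simp add: norm_minus_commute)
        then have "h (F (Inf I)) - h (F (Sup I)) \<le> T (Sup I) - T (Inf I)"
          by (rule order_trans[OF h])
        then show ?thesis by (simp add: algebra_simps)
      qed
      then have "(\<Sum>I\<in>D. (T (Sup I) - h (F (Sup I))) - (T (Inf I) - h (F (Inf I)))) \<le> (\<Sum>I\<in>D. 2 * (T (Sup I) - T (Inf I)))"
        by (rule sum_mono)
      also have "\<dots> = 2 * (\<Sum>I\<in>D. T (Sup I) - T (Inf I))" by (simp add: sum_distrib_left)
      also have "\<dots> < e" using d(2)[OF D] by simp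
      finally show "(\<Sum>I\<in>D. (T (Sup I) - h (F (Sup I))) - (T (Inf I) - h (F (Inf I)))) < e" .
    qed
  qed
  obtain k0 where k0: "is_primitive (\<lambda>x. T x - 0) k0" using main[of "\<lambda>_. 0"] by auto
  have "Re z - Re w \<le> norm (z - w)" "Im z - Im w \<le> norm (z - w)" for z w
    using complex_Re_le_cmod[of "z - w"] abs_Im_le_cmod[of "z - w"] by auto
  then obtain k1 k2 where k1: "is_primitive (\<lambda>x. T x - Re (F x)) k1" and k2: "is_primitive (\<lambda>x. T x - Im (F x)) k2"
    using main[of Re] main[of Im] by blast
  have re: "is_primitive (\<lambda>x. Re (F x)) (\<lambda>x. k0 x - k1 x)" using is_primitive_diff[OF k0 k1] by simp
  have im: "is_primitive (\<lambda>x. Im (F x)) (\<lambda>x. k0 x - k2 x)" using is_primitive_diff[OF k0 k2] by simp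
  have "is_primitive (\<lambda>x. complex_of_real (Re (F x)) + \<i> * complex_of_real (Im (F x)))
     (\<lambda>x. complex_of_real (k0 x - k1 x) + \<i> * complex_of_real (k0 x - k2 x))"
    by (intro is_primitive_add is_primitive_bounded_linear[OF re] is_primitive_bounded_linear[OF im])
      (auto intro: bounded_linear_of_real bounded_linear_const_mult)
  then show thesis using that by (simp flip: complex_eq)
qed

text \<open>On each \<open>{-N..N}\<close> the clipped function has a density, and differentiation
  almost everywhere identifies the density with \<open>deriv1 F\<close>, whatever value
  \<open>vector_derivative\<close> takes on the exceptional null set. This turns the conditions in
  the definitions of the operator domains into integral identities.\<close>

theorem locally_abs_continuous_primitive:
  assumes F: "locally_abs_continuous F"
  shows "is_primitive F (deriv1 F)"
proof -
  have *: "deriv1 F absolutely_integrable_on {- N..N} \<and> (\<forall>x\<in>{-N..N}. \<forall>y\<in>{-N..N}. x \<le> y \<longrightarrow> F y - F x = integral {x..y} (deriv1 F))"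
    if N: "N > 0" for N :: real
  proof -
    define G where "G x = F (max (-N) (min N x))" for x
    have GF: "G x = F x" if "x \<in> {-N..N}" for x using that unfolding G_def by (auto simp: min_def max_def)
    have clipG: "G x = G (max (- N) (min N x))" for x
    proof -
      have "max (-N) (min N (max (-N) (min N x))) = max (-N) (min N x)" using N by auto
      then show ?thesis unfolding G_def by (simp only:)
    qed
    have acG: "abs_continuous_on_Icc G (-N) N"
      unfolding abs_continuous_on_Icc_def
    proof (intro allI impI)
      fix e :: real assume e: "e > 0"
      have ac: "abs_continuous_on_Icc F (-N) N" using F unfolding locally_abs_continuous_def by simp
      obtain d where d: "d > 0" "\<And>D. D division_of \<Union>D \<Longrightarrow> \<Union>D \<subseteq> {-N..N} \<Longrightarrow> (\<Sum>I\<in>D. Sup I - Inf I) < d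
         \<Longrightarrow> (\<Sum>I\<in>D. norm (F (Sup I) - F (Inf I))) < e"
        using abs_continuous_on_IccE[OF ac e] by blast
      show "\<exists>d>0. \<forall>D. D division_of \<Union>D \<and> \<Union>D \<subseteq> {-N..N} \<and> (\<Sum>I\<in>D. Sup I - Inf I) < d
         \<longrightarrow> (\<Sum>I\<in>D. norm (G (Sup I) - G (Inf I))) < e"
      proof (intro exI[of _ d] conjI d(1) allI impI)
        fix D assume "D division_of \<Union>D \<and> \<Union>D \<subseteq> {-N..N} \<and> (\<Sum>I\<in>D. Sup I - Inf I) < d"
        then have D: "D division_of \<Union>D" "\<Union>D \<subseteq> {-N..N}" "(\<Sum>I\<in>D. Sup I - Inf I) < d" by auto
        have "G (Sup I) = F (Sup I) \<and> G (Inf I) = F (Inf I)" if "I \<in> D" for I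
        proof -
          have "I = {Inf I..Sup I} \<and> Inf I \<le> Sup I" using Icc_Sup_Inf[of I] division_ofD(3,4)[OF D(1) that] by blast
          then have "Inf I \<in> {-N..N}" "Sup I \<in> {-N..N}" using D(2) that by (metis UnionI atLeastAtMost_iff order_refl subsetD)+
          then show ?thesis using GF by blast
        qed
        then have "(\<Sum>I\<in>D. norm (G (Sup I) - G (Inf I))) = (\<Sum>I\<in>D. norm (F (Sup I) - F (Inf I)))" by simp
        then show "(\<Sum>I\<in>D. norm (G (Sup I) - G (Inf I))) < e" using d(2)[OF D] by simp
      qed
    qed
    have "-N < N" using N by simp
    then obtain k where k: "is_primitive G k"
      using clipped_abs_continuous_primitive[of "-N" N G, OF _ clipG acG] by blast
    obtain Z where Z: "negligible Z" "\<And>x. x \<notin> Z \<Longrightarrow> (G has_vector_derivative k x) (at x)"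
      using is_primitive_AE_derivative[OF k] unfolding AE_lebesgue_negligible by blast
    have eq: "deriv1 F x = k x" if "x \<in> {-N..N} - (Z \<union> {-N, N})" for x
    proof (rule vector_derivative_at)
      have "(G has_vector_derivative k x) (at x)" using Z that by auto
      then show "(F has_vector_derivative k x) (at x)"
        by (rule has_vector_derivative_transform_within_open[where S="{-N<..<N}"]) (use that GF in auto)
    qed
    have neg: "negligible (Z \<union> {-N, N})" using Z(1) by auto
    have "deriv1 F absolutely_integrable_on {-N..N}"
      by (rule absolutely_integrable_spike[OF is_primitiveD(1)[OF k] neg eq])
    moreover have "F y - F x = integral {x..y} (deriv1 F)" if "x \<in> {-N..N}" "y \<in> {-N..N}" "x \<le> y" for x y
    proof -
      have "integral {x..y} (deriv1 F) = integral {x..y} k"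
        by (rule integral_spike[OF neg]) (use eq that in auto)
      then show ?thesis using is_primitiveD(3)[OF k that(3)] GF that by simp
    qed
    ultimately show ?thesis by blast
  qed
  show ?thesis unfolding is_primitive_def
  proof (intro conjI allI impI)
    fix a b :: real
    define N where "N = \<bar>a\<bar> + \<bar>b\<bar> + 1"
    have N: "N > 0" "{a..b} \<subseteq> {-N..N}" "a \<in> {-N..N}" "b \<in> {-N..N}" unfolding N_def by auto
    show "deriv1 F absolutely_integrable_on {a..b}"
      using *[OF N(1)] N(2) absolutely_integrable_on_subinterval by blast
    show "F b - F a = integral {a..b} (deriv1 F)" if "a \<le> b" using *[OF N(1)] N(3,4) that by blast
  qed
qed

section \<open>Calculus of primitives: derivatives, products, gluing and rescaling\<close>

lemma is_primitive_continuous: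
  fixes F :: "real \<Rightarrow> 'a::euclidean_space"
  assumes F: "is_primitive F k"
  shows "continuous_on S F"
proof -
  have "isCont F x" for x
  proof -
    have "continuous_on {x-1..x+1} (\<lambda>y. F (x-1) + integral {x-1..y} k)"
      by (intro continuous_intros indefinite_integral_continuous_1 is_primitiveD(2)[OF F])
    moreover have "F (x-1) + integral {x-1..y} k = F y" if "y \<in> {x-1..x+1}" for y
      using is_primitiveD(3)[OF F, of "x-1" y] that by (auto simp: algebra_simps)
    ultimately have "continuous_on {x-1..x+1} F" using continuous_on_cong[of "{x-1..x+1}" "{x-1..x+1}" "\<lambda>y. F (x-1) + integral {x-1..y} k" F] by blast
    moreover have "x \<in> interior {x-1..x+1}" by simp
    ultimately show ?thesis using continuous_on_interior by blast
  qed
  then show ?thesis by (simp add: continuous_at_imp_continuous_on)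
qed

lemma is_primitive_continuous_derivative:
  fixes F :: "real \<Rightarrow> 'a::euclidean_space"
  assumes F: "is_primitive F k" and k: "continuous_on UNIV k"
  shows "(F has_vector_derivative k x) (at x)"
proof -
  have "((\<lambda>y. integral {x-1..y} k) has_vector_derivative k x) (at x within {x-1..x+1})"
    by (rule integral_has_vector_derivative) (auto intro: continuous_on_subset[OF k])
  then have "((\<lambda>y. integral {x-1..y} k) has_vector_derivative k x) (at x)"
    by (subst (asm) at_within_interior) auto
  then have "((\<lambda>y. F (x-1) + integral {x-1..y} k) has_vector_derivative 0 + k x) (at x)"
    by (intro derivative_intros)
  then have "((\<lambda>y. F (x-1) + integral {x-1..y} k) has_vector_derivative k x) (at x)" by simp
  then show ?thesis
  proof (rule has_vector_derivative_transform_within_open[where S="{x-1<..<x+1}"])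
    fix y assume "y \<in> {x-1<..<x+1}"
    then show "F (x-1) + integral {x-1..y} k = F y"
      using is_primitiveD(3)[OF F, of "x-1" y] by (auto simp: algebra_simps)
  qed auto
qed

lemma is_primitive_C1:
  fixes F :: "real \<Rightarrow> 'a::euclidean_space"
  assumes F: "\<And>x. (F has_vector_derivative F' x) (at x)" and c: "continuous_on UNIV F'"
  shows "is_primitive F F'"
  unfolding is_primitive_def
proof safe
  show "F' absolutely_integrable_on {a..b}" for a b
    by (intro absolutely_integrable_continuous_real continuous_on_subset[OF c]) auto
  fix a b :: real assume "a \<le> b"
  then show "F b - F a = integral {a..b} F'"
    using fundamental_theorem_of_calculus[of a b F F'] F by (metis has_vector_derivative_at_within integral_unique)
qed

lemma is_primitive_cong_AE:
  fixes F :: "real \<Rightarrow> 'a::euclidean_space"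
  assumes F: "is_primitive F k" and AE: "AE x in lebesgue. k x = l x"
  shows "is_primitive F l"
proof -
  obtain N where N: "negligible N" "\<And>x. x \<notin> N \<Longrightarrow> k x = l x" using AE unfolding AE_lebesgue_negligible by blast
  show ?thesis unfolding is_primitive_def
  proof safe
    show "l absolutely_integrable_on {a..b}" for a b
      by (rule absolutely_integrable_spike[OF is_primitiveD(1)[OF F] N(1)]) (use N in auto)
    fix a b :: real assume "a \<le> b"
    have "integral {a..b} l = integral {a..b} k" by (rule integral_spike[OF N(1)]) (use N in auto)
    then show "F b - F a = integral {a..b} l" using is_primitiveD(3)[OF F \<open>a \<le> b\<close>] by simp
  qed
qed

lemma is_primitive_AE_unique:
  fixes F :: "real \<Rightarrow> 'a::euclidean_space"
  assumes "is_primitive F k" "AE x in lebesgue. (F has_vector_derivative l x) (at x)"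
  shows "AE x in lebesgue. k x = l x"
  using is_primitive_AE_derivative[OF assms(1)] assms(2)
  by eventually_elim (rule vector_derivative_unique_at)

text \<open>In epsilon-delta form a product of absolutely continuous functions only needs bounds on
  a compact interval; its density is afterwards read off from the product rule almost everywhere.
  All later integrations by parts rest on this.\<close>

lemma is_primitive_mult:
  fixes F G :: "real \<Rightarrow> complex"
  assumes F: "is_primitive F k" and G: "is_primitive G l"
  shows "is_primitive (\<lambda>x. F x * G x) (\<lambda>x. k x * G x + F x * l x)"
proof -
  have "locally_abs_continuous (\<lambda>x. F x * G x)"
    unfolding locally_abs_continuous_def abs_continuous_on_Icc_def
  proof (intro allI impI)
    fix a b e :: real assume e: "e > 0"
    obtain B1 where B1: "\<And>x. x \<in> {a..b} \<Longrightarrow> norm (F x) \<le> B1"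
      using continuous_on_compact_bound[OF compact_Icc is_primitive_continuous[OF F]] by blast
    obtain B2 where B2: "\<And>x. x \<in> {a..b} \<Longrightarrow> norm (G x) \<le> B2"
      using continuous_on_compact_bound[OF compact_Icc is_primitive_continuous[OF G]] by blast
    define B where "B = max 1 (max B1 B2)"
    have B: "B \<ge> 1" "\<And>x. x \<in> {a..b} \<Longrightarrow> norm (F x) \<le> B" "\<And>x. x \<in> {a..b} \<Longrightarrow> norm (G x) \<le> B"
      using B1 B2 unfolding B_def by force+
    define h where "h = e / (2 * B)"
    have h: "h > 0" "B * (h + h) = e" unfolding h_def using e B(1) by (auto simp: field_simps)
    have acF: "abs_continuous_on_Icc F a b" and acG: "abs_continuous_on_Icc G a b"
      using is_primitive_locally_abs_continuous[OF F] is_primitive_locally_abs_continuous[OF G]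
      unfolding locally_abs_continuous_def by auto
    obtain d1 where d1: "d1 > 0" "\<And>D. D division_of \<Union>D \<Longrightarrow> \<Union>D \<subseteq> {a..b} \<Longrightarrow> (\<Sum>I\<in>D. Sup I - Inf I) < d1
       \<Longrightarrow> (\<Sum>I\<in>D. norm (F (Sup I) - F (Inf I))) < h" using abs_continuous_on_IccE[OF acF h(1)] by blast
    obtain d2 where d2: "d2 > 0" "\<And>D. D division_of \<Union>D \<Longrightarrow> \<Union>D \<subseteq> {a..b} \<Longrightarrow> (\<Sum>I\<in>D. Sup I - Inf I) < d2
       \<Longrightarrow> (\<Sum>I\<in>D. norm (G (Sup I) - G (Inf I))) < h" using abs_continuous_on_IccE[OF acG h(1)] by blast
    show "\<exists>d>0. \<forall>D. D division_of \<Union>D \<and> \<Union>D \<subseteq> {a..b} \<and> (\<Sum>I\<in>D. Sup I - Inf I) < d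
       \<longrightarrow> (\<Sum>I\<in>D. norm (F (Sup I) * G (Sup I) - F (Inf I) * G (Inf I))) < e"
    proof (intro exI[of _ "min d1 d2"] conjI allI impI)
      show "0 < min d1 d2" using d1(1) d2(1) by simp
      fix D assume "D division_of \<Union>D \<and> \<Union>D \<subseteq> {a..b} \<and> (\<Sum>I\<in>D. Sup I - Inf I) < min d1 d2"
      then have D: "D division_of \<Union>D" "\<Union>D \<subseteq> {a..b}" "(\<Sum>I\<in>D. Sup I - Inf I) < d1" "(\<Sum>I\<in>D. Sup I - Inf I) < d2" by auto
      have "norm (F (Sup I) * G (Sup I) - F (Inf I) * G (Inf I)) \<le>
         B * (norm (F (Sup I) - F (Inf I)) + norm (G (Sup I) - G (Inf I)))" if "I \<in> D" for I
      proof -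
        have "I = {Inf I..Sup I} \<and> Inf I \<le> Sup I" using Icc_Sup_Inf[of I] division_ofD(3,4)[OF D(1) that] by blast
        then have in1: "Inf I \<in> {a..b}" "Sup I \<in> {a..b}" using D(2) that by (metis UnionI atLeastAtMost_iff order_refl subsetD)+
        have "F (Sup I) * G (Sup I) - F (Inf I) * G (Inf I) = (F (Sup I) - F (Inf I)) * G (Sup I) + F (Inf I) * (G (Sup I) - G (Inf I))"
          by (simp add: algebra_simps)
        also have "norm \<dots> \<le> norm (F (Sup I) - F (Inf I)) * norm (G (Sup I)) + norm (F (Inf I)) * norm (G (Sup I) - G (Inf I))"
          by (metis norm_mult norm_triangle_ineq)
        also have "\<dots> \<le> norm (F (Sup I) - F (Inf I)) * B + B * norm (G (Sup I) - G (Inf I))"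
          using B in1 by (intro add_mono mult_left_mono mult_right_mono) auto
        finally show ?thesis by (simp add: algebra_simps)
      qed
      then have "(\<Sum>I\<in>D. norm (F (Sup I) * G (Sup I) - F (Inf I) * G (Inf I))) \<le>
        (\<Sum>I\<in>D. B * (norm (F (Sup I) - F (Inf I)) + norm (G (Sup I) - G (Inf I))))" by (rule sum_mono)
      also have "\<dots> = B * ((\<Sum>I\<in>D. norm (F (Sup I) - F (Inf I))) + (\<Sum>I\<in>D. norm (G (Sup I) - G (Inf I))))"
        by (simp add: sum.distrib flip: sum_distrib_left)
      also have "\<dots> < B * (h + h)" using d1(2)[OF D(1-3)] d2(2)[OF D(1,2,4)] B(1) by (intro mult_strict_left_mono) auto
      finally show "(\<Sum>I\<in>D. norm (F (Sup I) * G (Sup I) - F (Inf I) * G (Inf I))) < e" using h(2) by simp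
    qed
  qed
  then have P: "is_primitive (\<lambda>x. F x * G x) (deriv1 (\<lambda>x. F x * G x))"
    by (rule locally_abs_continuous_primitive)
  have "AE x in lebesgue. ((\<lambda>x. F x * G x) has_vector_derivative k x * G x + F x * l x) (at x)"
    using is_primitive_AE_derivative[OF F] is_primitive_AE_derivative[OF G]
  proof eventually_elim
    case (elim x)
    then show ?case using has_vector_derivative_mult[of F "k x" x UNIV G "l x"] by (simp add: algebra_simps)
  qed
  then show ?thesis by (intro is_primitive_cong_AE[OF P] is_primitive_AE_unique[OF P])
qed

lemma is_primitive_glue:
  fixes F G :: "real \<Rightarrow> 'a::euclidean_space"
  assumes F: "is_primitive F k" and G: "is_primitive G l" and m: "F m = G m"
  shows "is_primitive (\<lambda>x. if x < m then F x else G x) (\<lambda>x. if x < m then k x else l x)"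
  unfolding is_primitive_def
proof safe
  let ?h = "\<lambda>x. if x < m then k x else l x"
  show abs: "?h absolutely_integrable_on {a..b}" for a b
  proof -
    have "integrable lebesgue (\<lambda>x. indicat_real {..<m} x *\<^sub>R (indicat_real {a..b} x *\<^sub>R k x) +
        indicat_real {m..} x *\<^sub>R (indicat_real {a..b} x *\<^sub>R l x))"
      using is_primitiveD(1)[OF F, of a b] is_primitiveD(1)[OF G, of a b] unfolding set_integrable_def
      by (intro Bochner_Integration.integrable_add integrable_mult_indicator[of _ lebesgue "\<lambda>x. indicat_real {a..b} x *\<^sub>R k x"]
         integrable_mult_indicator[of _ lebesgue "\<lambda>x. indicat_real {a..b} x *\<^sub>R l x"]) auto
    moreover have "indicat_real {..<m} x *\<^sub>R (indicat_real {a..b} x *\<^sub>R k x) +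
        indicat_real {m..} x *\<^sub>R (indicat_real {a..b} x *\<^sub>R l x) = indicat_real {a..b} x *\<^sub>R ?h x" for x
      by (auto simp: indicator_def)
    ultimately show ?thesis unfolding set_integrable_def by simp
  qed
  fix a b :: real assume ab: "a \<le> b"
  have L: "integral {a..b} ?h = F b - F a" if "b \<le> m" "a \<le> b" for a b
  proof -
    have "integral {a..b} ?h = integral {a..b} k" by (rule integral_spike[of "{m}"]) (use that in auto)
    then show ?thesis using is_primitiveD(3)[OF F that(2)] by simp
  qed
  have R: "integral {a..b} ?h = G b - G a" if "m \<le> a" "a \<le> b" for a b
  proof -
    have "integral {a..b} ?h = integral {a..b} l" by (rule Henstock_Kurzweil_Integration.integral_cong) (use that in auto)
    then show ?thesis using is_primitiveD(3)[OF G that(2)] by simp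
  qed
  consider "b \<le> m" | "m \<le> a" | "a < m" "m < b" by linarith
  then show "(if b < m then F b else G b) - (if a < m then F a else G a) = integral {a..b} ?h"
  proof cases
    case 1 then show ?thesis using L[OF 1 ab] ab m by (cases "b = m"; cases "a = m") auto
  next
    case 2 then show ?thesis using R[OF 2 ab] ab by auto
  next
    case 3
    have "integral {a..b} ?h = integral {a..m} ?h + integral {m..b} ?h"
      using Henstock_Kurzweil_Integration.integral_combine[of a m b ?h] 3 set_lebesgue_integral_eq_integral(1)[OF abs[of a b]] by simp
    then show ?thesis using L[of m a] R[of m b] 3 m by simp
  qed
qed

lemma is_primitive_affine:
  fixes F :: "real \<Rightarrow> 'a::euclidean_space"
  assumes F: "is_primitive F k" and c: "c > 0"
  shows "is_primitive (\<lambda>x. F (t + c * x)) (\<lambda>x. c *\<^sub>R k (t + c * x))"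
  unfolding is_primitive_def
proof safe
  have ind: "indicat_real {a..b} x = indicat_real {t + c * a..t + c * b} (t + c * x)" for a b x
    using c by (auto simp: indicator_def)
  show abs: "(\<lambda>x. c *\<^sub>R k (t + c * x)) absolutely_integrable_on {a..b}" for a b
  proof -
    have "integrable lebesgue (\<lambda>x. (\<lambda>y. indicat_real {t + c * a..t + c * b} y *\<^sub>R k y) (t + c * x))"
      using is_primitiveD(1)[OF F, of "t + c * a" "t + c * b"] c
      by (subst lebesgue_integrable_real_affine_iff) (auto simp: set_integrable_def)
    then have "(\<lambda>x. k (t + c * x)) absolutely_integrable_on {a..b}" unfolding set_integrable_def ind[of a b] by simp
    then show ?thesis by (rule set_integrable_scaleR_right)
  qed
  fix a b :: real assume ab: "a \<le> b"
  have "integral {a..b} (\<lambda>x. c *\<^sub>R k (t + c * x)) = (LINT x:{a..b}|lebesgue. c *\<^sub>R k (t + c * x))"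
    using set_lebesgue_integral_eq_integral(2)[OF abs[of a b]] by (rule sym)
  also have "\<dots> = c *\<^sub>R (\<integral>x. (\<lambda>y. indicat_real {t + c * a..t + c * b} y *\<^sub>R k y) (t + c * x) \<partial>lebesgue)"
    unfolding set_lebesgue_integral_def ind[of a b] by (simp flip: integral_scaleR_right add: mult.commute)
  also have "\<dots> = (\<integral>y. indicat_real {t + c * a..t + c * b} y *\<^sub>R k y \<partial>lebesgue)"
    using lebesgue_integral_real_affine[of c "\<lambda>y. indicat_real {t + c * a..t + c * b} y *\<^sub>R k y" t] c by simp
  also have "\<dots> = integral {t + c * a..t + c * b} k"
    using set_lebesgue_integral_eq_integral(2)[OF is_primitiveD(1)[OF F]] unfolding set_lebesgue_integral_def by simp
  also have "\<dots> = F (t + c * b) - F (t + c * a)" using is_primitiveD(3)[OF F, of "t + c * a" "t + c * b"] ab c by simp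
  finally show "F (t + c * b) - F (t + c * a) = integral {a..b} (\<lambda>x. c *\<^sub>R k (t + c * x))" by simp
qed

text \<open>Carries the derivative and a representative of the second derivative as explicit data.
  Sums, gluings and rescalings act on the triple, so that no derivative has to be computed for a
  composite function; \<open>k\<close> matters only up to null sets.\<close>

definition H2 :: "(real \<Rightarrow> complex) \<Rightarrow> (real \<Rightarrow> complex) \<Rightarrow> (real \<Rightarrow> complex) \<Rightarrow> bool" where
  "H2 f f1 k \<longleftrightarrow> is_primitive f f1 \<and> is_primitive f1 k"

lemma H2_derivative: "H2 f f1 k \<Longrightarrow> (f has_vector_derivative f1 x) (at x)"
  unfolding H2_def using is_primitive_continuous_derivative is_primitive_continuous by blast

lemma H2_continuous: "H2 f f1 k \<Longrightarrow> continuous_on S f" "H2 f f1 k \<Longrightarrow> continuous_on S f1"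
  unfolding H2_def using is_primitive_continuous by blast+

lemma H2_add: "H2 f f1 k \<Longrightarrow> H2 g g1 l \<Longrightarrow> H2 (\<lambda>x. f x + g x) (\<lambda>x. f1 x + g1 x) (\<lambda>x. k x + l x)"
  unfolding H2_def by (auto intro: is_primitive_add)

lemma H2_diff: "H2 f f1 k \<Longrightarrow> H2 g g1 l \<Longrightarrow> H2 (\<lambda>x. f x - g x) (\<lambda>x. f1 x - g1 x) (\<lambda>x. k x - l x)"
  unfolding H2_def by (auto intro: is_primitive_diff)

lemma H2_cmul: "H2 f f1 k \<Longrightarrow> H2 (\<lambda>x. c * f x) (\<lambda>x. c * f1 x) (\<lambda>x. c * k x)"
  unfolding H2_def by (auto intro: is_primitive_bounded_linear bounded_linear_mult_right)

lemma H2_glue: "H2 f f1 k \<Longrightarrow> H2 g g1 l \<Longrightarrow> f m = g m \<Longrightarrow> f1 m = g1 m \<Longrightarrow>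
  H2 (\<lambda>x. if x < m then f x else g x) (\<lambda>x. if x < m then f1 x else g1 x) (\<lambda>x. if x < m then k x else l x)"
  unfolding H2_def by (auto intro: is_primitive_glue)

lemma H2_reflect: "H2 f f1 k \<Longrightarrow> H2 (\<lambda>x. f (-x)) (\<lambda>x. - f1 (-x)) (\<lambda>x. k (-x))"
  unfolding H2_def using is_primitive_reflect is_primitive_bounded_linear[OF is_primitive_reflect[of f1 k] bounded_linear_minus[OF bounded_linear_ident]]
  by auto

lemma H2_affine:
  assumes "H2 f f1 k" "c > 0"
  shows "H2 (\<lambda>x. f (t + c * x)) (\<lambda>x. c *\<^sub>R f1 (t + c * x)) (\<lambda>x. c\<^sup>2 *\<^sub>R k (t + c * x))"
  using assms is_primitive_affine[of f f1 c t]
    is_primitive_bounded_linear[OF is_primitive_affine[of f1 k c t] bounded_linear_scaleR_right[of c]]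
  unfolding H2_def by (auto simp: power2_eq_square)

lemma borel_measurable_lebesgue_cong_AE:
  fixes f g :: "real \<Rightarrow> 'a::euclidean_space"
  assumes "f \<in> borel_measurable lebesgue" "AE x in lebesgue. f x = g x"
  shows "g \<in> borel_measurable lebesgue"
  using borel_measurable_AE[OF assms] .

lemma continuous_borel_measurable_lebesgue:
  fixes f :: "real \<Rightarrow> 'a::euclidean_space"
  assumes "continuous_on UNIV f"
  shows "f \<in> borel_measurable lebesgue"
  using borel_measurable_continuous_onI[OF assms] by (simp add: measurable_completion)

lemma is_primitive_measurable:
  fixes F :: "real \<Rightarrow> 'a::euclidean_space"
  assumes F: "is_primitive F k"
  shows "k \<in> borel_measurable lebesgue"
proof (rule borel_measurable_LIMSEQ_metric)
  fix i :: nat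
  show "(\<lambda>x. indicat_real {- real i..real i} x *\<^sub>R k x) \<in> borel_measurable lebesgue"
    using is_primitiveD(1)[OF F] unfolding set_integrable_def by auto
next
  fix x :: real
  obtain N :: nat where N: "\<bar>x\<bar> \<le> real N" using real_arch_simple by blast
  have "eventually (\<lambda>i. indicat_real {- real i..real i} x *\<^sub>R k x = k x) sequentially"
    unfolding eventually_sequentially using N by (intro exI[of _ N]) (auto simp: indicator_def)
  then show "(\<lambda>i. indicat_real {- real i..real i} x *\<^sub>R k x) \<longlonglongrightarrow> k x" by (rule tendsto_eventually)
qed

subsection \<open>Square integrable functions\<close>

text \<open>Squared norms avoid square roots: sums are estimated with the factor 2 of
  \<open>norm_add_sq_le\<close>, and errors of order sqrt \<epsilon> in norm become linear in
  \<epsilon>.\<close>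

definition nsq :: "(real \<Rightarrow> complex) \<Rightarrow> real" where
  "nsq f = (LINT x|lebesgue. (norm (f x))\<^sup>2)"

lemma nsq_nonneg: "nsq f \<ge> 0" unfolding nsq_def by simp

lemma L2_norm_nsq: "L2_norm f = sqrt (nsq f)" unfolding L2_norm_def nsq_def ..

lemma L2_spaceD:
  assumes "f \<in> L2_space"
  shows "f \<in> borel_measurable lebesgue" "integrable lebesgue (\<lambda>x. (norm (f x))\<^sup>2)"
  using assms unfolding L2_space_def by auto

lemma L2_bound:
  fixes f :: "real \<Rightarrow> complex"
  assumes m: "f \<in> borel_measurable lebesgue" and h: "integrable lebesgue h" and b: "AE x in lebesgue. (norm (f x))\<^sup>2 \<le> h x"
  shows "f \<in> L2_space" "nsq f \<le> (LINT x|lebesgue. h x)"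
proof -
  have i: "integrable lebesgue (\<lambda>x. (norm (f x))\<^sup>2)"
  proof (rule Bochner_Integration.integrable_bound[OF h])
    show "(\<lambda>x. (norm (f x))\<^sup>2) \<in> borel_measurable lebesgue" using m by measurable
    show "AE x in lebesgue. norm ((norm (f x))\<^sup>2) \<le> norm (h x)" using b by eventually_elim auto
  qed
  then show "f \<in> L2_space" using m unfolding L2_space_def by auto
  show "nsq f \<le> (LINT x|lebesgue. h x)" unfolding nsq_def by (rule integral_mono_AE[OF i h b])
qed

lemma norm_add_sq_le: "(norm (a + b))\<^sup>2 \<le> 2 * (norm a)\<^sup>2 + 2 * (norm b)\<^sup>2" for a b :: "'a::real_normed_vector"
proof -
  have "(norm (a + b))\<^sup>2 \<le> (norm a + norm b)\<^sup>2" by (intro power_mono norm_triangle_ineq) auto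
  also have "\<dots> \<le> 2 * (norm a)\<^sup>2 + 2 * (norm b)\<^sup>2" using sum_squares_bound[of "norm a" "norm b"] by (simp add: power2_sum)
  finally show ?thesis .
qed

lemma L2_add:
  fixes f g :: "real \<Rightarrow> complex"
  assumes f: "f \<in> L2_space" and g: "g \<in> L2_space"
  shows "(\<lambda>x. f x + g x) \<in> L2_space" "nsq (\<lambda>x. f x + g x) \<le> 2 * nsq f + 2 * nsq g"
proof -
  note D = L2_spaceD[OF f] L2_spaceD[OF g]
  have m: "(\<lambda>x. f x + g x) \<in> borel_measurable lebesgue" using D by measurable
  have i: "integrable lebesgue (\<lambda>x. 2 * (norm (f x))\<^sup>2 + 2 * (norm (g x))\<^sup>2)" using D by auto
  note B = L2_bound[OF m i AE_I2[OF norm_add_sq_le]]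
  show "(\<lambda>x. f x + g x) \<in> L2_space" by (rule B(1))
  show "nsq (\<lambda>x. f x + g x) \<le> 2 * nsq f + 2 * nsq g" using B(2) D unfolding nsq_def by simp
qed

lemma L2_cmul:
  fixes f :: "real \<Rightarrow> complex"
  assumes f: "f \<in> L2_space"
  shows "(\<lambda>x. c * f x) \<in> L2_space" "nsq (\<lambda>x. c * f x) = (norm c)\<^sup>2 * nsq f"
  using L2_spaceD[OF f] unfolding L2_space_def nsq_def by (auto simp: norm_mult power_mult_distrib)

lemma L2_uminus: "f \<in> L2_space \<Longrightarrow> (\<lambda>x. - f x) \<in> L2_space" for f :: "real \<Rightarrow> complex"
  using L2_cmul(1)[of f "-1"] by simp

lemma L2_diff:
  fixes f g :: "real \<Rightarrow> complex"
  assumes f: "f \<in> L2_space" and g: "g \<in> L2_space"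
  shows "(\<lambda>x. f x - g x) \<in> L2_space" "nsq (\<lambda>x. f x - g x) \<le> 2 * nsq f + 2 * nsq g"
  using L2_add[OF f L2_uminus[OF g]] by (auto simp: nsq_def)

lemma L2_cong_AE:
  fixes f g :: "real \<Rightarrow> complex"
  assumes f: "f \<in> L2_space" and AE: "AE x in lebesgue. f x = g x"
  shows "g \<in> L2_space" "nsq g = nsq f"
proof -
  have m: "g \<in> borel_measurable lebesgue" using borel_measurable_lebesgue_cong_AE[OF L2_spaceD(1)[OF f] AE] .
  have e: "AE x in lebesgue. (norm (f x))\<^sup>2 = (norm (g x))\<^sup>2" using AE by eventually_elim auto
  have "integrable lebesgue (\<lambda>x. (norm (g x))\<^sup>2) \<longleftrightarrow> integrable lebesgue (\<lambda>x. (norm (f x))\<^sup>2)"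
    using e m L2_spaceD[OF f] by (intro integrable_cong_AE) (auto elim: eventually_mono)
  then show "g \<in> L2_space" using m L2_spaceD[OF f] unfolding L2_space_def by auto
  show "nsq g = nsq f" unfolding nsq_def
    using e m L2_spaceD[OF f] by (intro integral_cong_AE) (auto elim: eventually_mono)
qed

lemma L2_mult_integrable:
  fixes f g :: "real \<Rightarrow> complex"
  assumes f: "f \<in> L2_space" and g: "g \<in> L2_space"
  shows "integrable lebesgue (\<lambda>x. norm (f x) * norm (g x))" "integrable lebesgue (\<lambda>x. f x * g x)"
    "integrable lebesgue (\<lambda>x. f x * cnj (g x))"
proof -
  note D = L2_spaceD[OF f] L2_spaceD[OF g]
  have i: "integrable lebesgue (\<lambda>x. (norm (f x))\<^sup>2 + (norm (g x))\<^sup>2)" using D by auto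
  have le: "norm (f x) * norm (g x) \<le> (norm (f x))\<^sup>2 + (norm (g x))\<^sup>2" for x
    using sum_squares_bound[of "norm (f x)" "norm (g x)"] mult_nonneg_nonneg[OF norm_ge_zero[of "f x"] norm_ge_zero[of "g x"]]
    by linarith
  show "integrable lebesgue (\<lambda>x. norm (f x) * norm (g x))"
    by (rule Bochner_Integration.integrable_bound[OF i]) (use D le in auto)
  show "integrable lebesgue (\<lambda>x. f x * g x)"
    by (rule Bochner_Integration.integrable_bound[OF i]) (use D le in \<open>auto simp: norm_mult\<close>)
  have "(\<lambda>x. cnj (g x)) \<in> borel_measurable lebesgue" using measurable_compose[OF D(3) borel_measurable_continuous_onI[OF continuous_on_cnj[OF continuous_on_id]]] by simp
  then show "integrable lebesgue (\<lambda>x. f x * cnj (g x))"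
    by (intro Bochner_Integration.integrable_bound[OF i]) (use D le in \<open>auto simp: norm_mult\<close>)
qed

lemma L2_bounded_mult:
  fixes f g :: "real \<Rightarrow> complex"
  assumes f: "f \<in> L2_space" and g: "g \<in> borel_measurable lebesgue" "\<And>x. norm (g x) \<le> B"
  shows "(\<lambda>x. g x * f x) \<in> L2_space"
proof (rule L2_bound(1))
  show "(\<lambda>x. g x * f x) \<in> borel_measurable lebesgue" using g L2_spaceD[OF f] by measurable
  show "integrable lebesgue (\<lambda>x. B\<^sup>2 * (norm (f x))\<^sup>2)" using L2_spaceD[OF f] by auto
  have "(norm (g x * f x))\<^sup>2 \<le> B\<^sup>2 * (norm (f x))\<^sup>2" for x
    using g(2)[of x] by (auto simp: norm_mult power_mult_distrib intro!: mult_right_mono power_mono)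
  then show "AE x in lebesgue. (norm (g x * f x))\<^sup>2 \<le> B\<^sup>2 * (norm (f x))\<^sup>2" by auto
qed

subsection \<open>The domain of the free operator\<close>

lemma S0_domainD:
  assumes "f \<in> S0_domain V"
  shows "f \<in> L2_space" "H2 f (deriv1 f) (deriv1 (deriv1 f))" "schroedinger_expr V f \<in> L2_space"
  using assms locally_abs_continuous_primitive unfolding S0_domain_def H2_def by auto

lemma H2_deriv1: "H2 f f1 k \<Longrightarrow> deriv1 f = f1"
  using H2_derivative vector_derivative_at by (intro ext) blast

lemma H2_schroedinger_expr:
  assumes "H2 f f1 k"
  shows "AE x in lebesgue. schroedinger_expr V f x = complex_of_real (V x) * f x - k x"
proof -
  have "AE x in lebesgue. (f1 has_vector_derivative k x) (at x)"
    using assms is_primitive_AE_derivative unfolding H2_def by blast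
  then show ?thesis
    by eventually_elim (simp add: schroedinger_expr_def H2_deriv1[OF assms] vector_derivative_at)
qed

text \<open>The entrance to the domain for glued functions: square integrability is checked for
  \<open>V x * f x - k x\<close>, where \<open>k\<close> is known piecewise, and agrees almost
  everywhere with the differential expression.\<close>

lemma H2_S0_domain:
  assumes f: "f \<in> L2_space" and H: "H2 f f1 k" and G: "(\<lambda>x. complex_of_real (V x) * f x - k x) \<in> L2_space"
  shows "f \<in> S0_domain V"
proof -
  have "f differentiable (at x)" for x
    using H2_derivative[OF H] differentiableI_vector by blast
  moreover have "locally_abs_continuous f" "locally_abs_continuous (deriv1 f)"
    using H is_primitive_locally_abs_continuous unfolding H2_deriv1[OF H] unfolding H2_def by auto
  moreover have "AE x in lebesgue. complex_of_real (V x) * f x - k x = schroedinger_expr V f x"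
    using H2_schroedinger_expr[OF H, of V] by eventually_elim simp
  then have "schroedinger_expr V f \<in> L2_space" using L2_cong_AE(1)[OF G] by blast
  ultimately show ?thesis using f unfolding S0_domain_def by blast
qed

subsection \<open>The initial value problem\<close>

text \<open>The signed primitive, so that an initial value problem at 0 is treated on both
  half-lines by one integral operator.\<close>

definition prim :: "(real \<Rightarrow> complex) \<Rightarrow> real \<Rightarrow> complex" where
  "prim k x = (if 0 \<le> x then integral {0..x} k else - integral {x..0} k)"

lemma prim_0 [simp]: "prim k 0 = 0" unfolding prim_def by simp

lemma is_primitive_prim:
  assumes k: "\<And>a b. k absolutely_integrable_on {a..b}"
  shows "is_primitive (prim k) k"
  unfolding is_primitive_def
proof safe
  show "k absolutely_integrable_on {a..b}" for a b by (rule k)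
  fix a b :: real assume ab: "a \<le> b"
  have i: "k integrable_on {u..v}" for u v using k set_lebesgue_integral_eq_integral(1) by blast
  note c = Henstock_Kurzweil_Integration.integral_combine[OF _ _ i]
  consider "0 \<le> a" | "b < 0" | "a < 0" "0 \<le> b" using ab by linarith
  then show "prim k b - prim k a = integral {a..b} k"
  proof cases
    case 1 then show ?thesis using c[of 0 a b] ab unfolding prim_def by (simp add: algebra_simps)
  next
    case 2 then show ?thesis using c[of a b 0] ab unfolding prim_def by (simp add: algebra_simps)
  next
    case 3 then show ?thesis using c[of a 0 b] ab unfolding prim_def by (simp add: algebra_simps)
  qed
qed

text \<open>Each integration raises the power by one and divides by the new exponent; iterated, this
  yields the factorials that make the Neumann series converge.\<close>

lemma prim_norm_le:
  assumes k: "\<And>a b. k absolutely_integrable_on {a..b}"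
    and b: "\<And>t. \<bar>t\<bar> \<le> \<bar>x\<bar> \<Longrightarrow> norm (k t) \<le> C * \<bar>t\<bar> ^ n"
  shows "norm (prim k x) \<le> C * \<bar>x\<bar> ^ Suc n / real (Suc n)"
proof -
  have main: "norm (integral {0..y} l) \<le> C * y ^ Suc n / real (Suc n)"
    if y: "0 \<le> y" and l: "l integrable_on {0..y}" "\<And>t. 0 \<le> t \<Longrightarrow> t \<le> y \<Longrightarrow> norm (l t) \<le> C * t ^ n" for y and l :: "real \<Rightarrow> complex"
  proof -
    have "((\<lambda>t. C * t ^ n) has_integral C * y ^ Suc n / real (Suc n) - C * 0 ^ Suc n / real (Suc n)) {0..y}"
    proof (rule fundamental_theorem_of_calculus[OF y])
      fix t assume "t \<in> {0..y}"
      define m where "m = real (Suc n)"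
      have m: "m \<noteq> 0" unfolding m_def by simp
      have "((\<lambda>t. C * t ^ Suc n / m) has_real_derivative C * (m * t ^ n) / m) (at t within {0..y})"
        using DERIV_pow[of "Suc n" t "{0..y}"] unfolding m_def
        by (intro DERIV_cdivide DERIV_cmult) (simp del: of_nat_Suc power_Suc)
      then have "((\<lambda>t. C * t ^ Suc n / real (Suc n)) has_real_derivative C * t ^ n) (at t within {0..y})"
        using m unfolding m_def by (simp del: of_nat_Suc power_Suc)
      then show "((\<lambda>t. C * t ^ Suc n / real (Suc n)) has_vector_derivative C * t ^ n) (at t within {0..y})"
        by (simp add: has_real_derivative_iff_has_vector_derivative)
    qed
    then have h: "((\<lambda>t. C * t ^ n) has_integral C * y ^ Suc n / real (Suc n)) {0..y}" by simp
    have "norm (integral {0..y} l) \<le> integral {0..y} (\<lambda>t. C * t ^ n)"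
      by (rule Henstock_Kurzweil_Integration.integral_norm_bound_integral[OF l(1)]) (use h l(2) in auto)
    then show ?thesis using h integral_unique by metis
  qed
  have i: "k integrable_on {u..v}" for u v using k set_lebesgue_integral_eq_integral(1) by blast
  show ?thesis
  proof (cases "0 \<le> x")
    case True
    have "norm (k t) \<le> C * t ^ n" if "0 \<le> t" "t \<le> x" for t using b[of t] that by simp
    then show ?thesis unfolding prim_def using main[OF True i] True by simp
  next
    case False
    have "integral {x..0} k = integral {0..-x} (\<lambda>t. k (-t))"
      using Henstock_Kurzweil_Integration.integral_reflect_real[where f="\<lambda>t. k (-t)" and a=0 and b="-x"] by simp
    moreover have "(\<lambda>t. k (-t)) integrable_on {0..-x}"
      using Henstock_Kurzweil_Integration.integrable_reflect_real[where f=k and a=x and b=0] i by simp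
    moreover have "norm (k (-t)) \<le> C * t ^ n" if "0 \<le> t" "t \<le> -x" for t using b[of "-t"] that by simp
    ultimately show ?thesis unfolding prim_def using main[of "-x" "\<lambda>t. k (-t)"] False by simp
  qed
qed

lemma measurable_bounded_abs_integrable:
  fixes h :: "real \<Rightarrow> 'a::euclidean_space"
  assumes "h \<in> borel_measurable lebesgue" "\<And>x. x \<in> {a..b} \<Longrightarrow> norm (h x) \<le> B"
  shows "h absolutely_integrable_on {a..b}"
proof (rule measurable_bounded_by_integrable_imp_absolutely_integrable)
  show "h \<in> borel_measurable (lebesgue_on {a..b})" using assms(1) by (simp add: measurable_restrict_space1)
  show "(\<lambda>x. B) integrable_on {a..b}" by (rule integrable_const_ivl)
qed (use assms(2) in auto)

definition loc_bounded :: "(real \<Rightarrow> complex) \<Rightarrow> bool" where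
  "loc_bounded Q \<longleftrightarrow> Q \<in> borel_measurable lebesgue \<and> (\<forall>N. \<exists>K\<ge>0. \<forall>x. \<bar>x\<bar> \<le> N \<longrightarrow> norm (Q x) \<le> K)"

lemma loc_boundedE:
  assumes "loc_bounded Q"
  obtains K where "K \<ge> 0" "\<And>x. \<bar>x\<bar> \<le> N \<Longrightarrow> norm (Q x) \<le> K"
  using assms unfolding loc_bounded_def by blast

lemma loc_bounded_mult_abs_integrable:
  assumes Q: "loc_bounded Q" and f: "continuous_on UNIV f"
  shows "(\<lambda>x. Q x * f x) absolutely_integrable_on {a..b}"
proof -
  obtain K where K: "K \<ge> 0" "\<And>x. \<bar>x\<bar> \<le> \<bar>a\<bar> + \<bar>b\<bar> \<Longrightarrow> norm (Q x) \<le> K" using loc_boundedE[OF Q] by blast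
  obtain B where B: "\<And>x. x \<in> {a..b} \<Longrightarrow> norm (f x) \<le> B"
    using continuous_on_compact_bound[OF compact_Icc continuous_on_subset[OF f]] by blast
  show ?thesis
  proof (rule measurable_bounded_abs_integrable[where B="K * B"])
    have "f \<in> borel_measurable lebesgue" by (rule continuous_borel_measurable_lebesgue[OF f])
    then show "(\<lambda>x. Q x * f x) \<in> borel_measurable lebesgue" using Q unfolding loc_bounded_def by auto
    fix x assume x: "x \<in> {a..b}"
    then show "norm (Q x * f x) \<le> K * B"
      using K(2)[of x] B[OF x] K(1) by (auto simp: norm_mult intro!: mult_mono)
  qed
qed

lemma prim_continuous:
  assumes "\<And>a b. k absolutely_integrable_on {a..b}"
  shows "continuous_on S (prim k)"
  using is_primitive_continuous[OF is_primitive_prim[OF assms]] .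

lemma continuous_abs_integrable:
  fixes f :: "real \<Rightarrow> complex"
  shows "continuous_on UNIV f \<Longrightarrow> f absolutely_integrable_on {a..b}"
  by (rule absolutely_integrable_continuous_real[OF continuous_on_subset[OF _ subset_UNIV]])

lemma prim_add:
  assumes "\<And>a b. k absolutely_integrable_on {a..b}" "\<And>a b. l absolutely_integrable_on {a..b}"
  shows "prim (\<lambda>x. k x + l x) x = prim k x + prim l x"
proof -
  have "k integrable_on {a..b}" "l integrable_on {a..b}" for a b
    using assms set_lebesgue_integral_eq_integral(1) by blast+
  then show ?thesis unfolding prim_def by (simp add: Henstock_Kurzweil_Integration.integral_add)
qed

text \<open>With \<open>u0\<close> collecting the initial data and the inhomogeneity,
  \<open>f = u0 + volt Q f\<close> is the integrated form of \<open>f'' = Q f - g\<close>.\<close>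

definition volt :: "(real \<Rightarrow> complex) \<Rightarrow> (real \<Rightarrow> complex) \<Rightarrow> real \<Rightarrow> complex" where
  "volt Q f = prim (prim (\<lambda>t. Q t * f t))"

lemma volt_continuous:
  assumes Q: "loc_bounded Q" and f: "continuous_on UNIV f"
  shows "continuous_on S (volt Q f)"
  unfolding volt_def
  by (intro prim_continuous continuous_abs_integrable loc_bounded_mult_abs_integrable[OF Q f])

lemma volt_add:
  assumes Q: "loc_bounded Q" and f: "continuous_on UNIV f" and g: "continuous_on UNIV g"
  shows "volt Q (\<lambda>x. f x + g x) x = volt Q f x + volt Q g x"
proof -
  have 1: "prim (\<lambda>t. Q t * (f t + g t)) = (\<lambda>x. prim (\<lambda>t. Q t * f t) x + prim (\<lambda>t. Q t * g t) x)"
    using prim_add[OF loc_bounded_mult_abs_integrable[OF Q f] loc_bounded_mult_abs_integrable[OF Q g]]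
    by (intro ext) (simp add: algebra_simps)
  show ?thesis unfolding volt_def 1
    by (intro prim_add continuous_abs_integrable prim_continuous loc_bounded_mult_abs_integrable Q f g)
qed

text \<open>Two integrations gain two powers of \<open>\<bar>x\<bar>\<close>. One is spent as the
  constant \<open>N\<close>; the other is kept and already produces the factorial of
  \<open>n\<close> in the iteration.\<close>

lemma volt_norm_le:
  assumes Q: "loc_bounded Q" and f: "continuous_on UNIV f" and K: "K \<ge> 0" "C \<ge> 0" "\<And>t. \<bar>t\<bar> \<le> N \<Longrightarrow> norm (Q t) \<le> K"
    and b: "\<And>t. \<bar>t\<bar> \<le> N \<Longrightarrow> norm (f t) \<le> C * \<bar>t\<bar> ^ n" and x: "\<bar>x\<bar> \<le> N"
  shows "norm (volt Q f x) \<le> K * C * N * \<bar>x\<bar> ^ Suc n / real (Suc n)"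
proof -
  note I = loc_bounded_mult_abs_integrable[OF Q f]
  have 1: "norm (prim (\<lambda>t. Q t * f t) y) \<le> (K * C / real (Suc n)) * \<bar>y\<bar> ^ Suc n" if y: "\<bar>y\<bar> \<le> N" for y
  proof -
    have "norm (prim (\<lambda>t. Q t * f t) y) \<le> (K * C) * \<bar>y\<bar> ^ Suc n / real (Suc n)"
    proof (rule prim_norm_le[OF I])
      fix t assume "\<bar>t\<bar> \<le> \<bar>y\<bar>"
      then have "\<bar>t\<bar> \<le> N" using y by simp
      then have "norm (Q t) * norm (f t) \<le> K * (C * \<bar>t\<bar> ^ n)" using K b by (intro mult_mono) auto
      then show "norm (Q t * f t) \<le> K * C * \<bar>t\<bar> ^ n" by (simp add: norm_mult)
    qed
    then show ?thesis by simp
  qed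
  have "norm (volt Q f x) \<le> (K * C / real (Suc n)) * \<bar>x\<bar> ^ Suc (Suc n) / real (Suc (Suc n))"
    unfolding volt_def
  proof (rule prim_norm_le)
    show "prim (\<lambda>t. Q t * f t) absolutely_integrable_on {a..b}" for a b
      by (intro continuous_abs_integrable prim_continuous I)
  qed (use 1 x in auto)
  also have "\<dots> \<le> (K * C / real (Suc n)) * (\<bar>x\<bar> ^ Suc n * N) / 1"
    using K x by (intro frac_le mult_left_mono) (auto intro!: mult_left_mono simp: mult.commute[of _ N] mult_right_mono)
  also have "\<dots> = K * C * N * \<bar>x\<bar> ^ Suc n / real (Suc n)" by (simp add: algebra_simps)
  finally show ?thesis .
qed

text \<open>Neumann series of the Volterra equation. Its factorial bounds hold on every
  \<open>{-N..N}\<close> without any smallness of \<open>Q\<close>, so the solution is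
  global.\<close>

lemma volterra_exists:
  assumes Q: "loc_bounded Q" and u0: "continuous_on UNIV u0"
  obtains f where "continuous_on UNIV f" "\<And>x. f x = u0 x + volt Q f x"
proof -
  define u where "u = rec_nat u0 (\<lambda>_ v. volt Q v)"
  have u_0: "u 0 = u0" and u_S: "u (Suc n) = volt Q (u n)" for n unfolding u_def by auto
  have uc: "continuous_on UNIV (u n)" for n
    by (induction n) (auto simp: u_0 u_S u0 volt_continuous[OF Q])
  have bound: "\<exists>C L. C \<ge> 0 \<and> L \<ge> 0 \<and> (\<forall>n x. \<bar>x\<bar> \<le> N \<longrightarrow> norm (u n x) \<le> C * (L ^ n / fact n))" if N: "N \<ge> 0" for N
  proof -
    obtain K where K: "K \<ge> 0" "\<And>t. \<bar>t\<bar> \<le> N \<Longrightarrow> norm (Q t) \<le> K" using loc_boundedE[OF Q] by blast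
    obtain C where C0: "\<And>x. x \<in> {-N..N} \<Longrightarrow> norm (u0 x) \<le> C"
      using continuous_on_compact_bound[OF compact_Icc continuous_on_subset[OF u0]] by blast
    have "0 \<in> {-N..N}" using N by auto
    then have C1: "C \<ge> 0" using C0 norm_ge_zero order_trans by blast
    have C2: "norm (u0 t) \<le> C" if "\<bar>t\<bar> \<le> N" for t
    proof -
      have "t \<in> {-N..N}" using that by (auto simp: abs_le_iff)
      then show ?thesis by (rule C0)
    qed
    note C = C1 C2
    have *: "\<forall>x. \<bar>x\<bar> \<le> N \<longrightarrow> norm (u n x) \<le> (C * (K * N) ^ n / fact n) * \<bar>x\<bar> ^ n" for n
    proof (induction n)
      case 0 then show ?case using C by (simp add: u_0)
    next
      case (Suc n)
      show ?case
      proof (intro allI impI)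
        fix x assume x: "\<bar>x\<bar> \<le> N"
        have "norm (u (Suc n) x) \<le> K * (C * (K * N) ^ n / fact n) * N * \<bar>x\<bar> ^ Suc n / real (Suc n)"
          unfolding u_S by (rule volt_norm_le[OF Q uc K(1) _ K(2) _ x]) (use Suc C K N in auto)
        also have "\<dots> = (C * (K * N) ^ Suc n / fact (Suc n)) * \<bar>x\<bar> ^ Suc n" by (simp add: field_simps)
        finally show "norm (u (Suc n) x) \<le> (C * (K * N) ^ Suc n / fact (Suc n)) * \<bar>x\<bar> ^ Suc n" .
      qed
    qed
    have "norm (u n x) \<le> C * ((K * N * N) ^ n / fact n)" if "\<bar>x\<bar> \<le> N" for n x
    proof -
      have "norm (u n x) \<le> (C * (K * N) ^ n / fact n) * \<bar>x\<bar> ^ n" using * that by blast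
      also have "\<dots> \<le> (C * (K * N) ^ n / fact n) * N ^ n" using that C K N by (intro mult_left_mono power_mono) auto
      finally show ?thesis by (simp add: power_mult_distrib)
    qed
    then show ?thesis using C(1) K(1) N by (intro exI[of _ C] exI[of _ "K * N * N"]) auto
  qed
  define f where "f x = (\<Sum>n. u n x)" for x
  define S where "S n x = (\<Sum>i<n. u i x)" for n x
  have Sc: "continuous_on UNIV (S n)" for n unfolding S_def by (intro continuous_on_sum uc)
  have unif: "uniform_limit {-N..N} S f sequentially" if N: "N \<ge> 0" for N
  proof -
    obtain C L where CL: "C \<ge> 0" "L \<ge> 0" "\<And>n x. \<bar>x\<bar> \<le> N \<Longrightarrow> norm (u n x) \<le> C * (L ^ n / fact n)" using bound[OF N] by blast
    have "summable (\<lambda>n. C * (L ^ n / fact n))"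
      using summable_exp[of L] by (intro summable_mult) (simp add: field_simps)
    then show ?thesis unfolding S_def f_def by (intro Weierstrass_m_test) (use CL in auto)
  qed
  have fc: "continuous_on UNIV f"
  proof -
    have "isCont f x" for x
    proof -
      have "continuous_on {- (\<bar>x\<bar> + 1)..\<bar>x\<bar> + 1} f"
        by (rule uniform_limit_theorem[OF _ unif]) (auto intro!: always_eventually continuous_on_subset[OF Sc])
      moreover have "x \<in> interior {- (\<bar>x\<bar> + 1)..\<bar>x\<bar> + 1}" by auto
      ultimately show ?thesis using continuous_on_interior by blast
    qed
    then show ?thesis by (simp add: continuous_at_imp_continuous_on)
  qed
  have SS: "S (Suc n) x = u0 x + volt Q (S n) x" for n x
  proof (induction n arbitrary: x)
    case 0
    have "prim (\<lambda>x. 0) = (\<lambda>x. 0)" unfolding prim_def by auto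
    then have "volt Q (\<lambda>x. 0) x = 0" for x unfolding volt_def by simp
    then show ?case unfolding S_def by (simp add: u_0)
  next
    case (Suc n)
    have e: "S (Suc n) = (\<lambda>x. S n x + u n x)" unfolding S_def by (intro ext) simp
    have "volt Q (S (Suc n)) x = volt Q (S n) x + u (Suc n) x"
      unfolding e u_S by (rule volt_add[OF Q Sc uc])
    then have "u0 x + volt Q (S (Suc n)) x = S (Suc n) x + u (Suc n) x" using Suc by simp
    then show ?case unfolding S_def by simp
  qed
  have "f x = u0 x + volt Q f x" for x
  proof -
    define N where "N = \<bar>x\<bar>"
    have N: "N \<ge> 0" unfolding N_def by simp
    obtain K where K: "K \<ge> 0" "\<And>t. \<bar>t\<bar> \<le> N \<Longrightarrow> norm (Q t) \<le> K" using loc_boundedE[OF Q] by blast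
    have lim1: "(\<lambda>n. S n x) \<longlonglongrightarrow> f x" using unif[OF N] by (rule tendsto_uniform_limitI) (auto simp: N_def)
    \<comment> \<open>\<open>volt Q\<close> is continuous with respect to uniform convergence on
      \<open>{-N..N}\<close>, which justifies the limit in the recursion \<open>SS\<close>.\<close>
    have lim2: "(\<lambda>n. volt Q (S n) x) \<longlonglongrightarrow> volt Q f x"
      unfolding tendsto_iff
    proof (intro allI impI)
      fix e :: real assume e: "e > 0"
      define d where "d = e / (K * N * N + 1)"
      have KN: "K * N * N \<ge> 0" using K N by simp
      have d: "d > 0" unfolding d_def using e KN by (intro divide_pos_pos) auto
      have "\<forall>\<^sub>F n in sequentially. \<forall>t\<in>{-N..N}. dist (S n t) (f t) < d"
        using unif[OF N] d unfolding uniform_limit_iff by blast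
      then show "\<forall>\<^sub>F n in sequentially. dist (volt Q (S n) x) (volt Q f x) < e"
      proof eventually_elim
        case (elim n)
        have c: "continuous_on UNIV (\<lambda>t. S n t - f t)" by (intro continuous_intros Sc fc)
        have "volt Q (\<lambda>t. (S n t - f t) + f t) x = volt Q (\<lambda>t. S n t - f t) x + volt Q f x"
          by (rule volt_add[OF Q c fc])
        then have "dist (volt Q (S n) x) (volt Q f x) = norm (volt Q (\<lambda>t. S n t - f t) x)" by (simp add: dist_norm)
        also have "\<dots> \<le> K * d * N * \<bar>x\<bar> ^ Suc 0 / real (Suc 0)"
        proof (rule volt_norm_le[OF Q c K(1) _ K(2)])
          fix t assume "\<bar>t\<bar> \<le> N"
          then have "t \<in> {-N..N}" by (auto simp: abs_le_iff)
          then have "norm (S n t - f t) < d" using elim by (simp add: dist_norm)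
          then show "norm (S n t - f t) \<le> d * \<bar>t\<bar> ^ 0" by simp
        qed (use d in \<open>auto simp: N_def\<close>)
        also have "\<dots> = K * N * N * d" by (simp add: N_def)
        also have "\<dots> < e" unfolding d_def using e KN by (simp add: field_simps)
        finally show ?case .
      qed
    qed
    have "(\<lambda>n. S (Suc n) x) \<longlonglongrightarrow> u0 x + volt Q f x" unfolding SS by (intro tendsto_intros lim2)
    then show ?thesis using LIMSEQ_Suc[OF lim1] LIMSEQ_unique by blast
  qed
  then show thesis using that fc by blast
qed

lemma H2_affine_fun: "H2 (\<lambda>x. a + b * of_real x) (\<lambda>x. b) (\<lambda>x. 0)"
  unfolding H2_def
  by (auto intro!: is_primitive_C1 continuous_intros derivative_eq_intros simp: has_vector_derivative_def bounded_linear_of_real scaleR_conv_of_real mult.commute)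

lemma H2_prim_prim:
  assumes "\<And>a b. k absolutely_integrable_on {a..b}"
  shows "H2 (prim (prim k)) (prim k) k"
  unfolding H2_def using is_primitive_prim[OF assms] is_primitive_prim[OF continuous_abs_integrable[OF prim_continuous[OF assms]]] by blast

text \<open>The signs are chosen such that \<open>Q = V - \<zeta>\<close> gives the resolvent
  equation \<open>- f'' + (V - \<zeta>) f = g\<close>.\<close>

lemma ivp_exists:
  assumes Q: "loc_bounded Q" and g: "\<And>a b. g absolutely_integrable_on {a..b}"
  obtains f f1 where "H2 f f1 (\<lambda>x. Q x * f x - g x)" "f 0 = a" "f1 0 = b"
proof -
  define u0 where "u0 x = a + b * of_real x - prim (prim g) x" for x
  have "continuous_on UNIV u0" unfolding u0_def by (intro continuous_intros prim_continuous continuous_abs_integrable g)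
  then obtain f where f: "continuous_on UNIV f" "\<And>x. f x = u0 x + volt Q f x" using volterra_exists[OF Q] by blast
  define f1 where "f1 x = b - prim g x + prim (\<lambda>t. Q t * f t) x" for x
  have "H2 (\<lambda>x. u0 x + volt Q f x) f1 (\<lambda>x. 0 - g x + Q x * f x)"
    unfolding u0_def f1_def volt_def
    by (intro H2_add H2_diff H2_affine_fun H2_prim_prim g loc_bounded_mult_abs_integrable[OF Q f(1)])
  moreover have "(\<lambda>x. u0 x + volt Q f x) = f" using f(2) by auto
  ultimately have "H2 f f1 (\<lambda>x. Q x * f x - g x)" by (simp add: algebra_simps)
  moreover have "f 0 = a" unfolding f(2)[of 0] u0_def volt_def by simp
  moreover have "f1 0 = b" unfolding f1_def by simp
  ultimately show thesis using that by blast
qed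

subsection \<open>Local bounds and the energy identity\<close>

text \<open>On an interval of length 1 the function differs from its tangent at \<open>x0\<close> by
  at most \<open>J\<close>, the integral of \<open>norm (k x)\<close>. Integration against weights
  that reproduce value and slope of an affine function then bounds both. In this way integral bounds
  on solutions become bounds on their data at a point.\<close>

lemma H2_endpoint_bound:
  fixes x0 :: real
  assumes H: "H2 f f1 k"
  defines "M \<equiv> integral {x0..x0+1} (\<lambda>x. norm (f x)) + integral {x0..x0+1} (\<lambda>x. norm (k x))"
  shows "norm (f x0) \<le> 6 * M" "norm (f1 x0) \<le> 6 * M"
proof -
  have Pf: "is_primitive f f1" and Pf1: "is_primitive f1 k" using H unfolding H2_def by auto
  define J where "J = integral {x0..x0+1} (\<lambda>x. norm (k x))"
  have nk: "(\<lambda>x. norm (k x)) integrable_on {u..v}" for u v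
    using absolutely_integrable_norm[OF is_primitiveD(1)[OF Pf1, of u v]] set_lebesgue_integral_eq_integral(1) by (auto simp: o_def)
  have nf: "(\<lambda>x. norm (f x)) integrable_on {u..v}" for u v
    by (intro integrable_continuous_real continuous_intros H2_continuous[OF H])
  have J0: "J \<ge> 0" unfolding J_def by (rule Henstock_Kurzweil_Integration.integral_nonneg[OF nk]) auto
  have b1: "norm (f1 x - f1 x0) \<le> J" if "x \<in> {x0..x0+1}" for x
  proof -
    have "norm (f1 x - f1 x0) = norm (integral {x0..x} k)" using is_primitiveD(3)[OF Pf1, of x0 x] that by simp
    also have "\<dots> \<le> integral {x0..x} (\<lambda>x. norm (k x))"
      by (rule Henstock_Kurzweil_Integration.integral_norm_bound_integral[OF is_primitiveD(2)[OF Pf1] nk]) auto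
    also have "\<dots> \<le> J" unfolding J_def by (rule integral_subset_le[OF _ nk nk]) (use that in auto)
    finally show ?thesis .
  qed
  define e where "e x = f x - f x0 - of_real (x - x0) * f1 x0" for x
  have e: "norm (e x) \<le> J" if x: "x \<in> {x0..x0+1}" for x
  proof -
    have i: "f1 integrable_on {x0..x}" using is_primitiveD(2)[OF Pf] .
    have "integral {x0..x} (\<lambda>t. f1 t - f1 x0) = integral {x0..x} f1 - integral {x0..x} (\<lambda>t. f1 x0)"
      by (rule Henstock_Kurzweil_Integration.integral_diff[OF i]) auto
    also have "\<dots> = f x - f x0 - of_real (x - x0) * f1 x0"
      using is_primitiveD(3)[OF Pf, of x0 x] x by (simp add: scaleR_conv_of_real)
    finally have "e x = integral {x0..x} (\<lambda>t. f1 t - f1 x0)" unfolding e_def by simp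
    also have "norm \<dots> \<le> integral {x0..x} (\<lambda>t. J)"
      by (rule Henstock_Kurzweil_Integration.integral_norm_bound_integral) (use b1 x i in \<open>auto intro!: integrable_diff\<close>)
    also have "\<dots> = (x - x0) * J" using x by simp
    also have "\<dots> \<le> 1 * J" using x J0 by (intro mult_right_mono) auto
    finally show ?thesis by simp
  qed
  have key: "norm z \<le> 6 * M"
    if p: "continuous_on UNIV p" "\<And>x. x \<in> {x0..x0+1} \<Longrightarrow> \<bar>p x\<bar> \<le> 6"
      and i: "((\<lambda>x. of_real (p x) * (f x0 + of_real (x - x0) * f1 x0)) has_integral z) {x0..x0+1}" for p z
  proof -
    have "norm z \<le> integral {x0..x0+1} (\<lambda>x. 6 * (norm (f x) + J))"
    proof -
      have "norm (integral {x0..x0+1} (\<lambda>x. of_real (p x) * (f x0 + of_real (x - x0) * f1 x0))) \<le> integral {x0..x0+1} (\<lambda>x. 6 * (norm (f x) + J))"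
      proof (rule Henstock_Kurzweil_Integration.integral_norm_bound_integral)
        show "(\<lambda>x. of_real (p x) * (f x0 + of_real (x - x0) * f1 x0)) integrable_on {x0..x0 + 1}" using i by blast
        show "(\<lambda>x. 6 * (norm (f x) + J)) integrable_on {x0..x0 + 1}"
          by (intro integrable_continuous_real continuous_intros H2_continuous[OF H])
        fix x assume x: "x \<in> {x0..x0+1}"
        have "f x0 + of_real (x - x0) * f1 x0 = f x - e x" unfolding e_def by simp
        then have "norm (f x0 + of_real (x - x0) * f1 x0) \<le> norm (f x) + J"
          using e[OF x] norm_triangle_ineq4[of "f x" "e x"] by simp
        then show "norm (of_real (p x) * (f x0 + of_real (x - x0) * f1 x0)) \<le> 6 * (norm (f x) + J)"
          using p(2)[OF x] J0 unfolding norm_mult by (intro mult_mono) auto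
      qed
      then show ?thesis using integral_unique[OF i] by simp
    qed
    also have "\<dots> = 6 * integral {x0..x0+1} (\<lambda>x. norm (f x) + J)"
      by (rule Henstock_Kurzweil_Integration.integral_mult_right)
    also have "integral {x0..x0+1} (\<lambda>x. norm (f x) + J) = integral {x0..x0+1} (\<lambda>x. norm (f x)) + J"
      using Henstock_Kurzweil_Integration.integral_add[OF nf[of x0 "x0+1"] integrable_const_ivl[of J x0 "x0+1"]] by simp
    finally show ?thesis unfolding M_def J_def .
  qed
  define A B where "A = f x0" and "B = f1 x0"
  have ftc: "((\<lambda>x. of_real (p x) * (A + of_real (x - x0) * B)) has_integral P 1 - P 0) {x0..x0+1}"
    if P: "\<And>x. ((\<lambda>x. P (x - x0)) has_vector_derivative of_real (p x) * (A + of_real (x - x0) * B)) (at x)" for p P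
    using fundamental_theorem_of_calculus[of x0 "x0+1" "\<lambda>x. P (x - x0)"] P has_vector_derivative_at_within by fastforce
  have vd: "((\<lambda>x. c1 * of_real (x - x0) + c2 * (of_real (x - x0))\<^sup>2 + c3 * (of_real (x - x0)) ^ 3) has_vector_derivative
     (c1 + 2 * c2 * of_real (x - x0) + 3 * c3 * (of_real (x - x0))\<^sup>2)) (at x)" for c1 c2 c3 :: complex and x
  proof -
    have "((\<lambda>z. c1 * (z - of_real x0) + c2 * (z - of_real x0)\<^sup>2 + c3 * (z - of_real x0) ^ 3) has_field_derivative
     (c1 + 2 * c2 * (of_real x - of_real x0) + 3 * c3 * (of_real x - of_real x0)\<^sup>2)) (at (of_real x))"
      by (auto intro!: derivative_eq_intros simp: algebra_simps)
    from has_vector_derivative_real_field[OF this] show ?thesis by simp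
  qed
  \<comment> \<open>The weights \<open>4 - 6 * t\<close> and, further down,
    \<open>12 * t - 6\<close> are dual to \<open>1\<close> and \<open>t\<close> on the unit
    interval: their moments of order 0 and 1 are (1, 0) and (0, 1). Both are bounded by 6, the
    constant of the lemma.\<close>
  have "((\<lambda>x. of_real (4 - 6 * (x - x0)) * (A + of_real (x - x0) * B)) has_integral A) {x0..x0+1}"
    using ftc[of "\<lambda>t. 4 * A * of_real t + (2 * B - 3 * A) * (of_real t)\<^sup>2 + (- 2 * B) * (of_real t) ^ 3" "\<lambda>x. 4 - 6 * (x - x0)"]
      vd[of "4 * A" "2 * B - 3 * A" "- 2 * B"] by (simp add: algebra_simps power2_eq_square)
  then show "norm (f x0) \<le> 6 * M" unfolding A_def B_def
    by (intro key[of "\<lambda>x. 4 - 6 * (x - x0)"]) (auto intro!: continuous_intros)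
  have "((\<lambda>x. of_real (12 * (x - x0) - 6) * (A + of_real (x - x0) * B)) has_integral B) {x0..x0+1}"
    using ftc[of "\<lambda>t. (- 6 * A) * of_real t + (6 * A - 3 * B) * (of_real t)\<^sup>2 + (4 * B) * (of_real t) ^ 3" "\<lambda>x. 12 * (x - x0) - 6"]
      vd[of "- 6 * A" "6 * A - 3 * B" "4 * B"] by (simp add: algebra_simps power2_eq_square)
  then show "norm (f1 x0) \<le> 6 * M" unfolding A_def B_def
    by (intro key[of "\<lambda>x. 12 * (x - x0) - 6"]) (auto intro!: continuous_intros)
qed

lemma H2_endpoint_bound_left:
  fixes x0 :: real
  assumes H: "H2 f f1 k"
  defines "M \<equiv> integral {x0-1..x0} (\<lambda>x. norm (f x)) + integral {x0-1..x0} (\<lambda>x. norm (k x))"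
  shows "norm (f x0) \<le> 6 * M" "norm (f1 x0) \<le> 6 * M"
proof -
  have "integral {-x0..-x0+1} (\<lambda>x. norm (h (-x))) = integral {x0-1..x0} (\<lambda>x. norm (h x))" for h :: "real \<Rightarrow> complex"
    using Henstock_Kurzweil_Integration.integral_reflect_real[where f="\<lambda>x. norm (h x)" and a="x0-1" and b=x0] by simp
  then show "norm (f x0) \<le> 6 * M" "norm (f1 x0) \<le> 6 * M"
    using H2_endpoint_bound[OF H2_reflect[OF H], of "-x0"] unfolding M_def by simp_all
qed

lemma H2_energy:
  assumes H: "H2 f f1 k"
  shows "is_primitive (\<lambda>x. f1 x * cnj (f x)) (\<lambda>x. k x * cnj (f x) + f1 x * cnj (f1 x))"
  using H is_primitive_mult is_primitive_bounded_linear[OF _ bounded_linear_cnj] unfolding H2_def by blast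

text \<open>The term \<open>f1 x * cnj (f1 x)\<close> is real, so the imaginary part of the energy
  identity keeps only boundary terms.\<close>

lemma H2_energy_Im:
  assumes H: "H2 f f1 k" and ab: "a \<le> b"
  shows "(\<lambda>x. k x * cnj (f x)) absolutely_integrable_on {a..b}"
    "Im (integral {a..b} (\<lambda>x. k x * cnj (f x))) = Im (f1 b * cnj (f b)) - Im (f1 a * cnj (f a))"
proof -
  note E = H2_energy[OF H]
  have i: "(\<lambda>x. f1 x * cnj (f1 x)) absolutely_integrable_on {a..b}"
    by (intro continuous_abs_integrable continuous_intros H2_continuous[OF H])
  show j: "(\<lambda>x. k x * cnj (f x)) absolutely_integrable_on {a..b}"
    using set_integral_diff(1)[OF is_primitiveD(1)[OF E, of a b] i] by simp
  have "integral {a..b} (\<lambda>x. k x * cnj (f x) + f1 x * cnj (f1 x)) =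
     integral {a..b} (\<lambda>x. k x * cnj (f x)) + integral {a..b} (\<lambda>x. f1 x * cnj (f1 x))"
    using i j set_lebesgue_integral_eq_integral(1) by (intro Henstock_Kurzweil_Integration.integral_add) blast+
  then have "f1 b * cnj (f b) - f1 a * cnj (f a) = integral {a..b} (\<lambda>x. k x * cnj (f x)) + integral {a..b} (\<lambda>x. f1 x * cnj (f1 x))"
    using is_primitiveD(3)[OF E ab] by simp
  moreover have "Im (integral {a..b} (\<lambda>x. f1 x * cnj (f1 x))) = 0"
  proof -
    have "(\<lambda>x. f1 x * cnj (f1 x)) integrable_on {a..b}" using i set_lebesgue_integral_eq_integral(1) by blast
    from integral_linear[OF this bounded_linear_Im] show ?thesis by (simp add: o_def)
  qed
  ultimately show "Im (integral {a..b} (\<lambda>x. k x * cnj (f x))) = Im (f1 b * cnj (f b)) - Im (f1 a * cnj (f a))"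
    by (metis add_cancel_right_right minus_complex.simps(2) plus_complex.simps(2))
qed


lemma mult_cnj_norm: "z * cnj z = (complex_of_real (norm z))\<^sup>2"
  by (metis complex_norm_square of_real_power)

lemma set_integrable_subset_UNIV:
  fixes h :: "real \<Rightarrow> real"
  assumes "integrable lebesgue h" "A \<in> sets lebesgue"
  shows "h absolutely_integrable_on A"
  using integrable_mult_indicator[OF assms(2,1)] unfolding set_integrable_def by simp

text \<open>The limit point property. Otherwise \<open>|f'| |f| \<ge> e\<close> far out; as \<open>V\<close> is bounded from below, the
  function \<open>y = |f|\<^sup>2\<close> would satisfy \<open>y'' \<ge> 4 e - h\<close> with \<open>h\<close> integrable, and could not be
  integrable itself.\<close>

lemma H2_decay:
  fixes V :: "real \<Rightarrow> real"
  assumes H: "H2 f f1 k" and fi: "(\<lambda>x. (norm (f x))\<^sup>2) absolutely_integrable_on {0..}"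
    and Gi: "(\<lambda>x. (norm (G x))\<^sup>2) absolutely_integrable_on {0..}"
    and k: "AE x in lebesgue. x > 0 \<longrightarrow> k x = complex_of_real (V x) * f x - G x"
    and V: "\<And>x. V x \<ge> - c" and c: "c \<ge> 0" and e: "e > 0"
  shows "\<exists>x\<ge>N. norm (f1 x * cnj (f x)) < e"
proof (rule ccontr)
  assume "\<not> ?thesis"
  then have big0: "norm (f1 x) * norm (f x) \<ge> e" if "x \<ge> N" for x using that by (force simp: norm_mult)
  define N0 where "N0 = max N 0"
  have big: "norm (f1 x) * norm (f x) \<ge> e" if "x \<ge> N0" for x using big0 that unfolding N0_def by auto
  have N0: "N0 \<ge> 0" unfolding N0_def by simp
  have Pf: "is_primitive f f1" and Pf1: "is_primitive f1 k" using H unfolding H2_def by auto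
  define y where "y x = (norm (f x))\<^sup>2" for x
  define y1 where "y1 x = 2 * Re (f1 x * cnj (f x))" for x
  define y2 where "y2 x = 2 * Re (k x * cnj (f x)) + 2 * (norm (f1 x))\<^sup>2" for x
  have Py: "is_primitive y y1"
  proof -
    have "is_primitive (\<lambda>x. f x * cnj (f x)) (\<lambda>x. f1 x * cnj (f x) + f x * cnj (f1 x))"
      by (rule is_primitive_mult[OF Pf is_primitive_bounded_linear[OF Pf bounded_linear_cnj]])
    from is_primitive_bounded_linear[OF this bounded_linear_Re]
    have "is_primitive (\<lambda>x. Re (f x * cnj (f x))) (\<lambda>x. Re (f1 x * cnj (f x) + f x * cnj (f1 x)))" .
    moreover have "Re (f x * cnj (f x)) = y x" for x
      unfolding y_def complex_norm_square[symmetric] by simp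
    moreover have "Re (f1 x * cnj (f x) + f x * cnj (f1 x)) = y1 x" for x
      unfolding y1_def by simp
    ultimately show ?thesis by simp
  qed
  have Py1: "is_primitive y1 y2"
  proof -
    have "is_primitive (\<lambda>x. 2 *\<^sub>R Re (f1 x * cnj (f x))) (\<lambda>x. 2 *\<^sub>R Re (k x * cnj (f x) + f1 x * cnj (f1 x)))"
      by (rule is_primitive_bounded_linear[OF H2_energy[OF H]])
        (intro bounded_linear_compose[OF bounded_linear_scaleR_right bounded_linear_Re])
    moreover have "2 *\<^sub>R Re (k x * cnj (f x) + f1 x * cnj (f1 x)) = y2 x" for x
      unfolding y2_def complex_norm_square[symmetric] by simp
    ultimately show ?thesis unfolding y1_def by simp
  qed
  \<comment> \<open>The coefficient collects \<open>2 * c\<close> from the lower bound of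
    \<open>V\<close>, 1 from the product of \<open>G\<close> and \<open>f\<close>, and 2 from
    \<open>2 * (norm (f1 x))\<^sup>2 \<ge> 4 * norm (f1 x) * norm (f x) - 2 * (norm (f
    x))\<^sup>2\<close>.\<close>
  define h where "h x = (2 * c + 3) * (norm (f x))\<^sup>2 + (norm (G x))\<^sup>2" for x
  have hi: "h absolutely_integrable_on {0..}"
    unfolding h_def by (intro set_integral_add(1) set_integrable_mult_right fi Gi)
  have hii: "h integrable_on {0..}" and fii: "y integrable_on {0..}"
    using hi fi set_lebesgue_integral_eq_integral(1) unfolding y_def by blast+
  have h0: "h x \<ge> 0" for x unfolding h_def using c by simp
  have sub: "l integrable_on {u..v}" if "l integrable_on {0..}" "u \<ge> 0" for l :: "real \<Rightarrow> real" and u v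
    using integrable_on_subinterval[OF that(1)] that(2) by auto
  define B where "B = integral {0..} h"
  define A where "A = integral {0..} y"
  have hB: "integral {u..v} h \<le> B" if "u \<ge> 0" for u v
    unfolding B_def by (rule integral_subset_le[OF _ sub[OF hii that] hii]) (use that h0 in auto)
  have yA: "integral {u..v} y \<le> A" if "u \<ge> 0" for u v
    unfolding A_def by (rule integral_subset_le[OF _ sub[OF fii that] fii]) (use that in \<open>auto simp: y_def\<close>)
  obtain Z where Z: "negligible Z" "\<And>x. x \<notin> Z \<Longrightarrow> x > 0 \<Longrightarrow> k x = complex_of_real (V x) * f x - G x"
    using k unfolding AE_lebesgue_negligible by blast
  have y2: "y2 x \<ge> 4 * e - h x" if "x \<ge> N0" "x \<notin> Z \<union> {0}" for x
  proof -
    have "x > 0" using that N0 by auto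
    then have kx: "k x = complex_of_real (V x) * f x - G x" using Z that by auto
    have "k x * cnj (f x) = complex_of_real (V x * (norm (f x))\<^sup>2) - G x * cnj (f x)"
      unfolding kx by (simp add: algebra_simps mult_cnj_norm)
    then have r: "Re (k x * cnj (f x)) = V x * (norm (f x))\<^sup>2 - Re (G x * cnj (f x))" by simp
    have "Re (G x * cnj (f x)) \<le> norm (G x) * norm (f x)" using complex_Re_le_cmod[of "G x * cnj (f x)"] by (simp add: norm_mult)
    moreover have "2 * (norm (G x) * norm (f x)) \<le> (norm (G x))\<^sup>2 + (norm (f x))\<^sup>2"
      using sum_squares_bound[of "norm (G x)" "norm (f x)"] by simp
    moreover have "V x * (norm (f x))\<^sup>2 \<ge> - c * (norm (f x))\<^sup>2" using V[of x] by (intro mult_right_mono) auto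
    moreover have "2 * (norm (f1 x) * norm (f x)) \<le> (norm (f1 x))\<^sup>2 + (norm (f x))\<^sup>2"
      using sum_squares_bound[of "norm (f1 x)" "norm (f x)"] by simp
    ultimately show ?thesis using big[OF that(1)] unfolding y2_def r h_def by (simp add: algebra_simps)
  qed
  have y1: "y1 x \<ge> y1 N0 + 4 * e * (x - N0) - B" if x: "x \<ge> N0" for x
  proof -
    have i1: "(\<lambda>t. 4 * e - h t) integrable_on {N0..x}" by (intro integrable_diff integrable_const_ivl sub[OF hii N0])
    have "integral {N0..x} (\<lambda>t. 4 * e - h t) \<le> integral {N0..x} y2"
    proof -
      have n: "negligible (Z \<union> {0})" using Z(1) by auto
      have "integral {N0..x} (\<lambda>t. 4 * e - h t) \<le> integral {N0..x} (\<lambda>t. if t \<in> Z \<union> {0} then 4 * e - h t else y2 t)"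
      proof (rule integral_le[OF i1])
        show "(\<lambda>t. if t \<in> Z \<union> {0} then 4 * e - h t else y2 t) integrable_on {N0..x}"
          by (rule integrable_spike[OF is_primitiveD(2)[OF Py1, of N0 x] n]) auto
      qed (use y2 in auto)
      also have "\<dots> = integral {N0..x} y2" by (rule integral_spike[OF n]) auto
      finally show ?thesis .
    qed
    moreover have "integral {N0..x} (\<lambda>t. 4 * e - h t) = 4 * e * (x - N0) - integral {N0..x} h"
      using x by (subst Henstock_Kurzweil_Integration.integral_diff) (auto intro: sub[OF hii N0])
    ultimately show ?thesis using is_primitiveD(3)[OF Py1 x] hB[OF N0, of x] by linarith
  qed
  \<comment> \<open>From \<open>N1\<close> on the linear growth of \<open>y1\<close> has overcome
    both its value at \<open>N0\<close> and the constant \<open>B\<close>.\<close>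
  define N1 where "N1 = N0 + (\<bar>1 + B - y1 N0\<bar>) / (4 * e)"
  have N1: "N1 \<ge> N0" unfolding N1_def using e by simp
  have y1b: "y1 x \<ge> 1" if "x \<ge> N1" for x
  proof -
    have "4 * e * (x - N0) \<ge> 4 * e * (N1 - N0)" using that e by simp
    also have "4 * e * (N1 - N0) = \<bar>1 + B - y1 N0\<bar>" unfolding N1_def using e by simp
    finally show ?thesis using y1[of x] N1 that by linarith
  qed
  have yb: "y x \<ge> 1" if x: "x \<ge> N1 + 1" for x
  proof -
    have "integral {N1..x} (\<lambda>t. 1) \<le> integral {N1..x} y1"
      by (rule integral_le) (use y1b is_primitiveD(2)[OF Py] in auto)
    then have "x - N1 \<le> y x - y N1" using is_primitiveD(3)[OF Py, of N1 x] x by simp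
    moreover have "y N1 \<ge> 0" unfolding y_def by simp
    ultimately show ?thesis using x by linarith
  qed
  \<comment> \<open>On \<open>{N1+1..x}\<close>, an interval of length
    \<open>\<bar>A\<bar> + 1\<close>, the function \<open>y\<close> is at least 1, while its
    integral is at most \<open>A\<close>.\<close>
  define x where "x = N1 + 1 + \<bar>A\<bar> + 1"
  have "integral {N1+1..x} (\<lambda>t. 1) \<le> integral {N1+1..x} y"
    by (rule integral_le) (use yb sub[OF fii] N0 N1 in auto)
  also have "\<dots> \<le> A" using yA N0 N1 by auto
  finally show False unfolding x_def by simp
qed

subsection \<open>Point interactions: symmetry and a priori bounds\<close>

lemma AE_lebesgue_reflect:
  assumes "AE x in lebesgue. P x"
  shows "AE x in lebesgue. P (- x :: real)"
proof -
  obtain N where N: "negligible N" "\<And>x. x \<notin> N \<Longrightarrow> P x" using assms unfolding AE_lebesgue_negligible by blast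
  have "negligible (uminus ` N)"
    using N(1) by (intro negligible_differentiable_image_negligible) (auto intro!: derivative_intros simp: differentiable_on_def)
  moreover have "P (-x)" if "x \<notin> uminus ` N" for x using N(2)[of "-x"] that by force
  ultimately show ?thesis unfolding AE_lebesgue_negligible by blast
qed

lemma H2_Im_identity:
  fixes V :: "real \<Rightarrow> real"
  assumes H: "H2 f f1 k" and ab: "a \<le> b"
    and k: "AE x in lebesgue. a < x \<longrightarrow> x < b \<longrightarrow> k x = complex_of_real (V x) * f x - G x"
  shows "(\<lambda>x. Im (G x * cnj (f x))) absolutely_integrable_on {a..b}"
    "integral {a..b} (\<lambda>x. Im (G x * cnj (f x))) = Im (f1 a * cnj (f a)) - Im (f1 b * cnj (f b))"
proof -
  obtain Z where Z: "negligible Z" "\<And>x. x \<notin> Z \<Longrightarrow> a < x \<Longrightarrow> x < b \<Longrightarrow> k x = complex_of_real (V x) * f x - G x"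
    using k unfolding AE_lebesgue_negligible by blast
  have n: "negligible (Z \<union> {a, b})" using Z(1) by auto
  note E = H2_energy_Im[OF H ab]
  have i: "(\<lambda>x. - Im (k x * cnj (f x))) absolutely_integrable_on {a..b}"
    using absolutely_integrable_linear[OF E(1) bounded_linear_minus[OF bounded_linear_Im]] by (simp add: o_def)
  have eq: "Im (G x * cnj (f x)) = - Im (k x * cnj (f x))" if "x \<in> {a..b} - (Z \<union> {a, b})" for x
  proof -
    have "G x = complex_of_real (V x) * f x - k x" using Z that by auto
    then show ?thesis by (simp only:) (simp add: algebra_simps)
  qed
  show "(\<lambda>x. Im (G x * cnj (f x))) absolutely_integrable_on {a..b}"
    by (rule absolutely_integrable_spike[OF i n eq])
  have "integral {a..b} (\<lambda>x. Im (G x * cnj (f x))) = integral {a..b} (\<lambda>x. - Im (k x * cnj (f x)))"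
    using integral_spike[OF n, of "{a..b}" "\<lambda>x. - Im (k x * cnj (f x))" "\<lambda>x. Im (G x * cnj (f x))"] eq by simp
  also have "\<dots> = - Im (integral {a..b} (\<lambda>x. k x * cnj (f x)))"
  proof -
    have "(\<lambda>x. k x * cnj (f x)) integrable_on {a..b}" using E(1) set_lebesgue_integral_eq_integral(1) by blast
    from integral_linear[OF this bounded_linear_minus[OF bounded_linear_Im]] show ?thesis by (simp add: o_def)
  qed
  finally show "integral {a..b} (\<lambda>x. Im (G x * cnj (f x))) = Im (f1 a * cnj (f a)) - Im (f1 b * cnj (f b))"
    using E(2) by simp
qed

text \<open>Both halves are functions on the whole line, so that one-sided limits at 0 become
  ordinary values; each is tied to \<open>f\<close> and to the equation on its own side
  only.\<close>

definition iparts where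
  "iparts V \<alpha> \<beta> f G fm fm1 km fp fp1 kp \<longleftrightarrow> H2 fm fm1 km \<and> H2 fp fp1 kp \<and>
     (\<forall>x<0. f x = fm x) \<and> (\<forall>x>0. f x = fp x) \<and>
     fp 0 = complex_of_real \<alpha> * fm 0 + complex_of_real \<beta> * fm1 0 \<and> fp1 0 = complex_of_real (inverse \<alpha>) * fm1 0 \<and>
     (AE x in lebesgue. x < 0 \<longrightarrow> km x = complex_of_real (V x) * fm x - G x) \<and>
     (AE x in lebesgue. x > 0 \<longrightarrow> kp x = complex_of_real (V x) * fp x - G x)"

text \<open>\<open>f\<close> solves \<open>-f'' + V f = G\<close> away from \<open>0\<close> and satisfies the interface conditions at \<open>0\<close>. For
  \<open>\<alpha> = 1\<close>, \<open>\<beta> = 0\<close> this is the free equation, and the perturbed operators need no separate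
  existence theory.\<close>

definition iface :: "(real \<Rightarrow> real) \<Rightarrow> real \<Rightarrow> real \<Rightarrow> (real \<Rightarrow> complex) \<Rightarrow> (real \<Rightarrow> complex) \<Rightarrow> bool" where
  "iface V \<alpha> \<beta> f G \<longleftrightarrow> f \<in> L2_space \<and> G \<in> L2_space \<and>
     (\<exists>fm fm1 km fp fp1 kp. iparts V \<alpha> \<beta> f G fm fm1 km fp fp1 kp)"

text \<open>The interface conditions form a real matrix of determinant 1: in the product the
  coefficient of \<open>m1 * cnj m\<close> is 1 and that of \<open>m1 * cnj m1\<close> is real.
  Hence the boundary form does not jump at 0, which is the symmetry of the point
  interaction.\<close>

lemma interface_Im:
  assumes "\<alpha> \<noteq> 0" "p = complex_of_real \<alpha> * m + complex_of_real \<beta> * m1" "p1 = complex_of_real (inverse \<alpha>) * m1"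
  shows "Im (p1 * cnj p) = Im (m1 * cnj m)"
proof -
  have "p1 * cnj p = complex_of_real (inverse \<alpha> * \<alpha>) * (m1 * cnj m) + complex_of_real (inverse \<alpha> * \<beta>) * (m1 * cnj m1)"
    unfolding assms(2,3) by (simp add: algebra_simps)
  also have "m1 * cnj m1 = complex_of_real ((norm m1)\<^sup>2)" by (simp add: mult_cnj_norm)
  finally show ?thesis using assms(1) by (simp flip: of_real_mult)
qed

lemma L2_abs_integrable_norm_sq:
  "f \<in> L2_space \<Longrightarrow> A \<in> sets lebesgue \<Longrightarrow> (\<lambda>x. (norm (f x))\<^sup>2) absolutely_integrable_on A" for f :: "real \<Rightarrow> complex"
  using set_integrable_subset_UNIV L2_spaceD(2) by blast

lemma L2_reflect:
  fixes f :: "real \<Rightarrow> complex"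
  assumes "f \<in> L2_space"
  shows "(\<lambda>x. f (-x)) \<in> L2_space"
proof -
  have "(\<lambda>x. - x) \<in> lebesgue \<rightarrow>\<^sub>M (lebesgue :: real measure)"
    using lebesgue_affine_measurable[where c="\<lambda>_::real. -1" and t=0] by simp
  then have "(\<lambda>x. f (-x)) \<in> borel_measurable lebesgue"
    using measurable_compose L2_spaceD(1)[OF assms] by blast
  moreover have "integrable lebesgue (\<lambda>x. (norm (f (0 + (-1) * x)))\<^sup>2)"
    using lebesgue_integrable_real_affine_iff[of "-1" "\<lambda>x. (norm (f x))\<^sup>2" 0] L2_spaceD(2)[OF assms] by simp
  ultimately show ?thesis unfolding L2_space_def by simp
qed

locale potential =
  fixes V :: "real \<Rightarrow> real" and c :: real
  assumes V_meas: "V \<in> borel_measurable lebesgue"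
    and V_locb: "\<And>N. \<exists>K\<ge>0. \<forall>x. \<bar>x\<bar> \<le> N \<longrightarrow> \<bar>V x\<bar> \<le> K"
    and V_ge: "\<And>x. V x \<ge> - c" and c_nonneg: "c \<ge> 0"
begin

lemma loc_bounded_shift: "loc_bounded (\<lambda>x. complex_of_real (V x) - \<zeta>)"
  unfolding loc_bounded_def
proof (intro conjI allI)
  show "(\<lambda>x. complex_of_real (V x) - \<zeta>) \<in> borel_measurable lebesgue" using V_meas by measurable
  fix N :: real
  obtain K where K: "K \<ge> 0" "\<And>x. \<bar>x\<bar> \<le> N \<Longrightarrow> \<bar>V x\<bar> \<le> K" using V_locb by blast
  have "norm (complex_of_real (V x) - \<zeta>) \<le> K + norm \<zeta>" if "\<bar>x\<bar> \<le> N" for x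
    using norm_triangle_ineq4[of "complex_of_real (V x)" \<zeta>] K(2)[OF that] by simp
  then show "\<exists>K\<ge>0. \<forall>x. \<bar>x\<bar> \<le> N \<longrightarrow> norm (complex_of_real (V x) - \<zeta>) \<le> K"
    using K(1) by (intro exI[of _ "K + norm \<zeta>"]) auto
qed

lemma iparts_decay_right:
  assumes "iparts V \<alpha> \<beta> f G fm fm1 km fp fp1 kp" "f \<in> L2_space" "G \<in> L2_space" "e > 0"
  shows "\<exists>x\<ge>N. norm (fp1 x * cnj (fp x)) < e"
proof (rule H2_decay[OF _ _ _ _ V_ge c_nonneg \<open>e > 0\<close>])
  show "H2 fp fp1 kp" "AE x in lebesgue. x > 0 \<longrightarrow> kp x = complex_of_real (V x) * fp x - G x"
    using assms(1) unfolding iparts_def by auto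
  show "(\<lambda>x. (norm (G x))\<^sup>2) absolutely_integrable_on {0..}" by (rule L2_abs_integrable_norm_sq[OF assms(3)]) simp
  show "(\<lambda>x. (norm (fp x))\<^sup>2) absolutely_integrable_on {0..}"
  proof (rule absolutely_integrable_spike[where f="\<lambda>x. (norm (f x))\<^sup>2" and S="{0}"])
    show "(\<lambda>x. (norm (f x))\<^sup>2) absolutely_integrable_on {0..}" by (rule L2_abs_integrable_norm_sq[OF assms(2)]) simp
  qed (use assms(1) in \<open>auto simp: iparts_def\<close>)
qed

lemma iparts_decay_left:
  assumes "iparts V \<alpha> \<beta> f G fm fm1 km fp fp1 kp" "f \<in> L2_space" "G \<in> L2_space" "e > 0"
  shows "\<exists>x\<le>N. norm (fm1 x * cnj (fm x)) < e"
proof -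
  have "\<exists>x\<ge>-N. norm (- fm1 (-x) * cnj (fm (-x))) < e"
  proof (rule H2_decay[of "\<lambda>x. fm (-x)" "\<lambda>x. - fm1 (-x)" "\<lambda>x. km (-x)" "\<lambda>x. G (-x)" "\<lambda>x. V (-x)" c])
    show "H2 (\<lambda>x. fm (- x)) (\<lambda>x. - fm1 (- x)) (\<lambda>x. km (- x))"
      using assms(1) H2_reflect unfolding iparts_def by auto
    have "AE x in lebesgue. x < 0 \<longrightarrow> km x = complex_of_real (V x) * fm x - G x" using assms(1) unfolding iparts_def by auto
    from AE_lebesgue_reflect[OF this]
    show "AE x in lebesgue. x > 0 \<longrightarrow> km (- x) = complex_of_real (V (- x)) * fm (- x) - G (- x)" by simp
    show "(\<lambda>x. (norm (G (-x)))\<^sup>2) absolutely_integrable_on {0..}" by (rule L2_abs_integrable_norm_sq[OF L2_reflect[OF assms(3)]]) simp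
    show "(\<lambda>x. (norm (fm (-x)))\<^sup>2) absolutely_integrable_on {0..}"
    proof (rule absolutely_integrable_spike[where f="\<lambda>x. (norm (f (-x)))\<^sup>2" and S="{0}"])
      show "(\<lambda>x. (norm (f (-x)))\<^sup>2) absolutely_integrable_on {0..}" by (rule L2_abs_integrable_norm_sq[OF L2_reflect[OF assms(2)]]) simp
    qed (use assms(1) in \<open>auto simp: iparts_def\<close>)
  qed (use V_ge c_nonneg assms(4) in auto)
  then obtain x where "x \<ge> -N" "norm (fm1 (-x) * cnj (fm (-x))) < e" by (auto simp: norm_mult)
  then show ?thesis by (intro exI[of _ "-x"]) auto
qed

lemma iparts_Im_identity:
  assumes P: "iparts V \<alpha> \<beta> f G fm fm1 km fp fp1 kp" and \<alpha>: "\<alpha> \<noteq> 0" and ab: "a \<le> 0" "0 \<le> b"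
  shows "integral {a..0} (\<lambda>x. Im (G x * cnj (fm x))) + integral {0..b} (\<lambda>x. Im (G x * cnj (fp x))) =
    Im (fm1 a * cnj (fm a)) - Im (fp1 b * cnj (fp b))"
proof -
  have H: "H2 fm fm1 km" "H2 fp fp1 kp"
    "AE x in lebesgue. x < 0 \<longrightarrow> km x = complex_of_real (V x) * fm x - G x"
    "AE x in lebesgue. x > 0 \<longrightarrow> kp x = complex_of_real (V x) * fp x - G x"
    "fp 0 = complex_of_real \<alpha> * fm 0 + complex_of_real \<beta> * fm1 0" "fp1 0 = complex_of_real (inverse \<alpha>) * fm1 0"
    using P unfolding iparts_def by auto
  have 1: "AE x in lebesgue. a < x \<longrightarrow> x < 0 \<longrightarrow> km x = complex_of_real (V x) * fm x - G x" using H(3) by eventually_elim auto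
  have 2: "AE x in lebesgue. 0 < x \<longrightarrow> x < b \<longrightarrow> kp x = complex_of_real (V x) * fp x - G x" using H(4) by eventually_elim auto
  show ?thesis
    using H2_Im_identity(2)[OF H(1) ab(1) 1] H2_Im_identity(2)[OF H(2) ab(2) 2] interface_Im[OF \<alpha> H(5,6)] by simp
qed

text \<open>Over \<open>{a n..b n}\<close> the imaginary part of the form consists of the two outer
  boundary terms, because the contributions at 0 cancel; along suitable endpoints these terms tend
  to 0.\<close>

lemma iface_symmetric:
  assumes I: "iface V \<alpha> \<beta> f G" and \<alpha>: "\<alpha> \<noteq> 0"
  shows "Im (LINT x|lebesgue. G x * cnj (f x)) = 0"
proof -
  obtain fm fm1 km fp fp1 kp where P: "iparts V \<alpha> \<beta> f G fm fm1 km fp fp1 kp" using I unfolding iface_def by blast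
  have f: "f \<in> L2_space" and G: "G \<in> L2_space" using I unfolding iface_def by auto
  define h where "h x = Im (G x * cnj (f x))" for x
  have int: "integrable lebesgue (\<lambda>x. G x * cnj (f x))" by (rule L2_mult_integrable(3)[OF G f])
  have hi: "integrable lebesgue h" unfolding h_def using int by (rule integrable_Im)
  \<comment> \<open>Smallness of the boundary terms is available only at certain points arbitrarily
    far out, so the endpoints are chosen accordingly.\<close>
  have "\<exists>x\<le>- real n. norm (fm1 x * cnj (fm x)) < 1 / real (Suc n)" for n by (rule iparts_decay_left[OF P f G]) simp
  then obtain a where a: "\<And>n. a n \<le> - real n" "\<And>n. norm (fm1 (a n) * cnj (fm (a n))) < 1 / real (Suc n)" by metis
  have "\<exists>x\<ge>real n. norm (fp1 x * cnj (fp x)) < 1 / real (Suc n)" for n by (rule iparts_decay_right[OF P f G]) simp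
  then obtain b where b: "\<And>n. b n \<ge> real n" "\<And>n. norm (fp1 (b n) * cnj (fp (b n))) < 1 / real (Suc n)" by metis
  have habs: "h absolutely_integrable_on {u..v}" for u v by (rule set_integrable_subset_UNIV[OF hi]) simp
  have hint: "h integrable_on {u..v}" for u v using habs set_lebesgue_integral_eq_integral(1) by blast
  have bnd: "\<bar>LINT x|lebesgue. indicat_real {a n..b n} x *\<^sub>R h x\<bar> \<le> 2 / real (Suc n)" for n
  proof -
    have an: "a n \<le> 0" and bn: "0 \<le> b n" using a(1)[of n] b(1)[of n] by linarith+
    have "(LINT x|lebesgue. indicat_real {a n..b n} x *\<^sub>R h x) = integral {a n..b n} h"
      using set_lebesgue_integral_eq_integral(2)[OF habs[of "a n" "b n"]] unfolding set_lebesgue_integral_def by simp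
    also have "\<dots> = integral {a n..0} h + integral {0..b n} h"
      by (rule Henstock_Kurzweil_Integration.integral_combine[OF an bn hint, symmetric])
    also have "integral {a n..0} h = integral {a n..0} (\<lambda>x. Im (G x * cnj (fm x)))"
      by (rule integral_spike[of "{0}"]) (use P in \<open>auto simp: h_def iparts_def\<close>)
    also have "integral {0..b n} h = integral {0..b n} (\<lambda>x. Im (G x * cnj (fp x)))"
      by (rule integral_spike[of "{0}"]) (use P in \<open>auto simp: h_def iparts_def\<close>)
    also have "integral {a n..0} (\<lambda>x. Im (G x * cnj (fm x))) + integral {0..b n} (\<lambda>x. Im (G x * cnj (fp x))) =
        Im (fm1 (a n) * cnj (fm (a n))) - Im (fp1 (b n) * cnj (fp (b n)))"
      by (rule iparts_Im_identity[OF P \<alpha> an bn])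
    finally have eq: "(LINT x|lebesgue. indicat_real {a n..b n} x *\<^sub>R h x) =
        Im (fm1 (a n) * cnj (fm (a n))) - Im (fp1 (b n) * cnj (fp (b n)))" .
    have "\<bar>Im (fm1 (a n) * cnj (fm (a n)))\<bar> < 1 / real (Suc n)" "\<bar>Im (fp1 (b n) * cnj (fp (b n)))\<bar> < 1 / real (Suc n)"
      using order_le_less_trans[OF abs_Im_le_cmod a(2)] order_le_less_trans[OF abs_Im_le_cmod b(2)] by blast+
    moreover have "2 / real (Suc n) = 1 / real (Suc n) + 1 / real (Suc n)" by simp
    ultimately show ?thesis unfolding eq by linarith
  qed
  have lim0: "(\<lambda>n. LINT x|lebesgue. indicat_real {a n..b n} x *\<^sub>R h x) \<longlonglongrightarrow> 0"
  proof (rule Lim_null_comparison)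
    show "\<forall>\<^sub>F n in sequentially. norm (LINT x|lebesgue. indicat_real {a n..b n} x *\<^sub>R h x) \<le> 2 / real (Suc n)"
      using bnd by auto
    show "(\<lambda>n. 2 / real (Suc n)) \<longlonglongrightarrow> 0"
      using LIMSEQ_Suc[OF lim_const_over_n[of 2]] by simp
  qed
  have "(\<lambda>n. LINT x|lebesgue. indicat_real {a n..b n} x *\<^sub>R h x) \<longlonglongrightarrow> (LINT x|lebesgue. h x)"
  proof (rule integral_dominated_convergence[where w="\<lambda>x. norm (h x)"])
    show "h \<in> borel_measurable lebesgue" using hi by auto
    then show "(\<lambda>x. indicat_real {a n..b n} x *\<^sub>R h x) \<in> borel_measurable lebesgue" for n
      by (intro borel_measurable_scaleR borel_measurable_indicator) auto
    show "integrable lebesgue (\<lambda>x. norm (h x))" using hi by auto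
    show "AE x in lebesgue. (\<lambda>n. indicat_real {a n..b n} x *\<^sub>R h x) \<longlonglongrightarrow> h x"
    proof (rule AE_I2)
      fix x :: real
      obtain N :: nat where N: "\<bar>x\<bar> \<le> real N" using real_arch_simple by blast
      have "indicat_real {a n..b n} x *\<^sub>R h x = h x" if "n \<ge> N" for n
      proof -
        have "real N \<le> real n" using that by simp
        then have "x \<in> {a n..b n}" using a(1)[of n] b(1)[of n] N by auto
        then show ?thesis by simp
      qed
      then have "\<forall>\<^sub>F n in sequentially. indicat_real {a n..b n} x *\<^sub>R h x = h x" unfolding eventually_sequentially by blast
      then show "(\<lambda>n. indicat_real {a n..b n} x *\<^sub>R h x) \<longlonglongrightarrow> h x" by (rule tendsto_eventually)
    qed
    show "AE x in lebesgue. norm (indicat_real {a n..b n} x *\<^sub>R h x) \<le> norm (h x)" for n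
      by (auto simp: indicator_def)
  qed
  then have "(LINT x|lebesgue. h x) = 0" using lim0 LIMSEQ_unique by blast
  then show ?thesis unfolding h_def using integral_Im[OF int] by simp
qed

end

text \<open>Young's inequality with weight \<open>\<bar>Im \<zeta>\<bar>\<close>. Being pointwise it
  serves on the whole line and on bounded intervals alike, and its integration yields the constant
  \<open>1 / (Im \<zeta>)\<^sup>2\<close> for squared norms.\<close>

lemma shifted_Im_lower:
  fixes \<zeta> z w :: complex
  assumes "Im \<zeta> \<noteq> 0"
  shows "\<bar>Im \<zeta>\<bar> / 2 * (norm z)\<^sup>2 - (norm w)\<^sup>2 / (2 * \<bar>Im \<zeta>\<bar>) \<le> sgn (Im \<zeta>) * Im ((\<zeta> * z + w) * cnj z)"
proof -
  define \<eta> where "\<eta> = \<bar>Im \<zeta>\<bar>"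
  have \<eta>: "\<eta> > 0" using assms unfolding \<eta>_def by simp
  have eq: "(\<zeta> * z + w) * cnj z = \<zeta> * complex_of_real ((norm z)\<^sup>2) + w * cnj z"
  proof -
    have "(\<zeta> * z + w) * cnj z = \<zeta> * (z * cnj z) + w * cnj z" by (simp add: algebra_simps)
    then show ?thesis unfolding mult_cnj_norm by simp
  qed
  have "sgn (Im \<zeta>) * Im ((\<zeta> * z + w) * cnj z) = \<eta> * (norm z)\<^sup>2 + sgn (Im \<zeta>) * Im (w * cnj z)"
    unfolding eq \<eta>_def by (simp add: distrib_left abs_sgn del: complex_cnj_mult of_real_power flip: of_real_mult)
  moreover have "\<bar>sgn (Im \<zeta>) * Im (w * cnj z)\<bar> \<le> norm w * norm z"
    using abs_Im_le_cmod[of "w * cnj z"] assms by (simp add: abs_mult abs_sgn_eq norm_mult)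
  moreover have "norm w * norm z \<le> (norm w)\<^sup>2 / (2 * \<eta>) + \<eta> / 2 * (norm z)\<^sup>2"
  proof -
    have "0 \<le> (norm w - \<eta> * norm z)\<^sup>2 / (2 * \<eta>)" using \<eta> by simp
    also have "\<dots> = (norm w)\<^sup>2 / (2 * \<eta>) + \<eta> / 2 * (norm z)\<^sup>2 - norm w * norm z"
      using \<eta> by (simp add: field_simps power2_eq_square)
    finally show ?thesis by simp
  qed
  ultimately show ?thesis unfolding \<eta>_def[symmetric] by linarith
qed

text \<open>Here \<open>\<zeta> * f x + g x\<close> stands for the operator applied to
  \<open>f\<close>. Only the reality of its pairing with \<open>f\<close> enters, so the same bound
  applies to the point interaction and to the perturbed operators.\<close>

lemma symmetric_bound:
  fixes f g :: "real \<Rightarrow> complex"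
  assumes f: "f \<in> L2_space" and g: "g \<in> L2_space" and \<zeta>: "Im \<zeta> \<noteq> 0"
    and s: "Im (LINT x|lebesgue. (\<zeta> * f x + g x) * cnj (f x)) = 0"
  shows "nsq f \<le> nsq g / (Im \<zeta>)\<^sup>2"
proof -
  define \<eta> where "\<eta> = \<bar>Im \<zeta>\<bar>"
  have \<eta>: "\<eta> > 0" using \<zeta> unfolding \<eta>_def by simp
  have "(\<lambda>x. \<zeta> * f x + g x) \<in> L2_space" by (intro L2_add L2_cmul f g)
  then have i: "integrable lebesgue (\<lambda>x. (\<zeta> * f x + g x) * cnj (f x))" by (rule L2_mult_integrable(3)[OF _ f])
  have "(LINT x|lebesgue. \<eta> / 2 * (norm (f x))\<^sup>2 - (norm (g x))\<^sup>2 / (2 * \<eta>)) \<le>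
     (LINT x|lebesgue. sgn (Im \<zeta>) * Im ((\<zeta> * f x + g x) * cnj (f x)))"
    using shifted_Im_lower[OF \<zeta>] L2_spaceD[OF f] L2_spaceD[OF g] integrable_Im[OF i] unfolding \<eta>_def
    by (intro integral_mono) auto
  also have "\<dots> = 0" using s integral_Im[OF i] by simp
  finally have "\<eta> / 2 * nsq f \<le> nsq g / (2 * \<eta>)"
    using L2_spaceD[OF f] L2_spaceD[OF g] unfolding nsq_def by simp
  then have "nsq f \<le> nsq g / \<eta>\<^sup>2" using \<eta> by (simp add: field_simps power2_eq_square)
  then show ?thesis unfolding \<eta>_def by simp
qed

subsection \<open>Existence of resolvents\<close>

lemma L2_abs_integrable:
  fixes g :: "real \<Rightarrow> complex"
  assumes g: "g \<in> L2_space"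
  shows "g absolutely_integrable_on {a..b}"
proof (rule measurable_bounded_by_integrable_imp_absolutely_integrable)
  show "g \<in> borel_measurable (lebesgue_on {a..b})" using L2_spaceD(1)[OF g] by (simp add: measurable_restrict_space1)
  have "(\<lambda>x. (norm (g x))\<^sup>2) integrable_on {a..b}"
    using L2_abs_integrable_norm_sq[OF g, of "{a..b}"] set_lebesgue_integral_eq_integral(1) by auto
  then show "(\<lambda>x. 1 + (norm (g x))\<^sup>2) integrable_on {a..b}" by (intro integrable_add integrable_const_ivl)
  show "norm (g x) \<le> 1 + (norm (g x))\<^sup>2" for x
  proof -
    have "2 * norm (g x) \<le> 1 + (norm (g x))\<^sup>2" using sum_squares_bound[of 1 "norm (g x)"] by simp
    then show ?thesis using norm_ge_zero[of "g x"] by linarith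
  qed
qed simp

text \<open>The Cauchy-Schwarz inequality with a free parameter; later choices of \<open>t\<close>
  balance the length of the interval against the squared norm.\<close>

lemma integral_norm_le_sq:
  fixes f :: "real \<Rightarrow> complex"
  assumes "(\<lambda>x. norm (f x)) integrable_on {a..b}" "(\<lambda>x. (norm (f x))\<^sup>2) integrable_on {a..b}" "a \<le> b" "t > 0"
  shows "integral {a..b} (\<lambda>x. norm (f x)) \<le> (b - a) * t / 2 + integral {a..b} (\<lambda>x. (norm (f x))\<^sup>2) / (2 * t)"
proof -
  have i: "(\<lambda>x. t / 2 + (norm (f x))\<^sup>2 / (2 * t)) integrable_on {a..b}"
    by (intro integrable_add integrable_const_ivl integrable_on_divide assms)
  have "integral {a..b} (\<lambda>x. norm (f x)) \<le> integral {a..b} (\<lambda>x. t / 2 + (norm (f x))\<^sup>2 / (2 * t))"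
  proof (rule integral_le[OF assms(1) i])
    fix x
    have "0 \<le> (norm (f x) - t)\<^sup>2 / (2 * t)" using assms(4) by simp
    also have "\<dots> = t / 2 + (norm (f x))\<^sup>2 / (2 * t) - norm (f x)" using assms(4) by (simp add: field_simps power2_eq_square)
    finally show "norm (f x) \<le> t / 2 + (norm (f x))\<^sup>2 / (2 * t)" by simp
  qed
  also have "\<dots> = (b - a) * (t / 2) + integral {a..b} (\<lambda>x. (norm (f x))\<^sup>2 / (2 * t))"
    using assms(3) by (subst Henstock_Kurzweil_Integration.integral_add) (auto intro!: integrable_on_divide assms)
  finally show ?thesis by simp
qed

lemma L2_integral_sq_le:
  fixes g :: "real \<Rightarrow> complex"
  assumes g: "g \<in> L2_space" and A: "A \<in> sets lebesgue"
  shows "(\<lambda>x. (norm (g x))\<^sup>2) integrable_on A" "integral A (\<lambda>x. (norm (g x))\<^sup>2) \<le> nsq g"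
proof -
  note i = L2_abs_integrable_norm_sq[OF g A]
  show "(\<lambda>x. (norm (g x))\<^sup>2) integrable_on A" using i set_lebesgue_integral_eq_integral(1) by blast
  have "integral A (\<lambda>x. (norm (g x))\<^sup>2) = (LINT x|lebesgue. indicat_real A x *\<^sub>R (norm (g x))\<^sup>2)"
    using set_lebesgue_integral_eq_integral(2)[OF i] unfolding set_lebesgue_integral_def by simp
  also have "\<dots> \<le> nsq g" unfolding nsq_def
    using i L2_spaceD(2)[OF g] by (intro integral_mono) (auto simp: set_integrable_def indicator_def)
  finally show "integral A (\<lambda>x. (norm (g x))\<^sup>2) \<le> nsq g" .
qed

lemma L2_integral_norm_le:
  fixes g :: "real \<Rightarrow> complex"
  assumes g: "g \<in> L2_space" and ab: "a \<le> b" and t: "t > 0"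
  shows "(\<lambda>x. norm (g x)) integrable_on {a..b}"
    "integral {a..b} (\<lambda>x. norm (g x)) \<le> (b - a) * t / 2 + nsq g / (2 * t)"
proof -
  show i: "(\<lambda>x. norm (g x)) integrable_on {a..b}"
    using absolutely_integrable_norm[OF L2_abs_integrable[OF g]] set_lebesgue_integral_eq_integral(1) by (auto simp: o_def)
  have "integral {a..b} (\<lambda>x. norm (g x)) \<le> (b - a) * t / 2 + integral {a..b} (\<lambda>x. (norm (g x))\<^sup>2) / (2 * t)"
    by (rule integral_norm_le_sq[OF i L2_integral_sq_le(1)[OF g] ab t]) simp
  also have "\<dots> \<le> (b - a) * t / 2 + nsq g / (2 * t)"
    using L2_integral_sq_le(2)[OF g, of "{a..b}"] t by (intro add_left_mono divide_right_mono) auto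
  finally show "integral {a..b} (\<lambda>x. norm (g x)) \<le> (b - a) * t / 2 + nsq g / (2 * t)" .
qed

text \<open>If the determinant vanished, \<open>(m22, - m21)\<close> and \<open>(m12, - m11)\<close>
  would lie in the kernel, the matrix would be zero, and injectivity would fail. Thus uniqueness for
  a linear problem with two unknowns provides existence.\<close>

lemma complex_2x2_solve:
  fixes m11 m12 m21 m22 r1 r2 :: complex
  assumes inj: "\<And>a b. m11 * a + m12 * b = 0 \<Longrightarrow> m21 * a + m22 * b = 0 \<Longrightarrow> a = 0 \<and> b = 0"
  obtains a b where "m11 * a + m12 * b = r1" "m21 * a + m22 * b = r2"
proof -
  define D where "D = m11 * m22 - m12 * m21"
  have D: "D \<noteq> 0"
  proof
    assume D0: "D = 0"
    have 1: "m22 = 0 \<and> - m21 = 0" by (rule inj) (use D0 in \<open>auto simp: D_def algebra_simps\<close>)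
    have 2: "m12 = 0 \<and> - m11 = 0" by (rule inj) (use D0 in \<open>auto simp: D_def algebra_simps\<close>)
    have "(1::complex) = 0 \<and> (0::complex) = 0" by (rule inj) (use 1 2 in auto)
    then show False by simp
  qed
  show thesis
  proof (rule that)
    show "m11 * ((r1 * m22 - m12 * r2) / D) + m12 * ((m11 * r2 - r1 * m21) / D) = r1"
    proof -
      have "m11 * (r1 * m22 - m12 * r2) + m12 * (m11 * r2 - r1 * m21) = r1 * D" unfolding D_def by (simp add: algebra_simps)
      then show ?thesis using D by (simp add: field_simps)
    qed
    show "m21 * ((r1 * m22 - m12 * r2) / D) + m22 * ((m11 * r2 - r1 * m21) / D) = r2"
    proof -
      have "m21 * (r1 * m22 - m12 * r2) + m22 * (m11 * r2 - r1 * m21) = r2 * D" unfolding D_def by (simp add: algebra_simps)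
      then show ?thesis using D by (simp add: field_simps)
    qed
  qed
qed

context potential
begin

text \<open>The resolvent bound on a bounded interval: the Dirichlet conditions remove the outer
  boundary terms, and \<open>interface_Im\<close> those at 0. It is uniform in \<open>n\<close>, as
  the limit of growing intervals requires.\<close>

lemma dirichlet_bound:
  assumes Hm: "H2 fm fm1 (\<lambda>x. (complex_of_real (V x) - \<zeta>) * fm x - g x)"
    and Hp: "H2 fp fp1 (\<lambda>x. (complex_of_real (V x) - \<zeta>) * fp x - g x)"
    and if0: "fp 0 = complex_of_real \<alpha> * fm 0 + complex_of_real \<beta> * fm1 0" "fp1 0 = complex_of_real (inverse \<alpha>) * fm1 0"
    and \<alpha>: "\<alpha> \<noteq> 0" and \<zeta>: "Im \<zeta> \<noteq> 0" and g: "g \<in> L2_space" and n: "n \<ge> 0"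
    and bc: "fm (-n) = 0" "fp n = 0"
  shows "integral {-n..0} (\<lambda>x. (norm (fm x))\<^sup>2) + integral {0..n} (\<lambda>x. (norm (fp x))\<^sup>2) \<le> nsq g / (Im \<zeta>)\<^sup>2"
proof -
  define \<eta> where "\<eta> = \<bar>Im \<zeta>\<bar>"
  have \<eta>: "\<eta> > 0" using \<zeta> unfolding \<eta>_def by simp
  have id: "(\<lambda>x. Im ((\<zeta> * f x + g x) * cnj (f x))) absolutely_integrable_on {a..b} \<and>
     integral {a..b} (\<lambda>x. Im ((\<zeta> * f x + g x) * cnj (f x))) = Im (f1 a * cnj (f a)) - Im (f1 b * cnj (f b))"
    if "H2 f f1 (\<lambda>x. (complex_of_real (V x) - \<zeta>) * f x - g x)" "a \<le> b" for f f1 a b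
    using H2_Im_identity[OF that, of V "\<lambda>x. \<zeta> * f x + g x"] by (simp add: algebra_simps)
  have sq: "(\<lambda>x. (norm (f x))\<^sup>2) integrable_on {a..b}" if "H2 f f1 k" for f f1 k a b
    by (intro integrable_continuous_real continuous_intros H2_continuous[OF that])
  have gs: "(\<lambda>x. (norm (g x))\<^sup>2) integrable_on {a..b}" for a b by (rule L2_integral_sq_le(1)[OF g]) simp
  have low: "\<eta> / 2 * integral {a..b} (\<lambda>x. (norm (f x))\<^sup>2) - integral {a..b} (\<lambda>x. (norm (g x))\<^sup>2) / (2 * \<eta>)
      \<le> sgn (Im \<zeta>) * (Im (f1 a * cnj (f a)) - Im (f1 b * cnj (f b)))"
    if H: "H2 f f1 (\<lambda>x. (complex_of_real (V x) - \<zeta>) * f x - g x)" and ab: "a \<le> b" for f f1 a b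
  proof -
    have i: "(\<lambda>x. Im ((\<zeta> * f x + g x) * cnj (f x))) integrable_on {a..b}"
      using id[OF H ab] set_lebesgue_integral_eq_integral(1) by blast
    have "integral {a..b} (\<lambda>x. \<eta> / 2 * (norm (f x))\<^sup>2 - (norm (g x))\<^sup>2 / (2 * \<eta>)) \<le>
       integral {a..b} (\<lambda>x. sgn (Im \<zeta>) * Im ((\<zeta> * f x + g x) * cnj (f x)))"
    proof (rule integral_le)
      show "(\<lambda>x. \<eta> / 2 * (norm (f x))\<^sup>2 - (norm (g x))\<^sup>2 / (2 * \<eta>)) integrable_on {a..b}"
        by (intro integrable_diff integrable_on_divide integrable_on_mult_right sq[OF H] gs)
      show "(\<lambda>x. sgn (Im \<zeta>) * Im ((\<zeta> * f x + g x) * cnj (f x))) integrable_on {a..b}"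
        by (intro integrable_on_mult_right i)
    qed (use shifted_Im_lower[OF \<zeta>] in \<open>auto simp: \<eta>_def\<close>)
    also have "\<dots> = sgn (Im \<zeta>) * (Im (f1 a * cnj (f a)) - Im (f1 b * cnj (f b)))"
      using id[OF H ab] by (simp only: Henstock_Kurzweil_Integration.integral_mult_right)
    also have "integral {a..b} (\<lambda>x. \<eta> / 2 * (norm (f x))\<^sup>2 - (norm (g x))\<^sup>2 / (2 * \<eta>)) =
       \<eta> / 2 * integral {a..b} (\<lambda>x. (norm (f x))\<^sup>2) - integral {a..b} (\<lambda>x. (norm (g x))\<^sup>2) / (2 * \<eta>)"
      using integrable_on_mult_right[OF sq[OF H, of a b], of "\<eta> / 2"] integrable_on_divide[OF gs[of a b], of "2 * \<eta>"]
      by (subst Henstock_Kurzweil_Integration.integral_diff)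
        (simp_all only: Henstock_Kurzweil_Integration.integral_mult_right Henstock_Kurzweil_Integration.integral_divide)
    finally show ?thesis .
  qed
  have gtot: "integral {-n..0} (\<lambda>x. (norm (g x))\<^sup>2) + integral {0..n} (\<lambda>x. (norm (g x))\<^sup>2) \<le> nsq g"
    using Henstock_Kurzweil_Integration.integral_combine[OF _ _ gs, of "-n" 0 n] L2_integral_sq_le(2)[OF g, of "{-n..n}"] n by simp
  define X where "X = integral {-n..0} (\<lambda>x. (norm (fm x))\<^sup>2) + integral {0..n} (\<lambda>x. (norm (fp x))\<^sup>2)"
  define S where "S = integral {-n..0} (\<lambda>x. (norm (g x))\<^sup>2) + integral {0..n} (\<lambda>x. (norm (g x))\<^sup>2)"
  have "\<eta> / 2 * X - S / (2 * \<eta>) \<le> sgn (Im \<zeta>) * (Im (fm1 (-n) * cnj (fm (-n))) - Im (fm1 0 * cnj (fm 0)))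
      + sgn (Im \<zeta>) * (Im (fp1 0 * cnj (fp 0)) - Im (fp1 n * cnj (fp n)))"
    using low[OF Hm, of "-n" 0] low[OF Hp, of 0 n] n unfolding X_def S_def distrib_left add_divide_distrib by linarith
  also have "\<dots> = 0"
  proof -
    have "fm1 (-n) * cnj (fm (-n)) = 0" "fp1 n * cnj (fp n) = 0" using bc by auto
    then show ?thesis unfolding interface_Im[OF \<alpha> if0] by (simp only:) (simp del: times_complex.sel)
  qed
  finally have "\<eta> / 2 * X \<le> S / (2 * \<eta>)" by simp
  also have "\<dots> \<le> nsq g / (2 * \<eta>)" using gtot \<eta> unfolding S_def by (intro divide_right_mono) auto
  finally have "X \<le> nsq g / \<eta>\<^sup>2" using \<eta> by (simp add: field_simps power2_eq_square)
  then show ?thesis unfolding X_def \<eta>_def by simp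
qed

text \<open>Only \<open>{-1..0}\<close> is used, which lies in every \<open>{-n..0}\<close> with
  \<open>n \<ge> 1\<close>, so the bound is common to all approximating intervals.\<close>

lemma initial_data_bound:
  assumes K: "\<And>x. \<bar>x\<bar> \<le> 1 \<Longrightarrow> norm (complex_of_real (V x) - \<zeta>) \<le> K"
    and H: "H2 f f1 (\<lambda>x. (complex_of_real (V x) - \<zeta>) * f x - g x)" and g: "g \<in> L2_space"
    and X: "integral {-1..0} (\<lambda>x. (norm (f x))\<^sup>2) \<le> X"
  shows "norm (f 0) \<le> 6 * ((1 + K) * (1 + X) + (1 + nsq g))" "norm (f1 0) \<le> 6 * ((1 + K) * (1 + X) + (1 + nsq g))"
proof -
  have K0: "K \<ge> 0" using order_trans[OF norm_ge_zero K[of 0]] by simp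
  have c: "(\<lambda>x. norm (f x)) integrable_on {-1..0}" "(\<lambda>x. (norm (f x))\<^sup>2) integrable_on {-1..0}"
    by (intro integrable_continuous_real continuous_intros H2_continuous[OF H])+
  have gi: "(\<lambda>x. norm (g x)) integrable_on {-1..0}" "integral {-1..0} (\<lambda>x. norm (g x)) \<le> 1 + nsq g"
    using L2_integral_norm_le[OF g, of "-1" 0 1] nsq_nonneg[of g] by auto
  have "integral {-1..0} (\<lambda>x. (norm (f x))\<^sup>2) \<ge> 0" by (rule Henstock_Kurzweil_Integration.integral_nonneg[OF c(2)]) simp
  then have f1: "integral {-1..0} (\<lambda>x. norm (f x)) \<le> 1 + X"
    using integral_norm_le_sq[OF c, of 1] X by simp
  have ki: "(\<lambda>x. norm ((complex_of_real (V x) - \<zeta>) * f x - g x)) integrable_on {-1..0}"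
    using H absolutely_integrable_norm[OF is_primitiveD(1)] set_lebesgue_integral_eq_integral(1) unfolding H2_def o_def by blast
  have "integral {-1..0} (\<lambda>x. norm ((complex_of_real (V x) - \<zeta>) * f x - g x)) \<le> integral {-1..0} (\<lambda>x. K * norm (f x) + norm (g x))"
  proof (rule integral_le[OF ki])
    show "(\<lambda>x. K * norm (f x) + norm (g x)) integrable_on {- 1..0}" by (intro integrable_add integrable_on_mult_right c gi)
    fix x :: real assume "x \<in> {-1..0}"
    then have "norm ((complex_of_real (V x) - \<zeta>) * f x) \<le> K * norm (f x)" unfolding norm_mult by (intro mult_right_mono K) auto
    then show "norm ((complex_of_real (V x) - \<zeta>) * f x - g x) \<le> K * norm (f x) + norm (g x)"
      using norm_triangle_ineq4[of "(complex_of_real (V x) - \<zeta>) * f x" "g x"] by simp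
  qed
  also have "\<dots> = K * integral {-1..0} (\<lambda>x. norm (f x)) + integral {-1..0} (\<lambda>x. norm (g x))"
    using Henstock_Kurzweil_Integration.integral_add[OF integrable_on_mult_right[OF c(1), of K] gi(1)]
    by (simp only: Henstock_Kurzweil_Integration.integral_mult_right)
  also have "\<dots> \<le> K * (1 + X) + (1 + nsq g)" using f1 gi K0 by (intro add_mono mult_left_mono) auto
  finally have k1: "integral {-1..0} (\<lambda>x. norm ((complex_of_real (V x) - \<zeta>) * f x - g x)) \<le> K * (1 + X) + (1 + nsq g)" .
  have "integral {0-1..0} (\<lambda>x. norm (f x)) + integral {0-1..0} (\<lambda>x. norm ((complex_of_real (V x) - \<zeta>) * f x - g x)) \<le>
     (1 + K) * (1 + X) + (1 + nsq g)" using f1 k1 by (simp add: algebra_simps)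
  then have M: "6 * (integral {0-1..0} (\<lambda>x. norm (f x)) + integral {0-1..0} (\<lambda>x. norm ((complex_of_real (V x) - \<zeta>) * f x - g x)))
     \<le> 6 * ((1 + K) * (1 + X) + (1 + nsq g))" by (intro mult_left_mono) auto
  show "norm (f 0) \<le> 6 * ((1 + K) * (1 + X) + (1 + nsq g))" by (rule order_trans[OF H2_endpoint_bound_left(1)[OF H] M])
  show "norm (f1 0) \<le> 6 * ((1 + K) * (1 + X) + (1 + nsq g))" by (rule order_trans[OF H2_endpoint_bound_left(2)[OF H] M])
qed

text \<open>The problems on \<open>{-n..n}\<close> with Dirichlet conditions reduce to invertible \<open>2 \<times> 2\<close> systems. Their
  solutions are bounded in the \<open>L\<^sub>2\<close> norm uniformly in \<open>n\<close>, hence so are the initial data at \<open>0\<close>; a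
  subsequence of these converges, and the limit solves the problem by Fatou's lemma.\<close>

lemma iface_solution_exists:
  assumes \<alpha>: "\<alpha> \<noteq> 0" and \<zeta>: "Im \<zeta> \<noteq> 0" and g: "g \<in> L2_space"
  obtains f where "iface V \<alpha> \<beta> f (\<lambda>x. \<zeta> * f x + g x)"
proof -
  let ?Q = "\<lambda>x. complex_of_real (V x) - \<zeta>"
  note Q = loc_bounded_shift[of \<zeta>]
  obtain c c1 where c: "H2 c c1 (\<lambda>x. ?Q x * c x - 0)" "c 0 = 1" "c1 0 = 0"
    using ivp_exists[OF Q, of "\<lambda>_. 0" 1 0] by auto
  obtain s s1 where s: "H2 s s1 (\<lambda>x. ?Q x * s x - 0)" "s 0 = 0" "s1 0 = 1"
    using ivp_exists[OF Q, of "\<lambda>_. 0" 0 1] by auto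
  obtain p p1 where p: "H2 p p1 (\<lambda>x. ?Q x * p x - g x)" "p 0 = 0" "p1 0 = 0"
    using ivp_exists[OF Q L2_abs_integrable[OF g], of 0 0] by auto
  \<comment> \<open>\<open>F z w\<close> is the solution with data \<open>(z, w)\<close> at 0 and
    \<open>E z w\<close> its homogeneous analogue. Further down, \<open>P\<close> and
    \<open>R\<close> carry the data from the left of 0 to the right.\<close>
  define F where "F z w x = z * c x + w * s x + p x" for z w x
  define F1 where "F1 z w x = z * c1 x + w * s1 x + p1 x" for z w x
  define E where "E z w x = z * c x + w * s x" for z w x
  define E1 where "E1 z w x = z * c1 x + w * s1 x" for z w x
  have HF: "H2 (F z w) (F1 z w) (\<lambda>x. ?Q x * F z w x - g x)" for z w
  proof -
    have "H2 (\<lambda>x. z * c x + w * s x + p x) (\<lambda>x. z * c1 x + w * s1 x + p1 x)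
      (\<lambda>x. z * (?Q x * c x - 0) + w * (?Q x * s x - 0) + (?Q x * p x - g x))"
      by (intro H2_add H2_cmul c s p)
    then show ?thesis unfolding F_def[abs_def] F1_def[abs_def] by (simp add: algebra_simps)
  qed
  have HE: "H2 (E z w) (E1 z w) (\<lambda>x. ?Q x * E z w x - 0)" for z w
  proof -
    have "H2 (\<lambda>x. z * c x + w * s x) (\<lambda>x. z * c1 x + w * s1 x)
      (\<lambda>x. z * (?Q x * c x - 0) + w * (?Q x * s x - 0))"
      by (intro H2_add H2_cmul c s)
    then show ?thesis unfolding E_def[abs_def] E1_def[abs_def] by (simp add: algebra_simps)
  qed
  have F0: "F z w 0 = z" "F1 z w 0 = w" "E z w 0 = z" "E1 z w 0 = w" for z w
    unfolding F_def F1_def E_def E1_def by (auto simp: c s p)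
  define P where "P a b = complex_of_real \<alpha> * a + complex_of_real \<beta> * b" for a b
  define R where "R b = complex_of_real (inverse \<alpha>) * b" for b
  obtain K where K: "K \<ge> 0" "\<And>x. \<bar>x\<bar> \<le> 1 \<Longrightarrow> norm (?Q x) \<le> K" using loc_boundedE[OF Q] by blast
  define X where "X = nsq g / (Im \<zeta>)\<^sup>2"
  have sqi: "(\<lambda>x. (norm (f x))\<^sup>2) integrable_on {a..b}" if "H2 f f1 k" for f f1 k a b
    by (intro integrable_continuous_real continuous_intros H2_continuous[OF that])
  have sq0: "integral {a..b} (\<lambda>x. (norm (f x))\<^sup>2) \<ge> 0" if "H2 f f1 k" for f f1 k a b
    by (rule Henstock_Kurzweil_Integration.integral_nonneg[OF sqi[OF that]]) simp
  have dir: "\<exists>a b. F a b (- real (Suc n)) = 0 \<and> F (P a b) (R b) (real (Suc n)) = 0" for n :: nat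
  proof -
    define m where "m = real (Suc n)"
    have m: "m \<ge> 1" unfolding m_def by simp
    \<comment> \<open>With zero right side \<open>dirichlet_bound\<close> makes the left part vanish
      next to 0, and then \<open>H2_endpoint_bound_left\<close> gives vanishing data at 0.\<close>
    have inj: "a = 0 \<and> b = 0" if ab: "E a b (-m) = 0" "E (P a b) (R b) m = 0" for a b
    proof -
      have z: "(\<lambda>_. 0 :: complex) \<in> L2_space" "nsq (\<lambda>_. 0) = 0" unfolding L2_space_def nsq_def by auto
      have "integral {-m..0} (\<lambda>x. (norm (E a b x))\<^sup>2) + integral {0..m} (\<lambda>x. (norm (E (P a b) (R b) x))\<^sup>2) \<le> nsq (\<lambda>_. 0) / (Im \<zeta>)\<^sup>2"
        by (rule dirichlet_bound[OF HE HE _ _ \<alpha> \<zeta> z(1)]) (use m ab in \<open>auto simp: F0 P_def R_def\<close>)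
      then have "integral {-m..0} (\<lambda>x. (norm (E a b x))\<^sup>2) \<le> 0" using sq0[OF HE, of 0 m "P a b" "R b"] z(2) by simp
      moreover have "integral {-1..0} (\<lambda>x. (norm (E a b x))\<^sup>2) \<le> integral {-m..0} (\<lambda>x. (norm (E a b x))\<^sup>2)"
        by (rule integral_subset_le[OF _ sqi[OF HE] sqi[OF HE]]) (use m in auto)
      ultimately have z0: "integral {-1..0} (\<lambda>x. (norm (E a b x))\<^sup>2) = 0" using sq0[OF HE, of "-1" 0 a b] by linarith
      have e0: "E a b x = 0" if "x \<in> {-1..0}" for x
      proof -
        have "continuous_on {-1..0} (\<lambda>x. (norm (E a b x))\<^sup>2)"
          by (intro continuous_on_power continuous_on_norm H2_continuous(1)[OF HE])
        then have "\<forall>x\<in>{-1..0}. (norm (E a b x))\<^sup>2 = 0"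
          using integral_eq_0_iff[of "-1" 0 "\<lambda>x. (norm (E a b x))\<^sup>2"] z0 by simp
        then show ?thesis using that by simp
      qed
      have "integral {0-1..0} (\<lambda>x. norm (E a b x)) = integral {0-1..0} (\<lambda>x::real. 0 :: real)"
        by (intro Henstock_Kurzweil_Integration.integral_cong) (use e0 in auto)
      moreover have "integral {0-1..0} (\<lambda>x. norm (?Q x * E a b x - 0)) = integral {0-1..0} (\<lambda>x::real. 0 :: real)"
        by (intro Henstock_Kurzweil_Integration.integral_cong) (use e0 in auto)
      ultimately show ?thesis using H2_endpoint_bound_left[OF HE, of a b 0] by (simp add: F0)
    qed
    obtain a b where "(c (-m)) * a + (s (-m)) * b = - p (-m)"
      "(complex_of_real \<alpha> * c m) * a + (complex_of_real \<beta> * c m + complex_of_real (inverse \<alpha>) * s m) * b = - p m"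
    proof (rule complex_2x2_solve[of "c (-m)" "s (-m)" "complex_of_real \<alpha> * c m" "complex_of_real \<beta> * c m + complex_of_real (inverse \<alpha>) * s m"])
      fix a b assume "c (-m) * a + s (-m) * b = 0"
        "(complex_of_real \<alpha> * c m) * a + (complex_of_real \<beta> * c m + complex_of_real (inverse \<alpha>) * s m) * b = 0"
      then show "a = 0 \<and> b = 0" by (intro inj) (auto simp: E_def P_def R_def algebra_simps)
    qed blast
    then have "F a b (-m) = 0 \<and> F (P a b) (R b) m = 0"
      unfolding F_def P_def R_def by (simp add: algebra_simps eq_neg_iff_add_eq_0)
    then show ?thesis unfolding m_def by blast
  qed
  then obtain A B where AB: "\<And>n. F (A n) (B n) (- real (Suc n)) = 0" "\<And>n. F (P (A n) (B n)) (R (B n)) (real (Suc n)) = 0"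
    by metis
  have bnd: "integral {-real (Suc n)..0} (\<lambda>x. (norm (F (A n) (B n) x))\<^sup>2) +
     integral {0..real (Suc n)} (\<lambda>x. (norm (F (P (A n) (B n)) (R (B n)) x))\<^sup>2) \<le> X" for n
    unfolding X_def
    by (rule dirichlet_bound[OF HF HF _ _ \<alpha> \<zeta> g]) (use AB in \<open>auto simp: F0 P_def R_def\<close>)
  define M where "M = 6 * ((1 + K) * (1 + X) + (1 + nsq g))"
  have "norm (A n) \<le> M \<and> norm (B n) \<le> M" for n
  proof -
    have "integral {-1..0} (\<lambda>x. (norm (F (A n) (B n) x))\<^sup>2) \<le> integral {-real (Suc n)..0} (\<lambda>x. (norm (F (A n) (B n) x))\<^sup>2)"
      by (rule integral_subset_le[OF _ sqi[OF HF] sqi[OF HF]]) auto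
    also have "\<dots> \<le> X" using bnd[of n] sq0[OF HF, of 0 "real (Suc n)" "P (A n) (B n)" "R (B n)"] by linarith
    finally have "integral {-1..0} (\<lambda>x. (norm (F (A n) (B n) x))\<^sup>2) \<le> X" .
    note I = initial_data_bound[OF K(2) HF[of "A n" "B n"] g this, folded M_def]
    from I(1) I(2) show ?thesis unfolding F0 by (rule conjI)
  qed
  then have inM: "\<forall>n. (A n, B n) \<in> cball 0 M \<times> cball 0 M" by auto
  have "compact (cball 0 M \<times> cball 0 M :: (complex \<times> complex) set)" by (intro compact_Times compact_cball)
  then have "seq_compact (cball 0 M \<times> cball 0 M :: (complex \<times> complex) set)" by (rule compact_imp_seq_compact)
  \<comment> \<open>Bolzano-Weierstrass for the data at 0. Pointwise convergence of the solutions
    follows because they depend affinely on their data.\<close>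
  then obtain l r where lr: "strict_mono r" "((\<lambda>n. (A n, B n)) \<circ> r) \<longlonglongrightarrow> l"
    using seq_compactE[OF _ inM] by blast
  define a b where "a = fst l" and "b = snd l"
  have limA: "(\<lambda>n. A (r n)) \<longlonglongrightarrow> a" and limB: "(\<lambda>n. B (r n)) \<longlonglongrightarrow> b"
    using tendsto_fst[OF lr(2)] tendsto_snd[OF lr(2)] unfolding a_def b_def o_def by auto
  define f where "f x = (if x < 0 then F a b x else F (P a b) (R b) x)" for x
  define fn where "fn n x = (if x < 0 then F (A n) (B n) x else F (P (A n) (B n)) (R (B n)) x)" for n x
  have Fm: "F z w \<in> borel_measurable lebesgue" for z w
    by (rule continuous_borel_measurable_lebesgue[OF H2_continuous(1)[OF HF]])
  have im: "(\<lambda>x. if x < (0::real) then u x else v x) \<in> borel_measurable lebesgue"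
    if "u \<in> borel_measurable lebesgue" "v \<in> borel_measurable lebesgue" for u v :: "real \<Rightarrow> complex"
    using that by (intro measurable_If) auto
  have fmeas: "f \<in> borel_measurable lebesgue" and fnmeas: "\<And>n. fn n \<in> borel_measurable lebesgue"
    unfolding f_def[abs_def] fn_def[abs_def] by (intro im Fm)+
  \<comment> \<open>The squares are truncated to the interval on which the bound holds, which makes
    them integrands on the whole line; along \<open>r\<close> they converge pointwise to
    \<open>(norm (f x))\<^sup>2\<close>.\<close>
  define h where "h n x = indicat_real {- real (Suc n)..real (Suc n)} x * (norm (fn n x))\<^sup>2" for n x
  have hle: "(\<integral>\<^sup>+x. ennreal (h n x) \<partial>lebesgue) \<le> ennreal X" for n
  proof -
    let ?m = "real (Suc n)"
    have i1: "(\<lambda>x. (norm (fn n x))\<^sup>2) integrable_on {- ?m..0}"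
      by (rule integrable_spike[OF sqi[OF HF[of "A n" "B n"]], of "{0}"]) (auto simp: fn_def)
    have i2: "(\<lambda>x. (norm (fn n x))\<^sup>2) integrable_on {0..?m}"
      by (rule integrable_spike[OF sqi[OF HF[of "P (A n) (B n)" "R (B n)"]], of "{0}"]) (auto simp: fn_def)
    have i: "(\<lambda>x. (norm (fn n x))\<^sup>2) integrable_on {- ?m..?m}"
      by (rule Henstock_Kurzweil_Integration.integrable_combine[OF _ _ i1 i2]) auto
    have ab: "(\<lambda>x. (norm (fn n x))\<^sup>2) absolutely_integrable_on {- ?m..?m}"
      by (rule nonnegative_absolutely_integrable_1[OF i]) simp
    have hi: "integrable lebesgue (h n)" using ab unfolding set_integrable_def h_def[abs_def] by simp
    have "(\<integral>\<^sup>+x. ennreal (h n x) \<partial>lebesgue) = ennreal (LINT x|lebesgue. h n x)"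
      by (rule nn_integral_eq_integral[OF hi]) (simp add: h_def)
    also have "(LINT x|lebesgue. h n x) = integral {- ?m..?m} (\<lambda>x. (norm (fn n x))\<^sup>2)"
      using set_lebesgue_integral_eq_integral(2)[OF ab] unfolding set_lebesgue_integral_def h_def[abs_def] by simp
    also have "\<dots> = integral {- ?m..0} (\<lambda>x. (norm (fn n x))\<^sup>2) + integral {0..?m} (\<lambda>x. (norm (fn n x))\<^sup>2)"
      by (rule Henstock_Kurzweil_Integration.integral_combine[OF _ _ i, symmetric]) auto
    also have "integral {- ?m..0} (\<lambda>x. (norm (fn n x))\<^sup>2) = integral {- ?m..0} (\<lambda>x. (norm (F (A n) (B n) x))\<^sup>2)"
      by (rule integral_spike[of "{0}"]) (auto simp: fn_def)
    also have "integral {0..?m} (\<lambda>x. (norm (fn n x))\<^sup>2) = integral {0..?m} (\<lambda>x. (norm (F (P (A n) (B n)) (R (B n)) x))\<^sup>2)"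
      by (rule integral_spike[of "{0}"]) (auto simp: fn_def)
    finally show ?thesis using bnd[of n] by (simp add: ennreal_leI)
  qed
  have hlim: "(\<lambda>n. ennreal (h (r n) x)) \<longlonglongrightarrow> ennreal ((norm (f x))\<^sup>2)" for x
  proof -
    have "(\<lambda>n. fn (r n) x) \<longlonglongrightarrow> f x"
      unfolding fn_def f_def F_def P_def R_def by (cases "x < 0") (auto intro!: tendsto_intros limA limB)
    then have "(\<lambda>n. (norm (fn (r n) x))\<^sup>2) \<longlonglongrightarrow> (norm (f x))\<^sup>2" by (intro tendsto_intros)
    moreover have "\<forall>\<^sub>F n in sequentially. (norm (fn (r n) x))\<^sup>2 = h (r n) x"
    proof -
      obtain N :: nat where N: "\<bar>x\<bar> \<le> real N" using real_arch_simple by blast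
      have "(norm (fn (r n) x))\<^sup>2 = h (r n) x" if "n \<ge> N" for n
      proof -
        have "real N \<le> real (Suc (r n))" using seq_suble[OF lr(1), of n] that by simp
        then have "x \<in> {- real (Suc (r n))..real (Suc (r n))}" using N by auto
        then show ?thesis unfolding h_def by simp
      qed
      then show ?thesis unfolding eventually_sequentially by blast
    qed
    ultimately have "(\<lambda>n. h (r n) x) \<longlonglongrightarrow> (norm (f x))\<^sup>2" by (rule Lim_transform_eventually)
    then show ?thesis by (rule tendsto_ennrealI)
  qed
  have "(\<integral>\<^sup>+x. ennreal ((norm (f x))\<^sup>2) \<partial>lebesgue) = (\<integral>\<^sup>+x. liminf (\<lambda>n. ennreal (h (r n) x)) \<partial>lebesgue)"
    by (intro nn_integral_cong) (metis hlim lim_imp_Liminf sequentially_bot)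
  also have "\<dots> \<le> liminf (\<lambda>n. \<integral>\<^sup>+x. ennreal (h (r n) x) \<partial>lebesgue)"
  proof (rule nn_integral_liminf)
    fix n
    have "(\<lambda>x. norm (fn (r n) x)) \<in> borel_measurable lebesgue" using fnmeas[of "r n"] by measurable
    then have "h (r n) \<in> borel_measurable lebesgue"
      unfolding h_def[abs_def] by (intro borel_measurable_times borel_measurable_indicator borel_measurable_power) auto
    then show "(\<lambda>x. ennreal (h (r n) x)) \<in> borel_measurable lebesgue" by simp
  qed
  also have "\<dots> \<le> ennreal X"
    by (rule Liminf_le) (use hle in auto)
  finally have fin: "(\<integral>\<^sup>+x. ennreal ((norm (f x))\<^sup>2) \<partial>lebesgue) \<le> ennreal X" .
  have "integrable lebesgue (\<lambda>x. (norm (f x))\<^sup>2)"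
  proof (rule integrableI_bounded)
    show "(\<lambda>x. (norm (f x))\<^sup>2) \<in> borel_measurable lebesgue" using fmeas by measurable
    show "(\<integral>\<^sup>+x. ennreal (norm ((norm (f x))\<^sup>2)) \<partial>lebesgue) < \<infinity>" using fin by (simp add: order_le_less_trans)
  qed
  then have fL: "f \<in> L2_space" using fmeas unfolding L2_space_def by auto
  have "iparts V \<alpha> \<beta> f (\<lambda>x. \<zeta> * f x + g x) (F a b) (F1 a b) (\<lambda>x. ?Q x * F a b x - g x)
     (F (P a b) (R b)) (F1 (P a b) (R b)) (\<lambda>x. ?Q x * F (P a b) (R b) x - g x)"
    unfolding iparts_def
    by (intro conjI HF allI impI AE_I2) (auto simp: f_def F0 P_def R_def algebra_simps)
  moreover have "(\<lambda>x. \<zeta> * f x + g x) \<in> L2_space" by (intro L2_add L2_cmul fL g)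
  ultimately show thesis using that fL unfolding iface_def by blast
qed

lemma iface_bound:
  assumes "\<alpha> \<noteq> 0" "Im \<zeta> \<noteq> 0" "g \<in> L2_space" "iface V \<alpha> \<beta> f (\<lambda>x. \<zeta> * f x + g x)"
  shows "nsq f \<le> nsq g / (Im \<zeta>)\<^sup>2"
  by (rule symmetric_bound[OF _ assms(3,2) iface_symmetric[OF assms(4,1)]]) (use assms(4) in \<open>auto simp: iface_def\<close>)

end

subsection \<open>Cut-off functions\<close>

text \<open>The factor \<open>(1 - x\<^sup>2)\<^sup>2\<close> equals 1 to first order at 0 and has
  double zeros at -1 and 1. So \<open>a + b * x\<close> times this factor has the prescribed data at
  0 and continues by zero with matching value and slope.\<close>

lemma cutoff_exists:
  fixes a b :: complex
  obtains \<psi> \<psi>1 \<psi>2 where "H2 \<psi> \<psi>1 \<psi>2" "\<psi> 0 = a" "\<psi>1 0 = b" "\<And>x. \<bar>x\<bar> > 1 \<Longrightarrow> \<psi> x = 0 \<and> \<psi>2 x = 0"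
    "\<And>x. norm (\<psi> x) \<le> norm a + norm b" "\<And>x. norm (\<psi>2 x) \<le> 16 * (norm a + norm b)"
proof -
  define p where "p x = (a + b * of_real x) * of_real ((1 - x\<^sup>2)\<^sup>2)" for x :: real
  define p1 where "p1 x = b * of_real ((1 - x\<^sup>2)\<^sup>2) + (a + b * of_real x) * of_real (- 4 * x * (1 - x\<^sup>2))" for x :: real
  define p2 where "p2 x = 2 * b * of_real (- 4 * x * (1 - x\<^sup>2)) + (a + b * of_real x) * of_real (12 * x\<^sup>2 - 4)" for x :: real
  have d0: "((\<lambda>z. (a + b * z) * (1 - z\<^sup>2)\<^sup>2) has_field_derivative (b * (1 - z\<^sup>2)\<^sup>2 + (a + b * z) * (- 4 * z * (1 - z\<^sup>2)))) (at z)" for z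
    by (auto intro!: derivative_eq_intros simp: algebra_simps power2_eq_square)
  have d1: "((\<lambda>z. b * (1 - z\<^sup>2)\<^sup>2 + (a + b * z) * (- 4 * z * (1 - z\<^sup>2))) has_field_derivative
     (2 * b * (- 4 * z * (1 - z\<^sup>2)) + (a + b * z) * (12 * z\<^sup>2 - 4))) (at z)" for z
    by (auto intro!: derivative_eq_intros simp: algebra_simps power2_eq_square)
  have "(p has_vector_derivative p1 x) (at x)" for x
    using has_vector_derivative_real_field[OF d0[of "of_real x"]] unfolding p_def[abs_def] p1_def by simp
  moreover have v1: "(p1 has_vector_derivative p2 x) (at x)" for x
    using has_vector_derivative_real_field[OF d1[of "of_real x"]] unfolding p1_def[abs_def] p2_def by simp
  moreover have "continuous_on UNIV p1" "continuous_on UNIV p2"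
    unfolding p1_def[abs_def] p2_def[abs_def] by (intro continuous_intros)+
  ultimately have H: "H2 p p1 p2" unfolding H2_def by (intro conjI is_primitive_C1)
  have H0: "H2 (\<lambda>_. 0) (\<lambda>_. 0) (\<lambda>_. 0)" using H2_affine_fun[of 0 0] by simp
  have "H2 (\<lambda>x. if x < 1 then p x else 0) (\<lambda>x. if x < 1 then p1 x else 0) (\<lambda>x. if x < 1 then p2 x else 0)"
    by (rule H2_glue[OF H H0]) (auto simp: p_def p1_def)
  then have HH: "H2 (\<lambda>x. if x < -1 then 0 else if x < 1 then p x else 0)
     (\<lambda>x. if x < -1 then 0 else if x < 1 then p1 x else 0) (\<lambda>x. if x < -1 then 0 else if x < 1 then p2 x else 0)"
    by (intro H2_glue[OF H0]) (auto simp: p_def p1_def)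
  have lin: "norm (a + b * of_real x) \<le> norm a + norm b" if "\<bar>x\<bar> \<le> 1" for x :: real
  proof -
    have "norm (a + b * of_real x) \<le> norm a + norm b * \<bar>x\<bar>" using norm_triangle_ineq[of a "b * of_real x"] by (simp add: norm_mult)
    also have "\<dots> \<le> norm a + norm b" using that by (simp add: mult_left_le)
    finally show ?thesis .
  qed
  have sq: "0 \<le> 1 - x\<^sup>2 \<and> 1 - x\<^sup>2 \<le> 1" if "\<bar>x\<bar> \<le> 1" for x :: real using that by (simp add: abs_square_le_1)
  have np: "norm (p x) \<le> norm a + norm b" if x: "\<bar>x\<bar> \<le> 1" for x
  proof -
    have "norm (p x) = norm (a + b * of_real x) * (1 - x\<^sup>2)\<^sup>2" unfolding p_def norm_mult norm_of_real by simp
    also have "\<dots> \<le> (norm a + norm b) * 1" using lin[OF x] sq[OF x] by (intro mult_mono power_le_one) auto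
    finally show ?thesis by simp
  qed
  \<comment> \<open>The constant 16 comes from the two terms of \<open>p2\<close>, bounded by
    \<open>8 * norm b\<close> and \<open>8 * (norm a + norm b)\<close>.\<close>
  have np2: "norm (p2 x) \<le> 16 * (norm a + norm b)" if x: "\<bar>x\<bar> \<le> 1" for x
  proof -
    have "\<bar>- 4 * x * (1 - x\<^sup>2)\<bar> \<le> 4 * 1 * 1" unfolding abs_mult using sq[OF x] x by (intro mult_mono) auto
    then have "norm (2 * b * of_real (- 4 * x * (1 - x\<^sup>2))) \<le> (2 * norm b) * 4" unfolding norm_mult norm_of_real by (intro mult_mono) auto
    moreover have "\<bar>12 * x\<^sup>2 - 4\<bar> \<le> 8" using sq[OF x] zero_le_power2[of x] unfolding abs_le_iff by linarith
    then have "norm ((a + b * of_real x) * of_real (12 * x\<^sup>2 - 4)) \<le> (norm a + norm b) * 8"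
      unfolding norm_mult norm_of_real using lin[OF x] by (intro mult_mono) auto
    ultimately have "norm (p2 x) \<le> (2 * norm b) * 4 + (norm a + norm b) * 8"
      unfolding p2_def by (intro norm_triangle_le add_mono)
    then show ?thesis by (simp add: algebra_simps) (use norm_ge_zero[of a] in linarith)
  qed
  show thesis
    by (rule that[OF HH]) (use np np2 in \<open>auto simp: p_def p1_def abs_le_iff\<close>)
qed

lemma bounded_support_L2:
  fixes h :: "real \<Rightarrow> complex"
  assumes m: "h \<in> borel_measurable lebesgue" and b: "AE x in lebesgue. norm (h x) \<le> (if \<bar>x\<bar> \<le> N then B else 0)" and N: "N \<ge> 0"
  shows "h \<in> L2_space" "nsq h \<le> 2 * N * B\<^sup>2"
proof -
  have "integrable lebesgue (indicat_real {-N..N})"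
    using lmeasurable_cbox[of "-N" N] by (simp add: lmeasurable_iff_integrable)
  then have i: "integrable lebesgue (\<lambda>x. indicat_real {-N..N} x * B\<^sup>2)" by simp
  have "AE x in lebesgue. (norm (h x))\<^sup>2 \<le> indicat_real {-N..N} x * B\<^sup>2"
    using b
  proof eventually_elim
    case (elim x)
    then show ?case using power_mono[OF elim, of 2] by (auto simp: indicator_def abs_le_iff split: if_splits)
  qed
  note L = L2_bound[OF m i this]
  show "h \<in> L2_space" by (rule L(1))
  have "(LINT x|lebesgue. indicat_real {-N..N} x * B\<^sup>2) = measure lebesgue {-N..N} * B\<^sup>2" by simp
  also have "measure lebesgue {-N..N} = 2 * N" using N by simp
  finally have "(LINT x|lebesgue. indicat_real {-N..N} x * B\<^sup>2) = 2 * N * B\<^sup>2" .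
  then show "nsq h \<le> 2 * N * B\<^sup>2" using L(2) by (simp only:)
qed

lemma L2_glue:
  fixes u v :: "real \<Rightarrow> complex"
  assumes u: "u \<in> L2_space" and v: "v \<in> L2_space"
  shows "(\<lambda>x. if x < m then u x else v x) \<in> L2_space"
proof (rule L2_bound(1))
  show "(\<lambda>x. if x < m then u x else v x) \<in> borel_measurable lebesgue"
    using L2_spaceD(1)[OF u] L2_spaceD(1)[OF v] by (intro measurable_If) auto
  show "integrable lebesgue (\<lambda>x. (norm (u x))\<^sup>2 + (norm (v x))\<^sup>2)" using L2_spaceD(2)[OF u] L2_spaceD(2)[OF v] by auto
qed auto

lemma AE_lebesgue_neq: "AE x in lebesgue. x \<noteq> (a::real)"
  unfolding AE_lebesgue_negligible by (intro exI[of _ "{a}"]) auto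

lemma nsq_zero_AE:
  fixes f :: "real \<Rightarrow> complex"
  assumes "f \<in> L2_space" "nsq f \<le> 0"
  shows "AE x in lebesgue. f x = 0"
proof -
  have "(LINT x|lebesgue. (norm (f x))\<^sup>2) = 0" using assms(2) nsq_nonneg[of f] unfolding nsq_def by simp
  then have "AE x in lebesgue. (norm (f x))\<^sup>2 = 0"
    using integral_nonneg_eq_0_iff_AE[OF L2_spaceD(2)[OF assms(1)]] by simp
  then show ?thesis by eventually_elim simp
qed

subsection \<open>The domain of the point interaction\<close>

lemma iface_cong_AE:
  assumes "iface V \<alpha> \<beta> f G" "AE x in lebesgue. G x = G' x"
  shows "iface V \<alpha> \<beta> f G'"
proof -
  obtain fm fm1 km fp fp1 kp where P: "iparts V \<alpha> \<beta> f G fm fm1 km fp fp1 kp" using assms(1) unfolding iface_def by blast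
  have "AE x in lebesgue. x < 0 \<longrightarrow> km x = complex_of_real (V x) * fm x - G' x"
    "AE x in lebesgue. x > 0 \<longrightarrow> kp x = complex_of_real (V x) * fp x - G' x"
    using P assms(2) unfolding iparts_def by (auto elim: eventually_elim2)
  then have "iparts V \<alpha> \<beta> f G' fm fm1 km fp fp1 kp" using P unfolding iparts_def by auto
  then show ?thesis using assms L2_cong_AE(1) unfolding iface_def by blast
qed

lemma iface_diff:
  assumes "iface V \<alpha> \<beta> f G" "iface V \<alpha> \<beta> h K"
  shows "iface V \<alpha> \<beta> (\<lambda>x. f x - h x) (\<lambda>x. G x - K x)"
proof -
  obtain fm fm1 km fp fp1 kp where P: "iparts V \<alpha> \<beta> f G fm fm1 km fp fp1 kp" using assms(1) unfolding iface_def by blast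
  obtain hm hm1 lm hp hp1 lp where R: "iparts V \<alpha> \<beta> h K hm hm1 lm hp hp1 lp" using assms(2) unfolding iface_def by blast
  have m: "AE x in lebesgue. x < 0 \<longrightarrow> km x - lm x = complex_of_real (V x) * (fm x - hm x) - (G x - K x)"
  proof -
    have "AE x in lebesgue. x < 0 \<longrightarrow> km x = complex_of_real (V x) * fm x - G x" "AE x in lebesgue. x < 0 \<longrightarrow> lm x = complex_of_real (V x) * hm x - K x"
      using P R unfolding iparts_def by auto
    then show ?thesis
    proof eventually_elim
      case (elim x)
      show ?case
      proof
        assume "x < 0"
        then have "km x = complex_of_real (V x) * fm x - G x" "lm x = complex_of_real (V x) * hm x - K x" using elim by auto
        then show "km x - lm x = complex_of_real (V x) * (fm x - hm x) - (G x - K x)" by (simp only:) (simp add: algebra_simps)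
      qed
    qed
  qed
  have p: "AE x in lebesgue. x > 0 \<longrightarrow> kp x - lp x = complex_of_real (V x) * (fp x - hp x) - (G x - K x)"
  proof -
    have "AE x in lebesgue. x > 0 \<longrightarrow> kp x = complex_of_real (V x) * fp x - G x" "AE x in lebesgue. x > 0 \<longrightarrow> lp x = complex_of_real (V x) * hp x - K x"
      using P R unfolding iparts_def by auto
    then show ?thesis
    proof eventually_elim
      case (elim x)
      show ?case
      proof
        assume "x > 0"
        then have "kp x = complex_of_real (V x) * fp x - G x" "lp x = complex_of_real (V x) * hp x - K x" using elim by auto
        then show "kp x - lp x = complex_of_real (V x) * (fp x - hp x) - (G x - K x)" by (simp only:) (simp add: algebra_simps)
      qed
    qed
  qed
  have "iparts V \<alpha> \<beta> (\<lambda>x. f x - h x) (\<lambda>x. G x - K x) (\<lambda>x. fm x - hm x) (\<lambda>x. fm1 x - hm1 x) (\<lambda>x. km x - lm x)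
    (\<lambda>x. fp x - hp x) (\<lambda>x. fp1 x - hp1 x) (\<lambda>x. kp x - lp x)"
    using P R m p unfolding iparts_def by (auto intro!: H2_diff simp: algebra_simps)
  then show ?thesis using assms L2_diff(1) unfolding iface_def by blast
qed

lemma deriv1_cong:
  assumes "open S" "x \<in> S" "\<And>y. y \<in> S \<Longrightarrow> f y = g y"
  shows "deriv1 f x = deriv1 g x"
proof (rule vector_derivative_cong_eq)
  show "\<forall>\<^sub>F y in nhds x. y \<in> UNIV \<longrightarrow> f y = g y"
    using assms eventually_nhds_in_open[OF assms(1,2)] by (auto elim: eventually_mono)
qed auto

lemma schroedinger_expr_cong:
  assumes "open S" "x \<in> S" "\<And>y. y \<in> S \<Longrightarrow> f y = g y"
  shows "schroedinger_expr V f x = schroedinger_expr V g x"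
proof -
  have "deriv1 f y = deriv1 g y" if "y \<in> S" for y by (rule deriv1_cong[OF assms(1) that assms(3)])
  then have "deriv1 (deriv1 f) x = deriv1 (deriv1 g) x" by (rule deriv1_cong[OF assms(1,2)])
  then show ?thesis using assms unfolding schroedinger_expr_def by simp
qed

lemma S0_domain_AE:
  assumes "f \<in> S0_domain V"
  shows "deriv1 (deriv1 f) x = complex_of_real (V x) * f x - schroedinger_expr V f x"
  unfolding schroedinger_expr_def by simp

lemma Lim_at_right_eq:
  fixes f g :: "real \<Rightarrow> complex"
  assumes "isCont g a" "\<And>x. x > a \<Longrightarrow> f x = g x"
  shows "Lim (at_right a) f = g a"
proof (rule tendsto_Lim)
  have "(g \<longlongrightarrow> g a) (at_right a)" using assms(1) unfolding isCont_def by (rule filterlim_mono) (auto simp: at_within_le_at)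
  then show "(f \<longlongrightarrow> g a) (at_right a)"
    by (rule Lim_transform_eventually) (auto simp: eventually_at_filter assms(2))
qed simp

lemma Lim_at_left_eq:
  fixes f g :: "real \<Rightarrow> complex"
  assumes "isCont g a" "\<And>x. x < a \<Longrightarrow> f x = g x"
  shows "Lim (at_left a) f = g a"
proof (rule tendsto_Lim)
  have "(g \<longlongrightarrow> g a) (at_left a)" using assms(1) unfolding isCont_def by (rule filterlim_mono) (auto simp: at_within_le_at)
  then show "(f \<longlongrightarrow> g a) (at_left a)"
    by (rule Lim_transform_eventually) (auto simp: eventually_at_filter assms(2))
qed simp

lemma Lim_one_sided:
  assumes fm: "H2 fm fm1 km" and fp: "H2 fp fp1 kp" and f: "\<And>x. x < 0 \<Longrightarrow> f x = fm x" "\<And>x. x > 0 \<Longrightarrow> f x = fp x"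
  shows "Lim (at_left 0) f = fm 0" "Lim (at_right 0) f = fp 0"
    "Lim (at_left 0) (deriv1 f) = fm1 0" "Lim (at_right 0) (deriv1 f) = fp1 0"
proof -
  have c: "isCont fm 0" "isCont fm1 0" "isCont fp 0" "isCont fp1 0"
    using H2_continuous[OF fm, of UNIV] H2_continuous[OF fp, of UNIV] by (auto simp: continuous_on_eq_continuous_at)
  have dm: "deriv1 f x = fm1 x" if "x < 0" for x
    using deriv1_cong[of "{..<0}" x f fm] that f H2_deriv1[OF fm] by auto
  have dp: "deriv1 f x = fp1 x" if "x > 0" for x
    using deriv1_cong[of "{0<..}" x f fp] that f H2_deriv1[OF fp] by auto
  show "Lim (at_left 0) f = fm 0" "Lim (at_right 0) f = fp 0"
    "Lim (at_left 0) (deriv1 f) = fm1 0" "Lim (at_right 0) (deriv1 f) = fp1 0"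
    by (intro Lim_at_left_eq Lim_at_right_eq c f dm dp; assumption)+
qed

lemma S_point_domain_iface:
  assumes "f \<in> domain (S_point V \<alpha> \<beta>)"
  shows "iface V \<alpha> \<beta> f (schroedinger_expr V f)"
proof -
  obtain f1 f2 where f: "f \<in> L2_space" "f1 \<in> S0_domain V" "f2 \<in> S0_domain V" "\<And>x. x < 0 \<Longrightarrow> f x = f1 x" "\<And>x. x > 0 \<Longrightarrow> f x = f2 x"
    and bc: "Lim (at_right 0) f = complex_of_real \<alpha> * Lim (at_left 0) f + complex_of_real \<beta> * Lim (at_left 0) (deriv1 f)"
      "Lim (at_right 0) (deriv1 f) = complex_of_real (inverse \<alpha>) * Lim (at_left 0) (deriv1 f)"
    using assms unfolding S_point_def V_space_def S0_def by auto
  note D1 = S0_domainD[OF f(2)] and D2 = S0_domainD[OF f(3)]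
  have em: "schroedinger_expr V f x = schroedinger_expr V f1 x" if "x < 0" for x
    by (rule schroedinger_expr_cong[of "{..<0}"]) (use that f in auto)
  have ep: "schroedinger_expr V f x = schroedinger_expr V f2 x" if "x > 0" for x
    by (rule schroedinger_expr_cong[of "{0<..}"]) (use that f in auto)
  have "AE x in lebesgue. (if x < 0 then schroedinger_expr V f1 x else schroedinger_expr V f2 x) = schroedinger_expr V f x"
    using AE_lebesgue_neq[of 0] by eventually_elim (auto simp: em ep)
  then have G: "schroedinger_expr V f \<in> L2_space"
    by (rule L2_cong_AE(1)[OF L2_glue[OF D1(3) D2(3)]])
  have "iparts V \<alpha> \<beta> f (schroedinger_expr V f) f1 (deriv1 f1) (deriv1 (deriv1 f1)) f2 (deriv1 f2) (deriv1 (deriv1 f2))"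
    using D1(2) D2(2) f(4,5) bc em ep Lim_one_sided[OF D1(2) D2(2) f(4,5)]
    unfolding iparts_def by (auto simp: S0_domain_AE[OF f(2)] S0_domain_AE[OF f(3)])
  then show ?thesis using f(1) G unfolding iface_def by blast
qed

context potential
begin

lemma S0_domain_iface:
  assumes "f \<in> S0_domain V"
  shows "iface V 1 0 f (schroedinger_expr V f)"
proof -
  have "iparts V 1 0 f (schroedinger_expr V f) f (deriv1 f) (deriv1 (deriv1 f)) f (deriv1 f) (deriv1 (deriv1 f))"
    using S0_domainD[OF assms] unfolding iparts_def by (auto simp: S0_domain_AE[OF assms])
  then show ?thesis using S0_domainD[OF assms] unfolding iface_def by blast
qed

lemma cutoff_L2:
  assumes H: "H2 \<psi> \<psi>1 \<psi>2" and s: "\<And>x. \<bar>x\<bar> > N \<Longrightarrow> \<psi> x = 0 \<and> \<psi>2 x = 0" and b: "\<And>x. norm (\<psi> x) \<le> B" "\<And>x. norm (\<psi>2 x) \<le> B" and N: "N \<ge> 0"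
  shows "\<psi> \<in> L2_space" "(\<lambda>x. complex_of_real (V x) * \<psi> x - \<psi>2 x) \<in> L2_space"
proof -
  have m: "\<psi> \<in> borel_measurable lebesgue" "\<psi>2 \<in> borel_measurable lebesgue"
    using continuous_borel_measurable_lebesgue[OF H2_continuous(1)[OF H]] is_primitive_measurable H unfolding H2_def by auto
  show "\<psi> \<in> L2_space"
    by (rule bounded_support_L2(1)[OF m(1) _ N, of B]) (use s b in \<open>auto simp: not_le\<close>)
  obtain K where K: "K \<ge> 0" "\<And>x. \<bar>x\<bar> \<le> N \<Longrightarrow> \<bar>V x\<bar> \<le> K" using V_locb by blast
  show "(\<lambda>x. complex_of_real (V x) * \<psi> x - \<psi>2 x) \<in> L2_space"
  proof (rule bounded_support_L2(1)[OF _ AE_I2 N])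
    show "(\<lambda>x. complex_of_real (V x) * \<psi> x - \<psi>2 x) \<in> borel_measurable lebesgue" using V_meas m by measurable
    fix x
    show "norm (complex_of_real (V x) * \<psi> x - \<psi>2 x) \<le> (if \<bar>x\<bar> \<le> N then K * B + B else 0)"
    proof (cases "\<bar>x\<bar> \<le> N")
      case True
      have "norm (complex_of_real (V x) * \<psi> x) \<le> K * B" unfolding norm_mult norm_of_real using K True b by (intro mult_mono) auto
      then show ?thesis using True norm_triangle_ineq4[of "complex_of_real (V x) * \<psi> x" "\<psi>2 x"] b(2)[of x] by simp
    next
      case False then show ?thesis using s[of x] by simp
    qed
  qed
qed

text \<open>Beyond its own half-line \<open>fm\<close> may grow, whereas \<open>V_space\<close> asks
  for elements of the domain of \<open>S0\<close>. There it is replaced by a cut-off with the same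
  data at 0.\<close>

lemma extend_to_S0_domain:
  assumes H: "H2 fm fm1 km" and f: "f \<in> L2_space" "\<And>x. x < 0 \<Longrightarrow> f x = fm x" and G: "G \<in> L2_space"
    and k: "AE x in lebesgue. x < 0 \<longrightarrow> km x = complex_of_real (V x) * fm x - G x"
  obtains h where "h \<in> S0_domain V" "\<And>x. x < 0 \<Longrightarrow> h x = fm x"
proof -
  obtain \<psi> \<psi>1 \<psi>2 where \<psi>: "H2 \<psi> \<psi>1 \<psi>2" "\<psi> 0 = fm 0" "\<psi>1 0 = fm1 0" "\<And>x. \<bar>x\<bar> > 1 \<Longrightarrow> \<psi> x = 0 \<and> \<psi>2 x = 0"
    "\<And>x. norm (\<psi> x) \<le> norm (fm 0) + norm (fm1 0)" "\<And>x. norm (\<psi>2 x) \<le> 16 * (norm (fm 0) + norm (fm1 0))"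
    using cutoff_exists by blast
  have b1: "norm (\<psi> x) \<le> 16 * (norm (fm 0) + norm (fm1 0))" for x
  proof -
    have "1 * (norm (fm 0) + norm (fm1 0)) \<le> 16 * (norm (fm 0) + norm (fm1 0))" by (intro mult_right_mono) auto
    then show ?thesis using order_trans[OF \<psi>(5)[of x]] by simp
  qed
  note L = cutoff_L2[OF \<psi>(1,4) b1 \<psi>(6) zero_le_one]
  define h where "h x = (if x < 0 then fm x else \<psi> x)" for x
  have Hh: "H2 h (\<lambda>x. if x < 0 then fm1 x else \<psi>1 x) (\<lambda>x. if x < 0 then km x else \<psi>2 x)"
    unfolding h_def[abs_def] by (rule H2_glue[OF H \<psi>(1)]) (use \<psi> in auto)
  have "h = (\<lambda>x. if x < 0 then f x else \<psi> x)" unfolding h_def using f by auto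
  then have hL: "h \<in> L2_space" using L2_glue[OF f(1) L(1)] by simp
  have "(\<lambda>x. complex_of_real (V x) * h x - (if x < 0 then km x else \<psi>2 x)) \<in> L2_space"
  proof (rule L2_cong_AE(1)[OF L2_glue[OF G L(2)]])
    show "AE x in lebesgue. (if x < 0 then G x else complex_of_real (V x) * \<psi> x - \<psi>2 x) = complex_of_real (V x) * h x - (if x < 0 then km x else \<psi>2 x)"
      using k by eventually_elim (auto simp: h_def)
  qed simp_all
  then have "h \<in> S0_domain V" by (rule H2_S0_domain[OF hL Hh])
  then show thesis using that unfolding h_def by auto
qed

end

lemma S0_domain_reflect:
  assumes "h \<in> S0_domain (\<lambda>x. V (-x))"
  shows "(\<lambda>x. h (-x)) \<in> S0_domain V"
proof -
  note D = S0_domainD[OF assms]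
  have "(\<lambda>x. complex_of_real (V x) * h (-x) - deriv1 (deriv1 h) (-x)) \<in> L2_space"
    using L2_reflect[OF D(3)] by (simp add: S0_domain_AE[OF assms])
  then show ?thesis by (rule H2_S0_domain[OF L2_reflect[OF D(1)] H2_reflect[OF D(2)]])
qed

context potential
begin

lemma potential_reflect: "potential (\<lambda>x. V (-x)) c"
proof
  have "(\<lambda>x. - x) \<in> lebesgue \<rightarrow>\<^sub>M (lebesgue :: real measure)"
    using lebesgue_affine_measurable[where c="\<lambda>_::real. -1" and t=0] by simp
  then show "(\<lambda>x. V (-x)) \<in> borel_measurable lebesgue" using measurable_compose V_meas by blast
  show "\<exists>K\<ge>0. \<forall>x. \<bar>x\<bar> \<le> N \<longrightarrow> \<bar>V (- x)\<bar> \<le> K" for N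
  proof -
    obtain K where K: "K \<ge> 0" "\<And>x. \<bar>x\<bar> \<le> N \<Longrightarrow> \<bar>V x\<bar> \<le> K" using V_locb[of N] by blast
    show ?thesis by (intro exI[of _ K] conjI K(1) allI impI K(2)) simp
  qed
qed (auto simp: V_ge c_nonneg)

lemma iface_S_point_domain:
  assumes I: "iface V \<alpha> \<beta> f G"
  shows "f \<in> domain (S_point V \<alpha> \<beta>)" "AE x in lebesgue. schroedinger_expr V f x = G x"
proof -
  obtain fm fm1 km fp fp1 kp where P: "iparts V \<alpha> \<beta> f G fm fm1 km fp fp1 kp" using I unfolding iface_def by blast
  have f: "f \<in> L2_space" and G: "G \<in> L2_space" using I unfolding iface_def by auto
  have Hm: "H2 fm fm1 km" and Hp: "H2 fp fp1 kp" and fm: "\<And>x. x < 0 \<Longrightarrow> f x = fm x" and fp: "\<And>x. x > 0 \<Longrightarrow> f x = fp x"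
    and km: "AE x in lebesgue. x < 0 \<longrightarrow> km x = complex_of_real (V x) * fm x - G x"
    and kp: "AE x in lebesgue. x > 0 \<longrightarrow> kp x = complex_of_real (V x) * fp x - G x"
    using P unfolding iparts_def by auto
  obtain h1 where h1: "h1 \<in> S0_domain V" "\<And>x. x < 0 \<Longrightarrow> h1 x = fm x"
    using extend_to_S0_domain[OF Hm f fm G km] by blast
  \<comment> \<open>The right half-line is the left half-line for the reflected potential.\<close>
  interpret R: potential "\<lambda>x. V (-x)" c by (rule potential_reflect)
  have kp': "AE x in lebesgue. x < 0 \<longrightarrow> kp (-x) = complex_of_real (V (-x)) * fp (-x) - G (-x)"
    using AE_lebesgue_reflect[OF kp] by simp
  obtain h2 where h2: "h2 \<in> S0_domain (\<lambda>x. V (-x))" "\<And>x. x < 0 \<Longrightarrow> h2 x = fp (-x)"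
    using R.extend_to_S0_domain[OF H2_reflect[OF Hp] L2_reflect[OF f] _ L2_reflect[OF G] kp'] fp by auto
  have V: "f \<in> V_space V"
  proof -
    have m: "\<forall>x<0. f x = h1 x" using fm h1(2) by simp
    have p: "\<forall>x>0. f x = h2 (-x)" using fp h2(2) by simp
    have d: "h1 \<in> domain (S0 V)" "(\<lambda>x. h2 (-x)) \<in> domain (S0 V)"
      using h1(1) S0_domain_reflect[OF h2(1)] unfolding S0_def by simp_all
    show ?thesis unfolding V_space_def
      by (rule CollectI, rule conjI[OF f], rule bexI[OF _ d(1)], rule bexI[OF _ d(2)], rule conjI[OF m p])
  qed
  have "Lim (at_right 0) f = complex_of_real \<alpha> * Lim (at_left 0) f + complex_of_real \<beta> * Lim (at_left 0) (deriv1 f)"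
      "Lim (at_right 0) (deriv1 f) = complex_of_real (inverse \<alpha>) * Lim (at_left 0) (deriv1 f)"
    using Lim_one_sided[OF Hm Hp fm fp] P unfolding iparts_def by auto
  with V show "f \<in> domain (S_point V \<alpha> \<beta>)" unfolding S_point_def by simp
  have em: "schroedinger_expr V f x = schroedinger_expr V fm x" if "x < 0" for x
    by (rule schroedinger_expr_cong[of "{..<0}"]) (use that fm in auto)
  have ep: "schroedinger_expr V f x = schroedinger_expr V fp x" if "x > 0" for x
    by (rule schroedinger_expr_cong[of "{0<..}"]) (use that fp in auto)
  show "AE x in lebesgue. schroedinger_expr V f x = G x"
    using AE_lebesgue_neq[of 0] H2_schroedinger_expr[OF Hm, of V] H2_schroedinger_expr[OF Hp, of V] km kp
  proof eventually_elim
    case (elim x) then show ?case using em[of x] ep[of x] by (cases "x < 0") auto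
  qed
qed

lemma action_S_point: "action (S_point V \<alpha> \<beta>) = schroedinger_expr V"
  unfolding S_point_def by simp

lemma S_point_resolvent_iff:
  assumes "f \<in> domain (S_point V \<alpha> \<beta>)" "AE x in lebesgue. shifted (S_point V \<alpha> \<beta>) \<zeta> f x = g x"
  shows "iface V \<alpha> \<beta> f (\<lambda>x. \<zeta> * f x + g x)"
proof (rule iface_cong_AE[OF S_point_domain_iface[OF assms(1)]])
  show "AE x in lebesgue. schroedinger_expr V f x = \<zeta> * f x + g x"
    using assms(2) by eventually_elim (simp add: shifted_def action_S_point algebra_simps)
qed

lemma S_point_solution_exists:
  assumes "\<alpha> \<noteq> 0" "Im \<zeta> \<noteq> 0" "g \<in> L2_space"
  shows "\<exists>f\<in>domain (S_point V \<alpha> \<beta>). AE x in lebesgue. shifted (S_point V \<alpha> \<beta>) \<zeta> f x = g x"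
proof -
  obtain f where f: "iface V \<alpha> \<beta> f (\<lambda>x. \<zeta> * f x + g x)" using iface_solution_exists[OF assms] by blast
  have "AE x in lebesgue. shifted (S_point V \<alpha> \<beta>) \<zeta> f x = g x"
    using iface_S_point_domain(2)[OF f] by eventually_elim (simp add: shifted_def action_S_point)
  then show ?thesis using iface_S_point_domain(1)[OF f] by blast
qed

lemma S_point_resolvent_set:
  assumes \<alpha>: "\<alpha> \<noteq> 0" and \<zeta>: "Im \<zeta> \<noteq> 0"
  shows "\<zeta> \<in> resolvent_set (S_point V \<alpha> \<beta>)"
  unfolding resolvent_set_def
proof (intro CollectI conjI ballI impI)
  let ?T = "S_point V \<alpha> \<beta>"
  show "\<exists>f\<in>domain ?T. AE x in lebesgue. shifted ?T \<zeta> f x = g x" if "g \<in> L2_space" for g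
    by (rule S_point_solution_exists[OF \<alpha> \<zeta> that])
  have sL: "shifted ?T \<zeta> f \<in> L2_space" if "f \<in> domain ?T" for f
  proof -
    have I: "f \<in> L2_space" "schroedinger_expr V f \<in> L2_space" using S_point_domain_iface[OF that] unfolding iface_def by auto
    show ?thesis unfolding shifted_def action_S_point by (rule L2_diff(1)[OF I(2) L2_cmul(1)[OF I(1)]])
  qed
  show "AE x in lebesgue. f x = h x"
    if "f \<in> domain ?T" "h \<in> domain ?T" "AE x in lebesgue. shifted ?T \<zeta> f x = shifted ?T \<zeta> h x" for f h
  proof -
    have "iface V \<alpha> \<beta> (\<lambda>x. f x - h x) (\<lambda>x. (\<zeta> * f x + shifted ?T \<zeta> h x) - (\<zeta> * h x + shifted ?T \<zeta> h x))"
      by (rule iface_diff[OF S_point_resolvent_iff[OF that(1) that(3)] S_point_resolvent_iff[OF that(2)]]) simp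
    moreover have "(\<lambda>x. (\<zeta> * f x + shifted ?T \<zeta> h x) - (\<zeta> * h x + shifted ?T \<zeta> h x)) = (\<lambda>x. \<zeta> * (f x - h x) + 0)"
      by (rule ext) (simp add: right_diff_distrib)
    ultimately have I: "iface V \<alpha> \<beta> (\<lambda>x. f x - h x) (\<lambda>x. \<zeta> * (f x - h x) + 0)" by (simp only:)
    have z: "(\<lambda>_. 0 :: complex) \<in> L2_space" "nsq (\<lambda>_. 0) = 0" unfolding L2_space_def nsq_def by auto
    have "nsq (\<lambda>x. f x - h x) \<le> 0" using iface_bound[OF \<alpha> \<zeta> z(1) I] z(2) by simp
    then have "AE x in lebesgue. f x - h x = 0" using I nsq_zero_AE unfolding iface_def by blast
    then show ?thesis by eventually_elim simp
  qed
  show "\<exists>C. \<forall>f\<in>domain ?T. L2_norm f \<le> C * L2_norm (shifted ?T \<zeta> f)"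
  proof (intro exI[of _ "1 / \<bar>Im \<zeta>\<bar>"] ballI)
    fix f assume f: "f \<in> domain ?T"
    have "nsq f \<le> nsq (shifted ?T \<zeta> f) / (Im \<zeta>)\<^sup>2"
      by (rule iface_bound[OF \<alpha> \<zeta> sL[OF f] S_point_resolvent_iff[OF f]]) simp
    then have "sqrt (nsq f) \<le> sqrt (nsq (shifted ?T \<zeta> f) / (Im \<zeta>)\<^sup>2)" by (rule real_sqrt_le_mono)
    then show "L2_norm f \<le> 1 / \<bar>Im \<zeta>\<bar> * L2_norm (shifted ?T \<zeta> f)"
      unfolding L2_norm_nsq by (simp add: real_sqrt_divide)
  qed
qed

end

subsection \<open>Perturbed operators\<close>

lemma S0_domain_lincomb:
  assumes "f \<in> S0_domain V" "h \<in> S0_domain V"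
  shows "(\<lambda>x. a * f x + b * h x) \<in> S0_domain V"
    "AE x in lebesgue. schroedinger_expr V (\<lambda>x. a * f x + b * h x) x = a * schroedinger_expr V f x + b * schroedinger_expr V h x"
proof -
  note D = S0_domainD[OF assms(1)] and E = S0_domainD[OF assms(2)]
  have H: "H2 (\<lambda>x. a * f x + b * h x) (\<lambda>x. a * deriv1 f x + b * deriv1 h x) (\<lambda>x. a * deriv1 (deriv1 f) x + b * deriv1 (deriv1 h) x)"
    by (intro H2_add H2_cmul D E)
  have "(\<lambda>x. a * schroedinger_expr V f x + b * schroedinger_expr V h x) \<in> L2_space"
    by (intro L2_add L2_cmul D E)
  also have "(\<lambda>x. a * schroedinger_expr V f x + b * schroedinger_expr V h x) =
     (\<lambda>x. complex_of_real (V x) * (a * f x + b * h x) - (a * deriv1 (deriv1 f) x + b * deriv1 (deriv1 h) x))"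
    unfolding schroedinger_expr_def by (simp add: algebra_simps)
  finally show "(\<lambda>x. a * f x + b * h x) \<in> S0_domain V"
    by (rule H2_S0_domain[OF L2_add(1)[OF L2_cmul(1)[OF D(1)] L2_cmul(1)[OF E(1)]] H])
  show "AE x in lebesgue. schroedinger_expr V (\<lambda>x. a * f x + b * h x) x = a * schroedinger_expr V f x + b * schroedinger_expr V h x"
    using H2_schroedinger_expr[OF H, of V] by eventually_elim (simp add: schroedinger_expr_def algebra_simps)
qed

text \<open>The two parts of the perturbation are treated differently: the bounded multiplication
  \<open>W\<close> is absorbed into the potential, while the rank-two part leads to a linear system
  for two coefficients. Invariance of \<open>u1\<close> and \<open>u2\<close> under
  \<open>cnj\<close> makes the rank-two part symmetric.\<close>

locale perturbed = potential +
  fixes u1 u2 :: "real \<Rightarrow> complex" and t :: real and W :: "real \<Rightarrow> real" and Wb :: real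
  assumes u1: "u1 \<in> L2_space" "\<And>x. cnj (u1 x) = u1 x" and u2: "u2 \<in> L2_space" "\<And>x. cnj (u2 x) = u2 x"
    and W_meas: "W \<in> borel_measurable lebesgue" and W_bound: "\<And>x. \<bar>W x\<bar> \<le> Wb"
begin

definition pert :: "(real \<Rightarrow> complex) \<Rightarrow> real \<Rightarrow> complex" where
  "pert f x = complex_of_real t * (u1 x * (LINT s|lebesgue. u2 s * f s) + u2 x * (LINT s|lebesgue. u1 s * f s))
     + complex_of_real (W x) * f x"

lemma W_L2: "f \<in> L2_space \<Longrightarrow> (\<lambda>x. complex_of_real (W x) * f x) \<in> L2_space"
proof (rule L2_bounded_mult[where B=Wb])
  show "(\<lambda>x. complex_of_real (W x)) \<in> borel_measurable lebesgue" using W_meas by measurable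
qed (use W_bound in auto)

lemma pert_L2: "f \<in> L2_space \<Longrightarrow> pert f \<in> L2_space"
proof -
  assume f: "f \<in> L2_space"
  have "(\<lambda>x. complex_of_real t * ((LINT s|lebesgue. u2 s * f s) * u1 x + (LINT s|lebesgue. u1 s * f s) * u2 x)
     + complex_of_real (W x) * f x) \<in> L2_space"
    by (intro L2_add L2_cmul u1 u2 W_L2 f)
  then show ?thesis unfolding pert_def[abs_def] by (simp add: mult.commute)
qed

text \<open>The rank-two form equals \<open>t\<close> times
  \<open>c2 * cnj c1 + c1 * cnj c2\<close>, a number plus its conjugate, and the form of a real
  multiplication is real.\<close>

lemma pert_symmetric:
  assumes f: "f \<in> L2_space"
  shows "Im (LINT x|lebesgue. pert f x * cnj (f x)) = 0"
proof -
  define c1 c2 where "c1 = (LINT s|lebesgue. u1 s * f s)" and "c2 = (LINT s|lebesgue. u2 s * f s)"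
  have i1: "integrable lebesgue (\<lambda>x. u1 x * cnj (f x))" and i2: "integrable lebesgue (\<lambda>x. u2 x * cnj (f x))"
    by (intro L2_mult_integrable u1 u2 f)+
  have iW: "integrable lebesgue (\<lambda>x. complex_of_real (W x) * f x * cnj (f x))"
    by (intro L2_mult_integrable W_L2 f)
  have d1: "(LINT x|lebesgue. u1 x * cnj (f x)) = cnj c1" 
  proof -
    have "(LINT x|lebesgue. u1 x * cnj (f x)) = (LINT x|lebesgue. cnj (u1 x * f x))" by (simp only: complex_cnj_mult u1)
    also have "\<dots> = cnj c1" unfolding c1_def by (rule Bochner_Integration.integral_cnj)
    finally show ?thesis .
  qed
  have d2: "(LINT x|lebesgue. u2 x * cnj (f x)) = cnj c2" 
  proof -
    have "(LINT x|lebesgue. u2 x * cnj (f x)) = (LINT x|lebesgue. cnj (u2 x * f x))" by (simp only: complex_cnj_mult u2)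
    also have "\<dots> = cnj c2" unfolding c2_def by (rule Bochner_Integration.integral_cnj)
    finally show ?thesis .
  qed
  have "(LINT x|lebesgue. pert f x * cnj (f x)) =
     (LINT x|lebesgue. complex_of_real t * (c2 * (u1 x * cnj (f x)) + c1 * (u2 x * cnj (f x))) + complex_of_real (W x) * f x * cnj (f x))"
    unfolding pert_def c1_def[symmetric] c2_def[symmetric] by (simp add: algebra_simps)
  also have "\<dots> = complex_of_real t * (c2 * cnj c1 + c1 * cnj c2) + (LINT x|lebesgue. complex_of_real (W x) * f x * cnj (f x))"
    using i1 i2 iW by (simp add: d1 d2)
  finally have e: "(LINT x|lebesgue. pert f x * cnj (f x)) = \<dots>" .
  have "Im (LINT x|lebesgue. complex_of_real (W x) * f x * cnj (f x)) = (LINT x|lebesgue. Im (complex_of_real (W x) * f x * cnj (f x)))"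
    by (rule integral_Im[OF iW, symmetric])
  also have "\<dots> = 0" by (simp add: mult.assoc mult.commute)
  finally have "Im (LINT x|lebesgue. complex_of_real (W x) * f x * cnj (f x)) = 0" .
  moreover have "Im (complex_of_real t * (c2 * cnj c1 + c1 * cnj c2)) = 0" by (simp add: algebra_simps)
  ultimately show ?thesis unfolding e by (simp only: plus_complex.sel)
qed

lemma pert_lincomb:
  assumes "f \<in> L2_space" "h \<in> L2_space"
  shows "pert (\<lambda>x. a * f x + b * h x) x = a * pert f x + b * pert h x"
proof -
  have l: "(LINT s|lebesgue. u s * (a * f s + b * h s)) = a * (LINT s|lebesgue. u s * f s) + b * (LINT s|lebesgue. u s * h s)"
    if u: "u \<in> L2_space" for u
  proof -
    have "(LINT s|lebesgue. u s * (a * f s + b * h s)) = (LINT s|lebesgue. a * (u s * f s) + b * (u s * h s))"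
      by (simp add: algebra_simps)
    also have "\<dots> = a * (LINT s|lebesgue. u s * f s) + b * (LINT s|lebesgue. u s * h s)"
      using L2_mult_integrable(2)[OF u assms(1)] L2_mult_integrable(2)[OF u assms(2)] by simp
    finally show ?thesis .
  qed
  show ?thesis unfolding pert_def l[OF u1(1)] l[OF u2(1)] by (simp add: algebra_simps)
qed

definition S_pert :: L2_operator where
  "S_pert = \<lparr>domain = S0_domain V, action = (\<lambda>f x. schroedinger_expr V f x + pert f x)\<rparr>"

lemma S_pert_simps: "domain S_pert = S0_domain V" "shifted S_pert \<zeta> f x = schroedinger_expr V f x + pert f x - \<zeta> * f x"
  unfolding S_pert_def shifted_def by auto

lemma S_pert_bound:
  assumes f: "f \<in> S0_domain V" and g: "g \<in> L2_space" and e: "AE x in lebesgue. shifted S_pert \<zeta> f x = g x" and \<zeta>: "Im \<zeta> \<noteq> 0"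
  shows "nsq f \<le> nsq g / (Im \<zeta>)\<^sup>2"
proof (rule symmetric_bound[OF _ g \<zeta>])
  note D = S0_domainD[OF f]
  show "f \<in> L2_space" by (rule D)
  have i: "integrable lebesgue (\<lambda>x. schroedinger_expr V f x * cnj (f x))" "integrable lebesgue (\<lambda>x. pert f x * cnj (f x))"
    by (intro L2_mult_integrable D pert_L2)+
  have "(\<lambda>x. \<zeta> * f x + g x) \<in> L2_space" by (intro L2_add L2_cmul D g)
  then have m: "(\<lambda>x. (\<zeta> * f x + g x) * cnj (f x)) \<in> borel_measurable lebesgue"
    using L2_mult_integrable(3) D(1) borel_measurable_integrable by blast
  have "(LINT x|lebesgue. (\<zeta> * f x + g x) * cnj (f x)) = (LINT x|lebesgue. schroedinger_expr V f x * cnj (f x) + pert f x * cnj (f x))"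
  proof (rule integral_cong_AE[OF m])
    show "(\<lambda>x. schroedinger_expr V f x * cnj (f x) + pert f x * cnj (f x)) \<in> borel_measurable lebesgue" using i by auto
    show "AE x in lebesgue. (\<zeta> * f x + g x) * cnj (f x) = schroedinger_expr V f x * cnj (f x) + pert f x * cnj (f x)"
      using e
    proof eventually_elim
      case (elim x)
      then have "g x = schroedinger_expr V f x + pert f x - \<zeta> * f x" by (simp add: S_pert_simps)
      then show ?case by (simp only:) (simp add: algebra_simps)
    qed
  qed
  also have "\<dots> = (LINT x|lebesgue. schroedinger_expr V f x * cnj (f x)) + (LINT x|lebesgue. pert f x * cnj (f x))"
    using i by simp
  finally show "Im (LINT x|lebesgue. (\<zeta> * f x + g x) * cnj (f x)) = 0"
    using iface_symmetric[OF S0_domain_iface[OF f]] pert_symmetric[OF D(1)] by simp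
qed

lemma potential_sum: "potential (\<lambda>x. V x + W x) (c + Wb)"
proof
  show "(\<lambda>x. V x + W x) \<in> borel_measurable lebesgue" using V_meas W_meas by measurable
  show "\<exists>K\<ge>0. \<forall>x. \<bar>x\<bar> \<le> N \<longrightarrow> \<bar>V x + W x\<bar> \<le> K" for N
  proof -
    obtain K where K: "K \<ge> 0" "\<And>x. \<bar>x\<bar> \<le> N \<Longrightarrow> \<bar>V x\<bar> \<le> K" using V_locb[of N] by blast
    have "\<bar>V x + W x\<bar> \<le> K + Wb" if "\<bar>x\<bar> \<le> N" for x using K(2)[OF that] W_bound[of x] by linarith
    moreover have "K + Wb \<ge> 0" using K(1) W_bound[of 0] by linarith
    ultimately show ?thesis by blast
  qed
  show "- (c + Wb) \<le> V x + W x" for x using V_ge[of x] W_bound[of x] by linarith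
  show "0 \<le> c + Wb" using c_nonneg W_bound[of 0] by linarith
qed

text \<open>For \<open>\<alpha> = 1\<close> and \<open>\<beta> = 0\<close> the interface conditions
  say that value and slope agree at 0, so the two halves glue to one element of the domain.\<close>

lemma multiplication_solution_exists:
  assumes \<zeta>: "Im \<zeta> \<noteq> 0" and g: "g \<in> L2_space"
  obtains f where "f \<in> S0_domain V" "AE x in lebesgue. schroedinger_expr V f x + complex_of_real (W x) * f x - \<zeta> * f x = g x"
proof -
  interpret P: potential "\<lambda>x. V x + W x" "c + Wb" by (rule potential_sum)
  obtain f where I: "iface (\<lambda>x. V x + W x) 1 0 f (\<lambda>x. \<zeta> * f x + g x)"
    using P.iface_solution_exists[of 1 \<zeta> g 0] \<zeta> g by auto
  obtain fm fm1 km fp fp1 kp where Q: "iparts (\<lambda>x. V x + W x) 1 0 f (\<lambda>x. \<zeta> * f x + g x) fm fm1 km fp fp1 kp"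
    using I unfolding iface_def by blast
  define h where "h x = (if x < 0 then fm x else fp x)" for x
  define k where "k x = (if x < 0 then km x else kp x)" for x
  have H: "H2 h (\<lambda>x. if x < 0 then fm1 x else fp1 x) k"
    unfolding h_def[abs_def] k_def[abs_def] using Q unfolding iparts_def by (intro H2_glue) auto
  have hf: "h x = f x" if "x \<noteq> 0" for x using Q that unfolding iparts_def h_def by auto
  have hfA: "AE x in lebesgue. f x = h x" using AE_lebesgue_neq[of 0] by eventually_elim (simp add: hf)
  have fL: "f \<in> L2_space" using I unfolding iface_def by auto
  have hL: "h \<in> L2_space" by (rule L2_cong_AE(1)[OF fL hfA])
  have eq: "AE x in lebesgue. \<zeta> * h x + g x - complex_of_real (W x) * h x = complex_of_real (V x) * h x - k x"
  proof -
    have "AE x in lebesgue. x < 0 \<longrightarrow> km x = complex_of_real (V x + W x) * fm x - (\<zeta> * f x + g x)"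
      "AE x in lebesgue. x > 0 \<longrightarrow> kp x = complex_of_real (V x + W x) * fp x - (\<zeta> * f x + g x)"
      using Q unfolding iparts_def by auto
    with AE_lebesgue_neq[of 0] show ?thesis
    proof eventually_elim
      case (elim x)
      have "k x = complex_of_real (V x + W x) * h x - (\<zeta> * h x + g x)"
        using elim hf[of x] unfolding k_def h_def by (cases "x < 0") auto
      then show ?case by (simp add: algebra_simps)
    qed
  qed
  have "(\<lambda>x. complex_of_real (V x) * h x - k x) \<in> L2_space"
    by (rule L2_cong_AE(1)[OF _ eq]) (intro L2_diff L2_add L2_cmul W_L2 hL g)
  then have hS: "h \<in> S0_domain V" by (rule H2_S0_domain[OF hL H])
  have "AE x in lebesgue. schroedinger_expr V h x + complex_of_real (W x) * h x - \<zeta> * h x = g x"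
    using eq H2_schroedinger_expr[OF H, of V]
  proof eventually_elim
    case (elim x)
    show ?case unfolding elim(2) elim(1)[symmetric] by simp
  qed
  then show thesis using that hS by blast
qed

lemma S_pert_shifted_L2:
  assumes "f \<in> S0_domain V"
  shows "shifted S_pert \<zeta> f \<in> L2_space"
proof -
  have "(\<lambda>x. schroedinger_expr V f x + pert f x - \<zeta> * f x) \<in> L2_space"
    by (intro L2_diff L2_add L2_cmul pert_L2 S0_domainD[OF assms])
  moreover have "shifted S_pert \<zeta> f = (\<lambda>x. schroedinger_expr V f x + pert f x - \<zeta> * f x)"
    by (rule ext) (rule S_pert_simps)
  ultimately show ?thesis by simp
qed

lemma S_pert_lincomb:
  assumes "f \<in> S0_domain V" "h \<in> S0_domain V"
  shows "AE x in lebesgue. shifted S_pert \<zeta> (\<lambda>x. a * f x + b * h x) x = a * shifted S_pert \<zeta> f x + b * shifted S_pert \<zeta> h x"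
  using S0_domain_lincomb(2)[OF assms, of a b]
  by eventually_elim (simp add: S_pert_simps pert_lincomb S0_domainD(1)[OF assms(1)] S0_domainD(1)[OF assms(2)] algebra_simps)

lemma S_pert_diff:
  assumes "f \<in> S0_domain V" "h \<in> S0_domain V"
  shows "(\<lambda>x. f x - h x) \<in> S0_domain V"
    "AE x in lebesgue. shifted S_pert \<zeta> (\<lambda>x. f x - h x) x = shifted S_pert \<zeta> f x - shifted S_pert \<zeta> h x"
  using S0_domain_lincomb(1)[OF assms, of 1 "-1"] S_pert_lincomb[OF assms, of \<zeta> 1 "-1"] by simp_all

lemma S_pert_zero:
  assumes f: "f \<in> S0_domain V" and e: "AE x in lebesgue. shifted S_pert \<zeta> f x = 0" and \<zeta>: "Im \<zeta> \<noteq> 0"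
  shows "AE x in lebesgue. f x = 0"
proof -
  have z: "(\<lambda>_. 0 :: complex) \<in> L2_space" "nsq (\<lambda>_. 0) = 0" unfolding L2_space_def nsq_def by auto
  have "nsq f \<le> 0" using S_pert_bound[OF f z(1) e \<zeta>] z(2) by simp
  then show ?thesis using S0_domainD(1)[OF f] nsq_zero_AE by blast
qed

text \<open>\<open>f1\<close> and \<open>f2\<close> solve the equation without rank-two part for the
  right sides \<open>u1\<close> and \<open>u2\<close>. The ansatz \<open>F\<close> solves the full
  equation as soon as \<open>c1\<close> and \<open>c2\<close> equal its pairings with
  \<open>u1\<close> and \<open>u2\<close>. This system is injective: for \<open>z = 0\<close> the
  ansatz solves the homogeneous equation, whose solutions vanish by
  \<open>S_pert_zero\<close>.\<close>

lemma S_pert_solution_exists: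
  assumes \<zeta>: "Im \<zeta> \<noteq> 0" and g: "g \<in> L2_space"
  shows "\<exists>f\<in>S0_domain V. AE x in lebesgue. shifted S_pert \<zeta> f x = g x"
proof -
  let ?T = "complex_of_real t"
  let ?L = "\<lambda>f x. schroedinger_expr V f x + complex_of_real (W x) * f x - \<zeta> * f x"
  obtain f0 where f0: "f0 \<in> S0_domain V" "AE x in lebesgue. ?L f0 x = g x" using multiplication_solution_exists[OF \<zeta> g] by blast
  obtain f1 where f1: "f1 \<in> S0_domain V" "AE x in lebesgue. ?L f1 x = u1 x" using multiplication_solution_exists[OF \<zeta> u1(1)] by blast
  obtain f2 where f2: "f2 \<in> S0_domain V" "AE x in lebesgue. ?L f2 x = u2 x" using multiplication_solution_exists[OF \<zeta> u2(1)] by blast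
  note L = S0_domainD(1)[OF f0(1)] S0_domainD(1)[OF f1(1)] S0_domainD(1)[OF f2(1)]
  define ip where "ip u f = (LINT s|lebesgue. u s * f s)" for u f :: "real \<Rightarrow> complex"
  define F where "F z c1 c2 x = z * f0 x + (- ?T) * (c2 * f1 x + c1 * f2 x)" for z c1 c2 x
  have FS: "F z c1 c2 \<in> S0_domain V" for z c1 c2
    unfolding F_def[abs_def] by (intro S0_domain_lincomb f0 f1 f2)
  have FL: "AE x in lebesgue. ?L (F z c1 c2) x = z * g x - ?T * (c2 * u1 x + c1 * u2 x)" for z c1 c2
  proof -
    have S: "(\<lambda>x. c2 * f1 x + c1 * f2 x) \<in> S0_domain V" by (rule S0_domain_lincomb(1)[OF f1(1) f2(1)])
    show ?thesis
      using S0_domain_lincomb(2)[OF f0(1) S, of z "- ?T"] S0_domain_lincomb(2)[OF f1(1) f2(1), of c2 c1] f0(2) f1(2) f2(2)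
    proof eventually_elim
      case (elim x)
      show ?case unfolding F_def elim(3)[symmetric] elim(4)[symmetric] elim(5)[symmetric] elim(1)[unfolded elim(2)]
        by (simp add: algebra_simps)
    qed
  qed
  have ipF: "ip u (F z c1 c2) = z * ip u f0 - ?T * (c2 * ip u f1 + c1 * ip u f2)" if u: "u \<in> L2_space" for u z c1 c2
  proof -
    have "ip u (F z c1 c2) = (LINT s|lebesgue. z * (u s * f0 s) - ?T * (c2 * (u s * f1 s) + c1 * (u s * f2 s)))"
      unfolding ip_def F_def by (simp add: algebra_simps)
    also have "\<dots> = z * ip u f0 - ?T * (c2 * ip u f1 + c1 * ip u f2)"
      using L2_mult_integrable(2)[OF u L(1)] L2_mult_integrable(2)[OF u L(2)] L2_mult_integrable(2)[OF u L(3)]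
      unfolding ip_def by simp
    finally show ?thesis .
  qed
  have fin: "AE x in lebesgue. shifted S_pert \<zeta> (F z c1 c2) x = z * g x"
    if c: "c1 = ip u1 (F z c1 c2)" "c2 = ip u2 (F z c1 c2)" for z c1 c2
    using FL[of z c1 c2]
  proof eventually_elim
    case (elim x)
    have "pert (F z c1 c2) x = ?T * (u1 x * c2 + u2 x * c1) + complex_of_real (W x) * F z c1 c2 x"
      unfolding pert_def using c unfolding ip_def by simp
    then show ?case unfolding S_pert_simps using elim by (simp add: algebra_simps)
  qed
  obtain c1 c2 where c: "(1 + ?T * ip u1 f2) * c1 + (?T * ip u1 f1) * c2 = ip u1 f0"
     "(?T * ip u2 f2) * c1 + (1 + ?T * ip u2 f1) * c2 = ip u2 f0"
  proof (rule complex_2x2_solve[of "1 + ?T * ip u1 f2" "?T * ip u1 f1" "?T * ip u2 f2" "1 + ?T * ip u2 f1"])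
    fix c1 c2 assume a: "(1 + ?T * ip u1 f2) * c1 + (?T * ip u1 f1) * c2 = 0" "(?T * ip u2 f2) * c1 + (1 + ?T * ip u2 f1) * c2 = 0"
    have c1: "c1 = ip u1 (F 0 c1 c2)" and c2: "c2 = ip u2 (F 0 c1 c2)"
      unfolding ipF[OF u1(1)] ipF[OF u2(1)] using a by (simp_all add: algebra_simps eq_neg_iff_add_eq_0)
    have "AE x in lebesgue. shifted S_pert \<zeta> (F 0 c1 c2) x = 0" using fin[OF c1 c2] by simp
    then have "AE x in lebesgue. F 0 c1 c2 x = 0" by (rule S_pert_zero[OF FS _ \<zeta>])
    then have z: "ip u (F 0 c1 c2) = 0" for u unfolding ip_def
      by (intro integral_eq_zero_AE) (auto elim: eventually_mono)
    show "c1 = 0 \<and> c2 = 0" using c1 c2 z by simp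
  qed blast
  have "c1 = ip u1 (F 1 c1 c2)" "c2 = ip u2 (F 1 c1 c2)"
    unfolding ipF[OF u1(1)] ipF[OF u2(1)] using c by (simp_all add: algebra_simps)
  from fin[OF this] show ?thesis using FS by auto
qed

lemma S_pert_resolvent_set:
  assumes \<zeta>: "Im \<zeta> \<noteq> 0"
  shows "\<zeta> \<in> resolvent_set S_pert"
  unfolding resolvent_set_def
proof (intro CollectI conjI ballI impI)
  show "\<exists>f\<in>domain S_pert. AE x in lebesgue. shifted S_pert \<zeta> f x = g x" if "g \<in> L2_space" for g
    using S_pert_solution_exists[OF \<zeta> that] by (simp add: S_pert_simps)
  show "AE x in lebesgue. f x = h x"
    if "f \<in> domain S_pert" "h \<in> domain S_pert" "AE x in lebesgue. shifted S_pert \<zeta> f x = shifted S_pert \<zeta> h x" for f h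
  proof -
    have S: "f \<in> S0_domain V" "h \<in> S0_domain V" using that by (simp_all add: S_pert_simps)
    have "AE x in lebesgue. shifted S_pert \<zeta> (\<lambda>x. f x - h x) x = 0"
      using S_pert_diff(2)[OF S, of \<zeta>] that(3) by eventually_elim simp
    then have "AE x in lebesgue. f x - h x = 0" by (rule S_pert_zero[OF S_pert_diff(1)[OF S] _ \<zeta>])
    then show ?thesis by eventually_elim simp
  qed
  show "\<exists>C. \<forall>f\<in>domain S_pert. L2_norm f \<le> C * L2_norm (shifted S_pert \<zeta> f)"
  proof (intro exI[of _ "1 / \<bar>Im \<zeta>\<bar>"] ballI)
    fix f assume "f \<in> domain S_pert"
    then have f: "f \<in> S0_domain V" by (simp add: S_pert_simps)
    have "nsq f \<le> nsq (shifted S_pert \<zeta> f) / (Im \<zeta>)\<^sup>2"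
      by (rule S_pert_bound[OF f S_pert_shifted_L2[OF f] _ \<zeta>]) simp
    then have "sqrt (nsq f) \<le> sqrt (nsq (shifted S_pert \<zeta> f) / (Im \<zeta>)\<^sup>2)" by (rule real_sqrt_le_mono)
    then show "L2_norm f \<le> 1 / \<bar>Im \<zeta>\<bar> * L2_norm (shifted S_pert \<zeta> f)"
      unfolding L2_norm_nsq by (simp add: real_sqrt_divide)
  qed
qed

text \<open>\<open>w - u\<close> solves the perturbed equation with the residual of \<open>w\<close>
  as right side, so the resolvent bound controls it, and \<open>w - f\<close> is controlled
  directly. The hypothesis ranges over all solutions \<open>f\<close>, since
  \<open>resolvent\<close> returns an unspecified representative.\<close>

lemma resolvent_difference:
  assumes \<alpha>: "\<alpha> \<noteq> 0" and \<zeta>: "Im \<zeta> \<noteq> 0" and g: "g \<in> L2_space"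
    and appr: "\<And>f. iface V \<alpha> \<beta> f (\<lambda>x. \<zeta> * f x + g x) \<Longrightarrow> \<exists>w\<in>S0_domain V.
       (\<lambda>x. shifted S_pert \<zeta> w x - g x) \<in> L2_space \<and> nsq (\<lambda>x. shifted S_pert \<zeta> w x - g x) \<le> E \<and> nsq (\<lambda>x. w x - f x) \<le> E"
  shows "(L2_norm (\<lambda>x. resolvent S_pert \<zeta> g x - resolvent (S_point V \<alpha> \<beta>) \<zeta> g x))\<^sup>2 \<le> 2 * E / (Im \<zeta>)\<^sup>2 + 2 * E"
proof -
  define u where "u = resolvent S_pert \<zeta> g"
  define f where "f = resolvent (S_point V \<alpha> \<beta>) \<zeta> g"
  have "\<exists>f. f \<in> domain S_pert \<and> (AE x in lebesgue. shifted S_pert \<zeta> f x = g x)"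
    using S_pert_solution_exists[OF \<zeta> g] by (auto simp: S_pert_simps)
  from someI_ex[OF this] have u: "u \<in> S0_domain V" "AE x in lebesgue. shifted S_pert \<zeta> u x = g x"
    unfolding u_def resolvent_def by (simp_all add: S_pert_simps)
  have "\<exists>f. f \<in> domain (S_point V \<alpha> \<beta>) \<and> (AE x in lebesgue. shifted (S_point V \<alpha> \<beta>) \<zeta> f x = g x)"
    using S_point_solution_exists[OF \<alpha> \<zeta> g] by blast
  from someI_ex[OF this] have f: "f \<in> domain (S_point V \<alpha> \<beta>)" "AE x in lebesgue. shifted (S_point V \<alpha> \<beta>) \<zeta> f x = g x"
    unfolding f_def resolvent_def by simp_all
  have I: "iface V \<alpha> \<beta> f (\<lambda>x. \<zeta> * f x + g x)" by (rule S_point_resolvent_iff[OF f])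
  then have fL: "f \<in> L2_space" unfolding iface_def by blast
  obtain w where w: "w \<in> S0_domain V" "(\<lambda>x. shifted S_pert \<zeta> w x - g x) \<in> L2_space"
    "nsq (\<lambda>x. shifted S_pert \<zeta> w x - g x) \<le> E" "nsq (\<lambda>x. w x - f x) \<le> E" using appr[OF I] by blast
  have "nsq (\<lambda>x. w x - u x) \<le> nsq (\<lambda>x. shifted S_pert \<zeta> w x - g x) / (Im \<zeta>)\<^sup>2"
  proof (rule S_pert_bound[OF S_pert_diff(1)[OF w(1) u(1)] w(2) _ \<zeta>])
    show "AE x in lebesgue. shifted S_pert \<zeta> (\<lambda>x. w x - u x) x = shifted S_pert \<zeta> w x - g x"
      using S_pert_diff(2)[OF w(1) u(1), of \<zeta>] u(2) by eventually_elim simp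
  qed
  also have "\<dots> \<le> E / (Im \<zeta>)\<^sup>2" using w(3) by (intro divide_right_mono) auto
  finally have 1: "nsq (\<lambda>x. w x - u x) \<le> E / (Im \<zeta>)\<^sup>2" .
  have wL: "w \<in> L2_space" and uL: "u \<in> L2_space" using S0_domainD(1) w u by auto
  have "nsq (\<lambda>x. (w x - f x) - (w x - u x)) \<le> 2 * nsq (\<lambda>x. w x - f x) + 2 * nsq (\<lambda>x. w x - u x)"
    by (intro L2_diff wL uL fL)
  also have "\<dots> \<le> 2 * E + 2 * (E / (Im \<zeta>)\<^sup>2)" using 1 w(4) by (intro add_mono mult_left_mono) auto
  finally have "nsq (\<lambda>x. u x - f x) \<le> 2 * E / (Im \<zeta>)\<^sup>2 + 2 * E" by simp
  then show ?thesis unfolding u_def[symmetric] f_def[symmetric] L2_norm_nsq using nsq_nonneg by simp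
qed

end

subsection \<open>Antiderivatives of compactly supported functions\<close>

lemma is_primitive_improper:
  fixes \<psi> :: "real \<Rightarrow> real"
  assumes i: "integrable lebesgue \<psi>"
  shows "is_primitive (\<lambda>x. LINT s:{..x}|lebesgue. \<psi> s) \<psi>"
  unfolding is_primitive_def
proof safe
  have si: "set_integrable lebesgue A \<psi>" if "A \<in> sets lebesgue" for A
    unfolding set_integrable_def by (rule integrable_mult_indicator[OF that i])
  show "\<psi> absolutely_integrable_on {a..b}" for a b by (rule si) simp
  fix a b :: real assume ab: "a \<le> b"
  have "(LINT s:{..b}|lebesgue. \<psi> s) = (LINT s:{..a} \<union> {a<..b}|lebesgue. \<psi> s)"
    using ivl_disj_un_one(3)[OF ab] by simp
  also have "\<dots> = (LINT s:{..a}|lebesgue. \<psi> s) + (LINT s:{a<..b}|lebesgue. \<psi> s)"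
    by (rule set_integral_Un[OF _ si si]) auto
  also have "(LINT s:{a<..b}|lebesgue. \<psi> s) = integral {a<..b} \<psi>" by (rule set_lebesgue_integral_eq_integral(2)[OF si]) simp
  also have "\<dots> = integral {a..b} \<psi>"
  proof (rule integral_subset_negligible)
    show "negligible ({a..b} - {a<..b})" by (rule negligible_subset[OF negligible_sing[of a]]) auto
  qed auto
  finally show "(LINT s:{..b}|lebesgue. \<psi> s) - (LINT s:{..a}|lebesgue. \<psi> s) = integral {a..b} \<psi>" by simp
qed

locale bump =
  fixes \<phi> :: "real \<Rightarrow> real" and M :: real
  assumes L2: "\<phi> \<in> L2_space" and supp: "AE x in lebesgue. \<bar>x\<bar> > M \<longrightarrow> \<phi> x = 0" and mean: "(LINT x|lebesgue. \<phi> x) = 0" and M: "M > 0"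
begin

lemma complex_L2: "(\<lambda>x. complex_of_real (\<phi> x)) \<in> L2_space"
  using L2 unfolding L2_space_def by auto

lemma measurable: "\<phi> \<in> borel_measurable lebesgue" using L2 unfolding L2_space_def by auto

text \<open>On the core \<open>\<bar>\<phi> x\<bar> \<le> 1 + (\<phi> x)\<^sup>2\<close> and
  continuous weights are bounded, so compact support lets square integrability control all
  moments.\<close>

lemma integrable_weighted:
  assumes "continuous_on UNIV w"
  shows "integrable lebesgue (\<lambda>x. w x * \<phi> x)"
proof -
  obtain B where B: "\<And>x. x \<in> {-M..M} \<Longrightarrow> norm (w x) \<le> B"
    using continuous_on_compact_bound[OF compact_Icc continuous_on_subset[OF assms]] by blast
  have wm: "w \<in> borel_measurable lebesgue" by (rule continuous_borel_measurable_lebesgue[OF assms])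
  have "integrable lebesgue (indicat_real {-M..M})"
    using lmeasurable_cbox[of "-M" M] by (simp add: lmeasurable_iff_integrable)
  then have i: "integrable lebesgue (\<lambda>x. B * (indicat_real {-M..M} x + (\<phi> x)\<^sup>2))"
    using L2 unfolding L2_space_def by (intro integrable_mult_right Bochner_Integration.integrable_add) auto
  show ?thesis
  proof (rule Bochner_Integration.integrable_bound[OF i])
    show "(\<lambda>x. w x * \<phi> x) \<in> borel_measurable lebesgue" using wm measurable by measurable
    show "AE x in lebesgue. norm (w x * \<phi> x) \<le> norm (B * (indicat_real {-M..M} x + (\<phi> x)\<^sup>2))"
      using supp
    proof eventually_elim
      case (elim x)
      show ?case
      proof (cases "\<bar>x\<bar> > M")
        case True then show ?thesis using elim by simp
      next
        case False
        then have x: "x \<in> {-M..M}" by auto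
        have B0: "B \<ge> 0" using B[OF x] norm_ge_zero order_trans by blast
        have "2 * \<bar>\<phi> x\<bar> \<le> 1 + (\<phi> x)\<^sup>2" using sum_squares_bound[of 1 "\<bar>\<phi> x\<bar>"] by simp
        then have "\<bar>\<phi> x\<bar> \<le> 1 + (\<phi> x)\<^sup>2" using abs_ge_zero[of "\<phi> x"] by linarith
        then have "\<bar>w x\<bar> * \<bar>\<phi> x\<bar> \<le> B * (1 + (\<phi> x)\<^sup>2)" using B[OF x] B0 by (intro mult_mono) auto
        also have "\<dots> = norm (B * (indicat_real {-M..M} x + (\<phi> x)\<^sup>2))" using x B0 by simp
        finally show ?thesis by (simp add: abs_mult)
      qed
    qed
  qed
qed

lemma integrable: "integrable lebesgue \<phi>" using integrable_weighted[of "\<lambda>_. 1"] by simp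

lemma antideriv1_primitive: "is_primitive (antideriv1 \<phi>) \<phi>"
  using is_primitive_improper[OF integrable] unfolding antideriv1_def[abs_def] .

lemma antideriv1_left: "x \<le> -M \<Longrightarrow> antideriv1 \<phi> x = 0"
  unfolding antideriv1_def set_lebesgue_integral_def
  by (rule integral_eq_zero_AE, rule eventually_rev_mp[OF eventually_conj[OF supp AE_lebesgue_neq[of "-M"]]])
    (auto simp: indicator_def)

lemma antideriv1_right:
  assumes "x \<ge> M"
  shows "antideriv1 \<phi> x = 0"
proof -
  have "antideriv1 \<phi> x = (LINT s|lebesgue. \<phi> s)"
    unfolding antideriv1_def set_lebesgue_integral_def
  proof (rule integral_cong_AE)
    show "(\<lambda>s. indicat_real {..x} s *\<^sub>R \<phi> s) \<in> borel_measurable lebesgue"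
      by (intro borel_measurable_scaleR borel_measurable_indicator measurable) auto
    show "AE s in lebesgue. indicat_real {..x} s *\<^sub>R \<phi> s = \<phi> s"
      using supp by eventually_elim (use assms in \<open>auto simp: indicator_def\<close>)
  qed (rule measurable)
  then show ?thesis using mean by simp
qed

lemma antideriv2_left: "x \<le> -M \<Longrightarrow> antideriv2 \<phi> x = 0"
  unfolding antideriv2_def set_lebesgue_integral_def
  by (rule integral_eq_zero_AE, rule eventually_rev_mp[OF eventually_conj[OF supp AE_lebesgue_neq[of "-M"]]])
    (auto simp: indicator_def)

text \<open>\<open>antideriv2 \<phi> x\<close> is \<open>x * antideriv1 \<phi> x\<close> minus the
  first moment of \<open>\<phi>\<close> up to \<open>x\<close>; in the derivative the two terms
  containing \<open>\<phi>\<close> cancel.\<close>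

lemma H2_antideriv: "H2 (\<lambda>x. complex_of_real (antideriv2 \<phi> x)) (\<lambda>x. complex_of_real (antideriv1 \<phi> x)) (\<lambda>x. complex_of_real (\<phi> x))"
proof -
  have p1: "is_primitive (\<lambda>x. complex_of_real (antideriv1 \<phi> x)) (\<lambda>x. complex_of_real (\<phi> x))"
    by (rule is_primitive_bounded_linear[OF antideriv1_primitive bounded_linear_of_real])
  have i: "integrable lebesgue (\<lambda>s. s * \<phi> s)" by (rule integrable_weighted) (intro continuous_intros)
  define m where "m x = (LINT s:{..x}|lebesgue. s * \<phi> s)" for x
  have pm: "is_primitive (\<lambda>x. complex_of_real (m x)) (\<lambda>x. complex_of_real (x * \<phi> x))"
    unfolding m_def by (rule is_primitive_bounded_linear[OF is_primitive_improper[OF i] bounded_linear_of_real])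
  have px: "is_primitive complex_of_real (\<lambda>_. 1)"
    using H2_affine_fun[of 0 1] unfolding H2_def by simp
  have "is_primitive (\<lambda>x. complex_of_real x * complex_of_real (antideriv1 \<phi> x) - complex_of_real (m x))
    (\<lambda>x. (1 * complex_of_real (antideriv1 \<phi> x) + complex_of_real x * complex_of_real (\<phi> x)) - complex_of_real (x * \<phi> x))"
    by (rule is_primitive_diff[OF is_primitive_mult[OF px p1] pm])
  moreover have "complex_of_real x * complex_of_real (antideriv1 \<phi> x) - complex_of_real (m x) = complex_of_real (antideriv2 \<phi> x)" for x
  proof -
    have s: "set_integrable lebesgue {..x} (\<lambda>s. s * \<phi> s)" "set_integrable lebesgue {..x} (\<lambda>s. x * \<phi> s)"
      unfolding set_integrable_def by (intro integrable_mult_indicator i integrable_mult_right integrable; simp)+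
    have "antideriv2 \<phi> x = (LINT s:{..x}|lebesgue. x * \<phi> s - s * \<phi> s)" unfolding antideriv2_def by (simp add: algebra_simps)
    also have "\<dots> = x * antideriv1 \<phi> x - m x" unfolding antideriv1_def m_def using set_integral_diff(2)[OF s(2,1)] by simp
    finally show ?thesis by simp
  qed
  ultimately show ?thesis unfolding H2_def using p1 by simp
qed

lemma antideriv2_right:
  assumes "x \<ge> M"
  shows "antideriv2 \<phi> x = antideriv2 \<phi> M"
proof -
  have P: "is_primitive (\<lambda>x. complex_of_real (antideriv2 \<phi> x)) (\<lambda>x. complex_of_real (antideriv1 \<phi> x))"
    using H2_antideriv unfolding H2_def by blast
  have "complex_of_real (antideriv2 \<phi> x) - complex_of_real (antideriv2 \<phi> M) = integral {M..x} (\<lambda>x. complex_of_real (antideriv1 \<phi> x))"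
    by (rule is_primitiveD(3)[OF P assms])
  also have "\<dots> = integral {M..x} (\<lambda>_. 0)"
    by (rule Henstock_Kurzweil_Integration.integral_cong) (simp add: antideriv1_right)
  finally show ?thesis by simp
qed

lemma antideriv1_continuous: "continuous_on S (antideriv1 \<phi>)"
  by (rule is_primitive_continuous[OF antideriv1_primitive])

end

text \<open>Zero mean confines the first antiderivatives to \<open>{-M..M}\<close>, so the inner
  product over the line is an integral over the core.\<close>

lemma antideriv1_inner:
  assumes "bump \<phi> M" "bump \<psi> M"
  shows "L2_inner (antideriv1 \<phi>) (antideriv1 \<psi>) = integral {-M..M} (\<lambda>x. antideriv1 \<phi> x * antideriv1 \<psi> x)"
proof -
  interpret A: bump \<phi> M by fact
  interpret B: bump \<psi> M by fact
  have c: "(\<lambda>x. antideriv1 \<phi> x * antideriv1 \<psi> x) absolutely_integrable_on {-M..M}"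
    by (intro absolutely_integrable_continuous_real continuous_intros A.antideriv1_continuous B.antideriv1_continuous)
  have "L2_inner (antideriv1 \<phi>) (antideriv1 \<psi>) = (LINT x:{-M..M}|lebesgue. antideriv1 \<phi> x * antideriv1 \<psi> x)"
    unfolding L2_inner_def set_lebesgue_integral_def
  proof (intro Bochner_Integration.integral_cong refl)
    fix x :: real
    consider "x \<in> {-M..M}" | "x \<le> -M" | "x \<ge> M" by fastforce
    then show "antideriv1 \<phi> x * antideriv1 \<psi> x = indicat_real {-M..M} x *\<^sub>R (antideriv1 \<phi> x * antideriv1 \<psi> x)"
      by cases (auto simp: A.antideriv1_left A.antideriv1_right)
  qed
  then show ?thesis using set_lebesgue_integral_eq_integral(2)[OF c] by simp
qed

lemma antideriv1_norm:
  assumes "bump \<phi> M"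
  shows "(L2_norm (antideriv1 \<phi>))\<^sup>2 = integral {-M..M} (\<lambda>x. antideriv1 \<phi> x * antideriv1 \<phi> x)"
proof -
  have "(L2_norm (antideriv1 \<phi>))\<^sup>2 = L2_inner (antideriv1 \<phi>) (antideriv1 \<phi>)"
    unfolding L2_norm_def L2_inner_def by (subst real_sqrt_pow2) (auto simp: power2_eq_square)
  then show ?thesis using antideriv1_inner[OF assms assms] by simp
qed

subsection \<open>The inner problem\<close>

text \<open>The scaled equation near the origin. By \<open>gram\<close> and \<open>n12\<close> the function \<open>\<omega>\<close> solves the homogeneous
  equation; since \<open>\<omega>\<close> has the nonzero jump \<open>\<kappa>\<close>, the linear function is not orthogonal to \<open>\<omega>''\<close> and provides
  the missing degree of freedom for the solvability of the inhomogeneous equation.\<close>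

locale inner_problem =
  fixes F1 F2 p1 p2 P1 P2 :: "real \<Rightarrow> complex" and M n1 n2 :: real and \<kappa> :: complex
  assumes H1: "H2 P1 p1 F1" and H2': "H2 P2 p2 F2" and M: "M > 0"
    and p_bc: "p1 (-M) = 0" "p1 M = 0" "p2 (-M) = 0" "p2 M = 0" and P_bc: "P1 (-M) = 0" "P2 (-M) = 0"
    and n12: "n1 * n2 = 1"
    and gram: "integral {-M..M} (\<lambda>x. p1 x * p1 x) = complex_of_real (n1\<^sup>2)" "integral {-M..M} (\<lambda>x. p2 x * p2 x) = complex_of_real (n2\<^sup>2)"
      "integral {-M..M} (\<lambda>x. p1 x * p2 x) = 0"
    and \<kappa>: "\<kappa> = complex_of_real n2 * P1 M - complex_of_real n1 * P2 M" "\<kappa> \<noteq> 0"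
begin

text \<open>Bilinear, without conjugation: these are the functionals that occur in
  \<open>B_op\<close>, restricted to the core.\<close>

definition pair :: "(real \<Rightarrow> complex) \<Rightarrow> (real \<Rightarrow> complex) \<Rightarrow> complex" where
  "pair u v = integral {-M..M} (\<lambda>x. u x * v x)"

definition om where "om x = complex_of_real n2 * P1 x - complex_of_real n1 * P2 x"
definition om1 where "om1 x = complex_of_real n2 * p1 x - complex_of_real n1 * p2 x"

lemma H2_om: "H2 om om1 (\<lambda>x. complex_of_real n2 * F1 x - complex_of_real n1 * F2 x)"
  unfolding om_def[abs_def] om1_def[abs_def] by (intro H2_diff H2_cmul H1 H2')

lemma om_bc: "om (-M) = 0" "om M = \<kappa>" "om1 (-M) = 0" "om1 M = 0"
  unfolding om_def om1_def using p_bc P_bc \<kappa> by auto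

lemma by_parts:
  assumes "is_primitive u u'" "is_primitive v v'"
  shows "(\<lambda>x. u' x * v x) integrable_on {-M..M}" "(\<lambda>x. u x * v' x) integrable_on {-M..M}"
    "pair u' v = u M * v M - u (-M) * v (-M) - pair u v'"
proof -
  have a: "(\<lambda>x. f' x * g x) integrable_on {-M..M}" if f: "f' absolutely_integrable_on {-M..M}" and g: "continuous_on UNIV g"
    for f' g :: "real \<Rightarrow> complex"
  proof -
    obtain B where B: "\<And>x. x \<in> {-M..M} \<Longrightarrow> norm (g x) \<le> B"
      using continuous_on_compact_bound[OF compact_Icc continuous_on_subset[OF g]] by blast
    have bg: "bounded (g ` {-M..M})" unfolding bounded_iff using B by (intro exI[of _ B]) auto
    have "g \<in> borel_measurable (lebesgue_on {-M..M})"
      using continuous_borel_measurable_lebesgue[OF g] by (simp add: measurable_restrict_space1)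
    from absolutely_integrable_bounded_measurable_product[OF bilinear_times this _ bg f]
    show ?thesis using set_lebesgue_integral_eq_integral(1) by (simp add: mult.commute)
  qed
  show i1: "(\<lambda>x. u' x * v x) integrable_on {-M..M}"
    by (rule a[OF is_primitiveD(1)[OF assms(1)] is_primitive_continuous[OF assms(2)]])
  show i2: "(\<lambda>x. u x * v' x) integrable_on {-M..M}"
    using a[OF is_primitiveD(1)[OF assms(2)] is_primitive_continuous[OF assms(1)]] by (simp add: mult.commute)
  have "u M * v M - u (-M) * v (-M) = integral {-M..M} (\<lambda>x. u' x * v x + u x * v' x)"
    using is_primitiveD(3)[OF is_primitive_mult[OF assms], of "-M" M] M by simp
  then show "pair u' v = u M * v M - u (-M) * v (-M) - pair u v'"
    unfolding pair_def using Henstock_Kurzweil_Integration.integral_add[OF i1 i2] by simp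
qed

lemma prims: "is_primitive P1 p1" "is_primitive p1 F1" "is_primitive P2 p2" "is_primitive p2 F2"
  using H1 H2' unfolding H2_def by auto

lemma prim_id: "is_primitive complex_of_real (\<lambda>_. 1)"
  using H2_affine_fun[of 0 1] unfolding H2_def by simp

text \<open>Integration by parts: \<open>p1\<close> and \<open>p2\<close> vanish at both ends, so
  \<open>F1\<close> and \<open>F2\<close> act on \<open>P1\<close>, \<open>P2\<close> through the
  Gram matrix of \<open>p1\<close>, \<open>p2\<close>, and on the identity through
  \<open>P1 M\<close>, \<open>P2 M\<close>. The combination \<open>n2 * F1 - n1 * F2\<close> pairs
  with the identity to \<open>- \<kappa>\<close>.\<close>

lemma pair_F:
  "pair F1 P1 = - complex_of_real (n1\<^sup>2)" "pair F1 P2 = 0" "pair F2 P1 = 0" "pair F2 P2 = - complex_of_real (n2\<^sup>2)"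
  "pair F1 complex_of_real = - P1 M" "pair F2 complex_of_real = - P2 M" "pair F1 (\<lambda>_. a) = 0" "pair F2 (\<lambda>_. a) = 0"
proof -
  show "pair F1 P1 = - complex_of_real (n1\<^sup>2)" using by_parts(3)[OF prims(2,1)] p_bc gram unfolding pair_def by simp
  show "pair F1 P2 = 0" using by_parts(3)[OF prims(2,3)] p_bc gram unfolding pair_def by simp
  show "pair F2 P1 = 0" using by_parts(3)[OF prims(4,1)] p_bc gram unfolding pair_def by (simp add: mult.commute)
  show "pair F2 P2 = - complex_of_real (n2\<^sup>2)" using by_parts(3)[OF prims(4,3)] p_bc gram unfolding pair_def by simp
  have "integral {-M..M} p1 = P1 M" "integral {-M..M} p2 = P2 M"
    using is_primitiveD(3)[OF prims(1), of "-M" M] is_primitiveD(3)[OF prims(3), of "-M" M] M P_bc by simp_all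
  then show "pair F1 complex_of_real = - P1 M" "pair F2 complex_of_real = - P2 M"
    using by_parts(3)[OF prims(2) prim_id] by_parts(3)[OF prims(4) prim_id] p_bc unfolding pair_def by simp_all
  have "integral {-M..M} F1 = 0" "integral {-M..M} F2 = 0"
    using is_primitiveD(3)[OF prims(2), of "-M" M] is_primitiveD(3)[OF prims(4), of "-M" M] M p_bc by simp_all
  then show "pair F1 (\<lambda>_. a) = 0" "pair F2 (\<lambda>_. a) = 0" unfolding pair_def by simp_all
qed

lemma pair_lin:
  assumes F: "F absolutely_integrable_on {-M..M}" and u: "continuous_on UNIV u" and v: "continuous_on UNIV v"
  shows "pair F (\<lambda>x. a * u x + b * v x) = a * pair F u + b * pair F v"
    "(\<lambda>x. F x * u x) absolutely_integrable_on {-M..M}"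
proof -
  have a: "(\<lambda>x. F x * g x) absolutely_integrable_on {-M..M}" if g: "continuous_on UNIV g" for g :: "real \<Rightarrow> complex"
  proof -
    obtain B where B: "\<And>x. x \<in> {-M..M} \<Longrightarrow> norm (g x) \<le> B"
      using continuous_on_compact_bound[OF compact_Icc continuous_on_subset[OF g]] by blast
    have bg: "bounded (g ` {-M..M})" unfolding bounded_iff using B by (intro exI[of _ B]) auto
    have "g \<in> borel_measurable (lebesgue_on {-M..M})"
      using continuous_borel_measurable_lebesgue[OF g] by (simp add: measurable_restrict_space1)
    from absolutely_integrable_bounded_measurable_product[OF bilinear_times this _ bg F]
    show ?thesis by (simp add: mult.commute)
  qed
  show "(\<lambda>x. F x * u x) absolutely_integrable_on {-M..M}" by (rule a[OF u])
  have i: "(\<lambda>x. F x * u x) integrable_on {-M..M}" "(\<lambda>x. F x * v x) integrable_on {-M..M}"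
    using a[OF u] a[OF v] set_lebesgue_integral_eq_integral(1) by blast+
  have "pair F (\<lambda>x. a * u x + b * v x) = integral {-M..M} (\<lambda>x. a * (F x * u x) + b * (F x * v x))"
    unfolding pair_def by (simp add: algebra_simps)
  also have "\<dots> = integral {-M..M} (\<lambda>x. a * (F x * u x)) + integral {-M..M} (\<lambda>x. b * (F x * v x))"
    by (rule Henstock_Kurzweil_Integration.integral_add) (intro integrable_on_mult_right i)+
  finally show "pair F (\<lambda>x. a * u x + b * v x) = a * pair F u + b * pair F v"
    unfolding pair_def by simp
qed

lemma pair_norm_le:
  assumes F: "F absolutely_integrable_on {-M..M}" and u: "continuous_on UNIV u" and B: "\<And>x. x \<in> {-M..M} \<Longrightarrow> norm (u x) \<le> B"
  shows "norm (pair F u) \<le> B * integral {-M..M} (\<lambda>x. norm (F x))"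
proof -
  have nF: "(\<lambda>x. norm (F x)) integrable_on {-M..M}"
    using absolutely_integrable_norm[OF F] set_lebesgue_integral_eq_integral(1) by (auto simp: o_def)
  have "norm (pair F u) \<le> integral {-M..M} (\<lambda>x. B * norm (F x))"
    unfolding pair_def
  proof (rule Henstock_Kurzweil_Integration.integral_norm_bound_integral)
    show "(\<lambda>x. F x * u x) integrable_on {-M..M}"
      using pair_lin(2)[OF F u u] set_lebesgue_integral_eq_integral(1) by blast
    show "(\<lambda>x. B * norm (F x)) integrable_on {-M..M}" by (rule integrable_on_mult_right[OF nF])
    fix x assume "x \<in> {-M..M}"
    then show "norm (F x * u x) \<le> B * norm (F x)"
      unfolding norm_mult using mult_right_mono[OF B norm_ge_zero[of "F x"]] by (simp add: mult.commute)
  qed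
  then show ?thesis by simp
qed

text \<open>Ansatz \<open>A + b * x + h + d * P1 + s * om\<close>, with \<open>h\<close> the second
  primitive of \<open>k\<close> that vanishes together with its slope at \<open>-M\<close>. The
  coefficients of \<open>F1\<close> and \<open>F2\<close> in the equation depend on
  \<open>v\<close>, which gives two consistency conditions; they determine \<open>b\<close> and
  \<open>d\<close>, while \<open>A\<close> and \<open>s\<close> stay free because constants and
  \<open>om\<close> solve the homogeneous equation. Since \<open>p1\<close> and \<open>om1\<close>
  vanish at both ends, the slope of \<open>v\<close> is \<open>b\<close> at \<open>-M\<close> and
  \<open>b\<close> plus the integral of \<open>k\<close> at \<open>M\<close>.\<close>

lemma inner_solution_exists:
  obtains C where "C \<ge> 0" "\<And>k A s. (\<And>a b. k absolutely_integrable_on {a..b}) \<Longrightarrow>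
     \<exists>v v1. H2 v v1 (\<lambda>x. k x + pair F2 v * F1 x + pair F1 v * F2 x) \<and>
       v1 (-M) = pair k om / \<kappa> - integral {-M..M} k \<and> v1 M = pair k om / \<kappa> \<and>
       (\<forall>x\<in>{-M..M}. norm (v x - (A + s * om x)) \<le> C * integral {-M..M} (\<lambda>x. norm (k x)))"
proof -
  have ct: "continuous_on UNIV om" "continuous_on UNIV P1" using H2_continuous[OF H2_om] H2_continuous[OF H1] by auto
  obtain Bo where Bo: "\<And>x. x \<in> {-M..M} \<Longrightarrow> norm (om x) \<le> Bo"
    using continuous_on_compact_bound[OF compact_Icc continuous_on_subset[OF ct(1)]] by blast
  obtain BP where BP: "\<And>x. x \<in> {-M..M} \<Longrightarrow> norm (P1 x) \<le> BP"
    using continuous_on_compact_bound[OF compact_Icc continuous_on_subset[OF ct(2)]] by blast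
  have in0: "0 \<in> {-M..M}" using M by auto
  have Bo0: "Bo \<ge> 0" using Bo[OF in0] norm_ge_zero order_trans by blast
  have BP0: "BP \<ge> 0" using BP[OF in0] norm_ge_zero order_trans by blast
  define NF where "NF = integral {-M..M} (\<lambda>x. norm (F2 x))"
  have NF0: "NF \<ge> 0" unfolding NF_def
    using absolutely_integrable_norm[OF is_primitiveD(1)[OF prims(4)]] set_lebesgue_integral_eq_integral(1)
    by (intro Henstock_Kurzweil_Integration.integral_nonneg) (auto simp: o_def)
  \<comment> \<open>\<open>cb\<close> and \<open>cd\<close> bound \<open>b\<close> and
    \<open>d\<close> relative to the integral of \<open>norm (k x)\<close>; the summand 1 accounts
    for the integral of \<open>k\<close> in \<open>b\<close>.\<close>
  define cb where "cb = Bo / norm \<kappa> + 1"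
  have cb0: "cb \<ge> 0" unfolding cb_def using Bo0 by simp
  define cd where "cd = 2 * M * NF + cb * norm (P2 M)"
  have cd0: "cd \<ge> 0" unfolding cd_def using cb0 NF0 M by simp
  define C where "C = 2 * M + cd * BP + cb * M"
  have C0: "C \<ge> 0" unfolding C_def using cd0 cb0 BP0 M by simp
  show thesis
  proof (rule that[OF C0])
    fix k :: "real \<Rightarrow> complex" and A s :: complex
    assume k: "\<And>a b. k absolutely_integrable_on {a..b}"
    define K where "K = integral {-M..M} (\<lambda>x. norm (k x))"
    have nk: "(\<lambda>x. norm (k x)) integrable_on {a..b}" for a b
      using absolutely_integrable_norm[OF k] set_lebesgue_integral_eq_integral(1) by (auto simp: o_def)
    have ki: "k integrable_on {a..b}" for a b using k set_lebesgue_integral_eq_integral(1) by blast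
    have K0: "K \<ge> 0" unfolding K_def by (rule Henstock_Kurzweil_Integration.integral_nonneg[OF nk]) simp
    define h1 where "h1 x = prim k x - prim k (-M)" for x
    define h where "h x = prim (prim k) x - prim k (-M) * of_real x - (prim (prim k) (-M) + prim k (-M) * of_real M)" for x
    have Hh: "H2 h h1 k"
    proof -
      have "H2 (\<lambda>x. prim (prim k) x - ((prim (prim k) (-M) + prim k (-M) * of_real M) + prim k (-M) * of_real x)) (\<lambda>x. prim k x - prim k (-M)) (\<lambda>x. k x - 0)"
        by (intro H2_diff H2_prim_prim k H2_affine_fun)
      then show ?thesis unfolding h_def[abs_def] h1_def[abs_def] by (simp add: algebra_simps)
    qed
    have h0: "h (-M) = 0" "h1 (-M) = 0" unfolding h_def h1_def by simp_all
    have ph: "is_primitive h h1" "is_primitive h1 k" using Hh unfolding H2_def by auto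
    have h1M: "h1 M = integral {-M..M} k" using is_primitiveD(3)[OF ph(2), of "-M" M] M h0 by simp
    have h1b: "norm (h1 x) \<le> K" if x: "x \<in> {-M..M}" for x
    proof -
      have "norm (h1 x) = norm (integral {-M..x} k)" using is_primitiveD(3)[OF ph(2), of "-M" x] x h0 by simp
      also have "\<dots> \<le> integral {-M..x} (\<lambda>x. norm (k x))"
        by (rule Henstock_Kurzweil_Integration.integral_norm_bound_integral[OF ki nk]) auto
      also have "\<dots> \<le> K" unfolding K_def by (rule integral_subset_le[OF _ nk nk]) (use x in auto)
      finally show ?thesis .
    qed
    have hb: "norm (h x) \<le> 2 * M * K" if x: "x \<in> {-M..M}" for x
    proof -
      have "norm (h x) = norm (integral {-M..x} h1)" using is_primitiveD(3)[OF ph(1), of "-M" x] x h0 by simp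
      also have "\<dots> \<le> integral {-M..x} (\<lambda>_. K)"
        by (rule Henstock_Kurzweil_Integration.integral_norm_bound_integral[OF is_primitiveD(2)[OF ph(1)]]) (use h1b x in auto)
      also have "\<dots> = (x + M) * K" using x by simp
      also have "\<dots> \<le> 2 * M * K" using x K0 by (intro mult_right_mono) auto
      finally show ?thesis .
    qed
    \<comment> \<open>\<open>n2\<close> times the consistency condition for \<open>F1\<close> minus
      \<open>n1\<close> times that for \<open>F2\<close> eliminates \<open>d\<close> and leaves an
      equation for \<open>\<kappa> * b\<close>, whose other side is evaluated in
      \<open>om_h\<close>; this is where \<open>\<kappa> \<noteq> 0\<close> enters. The condition
      for \<open>F2\<close> then yields \<open>d\<close>.\<close>
    define b where "b = pair k om / \<kappa> - integral {-M..M} k"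
    define d where "d = pair F2 h - b * P2 M"
    have hc: "continuous_on UNIV h" using H2_continuous[OF Hh] by auto
    \<comment> \<open>Two integrations by parts move the second derivative from \<open>om\<close> to
      \<open>h\<close>; the only boundary term comes from the value \<open>\<kappa>\<close> of
      \<open>om\<close> at \<open>M\<close>.\<close>
    have om_h: "complex_of_real n2 * pair F1 h - complex_of_real n1 * pair F2 h = \<kappa> * b"
    proof -
      have po: "is_primitive om om1" "is_primitive om1 (\<lambda>x. complex_of_real n2 * F1 x - complex_of_real n1 * F2 x)"
        using H2_om unfolding H2_def by auto
      have "pair (\<lambda>x. complex_of_real n2 * F1 x - complex_of_real n1 * F2 x) h = - pair om1 h1"
        using by_parts(3)[OF po(2) ph(1)] om_bc by simp
      also have "pair om1 h1 = \<kappa> * integral {-M..M} k - pair om k"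
        using by_parts(3)[OF po(1) ph(2)] om_bc h1M by simp
      also have "pair om k = pair k om" unfolding pair_def by (simp add: mult.commute)
      finally have "pair (\<lambda>x. complex_of_real n2 * F1 x - complex_of_real n1 * F2 x) h = \<kappa> * b"
        unfolding b_def using \<kappa>(2) by (simp add: right_diff_distrib)
      moreover have "pair (\<lambda>x. complex_of_real n2 * F1 x - complex_of_real n1 * F2 x) h = complex_of_real n2 * pair F1 h - complex_of_real n1 * pair F2 h"
      proof -
        have i: "(\<lambda>x. F1 x * h x) integrable_on {-M..M}" "(\<lambda>x. F2 x * h x) integrable_on {-M..M}"
          using by_parts(1)[OF prims(2) ph(1)] by_parts(1)[OF prims(4) ph(1)] by auto
        have "pair (\<lambda>x. complex_of_real n2 * F1 x - complex_of_real n1 * F2 x) h =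
          integral {-M..M} (\<lambda>x. complex_of_real n2 * (F1 x * h x) - complex_of_real n1 * (F2 x * h x))"
          unfolding pair_def by (simp add: algebra_simps)
        also have "\<dots> = integral {-M..M} (\<lambda>x. complex_of_real n2 * (F1 x * h x)) - integral {-M..M} (\<lambda>x. complex_of_real n1 * (F2 x * h x))"
          by (rule Henstock_Kurzweil_Integration.integral_diff) (intro integrable_on_mult_right i)+
        finally show ?thesis unfolding pair_def by simp
      qed
      ultimately show ?thesis by simp
    qed
    define v where "v x = (A + b * of_real x) + ((h x + d * P1 x) + s * om x)" for x
    define v1 where "v1 x = b + ((h1 x + d * p1 x) + s * om1 x)" for x
    have Hv: "H2 v v1 (\<lambda>x. 0 + ((k x + d * F1 x) + s * (complex_of_real n2 * F1 x - complex_of_real n1 * F2 x)))"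
      unfolding v_def[abs_def] v1_def[abs_def] by (intro H2_add H2_affine_fun Hh H2_cmul H1 H2_om)
    have FA: "F1 absolutely_integrable_on {-M..M}" "F2 absolutely_integrable_on {-M..M}"
      using is_primitiveD(1)[OF prims(2)] is_primitiveD(1)[OF prims(4)] by auto
    have cont: "continuous_on UNIV P1" "continuous_on UNIV P2" "continuous_on UNIV complex_of_real" "continuous_on UNIV (\<lambda>_::real. 1::complex)"
      using H2_continuous[OF H1] H2_continuous[OF H2'] by (auto intro: continuous_intros)
    have pv: "pair F v = b * pair F complex_of_real + (pair F h + d * pair F P1) + s * (complex_of_real n2 * pair F P1 - complex_of_real n1 * pair F P2)"
      if F: "F absolutely_integrable_on {-M..M}" and z: "pair F (\<lambda>_. A) = 0" for F
    proof -
      have c1: "continuous_on UNIV (\<lambda>x. A + b * complex_of_real x)" "continuous_on UNIV (\<lambda>x. h x + d * P1 x)"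
        "continuous_on UNIV (\<lambda>x. (h x + d * P1 x) + s * om x)" "continuous_on UNIV (\<lambda>_::real. A)"
        by (intro continuous_intros hc cont ct)+
      have "pair F v = pair F (\<lambda>x. A + b * complex_of_real x) + pair F (\<lambda>x. (h x + d * P1 x) + s * om x)"
        unfolding v_def[abs_def] using pair_lin(1)[OF F c1(1) c1(3), of 1 1] by simp
      also have "pair F (\<lambda>x. A + b * complex_of_real x) = b * pair F complex_of_real"
        using pair_lin(1)[OF F c1(4) cont(3), of 1 b] z by simp
      also have "pair F (\<lambda>x. (h x + d * P1 x) + s * om x) = pair F (\<lambda>x. h x + d * P1 x) + s * pair F om"
        using pair_lin(1)[OF F c1(2) ct(1), of 1 s] by simp
      also have "pair F (\<lambda>x. h x + d * P1 x) = pair F h + d * pair F P1"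
        using pair_lin(1)[OF F hc cont(1), of 1 d] by simp
      also have "pair F om = complex_of_real n2 * pair F P1 - complex_of_real n1 * pair F P2"
        unfolding om_def[abs_def] using pair_lin(1)[OF F cont(1,2), of "complex_of_real n2" "- complex_of_real n1"] by simp
      finally show ?thesis by simp
    qed
    have n12c: "complex_of_real n1 * complex_of_real n2 = 1" using n12 by (simp flip: of_real_mult)
    have e2: "pair F2 v = d + s * complex_of_real n2"
    proof -
      have "complex_of_real n1 * (complex_of_real n2)\<^sup>2 = complex_of_real n2"
        using n12c by (simp add: power2_eq_square mult.assoc[symmetric])
      then show ?thesis unfolding pv[OF FA(2) pair_F(8)] pair_F d_def by (simp add: algebra_simps)
    qed
    have e1: "pair F1 v = - (s * complex_of_real n1)"
    proof -
      have n: "complex_of_real n2 * (complex_of_real n1)\<^sup>2 = complex_of_real n1"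
        using n12c by (simp add: power2_eq_square mult.assoc[symmetric] mult.commute)
      \<comment> \<open>The condition is tested after multiplication by \<open>n2\<close>, which is
        nonzero because \<open>n1 * n2 = 1\<close>; in this form it is \<open>om_h\<close>.\<close>
      have z: "- b * P1 M + pair F1 h - d * (complex_of_real n1)\<^sup>2 = 0"
      proof -
        have "complex_of_real n2 * (- b * P1 M + pair F1 h - d * (complex_of_real n1)\<^sup>2)
          = (complex_of_real n2 * pair F1 h - complex_of_real n1 * pair F2 h) - b * (complex_of_real n2 * P1 M - complex_of_real n1 * P2 M)"
        proof -
          have "complex_of_real n2 * (d * (complex_of_real n1)\<^sup>2) = d * complex_of_real n1" using n by (simp add: algebra_simps)
          then show ?thesis unfolding right_diff_distrib by (simp add: d_def algebra_simps)
        qed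
        also have "\<dots> = 0" unfolding om_h \<kappa>(1)[symmetric] by simp
        finally show ?thesis using n12 by auto
      qed
      show ?thesis unfolding pv[OF FA(1) pair_F(7)] pair_F using z n by (simp add: algebra_simps)
    qed
    have "H2 v v1 (\<lambda>x. k x + pair F2 v * F1 x + pair F1 v * F2 x)"
      using Hv unfolding e1 e2 by (simp add: algebra_simps)
    moreover have "v1 (-M) = pair k om / \<kappa> - integral {-M..M} k" unfolding v1_def using h0 p_bc om_bc b_def by simp
    moreover have "v1 M = pair k om / \<kappa>" unfolding v1_def using h1M p_bc om_bc b_def by simp
    moreover have "norm (v x - (A + s * om x)) \<le> C * K" if x: "x \<in> {-M..M}" for x
    proof -
      have "norm (pair k om) \<le> Bo * K" unfolding K_def by (rule pair_norm_le[OF k ct(1) Bo])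
      then have "norm (pair k om / \<kappa>) \<le> Bo / norm \<kappa> * K" using \<kappa>(2) by (simp add: norm_divide divide_right_mono)
      moreover have "norm (integral {-M..M} k) \<le> K" using h1b[of M] h1M M by simp
      ultimately have bb: "norm b \<le> cb * K" unfolding b_def cb_def
        using norm_triangle_ineq4[of "pair k om / \<kappa>" "integral {-M..M} k"] by (simp add: algebra_simps)
      have "norm (pair F2 h) \<le> 2 * M * K * NF" unfolding NF_def by (rule pair_norm_le[OF FA(2) hc hb])
      moreover have "norm (b * P2 M) \<le> cb * K * norm (P2 M)" unfolding norm_mult by (intro mult_right_mono bb) auto
      ultimately have dd: "norm d \<le> cd * K" unfolding d_def cd_def
        using norm_triangle_ineq4[of "pair F2 h" "b * P2 M"] by (simp add: algebra_simps)
      have "v x - (A + s * om x) = b * of_real x + (h x + d * P1 x)" unfolding v_def by simp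
      then have "norm (v x - (A + s * om x)) \<le> norm (b * of_real x) + (norm (h x) + norm (d * P1 x))"
        by (metis add_left_mono norm_triangle_ineq order_trans)
      moreover have "norm (b * of_real x) \<le> (cb * K) * M" unfolding norm_mult norm_of_real using x bb K0 cb0 by (intro mult_mono) auto
      moreover have "norm (d * P1 x) \<le> (cd * K) * BP" unfolding norm_mult using BP[OF x] dd K0 cd0 by (intro mult_mono) auto
      ultimately show ?thesis using hb[OF x] unfolding C_def by (simp add: algebra_simps)
    qed
    ultimately show "\<exists>v v1. H2 v v1 (\<lambda>x. k x + pair F2 v * F1 x + pair F1 v * F2 x) \<and>
       v1 (-M) = pair k om / \<kappa> - integral {-M..M} k \<and> v1 M = pair k om / \<kappa> \<and>
       (\<forall>x\<in>{-M..M}. norm (v x - (A + s * om x)) \<le> C * integral {-M..M} (\<lambda>x. norm (k x)))"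
      unfolding K_def by blast
  qed
qed

end

subsection \<open>Scaling and boundary layers\<close>

lemma AE_lebesgue_scale:
  assumes "AE x in lebesgue. P x" "r \<noteq> 0"
  shows "AE x in lebesgue. P (r * x :: real)"
proof -
  obtain N where N: "negligible N" "\<And>x. x \<notin> N \<Longrightarrow> P x" using assms(1) unfolding AE_lebesgue_negligible by blast
  have "negligible ((\<lambda>x. x / r) ` N)"
    using N(1) assms(2) by (intro negligible_differentiable_image_negligible) (auto intro!: derivative_intros simp: differentiable_on_def)
  moreover have "P (r * x)" if "x \<notin> (\<lambda>x. x / r) ` N" for x
  proof (rule N(2))
    show "r * x \<notin> N"
    proof
      assume "r * x \<in> N"
      then have "(r * x) / r \<in> (\<lambda>x. x / r) ` N" by (rule imageI)
      then show False using that assms(2) by simp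
    qed
  qed
  ultimately show ?thesis unfolding AE_lebesgue_negligible by blast
qed

lemma lebesgue_measurable_scale:
  fixes f :: "real \<Rightarrow> 'a::topological_space"
  assumes "f \<in> borel_measurable lebesgue" "r \<noteq> 0"
  shows "(\<lambda>x. f (r * x)) \<in> borel_measurable lebesgue"
proof -
  have "(\<lambda>x. r * x) \<in> lebesgue \<rightarrow>\<^sub>M (lebesgue :: real measure)"
    using lebesgue_affine_measurable[where c="\<lambda>_::real. r" and t=0] assms(2) by simp
  then show ?thesis using measurable_compose assms(1) by blast
qed

lemma L2_scale:
  fixes f :: "real \<Rightarrow> complex"
  assumes f: "f \<in> L2_space" and r: "r > 0"
  shows "(\<lambda>x. f (r * x)) \<in> L2_space" "nsq (\<lambda>x. f (r * x)) = nsq f / r"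
proof -
  have m: "(\<lambda>x. f (r * x)) \<in> borel_measurable lebesgue" by (rule lebesgue_measurable_scale[OF L2_spaceD(1)[OF f]]) (use r in simp)
  have "integrable lebesgue (\<lambda>x. (\<lambda>y. (norm (f y))\<^sup>2) (0 + r * x))"
  proof (subst lebesgue_integrable_real_affine_iff)
    show "r \<noteq> 0" using r by simp
  qed (rule L2_spaceD(2)[OF f])
  then show "(\<lambda>x. f (r * x)) \<in> L2_space" using m unfolding L2_space_def by simp
  show "nsq (\<lambda>x. f (r * x)) = nsq f / r"
  proof -
    have "nsq f = \<bar>r\<bar> *\<^sub>R (LINT x|lebesgue. (\<lambda>y. (norm (f y))\<^sup>2) (0 + r * x))"
      unfolding nsq_def by (rule lebesgue_integral_real_affine) (use r in simp)
    also have "\<dots> = r * nsq (\<lambda>x. f (r * x))" unfolding nsq_def using r by simp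
    finally have "nsq f = r * nsq (\<lambda>x. f (r * x))" .
    then show ?thesis using r by simp
  qed
qed

text \<open>The shape of both errors below: bounded on a core of half-width \<open>m\<close>, small
  up to distance 2, zero beyond. With \<open>m\<close> of order \<epsilon> and \<open>J\<close> of
  order sqrt \<epsilon> both terms are of order \<epsilon>.\<close>

lemma boundary_layer_nsq:
  fixes h :: "real \<Rightarrow> complex"
  assumes h: "h \<in> borel_measurable lebesgue" and m: "m \<ge> 0" "D \<ge> 0" "J \<ge> 0"
    and b: "AE x in lebesgue. norm (h x) \<le> (if \<bar>x\<bar> < m then D else if \<bar>x\<bar> \<le> 2 then J else 0)"
  shows "h \<in> L2_space" "nsq h \<le> 2 * m * D\<^sup>2 + 4 * J\<^sup>2"
proof -
  have i: "integrable lebesgue (indicat_real {-y..y})" for y :: real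
    using lmeasurable_cbox[of "-y" y] by (simp add: lmeasurable_iff_integrable)
  have i2: "integrable lebesgue (\<lambda>x. indicat_real {-m..m} x * D\<^sup>2 + indicat_real {-2..2} x * J\<^sup>2)"
    using i[of m] i[of 2] by (intro Bochner_Integration.integrable_add integrable_mult_left) auto
  have "AE x in lebesgue. (norm (h x))\<^sup>2 \<le> indicat_real {-m..m} x * D\<^sup>2 + indicat_real {-2..2} x * J\<^sup>2"
    using b
  proof eventually_elim
    case (elim x)
    consider "\<bar>x\<bar> < m" | "\<not> \<bar>x\<bar> < m" "\<bar>x\<bar> \<le> 2" | "\<not> \<bar>x\<bar> < m" "\<not> \<bar>x\<bar> \<le> 2" by blast
    then show ?case
    proof cases
      case 1
      then have x: "x \<in> {-m..m}" by auto
      have "norm (h x) \<le> D" using elim 1 by simp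
      then have "(norm (h x))\<^sup>2 \<le> D\<^sup>2" by (intro power_mono) auto
      also have "\<dots> \<le> indicat_real {-m..m} x * D\<^sup>2 + indicat_real {-2..2} x * J\<^sup>2" using x by simp
      finally show ?thesis .
    next
      case 2
      then have x: "x \<in> {-2..2}" by auto
      have "norm (h x) \<le> J" using elim 2 by simp
      then have "(norm (h x))\<^sup>2 \<le> J\<^sup>2" by (intro power_mono) auto
      also have "\<dots> \<le> indicat_real {-m..m} x * D\<^sup>2 + indicat_real {-2..2} x * J\<^sup>2" using x by simp
      finally show ?thesis .
    next
      case 3 then show ?thesis using elim by simp
    qed
  qed
  note L = L2_bound[OF h i2 this]
  show "h \<in> L2_space" by (rule L(1))
  have "(LINT x|lebesgue. indicat_real {-m..m} x * D\<^sup>2 + indicat_real {-2..2} x * J\<^sup>2) =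
     (LINT x|lebesgue. indicat_real {-m..m} x * D\<^sup>2) + (LINT x|lebesgue. indicat_real {-2..2::real} x * J\<^sup>2)"
    using i[of m] i[of 2] by (intro Bochner_Integration.integral_add integrable_mult_left) auto
  also have "\<dots> = measure lebesgue {-m..m} * D\<^sup>2 + measure lebesgue {-2..2::real} * J\<^sup>2" by simp
  also have "\<dots> = 2 * m * D\<^sup>2 + 4 * J\<^sup>2" using m by simp
  finally show "nsq h \<le> 2 * m * D\<^sup>2 + 4 * J\<^sup>2" using L(2) by simp
qed

text \<open>Since \<open>f\<close> and \<open>g\<close> are square integrable, Cauchy-Schwarz makes
  the integral of \<open>norm (k x)\<close> over \<open>{0..y}\<close> of order sqrt y. So
  \<open>f1\<close> is Hoelder continuous of exponent 1/2 at 0 and \<open>f\<close> is Lipschitz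
  there, with a constant that depends on \<open>K\<close> and \<open>X\<close> only and is thus
  common to all \<open>g\<close> in the unit ball.\<close>

lemma edge_bounds:
  fixes g :: "real \<Rightarrow> complex"
  assumes H: "H2 f f1 k" and k: "AE x in lebesgue. 0 < x \<longrightarrow> x < 1 \<longrightarrow> norm (k x) \<le> K * norm (f x) + norm (g x)"
    and g: "g \<in> L2_space" "nsq g \<le> 1" and X: "integral {0..1} (\<lambda>x. (norm (f x))\<^sup>2) \<le> X" and K: "K \<ge> 0"
    and C: "C = 13 * ((1 + K) * (1 + X) + 1)" and x: "x \<in> {0..1}"
  shows "norm (f 0) \<le> C" "norm (f1 0) \<le> C" "norm (f1 x - f1 0) \<le> C * sqrt x" "norm (f x - f 0) \<le> C * x" "norm (f x) \<le> C"
proof -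
  have Pf: "is_primitive f f1" "is_primitive f1 k" using H unfolding H2_def by auto
  define S where "S = (1 + K) * (1 + X) + 1"
  \<comment> \<open>\<open>6 * S\<close> will bound the data at 0 and \<open>7 * S\<close> the slope
    on \<open>{0..1}\<close>; their sum bounds \<open>f\<close> on that interval.\<close>
  have CS: "C = 13 * S" unfolding C S_def by simp
  have ci: "(\<lambda>x. norm (f x)) integrable_on {a..b}" "(\<lambda>x. (norm (f x))\<^sup>2) integrable_on {a..b}" for a b
    by (intro integrable_continuous_real continuous_intros H2_continuous[OF H])+
  have nk: "(\<lambda>x. norm (k x)) integrable_on {a..b}" for a b
    using absolutely_integrable_norm[OF is_primitiveD(1)[OF Pf(2)]] set_lebesgue_integral_eq_integral(1) by (auto simp: o_def)
  have X0: "X \<ge> 0" using Henstock_Kurzweil_Integration.integral_nonneg[OF ci(2)[of 0 1]] X by simp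
  have S0: "S \<ge> 1" unfolding S_def using K X0 by simp
  obtain Z where Z: "negligible Z" "\<And>x. x \<notin> Z \<Longrightarrow> 0 < x \<Longrightarrow> x < 1 \<Longrightarrow> norm (k x) \<le> K * norm (f x) + norm (g x)"
    using k unfolding AE_lebesgue_negligible by blast
  have kx: "integral {0..y} (\<lambda>x. norm (k x)) \<le> (K * (1 + X) / 2 + 1) * sqrt y"
    and fx: "integral {0..y} (\<lambda>x. norm (f x)) \<le> (1 + X) / 2 * sqrt y" if y: "0 \<le> y" "y \<le> 1" for y
  proof -
    have gi: "(\<lambda>x. norm (g x)) integrable_on {0..y}" using L2_integral_norm_le(1)[OF g(1) y(1) zero_less_one] .
    have 1: "integral {0..y} (\<lambda>x. norm (f x)) \<le> (1 + X) / 2 * sqrt y \<and> integral {0..y} (\<lambda>x. norm (g x)) \<le> sqrt y"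
    proof (cases "y = 0")
      case False
      then have s: "sqrt y > 0" using y by simp
      \<comment> \<open>With the parameter \<open>1 / sqrt y\<close> both terms of the
        Cauchy-Schwarz bound are proportional to \<open>sqrt y\<close>.\<close>
      have e: "y * (1 / sqrt y) / 2 + z / (2 * (1 / sqrt y)) = (1 + z) / 2 * sqrt y" for z
      proof -
        have "y * (1 / sqrt y) = sqrt y" using real_div_sqrt[OF y(1)] by simp
        then show ?thesis by (simp only:) (simp add: field_simps)
      qed
      have "integral {0..y} (\<lambda>x. norm (f x)) \<le> (y - 0) * (1 / sqrt y) / 2 + integral {0..y} (\<lambda>x. (norm (f x))\<^sup>2) / (2 * (1 / sqrt y))"
        by (rule integral_norm_le_sq[OF ci]) (use s y in auto)
      also have "\<dots> = (1 + integral {0..y} (\<lambda>x. (norm (f x))\<^sup>2)) / 2 * sqrt y" using e by simp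
      also have "\<dots> \<le> (1 + X) / 2 * sqrt y"
      proof -
        have "integral {0..y} (\<lambda>x. (norm (f x))\<^sup>2) \<le> integral {0..1} (\<lambda>x. (norm (f x))\<^sup>2)"
          by (rule integral_subset_le[OF _ ci(2) ci(2)]) (use y in auto)
        then show ?thesis using X s by (intro mult_right_mono divide_right_mono) auto
      qed
      finally have a: "integral {0..y} (\<lambda>x. norm (f x)) \<le> (1 + X) / 2 * sqrt y" .
      have "integral {0..y} (\<lambda>x. norm (g x)) \<le> (y - 0) * (1 / sqrt y) / 2 + nsq g / (2 * (1 / sqrt y))"
        by (rule L2_integral_norm_le(2)[OF g(1) y(1)]) (use s in auto)
      also have "\<dots> = (1 + nsq g) / 2 * sqrt y" using e by simp
      also have "\<dots> \<le> 1 * sqrt y" using g(2) s by (intro mult_right_mono) auto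
      finally show ?thesis using a by simp
    qed simp
    show "integral {0..y} (\<lambda>x. norm (f x)) \<le> (1 + X) / 2 * sqrt y" using 1 by blast
    have ik: "(\<lambda>x. K * norm (f x) + norm (g x)) integrable_on {0..y}" by (intro integrable_add integrable_on_mult_right ci gi)
    have n: "negligible (Z \<union> {0, 1})" using Z(1) by auto
    have "integral {0..y} (\<lambda>x. norm (k x)) = integral {0..y} (\<lambda>x. if x \<in> Z \<union> {0, 1} then 0 else norm (k x))"
      by (rule integral_spike[OF n]) auto
    also have "\<dots> \<le> integral {0..y} (\<lambda>x. K * norm (f x) + norm (g x))"
    proof (rule integral_le[OF _ ik])
      show "(\<lambda>x. if x \<in> Z \<union> {0, 1} then 0 else norm (k x)) integrable_on {0..y}"
        by (rule integrable_spike[OF nk n]) auto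
      fix z assume "z \<in> {0..y}"
      then show "(if z \<in> Z \<union> {0, 1} then 0 else norm (k z)) \<le> K * norm (f z) + norm (g z)"
        using Z(2)[of z] y K by auto
    qed
    also have "\<dots> = K * integral {0..y} (\<lambda>x. norm (f x)) + integral {0..y} (\<lambda>x. norm (g x))"
      using Henstock_Kurzweil_Integration.integral_add[OF integrable_on_mult_right[OF ci(1), of K] gi] by simp
    also have "\<dots> \<le> K * ((1 + X) / 2 * sqrt y) + sqrt y" using 1 K by (intro add_mono mult_left_mono) auto
    finally show "integral {0..y} (\<lambda>x. norm (k x)) \<le> (K * (1 + X) / 2 + 1) * sqrt y" by (simp add: algebra_simps)
  qed
  have "integral {0..0+1} (\<lambda>x. norm (f x)) + integral {0..0+1} (\<lambda>x. norm (k x)) \<le> S"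
  proof -
    define p where "p = K * (1 + X)"
    have S': "S = (1 + X) + p + 1" unfolding S_def p_def by (simp add: algebra_simps)
    have p0: "p \<ge> 0" unfolding p_def using K X0 by simp
    have i1: "integral {0..0+1} (\<lambda>x. norm (f x)) \<le> (1 + X) / 2" using fx[of 1] by simp
    have i2: "integral {0..0+1} (\<lambda>x. norm (k x)) \<le> p / 2 + 1" using kx[of 1] unfolding p_def by simp
    have "(1 + X) / 2 + (p / 2 + 1) \<le> S" unfolding S' using X0 p0 by (simp add: field_simps)
    then show ?thesis using add_mono[OF i1 i2] by (rule order_trans[rotated])
  qed
  then have 6: "6 * (integral {0..0+1} (\<lambda>x. norm (f x)) + integral {0..0+1} (\<lambda>x. norm (k x))) \<le> 6 * S" by simp
  have f0: "norm (f 0) \<le> 6 * S" and f10: "norm (f1 0) \<le> 6 * S"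
    using order_trans[OF H2_endpoint_bound(1)[OF H] 6] order_trans[OF H2_endpoint_bound(2)[OF H] 6] by auto
  have kS: "(K * (1 + X) / 2 + 1) \<le> S" unfolding S_def using K X0 by (simp add: field_simps)
  have d1: "norm (f1 y - f1 0) \<le> S * sqrt y" if y: "0 \<le> y" "y \<le> 1" for y
  proof -
    have "norm (f1 y - f1 0) = norm (integral {0..y} k)" using is_primitiveD(3)[OF Pf(2) y(1)] by simp
    also have "\<dots> \<le> integral {0..y} (\<lambda>x. norm (k x))"
      by (rule Henstock_Kurzweil_Integration.integral_norm_bound_integral[OF is_primitiveD(2)[OF Pf(2)] nk]) auto
    also have "\<dots> \<le> S * sqrt y" using kx[OF y] kS y by (meson mult_right_mono order_trans real_sqrt_ge_zero)
    finally show ?thesis .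
  qed
  have b1: "norm (f1 y) \<le> 7 * S" if y: "0 \<le> y" "y \<le> 1" for y
  proof -
    have "S * sqrt y \<le> S * 1" using y S0 by (intro mult_left_mono) auto
    then show ?thesis using d1[OF y] f10 norm_triangle_sub[of "f1 y" "f1 0"] by linarith
  qed
  have d0: "norm (f x - f 0) \<le> 7 * S * x"
  proof -
    have "norm (f x - f 0) = norm (integral {0..x} f1)" using is_primitiveD(3)[OF Pf(1), of 0 x] x by simp
    also have "\<dots> \<le> integral {0..x} (\<lambda>_. 7 * S)"
      by (rule Henstock_Kurzweil_Integration.integral_norm_bound_integral[OF is_primitiveD(2)[OF Pf(1)]]) (use b1 x in auto)
    also have "\<dots> = 7 * S * x" using x by simp
    finally show ?thesis .
  qed
  show "norm (f 0) \<le> C" "norm (f1 0) \<le> C" using f0 f10 S0 unfolding CS by linarith+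
  have "S * sqrt x \<le> C * sqrt x" using S0 x unfolding CS by (intro mult_right_mono) auto
  then show "norm (f1 x - f1 0) \<le> C * sqrt x" using d1[of x] x by simp
  have "7 * S * x \<le> C * x" using S0 x unfolding CS by (intro mult_right_mono) auto
  then show "norm (f x - f 0) \<le> C * x" using d0 by simp
  have "7 * S * x \<le> 7 * S * 1" using S0 x by (intro mult_left_mono) auto
  then show "norm (f x) \<le> C" using d0 f0 norm_triangle_sub[of "f x" "f 0"] unfolding CS by linarith
qed

lemma edge_bounds_left:
  fixes g :: "real \<Rightarrow> complex"
  assumes H: "H2 f f1 k" and k: "AE x in lebesgue. -1 < x \<longrightarrow> x < 0 \<longrightarrow> norm (k x) \<le> K * norm (f x) + norm (g x)"
    and g: "g \<in> L2_space" "nsq g \<le> 1" and X: "integral {-1..0} (\<lambda>x. (norm (f x))\<^sup>2) \<le> X" and K: "K \<ge> 0"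
    and C: "C = 13 * ((1 + K) * (1 + X) + 1)" and x: "x \<in> {0..1}"
  shows "norm (f 0) \<le> C" "norm (f1 0) \<le> C" "norm (f1 (-x) - f1 0) \<le> C * sqrt x" "norm (f (-x) - f 0) \<le> C * x" "norm (f (-x)) \<le> C"
proof -
  have k': "AE x in lebesgue. 0 < x \<longrightarrow> x < 1 \<longrightarrow> norm (k (-x)) \<le> K * norm (f (-x)) + norm (g (-x))"
    using AE_lebesgue_reflect[OF k] by eventually_elim auto
  have g': "nsq (\<lambda>x. g (-x)) \<le> 1"
    using lebesgue_integral_real_affine[of "-1" "\<lambda>y. (norm (g y))\<^sup>2" 0] g(2) unfolding nsq_def by simp
  have X': "integral {0..1} (\<lambda>x. (norm (f (-x)))\<^sup>2) \<le> X"
    using Henstock_Kurzweil_Integration.integral_reflect_real[where f="\<lambda>x. (norm (f x))\<^sup>2" and a="-1" and b=0] X by simp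
  note E = edge_bounds[OF H2_reflect[OF H] k' L2_reflect[OF g(1)] g' X' K C x]
  show "norm (f 0) \<le> C" "norm (f1 0) \<le> C" "norm (f (-x) - f 0) \<le> C * x" "norm (f (-x)) \<le> C"
    using E(1,2,4,5) by simp_all
  show "norm (f1 (-x) - f1 0) \<le> C * sqrt x" using E(3) by (simp add: norm_minus_commute)
qed

subsection \<open>The resonant configuration\<close>

locale scattering = potential V c for V c +
  fixes \<phi>1 \<phi>2 q :: "real \<Rightarrow> real" and M qb \<kappa> a0 a1 a2 :: real
  assumes b1: "bump \<phi>1 M" and b2: "bump \<phi>2 M"
    and q_meas: "q \<in> borel_measurable lebesgue" and q_bound: "\<And>x. \<bar>q x\<bar> \<le> qb" and q_supp: "\<And>x. \<bar>x\<bar> > M \<Longrightarrow> q x = 0"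
    and orth: "L2_inner (antideriv1 \<phi>1) (antideriv1 \<phi>2) = 0"
    and norms: "L2_norm (antideriv1 \<phi>1) * L2_norm (antideriv1 \<phi>2) = 1"
    and \<kappa>_om: "\<kappa> = omega \<phi>1 \<phi>2 M" and \<kappa>0: "\<kappa> \<noteq> 0"
    and a0: "a0 = (LINT x|lebesgue. q x)"
    and a1: "a1 = (LINT x|lebesgue. q x * omega \<phi>1 \<phi>2 x)"
    and a2: "a2 = (LINT x|lebesgue. q x * (omega \<phi>1 \<phi>2 x)\<^sup>2)"
    and resonance: "a0 * a2 = a1\<^sup>2" "a2 \<noteq> \<kappa> * a1"
begin

abbreviation "F1 \<equiv> \<lambda>x. complex_of_real (\<phi>1 x)"
abbreviation "F2 \<equiv> \<lambda>x. complex_of_real (\<phi>2 x)"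
abbreviation "n1 \<equiv> L2_norm (antideriv1 \<phi>1)"
abbreviation "n2 \<equiv> L2_norm (antideriv1 \<phi>2)"

lemma integral_of_real:
  "f integrable_on A \<Longrightarrow> integral A (\<lambda>x. complex_of_real (f x)) = complex_of_real (integral A f)" for f :: "real \<Rightarrow> real" and A
  using integral_linear[of f A complex_of_real] by (simp add: o_def bounded_linear_of_real)

lemma antideriv_gram:
  assumes "bump \<phi> M" "bump \<psi> M"
  shows "integral {-M..M} (\<lambda>x. complex_of_real (antideriv1 \<phi> x) * complex_of_real (antideriv1 \<psi> x)) =
    complex_of_real (integral {-M..M} (\<lambda>x. antideriv1 \<phi> x * antideriv1 \<psi> x))"
proof -
  have "(\<lambda>x. antideriv1 \<phi> x * antideriv1 \<psi> x) integrable_on {-M..M}"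
    by (intro integrable_continuous_real continuous_intros bump.antideriv1_continuous[OF assms(1)] bump.antideriv1_continuous[OF assms(2)])
  from integral_of_real[OF this] show ?thesis by simp
qed

lemma M_pos: "M > 0" using b1 by (rule bump.M)

sublocale I: inner_problem F1 F2 "\<lambda>x. complex_of_real (antideriv1 \<phi>1 x)" "\<lambda>x. complex_of_real (antideriv1 \<phi>2 x)"
  "\<lambda>x. complex_of_real (antideriv2 \<phi>1 x)" "\<lambda>x. complex_of_real (antideriv2 \<phi>2 x)" M n1 n2 "complex_of_real \<kappa>"
proof
  show "H2 (\<lambda>x. complex_of_real (antideriv2 \<phi>1 x)) (\<lambda>x. complex_of_real (antideriv1 \<phi>1 x)) F1" by (rule bump.H2_antideriv[OF b1])
  show "H2 (\<lambda>x. complex_of_real (antideriv2 \<phi>2 x)) (\<lambda>x. complex_of_real (antideriv1 \<phi>2 x)) F2" by (rule bump.H2_antideriv[OF b2])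
  show "integral {-M..M} (\<lambda>x. complex_of_real (antideriv1 \<phi>1 x) * complex_of_real (antideriv1 \<phi>1 x)) = complex_of_real (n1\<^sup>2)"
    unfolding antideriv_gram[OF b1 b1] antideriv1_norm[OF b1] ..
  show "integral {-M..M} (\<lambda>x. complex_of_real (antideriv1 \<phi>2 x) * complex_of_real (antideriv1 \<phi>2 x)) = complex_of_real (n2\<^sup>2)"
    unfolding antideriv_gram[OF b2 b2] antideriv1_norm[OF b2] ..
  show "integral {-M..M} (\<lambda>x. complex_of_real (antideriv1 \<phi>1 x) * complex_of_real (antideriv1 \<phi>2 x)) = 0"
    unfolding antideriv_gram[OF b1 b2] antideriv1_inner[OF b1 b2, symmetric] orth by simp
  show "complex_of_real \<kappa> = complex_of_real n2 * complex_of_real (antideriv2 \<phi>1 M) - complex_of_real n1 * complex_of_real (antideriv2 \<phi>2 M)"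
    unfolding \<kappa>_om omega_def by simp
qed (use M_pos norms \<kappa>0 in \<open>auto simp: bump.antideriv1_left[OF b1] bump.antideriv1_left[OF b2] bump.antideriv1_right[OF b1]
   bump.antideriv1_right[OF b2] bump.antideriv2_left[OF b1] bump.antideriv2_left[OF b2]\<close>)

lemma om_omega: "I.om x = complex_of_real (omega \<phi>1 \<phi>2 x)"
  unfolding I.om_def omega_def by simp

lemma omega_continuous: "continuous_on UNIV (omega \<phi>1 \<phi>2)"
proof -
  have "continuous_on UNIV (\<lambda>x. Re (I.om x))" by (intro continuous_intros H2_continuous[OF I.H2_om])
  then show ?thesis unfolding om_omega by simp
qed

lemma q_moment:
  assumes w: "continuous_on UNIV w"
  shows "(\<lambda>x. complex_of_real (q x) * complex_of_real (w x)) absolutely_integrable_on {a..b}"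
    "integral {-M..M} (\<lambda>x. complex_of_real (q x) * complex_of_real (w x)) = complex_of_real (LINT x|lebesgue. q x * w x)"
proof -
  have qb0: "qb \<ge> 0" using q_bound[of 0] by linarith
  have lb: "loc_bounded (\<lambda>x. complex_of_real (q x))"
    unfolding loc_bounded_def using q_meas q_bound qb0 by auto
  have wc: "continuous_on UNIV (\<lambda>x. complex_of_real (w x))" by (intro continuous_intros w)
  show abs: "(\<lambda>x. complex_of_real (q x) * complex_of_real (w x)) absolutely_integrable_on {a..b}" for a b
    by (rule loc_bounded_mult_abs_integrable[OF lb wc])
  have ir: "(\<lambda>x. q x * w x) absolutely_integrable_on {-M..M}"
    using absolutely_integrable_linear[OF abs[of "-M" M] bounded_linear_Re] by (simp add: o_def)
  have "(LINT x|lebesgue. q x * w x) = (LINT x:{-M..M}|lebesgue. q x * w x)"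
    unfolding set_lebesgue_integral_def
  proof (intro Bochner_Integration.integral_cong refl)
    fix x :: real
    show "q x * w x = indicat_real {-M..M} x *\<^sub>R (q x * w x)"
      using q_supp[of x] by (cases "\<bar>x\<bar> > M") (auto simp: indicator_def)
  qed
  also have "\<dots> = integral {-M..M} (\<lambda>x. q x * w x)" by (rule set_lebesgue_integral_eq_integral(2)[OF ir])
  finally show "integral {-M..M} (\<lambda>x. complex_of_real (q x) * complex_of_real (w x)) = complex_of_real (LINT x|lebesgue. q x * w x)"
    using integral_of_real[OF set_lebesgue_integral_eq_integral(1)[OF ir]] by simp
qed

definition "\<alpha> = (a2 - \<kappa> * a1) / a2"
definition "\<beta> = \<kappa>\<^sup>2 / (a2 - \<kappa> * a1)"

text \<open>If \<open>a2\<close> were 0, the resonance identity would give \<open>a1 = 0\<close> and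
  hence \<open>a2 = \<kappa> * a1\<close>.\<close>

lemma a2_nonzero: "a2 \<noteq> 0"
  using resonance by auto

lemma \<alpha>_nonzero: "\<alpha> \<noteq> 0"
  unfolding \<alpha>_def using a2_nonzero resonance by simp

text \<open>With \<open>d = a2 - \<kappa> * a1\<close> the interface conditions give
  \<open>s = \<kappa> / d * fm1 - a1 / a2 * fm\<close>. In the first identity the terms with
  \<open>fm\<close> cancel at once, in the second because \<open>a0 = a1\<^sup>2 / a2\<close>. The
  left sides are the moments of \<open>q\<close> against the profile
  \<open>fm + s * \<omega>\<close>: paired with \<open>\<omega>\<close> they give
  \<open>\<kappa>\<close> times the right slope of the corrector, and integrated they give the jump
  of its slope.\<close>

lemma matching:
  fixes fm fm1 fp fp1 s :: complex
  assumes if0: "fp = complex_of_real \<alpha> * fm + complex_of_real \<beta> * fm1" "fp1 = complex_of_real (inverse \<alpha>) * fm1"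
    and s: "s = (fp - fm) / complex_of_real \<kappa>"
  shows "fm * complex_of_real a1 + s * complex_of_real a2 = complex_of_real \<kappa> * fp1"
    "fp1 - (fm * complex_of_real a0 + s * complex_of_real a1) = fm1"
proof -
  define d where "d = a2 - \<kappa> * a1"
  have d: "d \<noteq> 0" unfolding d_def using resonance by simp
  have nz: "complex_of_real a2 \<noteq> 0" "complex_of_real d \<noteq> 0" "complex_of_real \<kappa> \<noteq> 0" using a2_nonzero d \<kappa>0 by simp_all
  have a0': "complex_of_real a0 = (complex_of_real a1)\<^sup>2 / complex_of_real a2"
    using resonance(1) a2_nonzero by (simp add: field_simps flip: of_real_mult of_real_power)
  have \<alpha>': "complex_of_real \<alpha> = complex_of_real d / complex_of_real a2" unfolding \<alpha>_def d_def by simp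
  have \<beta>': "complex_of_real \<beta> = (complex_of_real \<kappa>)\<^sup>2 / complex_of_real d" unfolding \<beta>_def d_def by simp
  have p1: "fp1 = complex_of_real a2 / complex_of_real d * fm1" unfolding if0(2) of_real_inverse \<alpha>' by simp
  have dd: "complex_of_real d = complex_of_real a2 - complex_of_real \<kappa> * complex_of_real a1" unfolding d_def by simp
  have "fp - fm = complex_of_real \<kappa> * (complex_of_real \<kappa> / complex_of_real d * fm1 - complex_of_real a1 / complex_of_real a2 * fm)"
    unfolding if0(1) \<alpha>' \<beta>' using nz by (simp add: field_simps power2_eq_square) (simp add: dd algebra_simps)
  then have s': "s = complex_of_real \<kappa> / complex_of_real d * fm1 - complex_of_real a1 / complex_of_real a2 * fm"
    unfolding s using nz by simp
  show "fm * complex_of_real a1 + s * complex_of_real a2 = complex_of_real \<kappa> * fp1"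
    unfolding s' p1 using nz by (simp add: field_simps)
  have "fp1 - fm1 = complex_of_real \<kappa> * complex_of_real a1 / complex_of_real d * fm1"
    unfolding p1 using nz by (simp add: field_simps) (simp add: dd algebra_simps)
  moreover have "fm * complex_of_real a0 + s * complex_of_real a1 = complex_of_real \<kappa> * complex_of_real a1 / complex_of_real d * fm1"
    unfolding s' a0' using nz by (simp add: field_simps power2_eq_square)
  ultimately show "fp1 - (fm * complex_of_real a0 + s * complex_of_real a1) = fm1"
    by (simp add: algebra_simps)
qed

end

context scattering
begin

text \<open>The outer solution is kept away from the origin and joined at \<open>\<plusminus> M \<epsilon>\<close> to a solution of the scaled inner
  problem. The jumps at the joints are of order \<open>\<epsilon>\<close> in the value and \<open>sqrt \<epsilon>\<close> in the derivative and are
  removed by cut-off functions that live outside the support of the perturbation.\<close>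

definition "S\<epsilon> \<epsilon> = S_eps V \<phi>1 \<phi>2 q \<epsilon>"

lemma qb_nonneg: "qb \<ge> 0"
  using q_bound[of 0] by linarith

lemma perturbed_scaled:
  assumes \<epsilon>: "\<epsilon> > 0"
  shows "perturbed V c (\<lambda>x. F1 (1 / \<epsilon> * x)) (\<lambda>x. F2 (1 / \<epsilon> * x)) (\<lambda>x. 1 / \<epsilon> * q (1 / \<epsilon> * x)) (1 / \<epsilon> * qb)"
proof
  show "(\<lambda>x. F1 (1 / \<epsilon> * x)) \<in> L2_space" "(\<lambda>x. F2 (1 / \<epsilon> * x)) \<in> L2_space"
    using L2_scale(1)[OF bump.complex_L2[OF b1], of "1 / \<epsilon>"] L2_scale(1)[OF bump.complex_L2[OF b2], of "1 / \<epsilon>"] \<epsilon> by auto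
  have "(\<lambda>x. q (1 / \<epsilon> * x)) \<in> borel_measurable lebesgue"
    by (rule lebesgue_measurable_scale[OF q_meas]) (use \<epsilon> in simp)
  then show "(\<lambda>x. 1 / \<epsilon> * q (1 / \<epsilon> * x)) \<in> borel_measurable lebesgue" by (intro borel_measurable_times) auto
  show "\<bar>1 / \<epsilon> * q (1 / \<epsilon> * x)\<bar> \<le> 1 / \<epsilon> * qb" for x
    unfolding abs_mult using \<epsilon> q_bound by (intro mult_mono) auto
qed simp_all

lemma S_eps_pert:
  assumes \<epsilon>: "\<epsilon> > 0"
  shows "S\<epsilon> \<epsilon> = perturbed.S_pert V (\<lambda>x. F1 (1 / \<epsilon> * x)) (\<lambda>x. F2 (1 / \<epsilon> * x)) (1 / \<epsilon> ^ 3) (\<lambda>x. 1 / \<epsilon> * q (1 / \<epsilon> * x))"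
  unfolding perturbed.S_pert_def[OF perturbed_scaled[OF \<epsilon>]] perturbed.pert_def[OF perturbed_scaled[OF \<epsilon>]]
    S\<epsilon>_def S_eps_def S0_def B_op_def by (simp add: add.assoc)

section \<open>The first-order profile in the core\<close>

lemma continuous_bounded_on_core:
  assumes "continuous_on UNIV u"
  obtains B where "B \<ge> 0" "\<And>x. x \<in> {-M..M} \<Longrightarrow> norm (u x :: complex) \<le> B"
proof -
  obtain B where B: "\<And>x. x \<in> {-M..M} \<Longrightarrow> norm (u x) \<le> B"
    using continuous_on_compact_bound[OF compact_Icc continuous_on_subset[OF assms]] by blast
  have "0 \<in> {-M..M}" using M_pos by auto
  then have "B \<ge> 0" using B norm_ge_zero order_trans by blast
  then show thesis using B that by blast
qed

text \<open>The forcing consists of \<open>\<epsilon> * q * v0\<close> and a multiple of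
  \<open>g (\<epsilon> * x)\<close>. By \<open>inner_solution_exists\<close> the slopes at the ends
  are \<epsilon> times moments of \<open>q\<close> plus a contribution of \<open>g\<close>;
  \<open>matching\<close> identifies the moments with the slopes of the outer solution, and the
  contribution of \<open>g\<close> is O(sqrt \<epsilon>) after division by \<epsilon>.\<close>

lemma inner_approximation:
  obtains C0 where "C0 \<ge> 0" "\<And>\<epsilon> g A b fp fp1 C. 0 < \<epsilon> \<Longrightarrow> \<epsilon> \<le> 1 \<Longrightarrow> g \<in> L2_space \<Longrightarrow> nsq g \<le> 1 \<Longrightarrow>
    norm A \<le> C \<Longrightarrow> norm fp \<le> C \<Longrightarrow> C \<ge> 1 \<Longrightarrow>
    fp = complex_of_real \<alpha> * A + complex_of_real \<beta> * b \<Longrightarrow> fp1 = complex_of_real (inverse \<alpha>) * b \<Longrightarrow>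
    \<exists>v (v1::real \<Rightarrow> complex) (v0::real \<Rightarrow> complex). H2 v v1 (\<lambda>x. (\<epsilon> * q x * v0 x - complex_of_real (\<epsilon>\<^sup>2) * g (\<epsilon> * x)) + I.pair F2 v * F1 x + I.pair F1 v * F2 x) \<and>
      continuous_on UNIV v0 \<and> v0 (-M) = A \<and> v0 M = fp \<and>
      norm (v1 (-M) / \<epsilon> - b) \<le> C0 * C * sqrt \<epsilon> \<and> norm (v1 M / \<epsilon> - fp1) \<le> C0 * C * sqrt \<epsilon> \<and>
      (\<forall>x\<in>{-M..M}. norm (v0 x) \<le> C0 * C \<and> norm (v x - v0 x) \<le> C0 * C * \<epsilon>)"
proof -
  obtain Ci where Ci: "Ci \<ge> 0" "\<And>k A s. (\<And>a b. k absolutely_integrable_on {a..b}) \<Longrightarrow>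
     \<exists>v v1. H2 v v1 (\<lambda>x. k x + I.pair F2 v * F1 x + I.pair F1 v * F2 x) \<and>
       v1 (-M) = I.pair k I.om / \<kappa> - integral {-M..M} k \<and> v1 M = I.pair k I.om / \<kappa> \<and>
       (\<forall>x\<in>{-M..M}. norm (v x - (A + s * I.om x)) \<le> Ci * integral {-M..M} (\<lambda>x. norm (k x)))"
    using I.inner_solution_exists by blast
  have omc: "continuous_on UNIV I.om" using H2_continuous[OF I.H2_om] by auto
  obtain Bo where Bo: "Bo \<ge> 0" "\<And>x. x \<in> {-M..M} \<Longrightarrow> norm (I.om x) \<le> Bo" using continuous_bounded_on_core[OF omc] by blast
  \<comment> \<open>\<open>cg * sqrt \<epsilon>\<close> will bound \<epsilon> times the integral of
    the norm of the scaled \<open>g\<close>, \<open>W * C\<close> the profile \<open>v0\<close>, and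
    \<open>cK * C * \<epsilon>\<close> the integral of the norm of the forcing.\<close>
  define cg where "cg = M + 1"
  define W where "W = 1 + 2 * Bo / \<bar>\<kappa>\<bar>"
  define cK where "cK = 2 * M * qb * W + cg"
  define C0 where "C0 = W + Ci * cK + (Bo / \<bar>\<kappa>\<bar> * cg + cg)"
  have nn: "cg \<ge> 0" "W \<ge> 0" "cK \<ge> 0" unfolding cg_def W_def cK_def using M_pos Bo qb_nonneg \<kappa>0
    by (auto intro!: add_nonneg_nonneg mult_nonneg_nonneg divide_nonneg_nonneg)
  have C00: "C0 \<ge> 0" unfolding C0_def using nn Ci(1) Bo by (auto intro!: add_nonneg_nonneg mult_nonneg_nonneg divide_nonneg_nonneg)
  show thesis
  proof (rule that[OF C00])
    fix \<epsilon> C :: real and g :: "real \<Rightarrow> complex" and A b fp fp1 :: complex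
    assume \<epsilon>: "0 < \<epsilon>" "\<epsilon> \<le> 1" and g: "g \<in> L2_space" "nsq g \<le> 1" and AC: "norm A \<le> C" "norm fp \<le> C" "C \<ge> 1"
      and if0: "fp = complex_of_real \<alpha> * A + complex_of_real \<beta> * b" "fp1 = complex_of_real (inverse \<alpha>) * b"
    \<comment> \<open>\<open>I.om\<close> rises from 0 to \<open>\<kappa>\<close> across the core,
      so this coefficient takes the profile from \<open>A\<close> at \<open>-M\<close> to
      \<open>fp\<close> at \<open>M\<close>.\<close>
    define s where "s = (fp - A) / complex_of_real \<kappa>"
    define v0 where "v0 x = A + s * I.om x" for x
    have v0c: "continuous_on UNIV v0" unfolding v0_def[abs_def] by (intro continuous_intros omc)
    have v0m: "v0 (-M) = A" "v0 M = fp" unfolding v0_def s_def using I.om_bc \<kappa>0 by simp_all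
    have sb: "norm s \<le> 2 * C / \<bar>\<kappa>\<bar>"
    proof -
      have "norm (fp - A) \<le> 2 * C" using AC norm_triangle_ineq4[of fp A] by linarith
      then show ?thesis unfolding s_def norm_divide norm_of_real by (rule divide_right_mono) simp
    qed
    have v0b: "norm (v0 x) \<le> W * C" if x: "x \<in> {-M..M}" for x
    proof -
      have "norm (s * I.om x) \<le> 2 * C / \<bar>\<kappa>\<bar> * Bo" unfolding norm_mult using sb Bo(2)[OF x] AC by (intro mult_mono) auto
      then have "norm (v0 x) \<le> C + 2 * C / \<bar>\<kappa>\<bar> * Bo" unfolding v0_def using AC(1) norm_triangle_ineq[of A "s * I.om x"] by linarith
      also have "\<dots> = W * C" unfolding W_def by (simp add: algebra_simps)
      finally show ?thesis .
    qed
    define ge where "ge x = g (\<epsilon> * x)" for x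
    have geL: "ge \<in> L2_space" and gen: "nsq ge \<le> 1 / \<epsilon>"
      unfolding ge_def[abs_def] using L2_scale[OF g(1) \<epsilon>(1)] g(2) \<epsilon> by (auto simp: divide_right_mono)
    have gei: "ge absolutely_integrable_on {a..b}" for a b by (rule L2_abs_integrable[OF geL])
    have se: "sqrt \<epsilon> > 0" "sqrt \<epsilon> * sqrt \<epsilon> = \<epsilon>" "sqrt \<epsilon> \<le> 1" using \<epsilon> by auto
    \<comment> \<open>Scaling raises the squared norm of \<open>g\<close> to at most
      \<open>1 / \<epsilon>\<close>; the parameter \<open>1 / sqrt \<epsilon>\<close> balances this
      against the length of the core.\<close>
    have g1: "\<epsilon> * integral {-M..M} (\<lambda>x. norm (ge x)) \<le> cg * sqrt \<epsilon>"
    proof -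
      have "integral {-M..M} (\<lambda>x. norm (ge x)) \<le> (M - -M) * (1 / sqrt \<epsilon>) / 2 + nsq ge / (2 * (1 / sqrt \<epsilon>))"
        by (rule L2_integral_norm_le(2)[OF geL]) (use M_pos se in auto)
      also have "\<dots> \<le> M / sqrt \<epsilon> + (1 / \<epsilon>) * sqrt \<epsilon>"
      proof (rule add_mono)
        have "nsq ge / (2 * (1 / sqrt \<epsilon>)) = nsq ge * sqrt \<epsilon> / 2" using se by simp
        also have "\<dots> \<le> nsq ge * sqrt \<epsilon>" using nsq_nonneg[of ge] se by simp
        also have "\<dots> \<le> (1 / \<epsilon>) * sqrt \<epsilon>" using gen se by (intro mult_right_mono) auto
        finally show "nsq ge / (2 * (1 / sqrt \<epsilon>)) \<le> (1 / \<epsilon>) * sqrt \<epsilon>" .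
      qed simp
      also have "(1 / \<epsilon>) * sqrt \<epsilon> = 1 / sqrt \<epsilon>"
      proof -
        have "sqrt \<epsilon> = \<epsilon> / sqrt \<epsilon>" using real_div_sqrt \<epsilon> by simp
        then show ?thesis using \<epsilon> by (metis divide_divide_eq_left' less_irrefl mult.commute mult.right_neutral nonzero_mult_div_cancel_left times_divide_eq_left times_divide_eq_right)
      qed
      also have "M / sqrt \<epsilon> + 1 / sqrt \<epsilon> = cg / sqrt \<epsilon>" unfolding cg_def by (simp add: add_divide_distrib)
      finally have "\<epsilon> * integral {-M..M} (\<lambda>x. norm (ge x)) \<le> \<epsilon> * (cg / sqrt \<epsilon>)" using \<epsilon> by (intro mult_left_mono) auto
      also have "\<dots> = cg * (\<epsilon> / sqrt \<epsilon>)" by simp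
      also have "\<epsilon> / sqrt \<epsilon> = sqrt \<epsilon>" using real_div_sqrt \<epsilon> by simp
      finally show ?thesis .
    qed
    have lq: "loc_bounded (\<lambda>x. complex_of_real (q x))"
      unfolding loc_bounded_def using q_meas q_bound qb_nonneg by auto
    have qv: "(\<lambda>x. complex_of_real (q x) * v0 x) absolutely_integrable_on {a..b}" for a b
      by (rule loc_bounded_mult_abs_integrable[OF lq v0c])
    define k where "k x = \<epsilon> * q x * v0 x - \<epsilon>\<^sup>2 * ge x" for x
    have kabs: "k absolutely_integrable_on {a..b}" for a b
    proof -
      have "(\<lambda>x. complex_of_real \<epsilon> * (complex_of_real (q x) * v0 x) - complex_of_real (\<epsilon>\<^sup>2) * ge x) absolutely_integrable_on {a..b}"
        by (intro set_integral_diff(1) set_integrable_mult_right qv gei)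
      then show ?thesis unfolding k_def[abs_def] by (simp add: mult.assoc)
    qed
    have nki: "(\<lambda>x. norm (k x)) integrable_on {-M..M}" and ngi: "(\<lambda>x. norm (ge x)) integrable_on {-M..M}"
      using absolutely_integrable_norm[OF kabs[of "-M" M]] absolutely_integrable_norm[OF gei[of "-M" M]] set_lebesgue_integral_eq_integral(1)
      by (auto simp: o_def)
    have kK: "integral {-M..M} (\<lambda>x. norm (k x)) \<le> cK * C * \<epsilon>"
    proof -
      have "integral {-M..M} (\<lambda>x. norm (k x)) \<le> integral {-M..M} (\<lambda>x. \<epsilon> * qb * (W * C) + \<epsilon>\<^sup>2 * norm (ge x))"
      proof (rule integral_le[OF nki])
        show "(\<lambda>x. \<epsilon> * qb * (W * C) + \<epsilon>\<^sup>2 * norm (ge x)) integrable_on {-M..M}"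
          by (intro integrable_add integrable_const_ivl integrable_on_mult_right ngi)
        fix x assume x: "x \<in> {-M..M}"
        have "\<bar>\<epsilon> * q x\<bar> \<le> \<epsilon> * qb" using q_bound[of x] \<epsilon> by (simp add: abs_mult)
        then have "norm (\<epsilon> * q x * v0 x) \<le> (\<epsilon> * qb) * (W * C)"
          unfolding norm_mult norm_of_real using v0b[OF x] \<epsilon> qb_nonneg by (intro mult_mono) auto
        moreover have "norm (complex_of_real (\<epsilon>\<^sup>2) * ge x) = \<epsilon>\<^sup>2 * norm (ge x)"
          unfolding norm_mult norm_of_real by simp
        ultimately show "norm (k x) \<le> \<epsilon> * qb * (W * C) + \<epsilon>\<^sup>2 * norm (ge x)"
          unfolding k_def using norm_triangle_ineq4[of "\<epsilon> * q x * v0 x" "\<epsilon>\<^sup>2 * ge x"] by linarith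
      qed
      also have "\<dots> = 2 * M * (\<epsilon> * qb * (W * C)) + \<epsilon> * (\<epsilon> * integral {-M..M} (\<lambda>x. norm (ge x)))"
        using Henstock_Kurzweil_Integration.integral_add[OF integrable_const_ivl[of "\<epsilon> * qb * (W * C)" "-M" M] integrable_on_mult_right[OF ngi, of "\<epsilon>\<^sup>2"]] M_pos
        by (simp add: power2_eq_square mult.assoc)
      also have "\<dots> \<le> 2 * M * (\<epsilon> * qb * (W * C)) + \<epsilon> * (cg * sqrt \<epsilon>)" using g1 \<epsilon> by (intro add_left_mono mult_left_mono) auto
      also have "\<dots> \<le> 2 * M * (\<epsilon> * qb * (W * C)) + \<epsilon> * (cg * C)"
        using order.trans[of "sqrt \<epsilon>" 1 C] AC(3) nn \<epsilon> by (intro add_left_mono mult_left_mono) auto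
      also have "\<dots> = cK * C * \<epsilon>" unfolding cK_def by (simp add: algebra_simps)
      finally show ?thesis .
    qed
    have ki: "integral {-M..M} k = \<epsilon> * (A * a0 + s * a1) - \<epsilon>\<^sup>2 * integral {-M..M} ge"
      and ko: "I.pair k I.om = \<epsilon> * (A * a1 + s * a2) - \<epsilon>\<^sup>2 * I.pair ge I.om"
    proof -
      have c: "continuous_on UNIV (\<lambda>x. 1 :: real)" "continuous_on UNIV (omega \<phi>1 \<phi>2)" "continuous_on UNIV (\<lambda>x. (omega \<phi>1 \<phi>2 x)\<^sup>2)"
        by (intro continuous_intros omega_continuous)+
      have qi: "(\<lambda>x. complex_of_real (q x) * complex_of_real (w x)) integrable_on {-M..M}" if "continuous_on UNIV w" for w
        using q_moment(1)[OF that] set_lebesgue_integral_eq_integral(1) by blast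
      have gi: "ge integrable_on {-M..M}" using gei set_lebesgue_integral_eq_integral(1) by blast
      have goi: "(\<lambda>x. ge x * I.om x) integrable_on {-M..M}"
        using I.pair_lin(2)[OF gei omc omc] set_lebesgue_integral_eq_integral(1) by blast
      have comb: "integral {-M..M} (\<lambda>x. \<epsilon> * (A * Q1 x + s * Q2 x) - \<epsilon>\<^sup>2 * G x) =
         \<epsilon> * (A * integral {-M..M} Q1 + s * integral {-M..M} Q2) - \<epsilon>\<^sup>2 * integral {-M..M} G"
        if "Q1 integrable_on {-M..M}" "Q2 integrable_on {-M..M}" "G integrable_on {-M..M}" for Q1 Q2 G :: "real \<Rightarrow> complex"
      proof (rule integral_unique)
        show "((\<lambda>x. \<epsilon> * (A * Q1 x + s * Q2 x) - \<epsilon>\<^sup>2 * G x) has_integral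
          \<epsilon> * (A * integral {-M..M} Q1 + s * integral {-M..M} Q2) - \<epsilon>\<^sup>2 * integral {-M..M} G) {-M..M}"
          using that by (intro has_integral_diff has_integral_add has_integral_mult_right integrable_integral)
      qed
      have "integral {-M..M} k = integral {-M..M} (\<lambda>x. \<epsilon> * (A * (complex_of_real (q x) * complex_of_real 1) +
          s * (complex_of_real (q x) * complex_of_real (omega \<phi>1 \<phi>2 x))) - \<epsilon>\<^sup>2 * ge x)"
        unfolding k_def v0_def om_omega by (simp add: algebra_simps)
      also have "\<dots> = \<epsilon> * (A * a0 + s * a1) - \<epsilon>\<^sup>2 * integral {-M..M} ge"
        unfolding comb[OF qi[OF c(1)] qi[OF c(2)] gi] q_moment(2)[OF c(1)] q_moment(2)[OF c(2)] a0 a1 by simp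
      finally show "integral {-M..M} k = \<epsilon> * (A * a0 + s * a1) - \<epsilon>\<^sup>2 * integral {-M..M} ge" .
      have "I.pair k I.om = integral {-M..M} (\<lambda>x. \<epsilon> * (A * (complex_of_real (q x) * complex_of_real (omega \<phi>1 \<phi>2 x)) +
          s * (complex_of_real (q x) * complex_of_real ((omega \<phi>1 \<phi>2 x)\<^sup>2))) - \<epsilon>\<^sup>2 * (ge x * I.om x))"
        unfolding I.pair_def k_def v0_def om_omega by (simp add: algebra_simps power2_eq_square)
      also have "\<dots> = \<epsilon> * (A * a1 + s * a2) - \<epsilon>\<^sup>2 * I.pair ge I.om"
        unfolding comb[OF qi[OF c(2)] qi[OF c(3)] goi] q_moment(2)[OF c(2)] q_moment(2)[OF c(3)] a1 a2 I.pair_def by simp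
      finally show "I.pair k I.om = \<epsilon> * (A * a1 + s * a2) - \<epsilon>\<^sup>2 * I.pair ge I.om" .
    qed
    note mt = matching[OF if0 s_def]
    obtain v v1 where v: "H2 v v1 (\<lambda>x. k x + I.pair F2 v * F1 x + I.pair F1 v * F2 x)"
       "v1 (-M) = I.pair k I.om / \<kappa> - integral {-M..M} k" "v1 M = I.pair k I.om / \<kappa>"
       "\<And>x. x \<in> {-M..M} \<Longrightarrow> norm (v x - (A + s * I.om x)) \<le> Ci * integral {-M..M} (\<lambda>x. norm (k x))"
      using Ci(2)[of k A s, OF kabs] by blast
    have \<epsilon>c: "complex_of_real \<epsilon> \<noteq> 0" and \<kappa>c: "complex_of_real \<kappa> \<noteq> 0" using \<epsilon> \<kappa>0 by auto
    \<comment> \<open>The moments of \<open>q\<close> cancel against \<open>fp1\<close> by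
      \<open>matching\<close>, and only the contribution of \<open>g\<close> survives.\<close>
    have vM: "v1 M / \<epsilon> - fp1 = - (\<epsilon> * I.pair ge I.om / \<kappa>)"
      unfolding v(3) ko mt(1) using \<epsilon>c \<kappa>c by (simp add: field_simps power2_eq_square)
    have vm: "v1 (-M) / \<epsilon> - b = - (\<epsilon> * I.pair ge I.om / \<kappa>) + \<epsilon> * integral {-M..M} ge"
    proof -
      have "v1 (-M) / \<epsilon> = v1 M / \<epsilon> - integral {-M..M} k / \<epsilon>" unfolding v(2,3) by (simp add: diff_divide_distrib)
      also have "integral {-M..M} k / \<epsilon> = (A * a0 + s * a1) - \<epsilon> * integral {-M..M} ge"
        unfolding ki using \<epsilon>c by (simp add: field_simps power2_eq_square)
      finally have p: "v1 (-M) / \<epsilon> = v1 M / \<epsilon> - ((A * a0 + s * a1) - \<epsilon> * integral {-M..M} ge)" .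
      have R: "fp1 = b + (A * a0 + s * a1)" using mt(2) by (simp add: algebra_simps)
      have "v1 M / \<epsilon> = fp1 - \<epsilon> * I.pair ge I.om / \<kappa>" using vM by (metis add.commute add_uminus_conv_diff diff_add_cancel)
      then show ?thesis unfolding p R by simp
    qed
    have gb: "norm (\<epsilon> * I.pair ge I.om / \<kappa>) \<le> Bo / \<bar>\<kappa>\<bar> * cg * sqrt \<epsilon>"
    proof -
      have "norm (I.pair ge I.om) \<le> Bo * integral {-M..M} (\<lambda>x. norm (ge x))" by (rule I.pair_norm_le[OF gei omc Bo(2)])
      then have "norm (\<epsilon> * I.pair ge I.om / \<kappa>) \<le> \<epsilon> * (Bo * integral {-M..M} (\<lambda>x. norm (ge x))) / \<bar>\<kappa>\<bar>"
        unfolding norm_divide norm_mult norm_of_real using \<epsilon> by (intro divide_right_mono mult_mono) auto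
      also have "\<dots> = Bo / \<bar>\<kappa>\<bar> * (\<epsilon> * integral {-M..M} (\<lambda>x. norm (ge x)))" by simp
      also have "\<dots> \<le> Bo / \<bar>\<kappa>\<bar> * (cg * sqrt \<epsilon>)" using g1 Bo(1) by (intro mult_left_mono) auto
      finally show ?thesis by simp
    qed
    have gb2: "norm (\<epsilon> * integral {-M..M} ge) \<le> cg * sqrt \<epsilon>"
    proof -
      have "ge integrable_on {-M..M}" using gei set_lebesgue_integral_eq_integral(1) by blast
      then have "norm (integral {-M..M} ge) \<le> integral {-M..M} (\<lambda>x. norm (ge x))"
        by (rule Henstock_Kurzweil_Integration.integral_norm_bound_integral[OF _ ngi]) auto
      then have "norm (\<epsilon> * integral {-M..M} ge) \<le> \<epsilon> * integral {-M..M} (\<lambda>x. norm (ge x))"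
        unfolding norm_mult using \<epsilon> by simp
      then show ?thesis using g1 by linarith
    qed
    define D where "D = Bo / \<bar>\<kappa>\<bar> * cg + cg"
    have D: "D * sqrt \<epsilon> \<le> C0 * C * sqrt \<epsilon>"
    proof -
      have "D \<le> C0 * 1" unfolding C0_def D_def using nn Ci(1) by simp
      also have "\<dots> \<le> C0 * C" using C00 AC(3) by (intro mult_left_mono) auto
      finally show ?thesis using se by (intro mult_right_mono) auto
    qed
    have e1: "norm (v1 M / \<epsilon> - fp1) \<le> C0 * C * sqrt \<epsilon>"
    proof -
      have "norm (v1 M / \<epsilon> - fp1) \<le> Bo / \<bar>\<kappa>\<bar> * cg * sqrt \<epsilon>" unfolding vM norm_minus_cancel by (rule gb)
      also have "\<dots> \<le> D * sqrt \<epsilon>" unfolding D_def using nn se by (intro mult_right_mono) auto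
      finally show ?thesis using D by linarith
    qed
    have e2: "norm (v1 (-M) / \<epsilon> - b) \<le> C0 * C * sqrt \<epsilon>"
    proof -
      have "norm (v1 (-M) / \<epsilon> - b) \<le> norm (\<epsilon> * I.pair ge I.om / \<kappa>) + norm (\<epsilon> * integral {-M..M} ge)"
        unfolding vm using norm_triangle_ineq[of "- (\<epsilon> * I.pair ge I.om / \<kappa>)" "\<epsilon> * integral {-M..M} ge"] by simp
      also have "\<dots> \<le> Bo / \<bar>\<kappa>\<bar> * cg * sqrt \<epsilon> + cg * sqrt \<epsilon>" by (intro add_mono gb gb2)
      also have "\<dots> = D * sqrt \<epsilon>" unfolding D_def by (simp add: algebra_simps)
      finally show ?thesis using D by linarith
    qed
    have e3: "norm (v0 x) \<le> C0 * C \<and> norm (v x - v0 x) \<le> C0 * C * \<epsilon>" if x: "x \<in> {-M..M}" for x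
    proof
      have "W \<le> C0" unfolding C0_def using nn Ci(1) Bo(1) by (auto intro!: add_nonneg_nonneg mult_nonneg_nonneg divide_nonneg_nonneg)
      then have "W * C \<le> C0 * C" using AC(3) by (intro mult_right_mono) auto
      then show "norm (v0 x) \<le> C0 * C" using v0b[OF x] by linarith
      have "norm (v x - v0 x) \<le> Ci * integral {-M..M} (\<lambda>x. norm (k x))" unfolding v0_def by (rule v(4)[OF x])
      also have "\<dots> \<le> Ci * (cK * C * \<epsilon>)" using kK Ci(1) by (intro mult_left_mono) auto
      also have "\<dots> = (Ci * cK) * (C * \<epsilon>)" by simp
      also have "\<dots> \<le> C0 * (C * \<epsilon>)"
      proof (rule mult_right_mono)
        show "Ci * cK \<le> C0" unfolding C0_def using nn Bo(1) by (auto intro!: add_nonneg_nonneg mult_nonneg_nonneg divide_nonneg_nonneg)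
      qed (use AC(3) \<epsilon> in auto)
      finally show "norm (v x - v0 x) \<le> C0 * C * \<epsilon>" by simp
    qed
    show "\<exists>v (v1::real \<Rightarrow> complex) (v0::real \<Rightarrow> complex). H2 v v1 (\<lambda>x. (\<epsilon> * q x * v0 x - complex_of_real (\<epsilon>\<^sup>2) * g (\<epsilon> * x)) + I.pair F2 v * F1 x + I.pair F1 v * F2 x) \<and>
      continuous_on UNIV v0 \<and> v0 (-M) = A \<and> v0 M = fp \<and>
      norm (v1 (-M) / \<epsilon> - b) \<le> C0 * C * sqrt \<epsilon> \<and> norm (v1 M / \<epsilon> - fp1) \<le> C0 * C * sqrt \<epsilon> \<and>
      (\<forall>x\<in>{-M..M}. norm (v0 x) \<le> C0 * C \<and> norm (v x - v0 x) \<le> C0 * C * \<epsilon>)"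
      using v(1)[unfolded k_def ge_def] v0c v0m e1 e2 e3 by blast
  qed
qed

end

text \<open>Substitution in the two functionals yields a factor \<open>e\<close>, which lowers
  \<open>1 / e ^ 3\<close> to the order of the scaled second derivative. These terms cancel, as does
  \<open>gx\<close>, and the rest stays bounded when \<open>v - v0\<close> is of order
  \<open>e\<close>.\<close>

lemma inner_residual_algebra:
  fixes e :: complex
  assumes "e \<noteq> 0"
  shows "Vx * vt - (1 / e)\<^sup>2 * ((e * qt * v0 - e\<^sup>2 * gx) + e2 * f1 + e1 * f2)
     + (1 / e ^ 3 * (f1 * (e * e2) + f2 * (e * e1)) + 1 / e * qt * vt) - z * vt - gx = (Vx - z) * vt + 1 / e * (qt * (vt - v0))"
  using assms by (simp add: field_simps power2_eq_square power3_eq_cube)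

section \<open>Gluing the inner and the outer solution\<close>

context scattering
begin

text \<open>Uniformity in \<open>g\<close> comes from \<open>edge_bounds\<close>: the solutions
  \<open>f\<close> for the unit ball share bounds for their data and their moduli of continuity at
  0. Residual and deviation from \<open>f\<close> are both dominated by one boundary layer profile,
  hence the single constant \<open>E\<close>.\<close>

lemma glued_approximation:
  assumes \<zeta>: "Im \<zeta> \<noteq> 0"
  obtains E \<epsilon>0 where "\<epsilon>0 > 0" "\<And>\<epsilon> g f. 0 < \<epsilon> \<Longrightarrow> \<epsilon> \<le> \<epsilon>0 \<Longrightarrow> g \<in> L2_space \<Longrightarrow> nsq g \<le> 1 \<Longrightarrow>
     iface V \<alpha> \<beta> f (\<lambda>x. \<zeta> * f x + g x) \<Longrightarrow>
     \<exists>w\<in>S0_domain V. (\<lambda>x. shifted (S\<epsilon> \<epsilon>) \<zeta> w x - g x) \<in> L2_space \<and>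
        nsq (\<lambda>x. shifted (S\<epsilon> \<epsilon>) \<zeta> w x - g x) \<le> E * \<epsilon> \<and> nsq (\<lambda>x. w x - f x) \<le> E * \<epsilon>"
proof -
  obtain C0 where C0: "C0 \<ge> 0" "\<And>\<epsilon> g A b fp fp1 C. 0 < \<epsilon> \<Longrightarrow> \<epsilon> \<le> 1 \<Longrightarrow> g \<in> L2_space \<Longrightarrow> nsq g \<le> 1 \<Longrightarrow>
    norm A \<le> C \<Longrightarrow> norm fp \<le> C \<Longrightarrow> C \<ge> 1 \<Longrightarrow>
    fp = complex_of_real \<alpha> * A + complex_of_real \<beta> * b \<Longrightarrow> fp1 = complex_of_real (inverse \<alpha>) * b \<Longrightarrow>
    \<exists>v (v1::real \<Rightarrow> complex) (v0::real \<Rightarrow> complex). H2 v v1 (\<lambda>x. (\<epsilon> * q x * v0 x - complex_of_real (\<epsilon>\<^sup>2) * g (\<epsilon> * x)) + I.pair F2 v * F1 x + I.pair F1 v * F2 x) \<and>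
      continuous_on UNIV v0 \<and> v0 (-M) = A \<and> v0 M = fp \<and>
      norm (v1 (-M) / \<epsilon> - b) \<le> C0 * C * sqrt \<epsilon> \<and> norm (v1 M / \<epsilon> - fp1) \<le> C0 * C * sqrt \<epsilon> \<and>
      (\<forall>x\<in>{-M..M}. norm (v0 x) \<le> C0 * C \<and> norm (v x - v0 x) \<le> C0 * C * \<epsilon>)"
    using inner_approximation by blast
  obtain K1 where K1: "K1 \<ge> 0" "\<And>x. \<bar>x\<bar> \<le> 2 \<Longrightarrow> norm (complex_of_real (V x) - \<zeta>) \<le> K1"
    using loc_boundedE[OF loc_bounded_shift[of \<zeta>], of 2] by blast
  \<comment> \<open>Bounds \<open>nsq f\<close> whenever \<open>nsq g \<le> 1\<close>; with it
    \<open>C\<close> is the constant of \<open>edge_bounds\<close>.\<close>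
  define X where "X = 1 / (Im \<zeta>)\<^sup>2"
  define C where "C = 13 * ((1 + K1) * (1 + X) + 1)"
  have X0: "X \<ge> 0" unfolding X_def by simp
  have "(1 + K1) * (1 + X) \<ge> 0" using K1(1) X0 by simp
  then have C1: "C \<ge> 1" unfolding C_def by (simp add: distrib_left)
  \<comment> \<open>\<open>cJ * sqrt \<epsilon>\<close> bounds the jumps of value and slope at a
    joint together: \<open>C0 * C\<close> twice for the inner solution, \<open>C * M\<close> and
    \<open>C * sqrt M\<close> for the change of the outer solution between 0 and the joint.\<close>
  define cJ where "cJ = 2 * (C0 * C) + C * M + C * sqrt M"
  \<comment> \<open>Bound in the core: the first two terms cover the residual, the last covers the
    difference of \<open>w\<close> and \<open>f\<close>.\<close>
  define D where "D = qb * (C0 * C) + K1 * (2 * (C0 * C)) + (2 * (C0 * C) + C)"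
  define E where "E = 2 * M * D\<^sup>2 + 4 * ((K1 + 17) * cJ)\<^sup>2"
  \<comment> \<open>Keeps \<open>M * \<epsilon>\<close> at most 1: the joints then lie in the range
    of \<open>edge_bounds\<close>, and cut-offs of radius 1 around them vanish beyond distance 2,
    where \<open>K1\<close> stops to apply.\<close>
  define \<epsilon>0 where "\<epsilon>0 = min 1 (1 / M)"
  have CC: "C0 * C \<ge> 0" using C0(1) C1 by simp
  have cJ0: "cJ \<ge> 0" unfolding cJ_def using CC C1 M_pos by simp
  have D0: "D \<ge> 0" unfolding D_def using CC C1 K1(1) qb_nonneg by simp
  have \<epsilon>0: "\<epsilon>0 > 0" unfolding \<epsilon>0_def using M_pos by simp
  show thesis
  proof (rule that[OF \<epsilon>0])
    fix \<epsilon> :: real and g f :: "real \<Rightarrow> complex"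
    assume \<epsilon>: "0 < \<epsilon>" "\<epsilon> \<le> \<epsilon>0" and g: "g \<in> L2_space" "nsq g \<le> 1" and If: "iface V \<alpha> \<beta> f (\<lambda>x. \<zeta> * f x + g x)"
    have \<epsilon>1: "\<epsilon> \<le> 1" using \<epsilon> unfolding \<epsilon>0_def by simp
    define m where "m = M * \<epsilon>"
    have m: "0 < m" "m \<le> 1"
    proof -
      show "0 < m" unfolding m_def using M_pos \<epsilon> by simp
      have "M * \<epsilon> \<le> M * (1 / M)" using \<epsilon> M_pos unfolding \<epsilon>0_def by (intro mult_left_mono) auto
      then show "m \<le> 1" unfolding m_def using M_pos by simp
    qed
    have m01: "m \<in> {0..1}" using m by simp
    have me: "1 / \<epsilon> * m = M" "1 / \<epsilon> * (-m) = -M" unfolding m_def using \<epsilon> by auto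
    have ec: "complex_of_real \<epsilon> \<noteq> 0" using \<epsilon> by simp
    have se: "sqrt \<epsilon> > 0" "\<epsilon> \<le> sqrt \<epsilon>" "(sqrt \<epsilon>)\<^sup>2 = \<epsilon>"
    proof -
      show "sqrt \<epsilon> > 0" "(sqrt \<epsilon>)\<^sup>2 = \<epsilon>" using \<epsilon> by auto
      have "\<epsilon> * \<epsilon> \<le> \<epsilon> * 1" using \<epsilon> \<epsilon>1 by (intro mult_left_mono) auto
      then show "\<epsilon> \<le> sqrt \<epsilon>" using \<epsilon> by (intro real_le_rsqrt) (simp add: power2_eq_square)
    qed
    interpret R: perturbed V c "\<lambda>x. F1 (1 / \<epsilon> * x)" "\<lambda>x. F2 (1 / \<epsilon> * x)" "1 / \<epsilon> ^ 3" "\<lambda>x. 1 / \<epsilon> * q (1 / \<epsilon> * x)" "1 / \<epsilon> * qb"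
      by (rule perturbed_scaled[OF \<epsilon>(1)])
    have Seq: "S\<epsilon> \<epsilon> = R.S_pert" by (rule S_eps_pert[OF \<epsilon>(1)])
    obtain fm fm1 km fp fp1 kp where P: "iparts V \<alpha> \<beta> f (\<lambda>x. \<zeta> * f x + g x) fm fm1 km fp fp1 kp" using If unfolding iface_def by blast
    have fL: "f \<in> L2_space" using If unfolding iface_def by blast
    have Hm: "H2 fm fm1 km" and Hp: "H2 fp fp1 kp" and fm: "\<And>x. x < 0 \<Longrightarrow> f x = fm x" and fp: "\<And>x. x > 0 \<Longrightarrow> f x = fp x"
      and km: "AE x in lebesgue. x < 0 \<longrightarrow> km x = complex_of_real (V x) * fm x - (\<zeta> * f x + g x)"
      and kp: "AE x in lebesgue. x > 0 \<longrightarrow> kp x = complex_of_real (V x) * fp x - (\<zeta> * f x + g x)"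
      and if0: "fp 0 = complex_of_real \<alpha> * fm 0 + complex_of_real \<beta> * fm1 0" "fp1 0 = complex_of_real (inverse \<alpha>) * fm1 0"
      using P unfolding iparts_def by auto
    have fX: "nsq f \<le> X"
      using iface_bound[OF \<alpha>_nonzero \<zeta> g(1) If] divide_right_mono[OF g(2), of "(Im \<zeta>)\<^sup>2"] unfolding X_def by simp
    have kp': "AE x in lebesgue. 0 < x \<longrightarrow> x < 1 \<longrightarrow> norm (kp x) \<le> K1 * norm (fp x) + norm (g x)"
      using kp
    proof eventually_elim
      case (elim x)
      show ?case
      proof (intro impI)
        assume x: "0 < x" "x < 1"
        then have "kp x = (complex_of_real (V x) - \<zeta>) * fp x - g x" using elim fp[of x] by (simp add: algebra_simps)
        moreover have "norm ((complex_of_real (V x) - \<zeta>) * fp x) \<le> K1 * norm (fp x)"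
          unfolding norm_mult using K1(2)[of x] x by (intro mult_right_mono) auto
        ultimately show "norm (kp x) \<le> K1 * norm (fp x) + norm (g x)"
          using norm_triangle_ineq4[of "(complex_of_real (V x) - \<zeta>) * fp x" "g x"] by simp
      qed
    qed
    have km': "AE x in lebesgue. -1 < x \<longrightarrow> x < 0 \<longrightarrow> norm (km x) \<le> K1 * norm (fm x) + norm (g x)"
      using km
    proof eventually_elim
      case (elim x)
      show ?case
      proof (intro impI)
        assume x: "-1 < x" "x < 0"
        then have "km x = (complex_of_real (V x) - \<zeta>) * fm x - g x" using elim fm[of x] by (simp add: algebra_simps)
        moreover have "norm ((complex_of_real (V x) - \<zeta>) * fm x) \<le> K1 * norm (fm x)"
          unfolding norm_mult using K1(2)[of x] x by (intro mult_right_mono) auto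
        ultimately show "norm (km x) \<le> K1 * norm (fm x) + norm (g x)"
          using norm_triangle_ineq4[of "(complex_of_real (V x) - \<zeta>) * fm x" "g x"] by simp
      qed
    qed
    have Xp: "integral {0..1} (\<lambda>x. (norm (fp x))\<^sup>2) \<le> X"
    proof -
      have "integral {0..1} (\<lambda>x. (norm (fp x))\<^sup>2) = integral {0..1} (\<lambda>x. (norm (f x))\<^sup>2)"
        by (rule integral_spike[of "{0}"]) (auto simp: fp)
      then show ?thesis using L2_integral_sq_le(2)[OF fL, of "{0..1}"] fX by simp
    qed
    have Xm: "integral {-1..0} (\<lambda>x. (norm (fm x))\<^sup>2) \<le> X"
    proof -
      have "integral {-1..0} (\<lambda>x. (norm (fm x))\<^sup>2) = integral {-1..0} (\<lambda>x. (norm (f x))\<^sup>2)"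
        by (rule integral_spike[of "{0}"]) (auto simp: fm)
      then show ?thesis using L2_integral_sq_le(2)[OF fL, of "{-1..0}"] fX by simp
    qed
    note ep = edge_bounds[OF Hp kp' g Xp K1(1) C_def]
    note em = edge_bounds_left[OF Hm km' g Xm K1(1) C_def]
    obtain v v1 v0 :: "real \<Rightarrow> complex" where v: "H2 v v1 (\<lambda>x. (\<epsilon> * q x * v0 x - complex_of_real (\<epsilon>\<^sup>2) * g (\<epsilon> * x)) + I.pair F2 v * F1 x + I.pair F1 v * F2 x)"
      "continuous_on UNIV v0" "v0 (-M) = fm 0" "v0 M = fp 0"
      "norm (v1 (-M) / \<epsilon> - fm1 0) \<le> C0 * C * sqrt \<epsilon>" "norm (v1 M / \<epsilon> - fp1 0) \<le> C0 * C * sqrt \<epsilon>"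
      "\<And>x. x \<in> {-M..M} \<Longrightarrow> norm (v0 x) \<le> C0 * C" "\<And>x. x \<in> {-M..M} \<Longrightarrow> norm (v x - v0 x) \<le> C0 * C * \<epsilon>"
      using C0(2)[OF \<epsilon>(1) \<epsilon>1 g em(1)[OF m01] ep(1)[OF m01] C1 if0] by blast
    have vb: "norm (v x) \<le> 2 * (C0 * C)" if x: "x \<in> {-M..M}" for x
    proof -
      have "C0 * C * \<epsilon> \<le> C0 * C * 1" using CC \<epsilon>1 by (intro mult_left_mono) auto
      then show ?thesis using v(7)[OF x] v(8)[OF x] norm_triangle_sub[of "v x" "v0 x"] by linarith
    qed
    define kk where "kk x = (\<epsilon> * q x * v0 x - complex_of_real (\<epsilon>\<^sup>2) * g (\<epsilon> * x)) + I.pair F2 v * F1 x + I.pair F1 v * F2 x" for x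
    define vs where "vs x = v (1 / \<epsilon> * x)" for x
    define vs1 where "vs1 x = (1 / complex_of_real \<epsilon>) * v1 (1 / \<epsilon> * x)" for x
    define vs2 where "vs2 x = (1 / complex_of_real \<epsilon>)\<^sup>2 * kk (1 / \<epsilon> * x)" for x
    have Hv: "H2 vs vs1 vs2"
    proof -
      have "H2 v v1 kk" using v(1) unfolding kk_def[abs_def] .
      from H2_affine[OF this, of "1 / \<epsilon>" 0] \<epsilon>
      have "H2 (\<lambda>x. v (1 / \<epsilon> * x)) (\<lambda>x. (1 / \<epsilon>) *\<^sub>R v1 (1 / \<epsilon> * x)) (\<lambda>x. (1 / \<epsilon>)\<^sup>2 *\<^sub>R kk (1 / \<epsilon> * x))" by simp
      then show ?thesis unfolding vs_def[abs_def] vs1_def[abs_def] vs2_def[abs_def] by (simp add: scaleR_conv_of_real)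
    qed
    have vsm: "vs m = v M" "vs (-m) = v (-M)" "vs1 m = v1 M / \<epsilon>" "vs1 (-m) = v1 (-M) / \<epsilon>"
      unfolding vs_def vs1_def me by auto
    define jp0 jp1 jm0 jm1 where "jp0 = vs m - fp m" and "jp1 = vs1 m - fp1 m" and "jm0 = vs (-m) - fm (-m)" and "jm1 = vs1 (-m) - fm1 (-m)"
    have MM: "M \<in> {-M..M}" "-M \<in> {-M..M}" using M_pos by auto
    have sm: "sqrt m = sqrt M * sqrt \<epsilon>" unfolding m_def by (rule real_sqrt_mult)
    have jump: "norm j0 + norm j1 \<le> cJ * sqrt \<epsilon>"
      if "norm j0 \<le> C0 * C * \<epsilon> + C * m" "norm j1 \<le> C0 * C * sqrt \<epsilon> + C * sqrt m" for j0 j1 :: complex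
    proof -
      have "C0 * C * \<epsilon> \<le> C0 * C * sqrt \<epsilon>" using CC se by (intro mult_left_mono) auto
      moreover have "C * m \<le> C * M * sqrt \<epsilon>" unfolding m_def using C1 M_pos se by (simp add: mult.assoc)
      moreover have "C * sqrt m = C * sqrt M * sqrt \<epsilon>" unfolding sm by simp
      moreover have "cJ * sqrt \<epsilon> = 2 * (C0 * C * sqrt \<epsilon>) + C * M * sqrt \<epsilon> + C * sqrt M * sqrt \<epsilon>"
        unfolding cJ_def by (simp add: algebra_simps)
      ultimately show ?thesis using that by linarith
    qed
    have Jp: "norm jp0 + norm jp1 \<le> cJ * sqrt \<epsilon>"
    proof (rule jump)
      have "norm jp0 \<le> norm (v M - v0 M) + norm (fp m - fp 0)"
        unfolding jp0_def vsm v(4) using norm_triangle_ineq4[of "v M - fp 0" "fp m - fp 0"] by simp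
      then show "norm jp0 \<le> C0 * C * \<epsilon> + C * m" using v(8)[OF MM(1)] ep(4)[OF m01] by linarith
      have "norm jp1 \<le> norm (v1 M / \<epsilon> - fp1 0) + norm (fp1 m - fp1 0)"
        unfolding jp1_def vsm using norm_triangle_ineq4[of "v1 M / \<epsilon> - fp1 0" "fp1 m - fp1 0"] by simp
      then show "norm jp1 \<le> C0 * C * sqrt \<epsilon> + C * sqrt m" using v(6) ep(3)[OF m01] by linarith
    qed
    have Jm: "norm jm0 + norm jm1 \<le> cJ * sqrt \<epsilon>"
    proof (rule jump)
      have "norm jm0 \<le> norm (v (-M) - v0 (-M)) + norm (fm (-m) - fm 0)"
        unfolding jm0_def vsm v(3) using norm_triangle_ineq4[of "v (-M) - fm 0" "fm (-m) - fm 0"] by simp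
      then show "norm jm0 \<le> C0 * C * \<epsilon> + C * m" using v(8)[OF MM(2)] em(4)[OF m01] by linarith
      have "norm jm1 \<le> norm (v1 (-M) / \<epsilon> - fm1 0) + norm (fm1 (-m) - fm1 0)"
        unfolding jm1_def vsm using norm_triangle_ineq4[of "v1 (-M) / \<epsilon> - fm1 0" "fm1 (-m) - fm1 0"] by simp
      then show "norm jm1 \<le> C0 * C * sqrt \<epsilon> + C * sqrt m" using v(5) em(3)[OF m01] by linarith
    qed
    define Jb where "Jb = cJ * sqrt \<epsilon>"
    have Jb0: "Jb \<ge> 0" unfolding Jb_def using cJ0 se by simp
    \<comment> \<open>The cut-off is centred at the joint \<open>a\<close>. Half of it would reach
      into the core, but \<open>w\<close> uses it on the outer side only.\<close>
    have layer: "\<exists>S S1 S2. H2 S S1 S2 \<and> S a = j0 \<and> S1 a = j1 \<and> (\<forall>x. \<bar>x\<bar> > 2 \<longrightarrow> S x = 0 \<and> S2 x = 0) \<and>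
       (\<forall>x. norm (S x) \<le> Jb) \<and> (\<forall>x. norm (S2 x) \<le> 16 * Jb)"
      if j: "norm j0 + norm j1 \<le> Jb" and a: "\<bar>a\<bar> \<le> 1" for a j0 j1
    proof -
      obtain \<psi> \<psi>1 \<psi>2 where \<psi>: "H2 \<psi> \<psi>1 \<psi>2" "\<psi> 0 = j0" "\<psi>1 0 = j1" "\<And>x. \<bar>x\<bar> > 1 \<Longrightarrow> \<psi> x = 0 \<and> \<psi>2 x = 0"
        "\<And>x. norm (\<psi> x) \<le> norm j0 + norm j1" "\<And>x. norm (\<psi>2 x) \<le> 16 * (norm j0 + norm j1)"
        using cutoff_exists by blast
      have H: "H2 (\<lambda>x. \<psi> (-a + x)) (\<lambda>x. \<psi>1 (-a + x)) (\<lambda>x. \<psi>2 (-a + x))"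
        using H2_affine[OF \<psi>(1), of 1 "-a"] by simp
      have z: "\<psi> (-a + x) = 0 \<and> \<psi>2 (-a + x) = 0" if "\<bar>x\<bar> > 2" for x
        by (rule \<psi>(4)) (use that a in linarith)
      have b1: "norm (\<psi> (-a + x)) \<le> Jb" for x by (rule order_trans[OF \<psi>(5) j])
      have b2: "norm (\<psi>2 (-a + x)) \<le> 16 * Jb" for x
        using \<psi>(6)[of "-a + x"] mult_left_mono[OF j, of 16] by simp
      show ?thesis
        by (rule exI[of _ "\<lambda>x. \<psi> (-a + x)"], rule exI[of _ "\<lambda>x. \<psi>1 (-a + x)"], rule exI[of _ "\<lambda>x. \<psi>2 (-a + x)"])
          (use H \<psi>(2,3) z b1 b2 in auto)
    qed
    obtain Sp Sp1 Sp2 where Sp: "H2 Sp Sp1 Sp2" "Sp m = jp0" "Sp1 m = jp1" "\<And>x. \<bar>x\<bar> > 2 \<Longrightarrow> Sp x = 0 \<and> Sp2 x = 0"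
       "\<And>x. norm (Sp x) \<le> Jb" "\<And>x. norm (Sp2 x) \<le> 16 * Jb"
      using layer[of jp0 jp1 m] Jp m unfolding Jb_def by auto
    obtain Sm Sm1 Sm2 where Sm: "H2 Sm Sm1 Sm2" "Sm (-m) = jm0" "Sm1 (-m) = jm1" "\<And>x. \<bar>x\<bar> > 2 \<Longrightarrow> Sm x = 0 \<and> Sm2 x = 0"
       "\<And>x. norm (Sm x) \<le> Jb" "\<And>x. norm (Sm2 x) \<le> 16 * Jb"
      using layer[of jm0 jm1 "-m"] Jm m unfolding Jb_def by auto
    define w where "w x = (if x < -m then fm x + Sm x else if x < m then vs x else fp x + Sp x)" for x
    define w1 where "w1 x = (if x < -m then fm1 x + Sm1 x else if x < m then vs1 x else fp1 x + Sp1 x)" for x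
    define kw where "kw x = (if x < -m then km x + Sm2 x else if x < m then vs2 x else kp x + Sp2 x)" for x
    have Hw: "H2 w w1 kw"
    proof -
      have "H2 (\<lambda>x. if x < m then vs x else fp x + Sp x) (\<lambda>x. if x < m then vs1 x else fp1 x + Sp1 x) (\<lambda>x. if x < m then vs2 x else kp x + Sp2 x)"
        by (rule H2_glue[OF Hv H2_add[OF Hp Sp(1)]]) (simp_all add: Sp(2,3) jp0_def jp1_def)
      then show ?thesis unfolding w_def[abs_def] w1_def[abs_def] kw_def[abs_def]
        by (rule H2_glue[OF H2_add[OF Hm Sm(1)]]) (use m in \<open>simp_all add: Sm(2,3) jm0_def jm1_def\<close>)
    qed
    \<comment> \<open>Large enough to dominate a cut-off itself as well as its residual, which is at
      most \<open>K1 * Jb + 16 * Jb\<close>.\<close>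
    define J where "J = (K1 + 17) * Jb"
    have J0: "J \<ge> 0" unfolding J_def using K1(1) Jb0 by simp
    have JbJ: "Jb \<le> J"
    proof -
      have "1 * Jb \<le> (K1 + 17) * Jb" using K1(1) Jb0 by (intro mult_right_mono) auto
      then show ?thesis unfolding J_def by simp
    qed
    have Eeq: "2 * m * D\<^sup>2 + 4 * J\<^sup>2 = E * \<epsilon>"
    proof -
      have "J\<^sup>2 = ((K1 + 17) * cJ)\<^sup>2 * \<epsilon>" unfolding J_def Jb_def using se(3) by (simp add: power_mult_distrib)
      then show ?thesis unfolding E_def m_def by (simp add: algebra_simps)
    qed
    have wmeas: "w \<in> borel_measurable lebesgue" by (rule continuous_borel_measurable_lebesgue[OF H2_continuous(1)[OF Hw]])
    have inr: "1 / \<epsilon> * x \<in> {-M..M}" if "\<bar>x\<bar> < m" for x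
      using that \<epsilon> unfolding m_def by (auto simp: abs_less_iff field_simps)
    have wfA: "AE x in lebesgue. norm (w x - f x) \<le> (if \<bar>x\<bar> < m then D else if \<bar>x\<bar> \<le> 2 then J else 0)"
      using AE_lebesgue_neq[of 0] AE_lebesgue_neq[of "-m"]
    proof eventually_elim
      case (elim x)
      consider "x < -m" | "\<bar>x\<bar> < m" | "x \<ge> m" using elim by linarith
      then show ?case
      proof cases
        case 1
        then have "w x - f x = Sm x" unfolding w_def using fm[of x] m by simp
        then show ?thesis using 1 m Sm(4)[of x] Sm(5)[of x] JbJ by (cases "\<bar>x\<bar> \<le> 2") auto
      next
        case 2
        then have wx: "w x = v (1 / \<epsilon> * x)" unfolding w_def vs_def by (auto simp: abs_less_iff)
        have fx: "norm (f x) \<le> C"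
        proof (cases "x < 0")
          case True
          then show ?thesis using em(5)[of "-x"] fm[of x] 2 m by auto
        next
          case False
          then show ?thesis using ep(5)[of x] fp[of x] 2 m elim by auto
        qed
        have "norm (w x - f x) \<le> 2 * (C0 * C) + C"
          unfolding wx using vb[OF inr[OF 2]] fx norm_triangle_ineq4[of "v (1 / \<epsilon> * x)" "f x"] by linarith
        also have "\<dots> \<le> D" unfolding D_def using CC K1(1) qb_nonneg by simp
        finally show ?thesis using 2 by simp
      next
        case 3
        then have "w x - f x = Sp x" unfolding w_def using fp[of x] m by simp
        then show ?thesis using 3 m Sp(4)[of x] Sp(5)[of x] JbJ by (cases "\<bar>x\<bar> \<le> 2") auto
      qed
    qed
    have wfm: "(\<lambda>x. w x - f x) \<in> borel_measurable lebesgue" using wmeas L2_spaceD(1)[OF fL] by measurable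
    note WF = boundary_layer_nsq[OF wfm less_imp_le[OF m(1)] D0 J0 wfA, unfolded Eeq]
    have wL: "w \<in> L2_space" using L2_add(1)[OF WF(1) fL] by simp
    \<comment> \<open>Substitution \<open>s = \<epsilon> * x\<close> with Jacobian
      \<open>\<epsilon>\<close>: the scaled support lies in the core, where \<open>w\<close> is the
      rescaled \<open>v\<close>.\<close>
    have pairing: "(LINT s|lebesgue. complex_of_real (\<phi> (1 / \<epsilon> * s)) * w s) = complex_of_real \<epsilon> * I.pair (\<lambda>x. complex_of_real (\<phi> x)) v"
      if b: "bump \<phi> M" for \<phi>
    proof -
      have F: "(\<lambda>x. complex_of_real (\<phi> x)) absolutely_integrable_on {-M..M}" by (rule L2_abs_integrable[OF bump.complex_L2[OF b]])
      have vc: "continuous_on UNIV v" using H2_continuous[OF v(1)] by auto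
      have wm: "(\<lambda>x. w (\<epsilon> * x)) \<in> borel_measurable lebesgue" by (rule lebesgue_measurable_scale[OF wmeas]) (use \<epsilon> in simp)
      have fmeas: "(\<lambda>x. complex_of_real (\<phi> x)) \<in> borel_measurable lebesgue" by (rule L2_spaceD(1)[OF bump.complex_L2[OF b]])
      have vm: "v \<in> borel_measurable lebesgue" by (rule continuous_borel_measurable_lebesgue[OF vc])
      have "(LINT s|lebesgue. complex_of_real (\<phi> (1 / \<epsilon> * s)) * w s) =
         \<bar>\<epsilon>\<bar> *\<^sub>R (LINT x|lebesgue. complex_of_real (\<phi> (1 / \<epsilon> * (0 + \<epsilon> * x))) * w (0 + \<epsilon> * x))"
        by (rule lebesgue_integral_real_affine) (use \<epsilon> in simp)
      also have "\<dots> = complex_of_real \<epsilon> * (LINT x|lebesgue. complex_of_real (\<phi> x) * w (\<epsilon> * x))"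
        using \<epsilon> by (simp add: scaleR_conv_of_real)
      also have "(LINT x|lebesgue. complex_of_real (\<phi> x) * w (\<epsilon> * x)) = (LINT x:{-M..M}|lebesgue. complex_of_real (\<phi> x) * v x)"
        unfolding set_lebesgue_integral_def
      proof (rule integral_cong_AE)
        show "(\<lambda>x. complex_of_real (\<phi> x) * w (\<epsilon> * x)) \<in> borel_measurable lebesgue" using fmeas wm by (rule borel_measurable_times)
        show "(\<lambda>x. indicat_real {-M..M} x *\<^sub>R (complex_of_real (\<phi> x) * v x)) \<in> borel_measurable lebesgue"
          by (intro borel_measurable_scaleR borel_measurable_indicator borel_measurable_times fmeas vm) simp
        show "AE x in lebesgue. complex_of_real (\<phi> x) * w (\<epsilon> * x) = indicat_real {-M..M} x *\<^sub>R (complex_of_real (\<phi> x) * v x)"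
          using bump.supp[OF b] AE_lebesgue_neq[of M] AE_lebesgue_neq[of "-M"]
        proof eventually_elim
          case (elim x)
          show ?case
          proof (cases "\<bar>x\<bar> > M")
            case True then show ?thesis using elim by simp
          next
            case False
            then have x: "-M < x" "x < M" using elim by auto
            have "\<epsilon> * (-M) < \<epsilon> * x" "\<epsilon> * x < \<epsilon> * M" using mult_strict_left_mono[OF x(1) \<epsilon>(1)] mult_strict_left_mono[OF x(2) \<epsilon>(1)] by simp_all
            then have "-m < \<epsilon> * x" "\<epsilon> * x < m" unfolding m_def by (auto simp: mult.commute)
            then have "w (\<epsilon> * x) = v x" unfolding w_def vs_def using \<epsilon> by simp
            then show ?thesis using x by simp
          qed
        qed
      qed
      also have "\<dots> = I.pair (\<lambda>x. complex_of_real (\<phi> x)) v"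
        unfolding I.pair_def by (rule set_lebesgue_integral_eq_integral(2)[OF I.pair_lin(2)[OF F vc vc]])
      finally show ?thesis .
    qed
    \<comment> \<open>The residual with \<open>kw\<close> in place of the second derivative of
      \<open>w\<close>. It can be estimated before \<open>w\<close> is known to lie in the domain,
      and its square integrability then yields this membership.\<close>
    define rr where "rr x = complex_of_real (V x) * w x - kw x + R.pert w x - \<zeta> * w x - g x" for x
    have pertw: "R.pert w x = 1 / complex_of_real \<epsilon> ^ 3 * (F1 (1 / \<epsilon> * x) * (complex_of_real \<epsilon> * I.pair F2 v) + F2 (1 / \<epsilon> * x) * (complex_of_real \<epsilon> * I.pair F1 v))
       + 1 / complex_of_real \<epsilon> * complex_of_real (q (1 / \<epsilon> * x)) * w x" for x
      unfolding R.pert_def pairing[OF b1] pairing[OF b2] by simp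
    have s1: "AE x in lebesgue. \<bar>1 / \<epsilon> * x\<bar> > M \<longrightarrow> \<phi>1 (1 / \<epsilon> * x) = 0" by (rule AE_lebesgue_scale[OF bump.supp[OF b1]]) (use \<epsilon> in simp)
    have s2: "AE x in lebesgue. \<bar>1 / \<epsilon> * x\<bar> > M \<longrightarrow> \<phi>2 (1 / \<epsilon> * x) = 0" by (rule AE_lebesgue_scale[OF bump.supp[OF b2]]) (use \<epsilon> in simp)
    have layer_bound: "norm ((complex_of_real (V x) - \<zeta>) * S - S2) \<le> (if \<bar>x\<bar> \<le> 2 then J else 0)"
      if "norm S \<le> Jb" "norm S2 \<le> 16 * Jb" "\<bar>x\<bar> > 2 \<Longrightarrow> S = 0 \<and> S2 = 0" for x S S2
    proof (cases "\<bar>x\<bar> \<le> 2")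
      case True
      have "norm ((complex_of_real (V x) - \<zeta>) * S) \<le> K1 * Jb" unfolding norm_mult using K1 True that(1) by (intro mult_mono) auto
      then have "norm ((complex_of_real (V x) - \<zeta>) * S - S2) \<le> K1 * Jb + 16 * Jb"
        using that(2) norm_triangle_ineq4[of "(complex_of_real (V x) - \<zeta>) * S" S2] by linarith
      also have "\<dots> \<le> J" unfolding J_def using Jb0 by (simp add: algebra_simps)
      finally show ?thesis using True by simp
    next
      case False then show ?thesis using that(3) by simp
    qed
    have rrA: "AE x in lebesgue. norm (rr x) \<le> (if \<bar>x\<bar> < m then D else if \<bar>x\<bar> \<le> 2 then J else 0)"
      using AE_lebesgue_neq[of "-m"] AE_lebesgue_neq[of m] s1 s2 km kp
    proof eventually_elim
      case (elim x)
      have out: "\<bar>1 / \<epsilon> * x\<bar> > M" if "\<bar>x\<bar> > m"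
        using that \<epsilon> unfolding m_def by (simp add: abs_mult field_simps)
      have p0: "R.pert w x = 0" if "\<bar>x\<bar> > m"
        unfolding pertw using elim(3,4) out[OF that] q_supp[OF out[OF that]] by simp
      consider "x < -m" | "\<bar>x\<bar> < m" | "x > m" using elim(1,2) by linarith
      then show ?case
      proof cases
        case 1
        then have x: "x < 0" "\<bar>x\<bar> > m" using m by auto
        have k: "km x = complex_of_real (V x) * fm x - (\<zeta> * fm x + g x)" using elim(5) x fm[of x] by simp
        have "rr x = (complex_of_real (V x) - \<zeta>) * Sm x - Sm2 x"
          unfolding rr_def p0[OF x(2)] w_def kw_def using 1 k by (simp add: algebra_simps)
        then show ?thesis using layer_bound[OF Sm(5)[of x] Sm(6)[of x] Sm(4)[of x]] x(2) by simp
      next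
        case 3
        then have x: "x > 0" "\<bar>x\<bar> > m" using m by auto
        have k: "kp x = complex_of_real (V x) * fp x - (\<zeta> * fp x + g x)" using elim(6) x fp[of x] by simp
        have "rr x = (complex_of_real (V x) - \<zeta>) * Sp x - Sp2 x"
          unfolding rr_def p0[OF x(2)] w_def kw_def using 3 m k by (simp add: algebra_simps)
        then show ?thesis using layer_bound[OF Sp(5)[of x] Sp(6)[of x] Sp(4)[of x]] x(2) by simp
      next
        case 2
        define t where "t = 1 / \<epsilon> * x"
        have t: "t \<in> {-M..M}" unfolding t_def by (rule inr[OF 2])
        have et: "\<epsilon> * t = x" unfolding t_def using \<epsilon> by simp
        have wx: "w x = v t" and kwx: "kw x = (1 / complex_of_real \<epsilon>)\<^sup>2 * kk t"
          using 2 unfolding w_def kw_def vs_def vs2_def t_def by (auto simp: abs_less_iff)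
        have rx: "rr x = (complex_of_real (V x) - \<zeta>) * v t + 1 / complex_of_real \<epsilon> * (complex_of_real (q t) * (v t - v0 t))"
          unfolding rr_def pertw wx kwx kk_def et t_def[symmetric]
          using inner_residual_algebra[OF ec, of "complex_of_real (V x)" "v t" "complex_of_real (q t)" "v0 t" "g x" "I.pair F2 v" "F1 t" "I.pair F1 v" "F2 t" \<zeta>]
          by simp
        have n1: "norm ((complex_of_real (V x) - \<zeta>) * v t) \<le> K1 * (2 * (C0 * C))"
          unfolding norm_mult using K1 2 m vb[OF t] by (intro mult_mono) auto
        have "norm (1 / complex_of_real \<epsilon> * (complex_of_real (q t) * (v t - v0 t))) \<le> 1 / \<epsilon> * (qb * (C0 * C * \<epsilon>))"
          unfolding norm_mult norm_divide norm_of_real norm_one using \<epsilon> q_bound[of t] v(8)[OF t] qb_nonneg by (intro mult_mono) auto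
        also have "\<dots> = qb * (C0 * C)" using \<epsilon> by simp
        finally have "norm (rr x) \<le> K1 * (2 * (C0 * C)) + qb * (C0 * C)"
          unfolding rx by (rule norm_triangle_le[OF add_mono[OF n1]])
        also have "\<dots> \<le> D" unfolding D_def using CC C1 by simp
        finally show ?thesis using 2 by simp
      qed
    qed
    have rrm: "rr \<in> borel_measurable lebesgue"
    proof -
      have "kw \<in> borel_measurable lebesgue" using Hw is_primitive_measurable unfolding H2_def by blast
      moreover have "R.pert w \<in> borel_measurable lebesgue" by (rule L2_spaceD(1)[OF R.pert_L2[OF wL]])
      ultimately show ?thesis unfolding rr_def[abs_def] using V_meas wmeas L2_spaceD(1)[OF g(1)] by measurable
    qed
    note RR = boundary_layer_nsq[OF rrm less_imp_le[OF m(1)] D0 J0 rrA, unfolded Eeq]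
    have "(\<lambda>x. ((rr x - R.pert w x) + \<zeta> * w x) + g x) \<in> L2_space"
      by (rule L2_add(1)[OF L2_add(1)[OF L2_diff(1)[OF RR(1) R.pert_L2[OF wL]] L2_cmul(1)[OF wL]] g(1)])
    then have "(\<lambda>x. complex_of_real (V x) * w x - kw x) \<in> L2_space" unfolding rr_def by simp
    then have wS: "w \<in> S0_domain V" by (rule H2_S0_domain[OF wL Hw])
    have req: "AE x in lebesgue. rr x = shifted (S\<epsilon> \<epsilon>) \<zeta> w x - g x"
      using H2_schroedinger_expr[OF Hw, of V] by eventually_elim (simp only: rr_def Seq R.S_pert_simps)
    show "\<exists>w\<in>S0_domain V. (\<lambda>x. shifted (S\<epsilon> \<epsilon>) \<zeta> w x - g x) \<in> L2_space \<and>
        nsq (\<lambda>x. shifted (S\<epsilon> \<epsilon>) \<zeta> w x - g x) \<le> E * \<epsilon> \<and> nsq (\<lambda>x. w x - f x) \<le> E * \<epsilon>"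
    proof (rule bexI[OF _ wS], intro conjI)
      show "(\<lambda>x. shifted (S\<epsilon> \<epsilon>) \<zeta> w x - g x) \<in> L2_space" by (rule L2_cong_AE(1)[OF RR(1) req])
      show "nsq (\<lambda>x. shifted (S\<epsilon> \<epsilon>) \<zeta> w x - g x) \<le> E * \<epsilon>" using L2_cong_AE(2)[OF RR(1) req] RR(2) by simp
      show "nsq (\<lambda>x. w x - f x) \<le> E * \<epsilon>" by (rule WF(2))
    qed
  qed
qed

section \<open>Convergence of the resolvents\<close>

lemma resolvent_distance_tendsto:
  assumes \<zeta>: "Im \<zeta> \<noteq> 0"
  shows "((\<lambda>\<epsilon>. L2_opnorm (\<lambda>g x. resolvent (S\<epsilon> \<epsilon>) \<zeta> g x - resolvent (S_point V \<alpha> \<beta>) \<zeta> g x)) \<longlongrightarrow> 0) (at_right 0)"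
proof (rule glued_approximation[OF \<zeta>])
  fix E \<epsilon>0 :: real
  assume E: "\<epsilon>0 > 0" "\<And>\<epsilon> g f. 0 < \<epsilon> \<Longrightarrow> \<epsilon> \<le> \<epsilon>0 \<Longrightarrow> g \<in> L2_space \<Longrightarrow> nsq g \<le> 1 \<Longrightarrow>
     iface V \<alpha> \<beta> f (\<lambda>x. \<zeta> * f x + g x) \<Longrightarrow>
     \<exists>w\<in>S0_domain V. (\<lambda>x. shifted (S\<epsilon> \<epsilon>) \<zeta> w x - g x) \<in> L2_space \<and>
        nsq (\<lambda>x. shifted (S\<epsilon> \<epsilon>) \<zeta> w x - g x) \<le> E * \<epsilon> \<and> nsq (\<lambda>x. w x - f x) \<le> E * \<epsilon>"
  define b where "b \<epsilon> = sqrt (2 * (E * \<epsilon>) / (Im \<zeta>)\<^sup>2 + 2 * (E * \<epsilon>))" for \<epsilon>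
  have bound: "L2_opnorm (\<lambda>g x. resolvent (S\<epsilon> \<epsilon>) \<zeta> g x - resolvent (S_point V \<alpha> \<beta>) \<zeta> g x) \<le> ennreal (b \<epsilon>)"
    if \<epsilon>: "0 < \<epsilon>" "\<epsilon> \<le> \<epsilon>0" for \<epsilon>
    unfolding L2_opnorm_def
  proof (rule SUP_least)
    fix g :: "real \<Rightarrow> complex" assume "g \<in> {g \<in> L2_space. L2_norm g \<le> 1}"
    then have g: "g \<in> L2_space" "nsq g \<le> 1" unfolding L2_norm_nsq by auto
    interpret R: perturbed V c "\<lambda>x. F1 (1 / \<epsilon> * x)" "\<lambda>x. F2 (1 / \<epsilon> * x)" "1 / \<epsilon> ^ 3" "\<lambda>x. 1 / \<epsilon> * q (1 / \<epsilon> * x)" "1 / \<epsilon> * qb"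
      by (rule perturbed_scaled[OF \<epsilon>(1)])
    have Seq: "S\<epsilon> \<epsilon> = R.S_pert" by (rule S_eps_pert[OF \<epsilon>(1)])
    have "(L2_norm (\<lambda>x. resolvent (S\<epsilon> \<epsilon>) \<zeta> g x - resolvent (S_point V \<alpha> \<beta>) \<zeta> g x))\<^sup>2 \<le> 2 * (E * \<epsilon>) / (Im \<zeta>)\<^sup>2 + 2 * (E * \<epsilon>)"
      unfolding Seq by (rule R.resolvent_difference[OF \<alpha>_nonzero \<zeta> g(1)]) (rule E(2)[OF \<epsilon> g, unfolded Seq])
    then have "L2_norm (\<lambda>x. resolvent (S\<epsilon> \<epsilon>) \<zeta> g x - resolvent (S_point V \<alpha> \<beta>) \<zeta> g x) \<le> b \<epsilon>"
      unfolding b_def by (rule real_le_rsqrt)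
    then show "ennreal (L2_norm (\<lambda>x. resolvent (S\<epsilon> \<epsilon>) \<zeta> g x - resolvent (S_point V \<alpha> \<beta>) \<zeta> g x)) \<le> ennreal (b \<epsilon>)"
      by (rule ennreal_leI)
  qed
  have "((\<lambda>\<epsilon>. b \<epsilon>) \<longlongrightarrow> sqrt (2 * (E * 0) / (Im \<zeta>)\<^sup>2 + 2 * (E * 0))) (at_right 0)"
    unfolding b_def by (intro tendsto_intros) (use \<zeta> in auto)
  then have "((\<lambda>\<epsilon>. ennreal (b \<epsilon>)) \<longlongrightarrow> ennreal 0) (at_right 0)" by (intro tendsto_ennrealI) simp
  then have lim: "((\<lambda>\<epsilon>. ennreal (b \<epsilon>)) \<longlongrightarrow> 0) (at_right 0)" by simp
  show ?thesis
  proof (rule tendsto_sandwich[OF _ _ tendsto_const lim])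
    show "\<forall>\<^sub>F \<epsilon> in at_right 0. L2_opnorm (\<lambda>g x. resolvent (S\<epsilon> \<epsilon>) \<zeta> g x - resolvent (S_point V \<alpha> \<beta>) \<zeta> g x) \<le> ennreal (b \<epsilon>)"
      unfolding eventually_at_right_field using bound E(1) by (intro exI[of _ \<epsilon>0]) auto
  qed simp
qed

lemma converges: "norm_resolvent_convergence (S_eps V \<phi>1 \<phi>2 q) (S_point V \<alpha> \<beta>)"
  unfolding norm_resolvent_convergence_def
proof (intro allI impI conjI)
  fix \<zeta> :: complex assume "\<zeta> \<notin> \<real>"
  then have \<zeta>: "Im \<zeta> \<noteq> 0" by (simp add: complex_is_Real_iff)
  show "\<zeta> \<in> resolvent_set (S_point V \<alpha> \<beta>)" by (rule S_point_resolvent_set[OF \<alpha>_nonzero \<zeta>])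
  show "((\<lambda>\<epsilon>. L2_opnorm (\<lambda>g x. resolvent (S_eps V \<phi>1 \<phi>2 q \<epsilon>) \<zeta> g x - resolvent (S_point V \<alpha> \<beta>) \<zeta> g x)) \<longlongrightarrow> 0) (at_right 0)"
    using resolvent_distance_tendsto[OF \<zeta>] unfolding S\<epsilon>_def .
  fix \<epsilon> :: real assume \<epsilon>: "\<epsilon> > 0"
  show "\<zeta> \<in> resolvent_set (S_eps V \<phi>1 \<phi>2 q \<epsilon>)"
    unfolding S\<epsilon>_def[symmetric] S_eps_pert[OF \<epsilon>]
    by (rule perturbed.S_pert_resolvent_set[OF perturbed_scaled[OF \<epsilon>] \<zeta>])
qed

end

section \<open>From the stated hypotheses to the setting of the locales\<close>

lemma bounded_real_subset_Icc: "bounded S \<Longrightarrow> \<exists>N>0. \<forall>x\<in>S. \<bar>x\<bar> \<le> N" for S :: "real set"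
  by (auto simp: bounded_pos)

theorem theorem1:
  fixes V \<phi>1 \<phi>2 q :: "real \<Rightarrow> real" and \<kappa> a0 a1 a2 :: real
  assumes V_measurable: "V \<in> borel_measurable lebesgue"
    and V_locally_bounded: "\<And>K. compact K \<Longrightarrow> bounded (V ` K)"
    and V_bounded_below: "bdd_below (range V)"
    and \<phi>1: "\<phi>1 \<in> L2_space" "compact_ess_support \<phi>1"
    and \<phi>2: "\<phi>2 \<in> L2_space" "compact_ess_support \<phi>2"
    and q: "q \<in> borel_measurable lebesgue" "bounded (range q)" "compact (closure {x. q x \<noteq> 0})"
    and zero_means: "(LINT x|lebesgue. \<phi>1 x) = 0" "(LINT x|lebesgue. \<phi>2 x) = 0"
    and orthogonal: "L2_inner (antideriv1 \<phi>1) (antideriv1 \<phi>2) = 0"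
    and normalized: "L2_norm (antideriv1 \<phi>1) * L2_norm (antideriv1 \<phi>2) = 1"
    and \<kappa>: "\<kappa> = Lim at_top (omega \<phi>1 \<phi>2)"
    and a0: "a0 = (LINT x|lebesgue. q x)"
    and a1: "a1 = (LINT x|lebesgue. q x * omega \<phi>1 \<phi>2 x)"
    and a2: "a2 = (LINT x|lebesgue. q x * (omega \<phi>1 \<phi>2 x)\<^sup>2)"
    and resonance: "a0 * a2 = a1\<^sup>2" "a2 \<noteq> \<kappa> * a1"
    and \<kappa>_nonzero: "\<kappa> \<noteq> 0"
  shows "norm_resolvent_convergence (S_eps V \<phi>1 \<phi>2 q)
           (S_point V ((a2 - \<kappa> * a1) / a2) (\<kappa>\<^sup>2 / (a2 - \<kappa> * a1)))"
proof -
  obtain L where L: "\<And>x. L \<le> V x" using V_bounded_below unfolding bdd_below_def by auto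
  have ess: "\<exists>N>0. AE x in lebesgue. \<bar>x\<bar> > N \<longrightarrow> \<phi> x = 0" if cs: "compact_ess_support \<phi>" for \<phi>
  proof -
    obtain K where K: "compact K" "AE x in lebesgue. x \<notin> K \<longrightarrow> \<phi> x = 0" using cs unfolding compact_ess_support_def by blast
    obtain N where N: "N > 0" "\<forall>x\<in>K. \<bar>x\<bar> \<le> N" using bounded_real_subset_Icc[OF compact_imp_bounded[OF K(1)]] by blast
    have "AE x in lebesgue. \<bar>x\<bar> > N \<longrightarrow> \<phi> x = 0" using K(2) by eventually_elim (use N in force)
    then show ?thesis using N by blast
  qed
  obtain N1 where N1: "N1 > 0" "AE x in lebesgue. \<bar>x\<bar> > N1 \<longrightarrow> \<phi>1 x = 0" using ess[OF \<phi>1(2)] by blast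
  obtain N2 where N2: "N2 > 0" "AE x in lebesgue. \<bar>x\<bar> > N2 \<longrightarrow> \<phi>2 x = 0" using ess[OF \<phi>2(2)] by blast
  obtain N3 where N3: "N3 > 0" "\<forall>x\<in>closure {x. q x \<noteq> 0}. \<bar>x\<bar> \<le> N3"
    using bounded_real_subset_Icc[OF compact_imp_bounded[OF q(3)]] by blast
  obtain qb where qb: "\<And>x. \<bar>q x\<bar> \<le> qb" using q(2) unfolding bounded_iff by auto
  define M where "M = max N1 (max N2 N3)"
  have M: "M > 0" "N1 \<le> M" "N2 \<le> M" "N3 \<le> M" unfolding M_def using N1 N2 N3 by auto
  have b1: "bump \<phi>1 M"
  proof
    show "AE x in lebesgue. \<bar>x\<bar> > M \<longrightarrow> \<phi>1 x = 0" using N1(2) by eventually_elim (use M in auto)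
  qed (use \<phi>1 zero_means M in auto)
  have b2: "bump \<phi>2 M"
  proof
    show "AE x in lebesgue. \<bar>x\<bar> > M \<longrightarrow> \<phi>2 x = 0" using N2(2) by eventually_elim (use M in auto)
  qed (use \<phi>2 zero_means M in auto)
  \<comment> \<open>Zero means make \<open>omega\<close> constant from \<open>M\<close> on, so its
    limit at infinity is its value at the edge of the core.\<close>
  have \<kappa>M: "\<kappa> = omega \<phi>1 \<phi>2 M"
  proof -
    have "eventually (\<lambda>x. omega \<phi>1 \<phi>2 x = omega \<phi>1 \<phi>2 M) at_top"
      using eventually_ge_at_top[of M]
      by eventually_elim (metis omega_def bump.antideriv2_right[OF b1] bump.antideriv2_right[OF b2])
    then have "(omega \<phi>1 \<phi>2 \<longlongrightarrow> omega \<phi>1 \<phi>2 M) at_top" by (rule tendsto_eventually)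
    then show ?thesis unfolding \<kappa> by (intro tendsto_Lim) auto
  qed
  \<comment> \<open>The lower bound of \<open>V\<close> is rewritten as \<open>- c\<close> with
    nonnegative \<open>c\<close>, the form used in the limit point argument.\<close>
  have pot: "potential V (max 0 (- L))"
  proof
    show "\<exists>K\<ge>0. \<forall>x. \<bar>x\<bar> \<le> N \<longrightarrow> \<bar>V x\<bar> \<le> K" for N
    proof -
      obtain B where B: "B > 0" "\<forall>y\<in>V ` {-N..N}. \<bar>y\<bar> \<le> B"
        using bounded_real_subset_Icc[OF V_locally_bounded[OF compact_Icc]] by blast
      have "\<bar>V x\<bar> \<le> B" if "\<bar>x\<bar> \<le> N" for x
      proof -
        have "x \<in> {-N..N}" using that by (auto simp: abs_le_iff)
        then show ?thesis using B by auto
      qed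
      then show ?thesis using B(1) less_imp_le by blast
    qed
    show "- max 0 (- L) \<le> V x" for x using L[of x] by auto
  qed (use V_measurable in auto)
  have q_supp: "q x = 0" if "\<bar>x\<bar> > M" for x
  proof (rule ccontr)
    assume "q x \<noteq> 0"
    then have "x \<in> closure {x. q x \<noteq> 0}" using closure_subset[of "{x. q x \<noteq> 0}"] by blast
    then have "\<bar>x\<bar> \<le> N3" using N3(2) by blast
    then show False using that M(4) by linarith
  qed
  interpret potential V "max 0 (- L)" by (rule pot)
  interpret scattering V "max 0 (- L)" \<phi>1 \<phi>2 q M qb \<kappa> a0 a1 a2
    by (intro scattering.intro scattering_axioms.intro pot b1 b2 q(1) qb q_supp orthogonal normalized \<kappa>M \<kappa>_nonzero a0 a1 a2 resonance)
  show ?thesis using converges unfolding \<alpha>_def \<beta>_def .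
qed

end
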